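(* Let $n\ge3$, $\emptyset\ne S\subseteq\{1,\dots,n-1\}$, $\mathfrak p:=\sum_{i\in S}\mathfrak p_i'$. Then, as sets of products, $$\mathrm{GL}_\infty(\mathbb S_{n-1},\mathfrak p)=(1+\mathfrak p\mathfrak p_n)^*=\widetilde\Theta_{n,2}(\mathfrak p)\widetilde{\mathcal E}_{n,2}(\mathfrak p)\cdots\widetilde\Theta_{n,n-1}(\mathfrak p)\widetilde{\mathcal E}_{n,n-1}(\mathfrak p),$$ and for $2\le s\le n-1$, $(1+\mathfrak p\mathfrak p_n)^*_s=\widetilde\Theta_{n,s}(\mathfrak p)\widetilde{\mathcal E}_{n,s}(\mathfrak p)\cdots\widetilde\Theta_{n,n-1}(\mathfrak p)\widetilde{\mathcal E}_{n,n-1}(\mathfrak p)$, while $(1+\mathfrak p\mathfrak p_n)^*_n=(1+F_n)^*$.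
   Context: $K$ is a field, $\mathbb N=\{0,1,\dots\}$. $\mathbb S_n$: $K$-algebra generated by $x_1,\dots,x_n,y_1,\dots,y_n$ with relations $y_ix_i=1$, $[x_i,y_j]=[x_i,x_j]=[y_i,y_j]=0$ ($i\ne j$). $E_{st}(i):=x_i^sy_i^t-x_i^{s+1}y_i^{t+1}$, $e_i:=E_{00}(i)$, $e_I:=\prod_{i\in I}e_i$, $E_{\alpha\beta}(I):=\prod_{i\in I}E_{\alpha_i\beta_i}(i)$ for $\alpha,\beta\in\mathbb N^I$. $\theta_{ij}(J):=(1+(y_i-1)e_{J\setminus\{i\}})(1+(x_j-1)e_{J\setminus\{j\}})$. $\mathfrak p_i$ = ideal of $\mathbb S_n$ generated by $e_i$; $\mathfrak p_I:=\prod_{i\in I}\mathfrak p_i$; $\mathfrak a_{n,s}:=\sum_{|I|=s}\mathfrak p_I$; $F_n:=\mathfrak p_{\{1,\dots,n\}}$; $(1+\mathfrak b)^*$ = units of $\mathbb S_n$ in $1+\mathfrak b$. $\mathbb S_{n-1}$ = subalgebra generated by $x_k,y_k$ ($k<n$); $\mathfrak p_i'$ = ideal of $\mathbb S_{n-1}$ generated by $e_i$; $\mathfrak p\mathfrak p_n:=\sum_{i\in S}\mathfrak p_i\mathfrak p_n$; $(1+\mathfrak p\mathfrak p_n)^*_s:=(1+\mathfrak p\mathfrak p_n)^*\cap(1+\mathfrak a_{n,s})^*$. $\mathrm{GL}_\infty(\mathbb S_{n-1})$ is identified with $(1+\mathfrak p_n)^*$ via $(a_{kl})\mapsto1+\sum(a_{kl}-\delta_{kl})E_{kl}(n)$,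 under which the congruence subgroup $\mathrm{GL}_\infty(\mathbb S_{n-1},\mathfrak p):=\ker(\mathrm{GL}_\infty(\mathbb S_{n-1})\to\mathrm{GL}_\infty(\mathbb S_{n-1}/\mathfrak p))$ corresponds to $(1+\mathfrak p\mathfrak p_n)^*$. $\mathcal J(\mathfrak p):=\{J\subseteq\{1,\dots,n\}:n\in J,\ J\cap S\ne\emptyset\}$. $\mu_I(\lambda):=\lambda e_I+1-e_I$, $U_I(K):=\{\mu_I(\lambda):\lambda\in K^*\}$; $\mathbb S_{CI}$ = subalgebra generated by $x_k,y_k$, $k\notin I$; $E_\infty(\mathbb S_{CI})$ = subgroup of $\mathbb S_n^*$ generated by $1+aE_{\alpha\beta}(I)$, $a\in\mathbb S_{CI}$, $\alpha\ne\beta\in\mathbb N^I$. $\widetilde{\mathcal E}_{n,s}(\mathfrak p)$: set of products, in a fixed order over all $I\in\mathcal J(\mathfrak p)$ with $|I|=s$, of elements of $U_I(K)E_\infty(\mathbb S_{CI})$. $\widetilde\Theta_{n,s}(\mathfrak p)$ ($2\le s\le n-1$): set of products, in a fixed order, of integer powers of the following elements: (i) $\theta_{m'(J'),j'}(J')$ where $i\in S$, $|J'|=s+1$, $n\in J'$, $J'\cap S=\{i\}$, $m'(J'):=\max(J'\setminus\{n,i\})$, $j'\in J'\setminus\{n,i,m'(J')\}$; (ii) $\theta_{m(J),j}(J)$ where $|J|=s+1$, $n\in J$, $|J\cap S|\ge2$, $m(J):=\max(J\setminus\{n\})$, $j\in J\setminus\{n,m(J)\}$. Products of sets mean sets of products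 of elements. *)

theory Defs
  imports Main "HOL-Library.Poly_Mapping"
begin

section \<open>The Jacobson algebras S_n, realised inside the monoid algebra of the
  restricted direct power of the bicyclic monoid\<close>

text \<open>A word x^a y^b (a, b exponent vectors, indices 1,2,...) is the pair (a,b).
  Relations y_i x_i = 1, commuting of different indices, give the product
  x^a y^b x^c y^d = x^(a + (c - b)) y^(d + (b - c)) (coordinatewise truncated minus).\<close>

type_synonym mon = "(nat \<Rightarrow>\<^sub>0 nat) \<times> (nat \<Rightarrow>\<^sub>0 nat)"
type_synonym 'k sn = "mon \<Rightarrow>\<^sub>0 'k"

definition bmul :: "mon \<Rightarrow> mon \<Rightarrow> mon" where
  "bmul p q = (fst p + (fst q - snd p), snd q + (snd p - fst q))"

definition smul :: "'k::field sn \<Rightarrow> 'k sn \<Rightarrow> 'k sn" (infixl "\<star>" 70) where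
  "f \<star> g = (\<Sum>p\<in>Poly_Mapping.keys f. \<Sum>q\<in>Poly_Mapping.keys g.
      Poly_Mapping.single (bmul p q) (Poly_Mapping.lookup f p * Poly_Mapping.lookup g q))"

definition sc :: "'k::field \<Rightarrow> 'k sn" where
  "sc c = Poly_Mapping.single (0, 0) c"

definition sone :: "'k::field sn" where
  "sone = sc 1"

definition Xg :: "nat \<Rightarrow> 'k::field sn" where
  "Xg i = Poly_Mapping.single (Poly_Mapping.single i 1, 0) 1"

definition Yg :: "nat \<Rightarrow> 'k::field sn" where
  "Yg i = Poly_Mapping.single (0, Poly_Mapping.single i 1) 1"

definition spow :: "'k::field sn \<Rightarrow> nat \<Rightarrow> 'k sn" where
  "spow f k = ((\<lambda>g. f \<star> g) ^^ k) sone"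

definition sprod_list :: "'k::field sn list \<Rightarrow> 'k sn" where
  "sprod_list xs = foldr (\<star>) xs sone"

inductive_set alg_gen :: "nat set \<Rightarrow> 'k::field sn set" for A :: "nat set" where
  scal: "sc c \<in> alg_gen A"
| genx: "k \<in> A \<Longrightarrow> Xg k \<in> alg_gen A"
| geny: "k \<in> A \<Longrightarrow> Yg k \<in> alg_gen A"
| add: "a \<in> alg_gen A \<Longrightarrow> b \<in> alg_gen A \<Longrightarrow> a + b \<in> alg_gen A"
| mul: "a \<in> alg_gen A \<Longrightarrow> b \<in> alg_gen A \<Longrightarrow> a \<star> b \<in> alg_gen A"

definition Sn :: "nat \<Rightarrow> 'k::field sn set" where
  "Sn n = alg_gen {1..n}"

definition Est :: "nat \<Rightarrow> nat \<Rightarrow> nat \<Rightarrow> 'k::field sn" where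
  "Est s t i = spow (Xg i) s \<star> spow (Yg i) t - spow (Xg i) (s+1) \<star> spow (Yg i) (t+1)"

definition ee :: "nat \<Rightarrow> 'k::field sn" where
  "ee i = Est 0 0 i"

definition eI :: "nat set \<Rightarrow> 'k::field sn" where
  "eI I = sprod_list (map ee (sorted_list_of_set I))"

definition EI :: "(nat \<Rightarrow> nat) \<Rightarrow> (nat \<Rightarrow> nat) \<Rightarrow> nat set \<Rightarrow> 'k::field sn" where
  "EI \<alpha> \<beta> I = sprod_list (map (\<lambda>i. Est (\<alpha> i) (\<beta> i) i) (sorted_list_of_set I))"

definition theta :: "nat \<Rightarrow> nat \<Rightarrow> nat set \<Rightarrow> 'k::field sn" where
  "theta i j J = (sone + (Yg i - sone) \<star> eI (J - {i})) \<star> (sone + (Xg j - sone) \<star> eI (J - {j}))"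

definition mu :: "nat set \<Rightarrow> 'k::field \<Rightarrow> 'k sn" where
  "mu I c = sc c \<star> eI I + sone - eI I"

definition gen_ideal :: "'k::field sn set \<Rightarrow> 'k sn set \<Rightarrow> 'k sn set" where
  "gen_ideal R X = {sum_list (map (\<lambda>(a,x,b). a \<star> x \<star> b) ts) | ts. set ts \<subseteq> R \<times> X \<times> R}"

definition iprod :: "'k::field sn set \<Rightarrow> 'k sn set \<Rightarrow> 'k sn set" where
  "iprod I J = {sum_list (map (\<lambda>(a,b). a \<star> b) ts) | ts. set ts \<subseteq> I \<times> J}"

definition isum :: "'k::field sn set set \<Rightarrow> 'k sn set" where
  "isum F = {sum_list xs | xs. set xs \<subseteq> \<Union>F}"

definition pi :: "nat \<Rightarrow> nat \<Rightarrow> 'k::field sn set" where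
  "pi n i = gen_ideal (Sn n) {ee i}"

definition pI :: "nat \<Rightarrow> nat set \<Rightarrow> 'k::field sn set" where
  "pI n I = foldr iprod (map (pi n) (sorted_list_of_set I)) (Sn n)"

definition ans :: "nat \<Rightarrow> nat \<Rightarrow> 'k::field sn set" where
  "ans n s = isum {pI n I | I. I \<subseteq> {1..n} \<and> card I = s}"

definition Fn :: "nat \<Rightarrow> 'k::field sn set" where
  "Fn n = pI n {1..n}"

definition frakp :: "nat \<Rightarrow> nat set \<Rightarrow> 'k::field sn set" where
  "frakp n S = isum {gen_ideal (Sn (n-1)) {ee i} | i. i \<in> S}"

definition ppn :: "nat \<Rightarrow> nat set \<Rightarrow> 'k::field sn set" where
  "ppn n S = isum {iprod (pi n i) (pi n n) | i. i \<in> S}"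

definition sunits :: "'k::field sn set \<Rightarrow> 'k sn set" where
  "sunits R = {u \<in> R. \<exists>v\<in>R. u \<star> v = sone \<and> v \<star> u = sone}"

definition sinv :: "'k::field sn set \<Rightarrow> 'k sn \<Rightarrow> 'k sn" where
  "sinv R u = (THE v. v \<in> R \<and> u \<star> v = sone \<and> v \<star> u = sone)"

definition zpow :: "'k::field sn set \<Rightarrow> 'k sn \<Rightarrow> int \<Rightarrow> 'k sn" where
  "zpow R u z = (if 0 \<le> z then spow u (nat z) else spow (sinv R u) (nat (- z)))"

definition onep :: "'k::field sn set \<Rightarrow> 'k sn set \<Rightarrow> 'k sn set" where
  "onep R b = {u \<in> sunits R. u - sone \<in> b}"

definition onep_s :: "nat \<Rightarrow> nat set \<Rightarrow> nat \<Rightarrow> 'k::field sn set" where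
  "onep_s n S s = onep (Sn n) (ppn n S) \<inter> onep (Sn n) (ans n s)"

definition setmul :: "'k::field sn set \<Rightarrow> 'k sn set \<Rightarrow> 'k sn set" where
  "setmul A B = {a \<star> b | a b. a \<in> A \<and> b \<in> B}"

definition setprod_list :: "'k::field sn set list \<Rightarrow> 'k sn set" where
  "setprod_list As = foldr setmul As {sone}"

text \<open>E_infinity(S_CI) as a subgroup of S_n^* (n is the ambient n).\<close>
inductive_set Einf :: "nat \<Rightarrow> nat set \<Rightarrow> 'k::field sn set" for n :: nat and I :: "nat set" where
  one: "sone \<in> Einf n I"
| gen: "a \<in> alg_gen ({1..n} - I) \<Longrightarrow> (\<exists>i\<in>I. \<alpha> i \<noteq> \<beta> i) \<Longrightarrow>
        sone + a \<star> EI \<alpha> \<beta> I \<in> Einf n I"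
| mul: "g \<in> Einf n I \<Longrightarrow> h \<in> Einf n I \<Longrightarrow> g \<star> h \<in> Einf n I"
| inv: "g \<in> Einf n I \<Longrightarrow> sinv (Sn n) g \<in> Einf n I"

definition UE :: "nat \<Rightarrow> nat set \<Rightarrow> 'k::field sn set" where
  "UE n I = {mu I c \<star> g | c g. c \<noteq> 0 \<and> g \<in> Einf n I}"

definition Jp :: "nat \<Rightarrow> nat set \<Rightarrow> nat set set" where
  "Jp n S = {J. J \<subseteq> {1..n} \<and> n \<in> J \<and> J \<inter> S \<noteq> {}}"

text \<open>E~_{n,s}(p) for a given ordering Is of {I in J(p). |I| = s}.\<close>
definition Etil :: "nat \<Rightarrow> nat set list \<Rightarrow> 'k::field sn set" where
  "Etil n Is = setprod_list (map (UE n) Is)"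

definition theta_idx :: "nat \<Rightarrow> nat set \<Rightarrow> nat \<Rightarrow> (nat \<times> nat \<times> nat set) set" where
  "theta_idx n S s =
     {(m, j, J) | i m j J. i \<in> S \<and> J \<subseteq> {1..n} \<and> card J = s + 1 \<and> n \<in> J \<and> J \<inter> S = {i}
         \<and> m = Max (J - {n, i}) \<and> j \<in> J - {n, i, m}}
   \<union> {(m, j, J) | m j J. J \<subseteq> {1..n} \<and> card J = s + 1 \<and> n \<in> J \<and> 2 \<le> card (J \<inter> S)
         \<and> m = Max (J - {n}) \<and> j \<in> J - {n, m}}"

text \<open>Theta~_{n,s}(p) for a given ordering ts of the index data.\<close>
definition Thtil :: "nat \<Rightarrow> (nat \<times> nat \<times> nat set) list \<Rightarrow> 'k::field sn set" where
  "Thtil n ts = {sprod_list (map (\<lambda>((m, j, J), z). zpow (Sn n) (theta m j J) z) (zip ts zs))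
                 | zs. length zs = length ts}"

definition chain :: "nat \<Rightarrow> (nat \<Rightarrow> (nat \<times> nat \<times> nat set) list) \<Rightarrow> (nat \<Rightarrow> nat set list)
                     \<Rightarrow> nat \<Rightarrow> 'k::field sn set" where
  "chain n ordT ordE s0 =
     setprod_list (concat (map (\<lambda>s. [Thtil n (ordT s), Etil n (ordE s)]) [s0..<n]))"

type_synonym 'k mat = "nat \<Rightarrow> nat \<Rightarrow> 'k sn"

definition mdelta :: "'k::field mat" where
  "mdelta k l = (if k = l then sone else 0)"

definition mmul :: "'k::field mat \<Rightarrow> 'k mat \<Rightarrow> 'k mat" where
  "mmul A B k l = (\<Sum>m\<in>{m. A k m \<noteq> 0}. A k m \<star> B m l)"

definition fin_mat :: "'k::field sn set \<Rightarrow> 'k mat \<Rightarrow> bool" where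
  "fin_mat R A \<longleftrightarrow> (\<forall>k l. A k l \<in> R) \<and> finite {(k, l). A k l \<noteq> mdelta k l}"

definition GLinf :: "'k::field sn set \<Rightarrow> 'k mat set" where
  "GLinf R = {A. fin_mat R A \<and> (\<exists>B. fin_mat R B \<and> mmul A B = mdelta \<and> mmul B A = mdelta)}"

text \<open>Kernel of GL_inf(R) -> GL_inf(R/p).\<close>
definition GLcong :: "'k::field sn set \<Rightarrow> 'k sn set \<Rightarrow> 'k mat set" where
  "GLcong R p = {A \<in> GLinf R. \<forall>k l. A k l - mdelta k l \<in> p}"

definition phiGL :: "nat \<Rightarrow> 'k::field mat \<Rightarrow> 'k sn" where
  "phiGL n A = sone + (\<Sum>(k, l)\<in>{(k, l). A k l \<noteq> mdelta k l}. (A k l - mdelta k l) \<star> Est k l n)"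

end

theory Submission
  imports "Jordan_Normal_Form.Determinant" "HOL-Computational_Algebra.Fraction_Field"
    "HOL-Library.Countable_Set" Defs
begin

text \<open>For a set \<open>I\<close> of indices, letting the variables in \<open>I\<close> act by shifts on a space with basis \<open>\<nat>\<^sup>I\<close> and
  sending the remaining ones to Laurent variables gives a representation of \<open>S\<^sub>n\<close> by column-finite
  matrices over a Laurent polynomial ring. The intersections of kernels of these representations are
  exactly the sums of the ideals \<open>p\<^sub>I\<close>. If \<open>u\<close> is a unit in \<open>1 + p p\<^sub>n\<close> congruent to \<open>1\<close> modulo
  \<open>a\<^sub>n\<^sub>,\<^sub>s\<close>, its matrix at an index set \<open>I\<close> of size \<open>s\<close> is a finite invertible matrix over a Laurent
  polynomial ring over a field, hence (stable \<open>K\<^sub>1\<close>) a monomial times a product of elementary matrices.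
  An index computation shows that the exponents of these monomials satisfy, for each set \<open>J\<close> of size
  \<open>s + 1\<close>, one linear relation, so they are removed by powers of the \<open>\<theta>\<close>'s; the constants and the elementary
  matrices are removed by elements of \<open>U\<^sub>I(K) E\<^sub>\<infinity>\<close>. What remains is congruent to \<open>1\<close> modulo \<open>a\<^sub>n\<^sub>,\<^sub>s\<^sub>+\<^sub>1\<close>.
  Finally \<open>(1 + F\<^sub>n)\<^sup>*\<close> is absorbed by the last factor, because diagonal matrices become
  products of elementary ones in the presence of elements with \<open>y x = 1\<close>, \<open>x y \<noteq> 1\<close>.

  The \<open>K\<^sub>1\<close> statement is proved by induction on the number of variables: over the function field in
  one more variable everything is elementary, and this descends to the Laurent extension by comparing
  lattices at the two places \<open>0\<close> and \<open>\<infinity>\<close>.\<close>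


section \<open>Column-finite matrices\<close>

text \<open>All coefficient rings are subsets of one fraction field, and matrices of all sizes lie
  in one ring of column-finite matrices, so change of ring and stabilisation are inclusions of sets.
  Column finiteness is what the action of \<open>S_n\<close> provides: a word sends a basis vector
  to a multiple of one basis vector or to 0.

  The relation attached to \<open>J\<close> is a vanishing Fredholm index. On the module whose basis
  consists of the functions on \<open>J\<close>, the unit acts, after elementary corrections and up
  to finitely many entries, as the identity except along certain coordinate axes \<open>j\<close>,
  where it is a scaled shift by the exponent of \<open>t_j\<close> in the determinant at
  \<open>J - {j}\<close>. Invertibility forces the shifts to add up to 0. Each \<theta> moves one
  unit of shift between two axes, so comparing every axis with a fixed one removes all shifts.

  In the descent, an elementary factorisation over the larger ring exhibits a lattice quotient as a
  free module on which the uniformiser is strictly triangular. The companion matrix of \<alpha>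
  describes the same quotient, and comparing the two makes \<alpha> elementary over
  polynomials.\<close>

typedef (overloaded) 'a cf = "{A :: nat \<Rightarrow> nat \<Rightarrow> 'a::zero. \<forall>j. finite {i. A i j \<noteq> 0}}"
  morphisms ent Abs_cf
  by (rule exI[of _ "\<lambda>_ _. 0"]) simp

setup_lifting type_definition_cf

lemma finite_col [simp]: "finite {i. ent A i j \<noteq> 0}"
  using ent by auto

lemma cf_eqI: "(\<And>i j. ent A i j = ent B i j) \<Longrightarrow> A = B"
  by (metis ent_inject ext)

lift_definition mun :: "nat \<Rightarrow> nat \<Rightarrow> 'a::zero \<Rightarrow> 'a cf" is
  "\<lambda>i j a k l. if k = i \<and> l = j then a else 0"
  by simp

lemma ent_mun: "ent (mun i j a) k l = (if k = i \<and> l = j then a else 0)"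
  by transfer simp

instantiation cf :: (comm_ring_1) ring_1
begin

lift_definition zero_cf :: "'a cf" is "\<lambda>_ _. 0" by simp

lift_definition one_cf :: "'a cf" is "\<lambda>i j. if i = j then 1 else 0" by simp

lift_definition plus_cf :: "'a cf \<Rightarrow> 'a cf \<Rightarrow> 'a cf" is "\<lambda>A B i j. A i j + B i j"
proof -
  fix A B :: "nat \<Rightarrow> nat \<Rightarrow> 'a" and j
  assume "\<And>j. finite {i. A i j \<noteq> 0}" "\<And>j. finite {i. B i j \<noteq> 0}"
  then show "finite {i. A i j + B i j \<noteq> 0}"
    by (rule_tac finite_subset[of _ "{i. A i j \<noteq> 0} \<union> {i. B i j \<noteq> 0}"]) auto
qed

lift_definition uminus_cf :: "'a cf \<Rightarrow> 'a cf" is "\<lambda>A i j. - A i j"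
  by simp

lift_definition minus_cf :: "'a cf \<Rightarrow> 'a cf \<Rightarrow> 'a cf" is "\<lambda>A B i j. A i j - B i j"
proof -
  fix A B :: "nat \<Rightarrow> nat \<Rightarrow> 'a" and j
  assume "\<And>j. finite {i. A i j \<noteq> 0}" "\<And>j. finite {i. B i j \<noteq> 0}"
  then show "finite {i. A i j - B i j \<noteq> 0}"
    by (rule_tac finite_subset[of _ "{i. A i j \<noteq> 0} \<union> {i. B i j \<noteq> 0}"]) auto
qed

lift_definition times_cf :: "'a cf \<Rightarrow> 'a cf \<Rightarrow> 'a cf" is
  "\<lambda>A B i j. \<Sum>k\<in>{k. B k j \<noteq> 0}. A i k * B k j"
proof -
  fix A B :: "nat \<Rightarrow> nat \<Rightarrow> 'a" and j
  assume *: "\<And>j. finite {i. A i j \<noteq> 0}" "\<And>j. finite {i. B i j \<noteq> 0}"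
  have "{i. (\<Sum>k\<in>{k. B k j \<noteq> 0}. A i k * B k j) \<noteq> 0} \<subseteq> (\<Union>k\<in>{k. B k j \<noteq> 0}. {i. A i k \<noteq> 0})"
  proof
    fix i assume "i \<in> {i. (\<Sum>k\<in>{k. B k j \<noteq> 0}. A i k * B k j) \<noteq> 0}"
    then obtain k where "k \<in> {k. B k j \<noteq> 0}" "A i k * B k j \<noteq> 0"
      by (auto elim: sum.not_neutral_contains_not_neutral)
    then show "i \<in> (\<Union>k\<in>{k. B k j \<noteq> 0}. {i. A i k \<noteq> 0})" by auto
  qed
  then show "finite {i. (\<Sum>k\<in>{k. B k j \<noteq> 0}. A i k * B k j) \<noteq> 0}"
    using * by (meson finite_UN_I finite_subset)
qed

lemma ent_zero [simp]: "ent 0 i j = 0" by transfer simp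
lemma ent_one: "ent 1 i j = (if i = j then 1 else 0)" by transfer simp
lemma ent_add [simp]: "ent (A + B) i j = ent A i j + ent B i j" by transfer simp
lemma ent_uminus [simp]: "ent (- A) i j = - ent A i j" by transfer simp
lemma ent_minus [simp]: "ent (A - B) i j = ent A i j - ent B i j" by transfer simp

lemma ent_mult_raw: "ent (A * B) i j = (\<Sum>k\<in>{k. ent B k j \<noteq> 0}. ent A i k * ent B k j)"
  by transfer simp

text \<open>The defining sum runs over the support of one column of the right factor, which changes
  with that factor. Any finite superset gives the same value, so several products can be brought to
  one range of summation.\<close>

lemma ent_mult:
  assumes "finite K" "{k. ent B k j \<noteq> 0} \<subseteq> K"
  shows "ent (A * B) i j = (\<Sum>k\<in>K. ent A i k * ent B k j)"
  unfolding ent_mult_raw using assms by (intro sum.mono_neutral_left) auto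

instance
proof
  fix A B C :: "'a cf"
  show "A + B + C = A + (B + C)" by (rule cf_eqI) simp
  show "A + B = B + A" by (rule cf_eqI) simp
  show "0 + A = A" by (rule cf_eqI) simp
  show "- A + A = 0" by (rule cf_eqI) simp
  show "A - B = A + - B" by (rule cf_eqI) simp
  show "1 * A = A"
  proof (rule cf_eqI)
    fix i j
    have "ent (1 * A) i j = (\<Sum>k\<in>insert i {k. ent A k j \<noteq> 0}. ent 1 i k * ent A k j)"
      by (rule ent_mult) auto
    also have "\<dots> = ent 1 i i * ent A i j"
      by (subst sum.insert_remove) (auto simp: ent_one intro!: sum.neutral)
    finally show "ent (1 * A) i j = ent A i j" by (simp add: ent_one)
  qed
  show "A * 1 = A"
  proof (rule cf_eqI)
    fix i j
    have "ent (A * 1) i j = (\<Sum>k\<in>{j}. ent A i k * ent 1 k j)"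
      by (rule ent_mult) (auto simp: ent_one split: if_splits)
    then show "ent (A * 1) i j = ent A i j" by (simp add: ent_one)
  qed
  show "(0::'a cf) \<noteq> 1"
    by (metis ent_one ent_zero zero_neq_one)
  show "(A + B) * C = A * C + B * C"
    by (rule cf_eqI) (simp add: ent_mult_raw sum.distrib algebra_simps)
  show "A * (B + C) = A * B + A * C"
  proof (rule cf_eqI)
    fix i j
    define K where "K = {k. ent B k j \<noteq> 0} \<union> {k. ent C k j \<noteq> 0}"
    have K: "finite K" "{k. ent B k j \<noteq> 0} \<subseteq> K" "{k. ent C k j \<noteq> 0} \<subseteq> K"
      "{k. ent (B + C) k j \<noteq> 0} \<subseteq> K" unfolding K_def by auto
    show "ent (A * (B + C)) i j = ent (A * B + A * C) i j"
      by (simp add: ent_mult[OF K(1,4)] ent_mult[OF K(1,2)] ent_mult[OF K(1,3)] sum.distrib algebra_simps)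
  qed
  show "A * B * C = A * (B * C)"
  proof (rule cf_eqI)
    fix i j
    define K where "K = {k. ent C k j \<noteq> 0}"
    define M where "M = (\<Union>k\<in>K. {m. ent B m k \<noteq> 0})"
    have fK: "finite K" and fM: "finite M" unfolding K_def M_def by auto
    have BC: "{m. ent (B * C) m j \<noteq> 0} \<subseteq> M"
    proof
      fix m assume "m \<in> {m. ent (B * C) m j \<noteq> 0}"
      then have "(\<Sum>k\<in>K. ent B m k * ent C k j) \<noteq> 0" by (simp add: ent_mult_raw K_def)
      then obtain k where "k \<in> K" "ent B m k * ent C k j \<noteq> 0"
        by (auto elim: sum.not_neutral_contains_not_neutral)
      then have "ent B m k \<noteq> 0" by auto
      then show "m \<in> M" unfolding M_def using \<open>k \<in> K\<close> by auto
    qed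
    have "ent (A * B * C) i j = (\<Sum>k\<in>K. ent (A * B) i k * ent C k j)"
      by (simp add: ent_mult_raw K_def)
    also have "\<dots> = (\<Sum>k\<in>K. (\<Sum>m\<in>M. ent A i m * ent B m k) * ent C k j)"
      by (rule sum.cong[OF refl], subst ent_mult[OF fM]) (auto simp: M_def)
    also have "\<dots> = (\<Sum>m\<in>M. \<Sum>k\<in>K. ent A i m * (ent B m k * ent C k j))"
      by (subst sum.swap) (simp add: sum_distrib_right mult.assoc)
    also have "\<dots> = (\<Sum>m\<in>M. ent A i m * ent (B * C) m j)"
      by (simp add: ent_mult_raw[of B C] K_def sum_distrib_left)
    also have "\<dots> = ent (A * (B * C)) i j"
      by (rule ent_mult[OF fM BC, symmetric])
    finally show "ent (A * B * C) i j = ent (A * (B * C)) i j" .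
  qed
qed

end

lemma mun_zero [simp]: "mun i j (0::'a::comm_ring_1) = 0"
  by (rule cf_eqI) (simp add: ent_mun)

lemma ent_mun_mult: "ent (mun i j a * A) k l = (if k = i then a * ent A j l else 0)"
proof -
  have "ent (mun i j a * A) k l = (\<Sum>m\<in>insert j {m. ent A m l \<noteq> 0}. ent (mun i j a) k m * ent A m l)"
    by (rule ent_mult) auto
  also have "\<dots> = ent (mun i j a) k j * ent A j l"
    by (subst sum.insert_remove) (auto simp: ent_mun intro!: sum.neutral)
  finally show ?thesis by (simp add: ent_mun)
qed

lemma ent_mult_mun: "ent (A * mun i j a) k l = (if l = j then ent A k i * a else 0)"
proof -
  have "ent (A * mun i j a) k l = (\<Sum>m\<in>{i}. ent A k m * ent (mun i j a) m l)"
    by (rule ent_mult) (auto simp: ent_mun)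
  then show ?thesis by (simp add: ent_mun)
qed

lemma mun_mult_mun: "mun i j a * mun k l b = (if j = k then mun i l (a * b) else 0)"
  by (rule cf_eqI) (auto simp: ent_mun_mult ent_mun)

lemma mun_add: "mun i j a + mun i j b = mun i j (a + b)"
  by (rule cf_eqI) (simp add: ent_mun)

lemma mun_uminus: "- mun i j a = mun i j (- a)"
  by (rule cf_eqI) (simp add: ent_mun)

text \<open>\<open>bdd r\<close> collects the matrices that agree with the identity outside the top left
  \<open>r \<times> r\<close> block; their union over all \<open>r\<close> contains the stable general linear group.\<close>

definition bdd :: "nat \<Rightarrow> 'a::comm_ring_1 cf set" where
  "bdd r = {A. \<forall>i j. r \<le> i \<or> r \<le> j \<longrightarrow> ent A i j = ent 1 i j}"

lemma bddD: "A \<in> bdd r \<Longrightarrow> r \<le> i \<or> r \<le> j \<Longrightarrow> ent A i j = (if i = j then 1 else 0)"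
  by (auto simp: bdd_def ent_one)

lemma bdd_mono: "A \<in> bdd r \<Longrightarrow> r \<le> r' \<Longrightarrow> A \<in> bdd r'"
  by (auto simp: bdd_def)

lemma bdd_one [simp]: "1 \<in> bdd r" by (simp add: bdd_def)

lemma ent_mult_bdd:
  assumes "B \<in> bdd r" "j < r"
  shows "ent (A * B) i j = (\<Sum>k<r. ent A i k * ent B k j)"
  by (rule ent_mult) (use assms in \<open>auto simp: bdd_def ent_one not_less[symmetric] split: if_splits\<close>)

lemma ent_mult_bdd_out:
  assumes "B \<in> bdd r" "r \<le> j"
  shows "ent (A * B) i j = ent A i j"
proof -
  have "ent (A * B) i j = (\<Sum>k\<in>{j}. ent A i k * ent B k j)"
    by (rule ent_mult) (use assms in \<open>auto simp: bdd_def ent_one split: if_splits\<close>)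
  then show ?thesis using assms by (simp add: bdd_def ent_one)
qed

lemma bdd_mult [intro]:
  assumes "A \<in> bdd r" "B \<in> bdd r"
  shows "A * B \<in> bdd r"
  unfolding bdd_def
proof (safe)
  fix i j assume "r \<le> j"
  then show "ent (A * B) i j = ent 1 i j"
    using assms by (simp add: ent_mult_bdd_out) (simp add: bdd_def)
next
  fix i j assume i: "r \<le> i"
  show "ent (A * B) i j = ent 1 i j"
  proof (cases "j < r")
    case True
    have "ent (A * B) i j = (\<Sum>k<r. ent A i k * ent B k j)"
      using assms True by (rule_tac ent_mult_bdd)
    also have "\<dots> = 0"
      by (rule sum.neutral) (use assms i in \<open>auto simp: bdd_def ent_one\<close>)
    finally show ?thesis using True i by (simp add: ent_one)
  next
    case False
    then show ?thesis using assms by (simp add: ent_mult_bdd_out) (simp add: bdd_def)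
  qed
qed

lemma bdd_elem: "i < r \<Longrightarrow> j < r \<Longrightarrow> 1 + mun i j a \<in> bdd r"
  by (auto simp: bdd_def ent_mun)

section \<open>Subrings and elementary matrices\<close>

text \<open>Rings of coefficients are sets inside one ambient type; enlarging the ring is then a set
  inclusion, as in \<open>elm_mono\<close>, and no transfer of matrices is involved.\<close>

definition subrng :: "'a::comm_ring_1 set \<Rightarrow> bool" where
  "subrng R \<longleftrightarrow> 1 \<in> R \<and> (\<forall>x\<in>R. \<forall>y\<in>R. x - y \<in> R \<and> x * y \<in> R)"

lemma subrngD:
  assumes "subrng R"
  shows "1 \<in> R" "0 \<in> R" "x \<in> R \<Longrightarrow> y \<in> R \<Longrightarrow> x - y \<in> R" "x \<in> R \<Longrightarrow> y \<in> R \<Longrightarrow> x * y \<in> R"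
    "x \<in> R \<Longrightarrow> - x \<in> R" "x \<in> R \<Longrightarrow> y \<in> R \<Longrightarrow> x + y \<in> R"
proof -
  show 1: "1 \<in> R" and 2: "\<And>x y. x \<in> R \<Longrightarrow> y \<in> R \<Longrightarrow> x - y \<in> R"
    and "x \<in> R \<Longrightarrow> y \<in> R \<Longrightarrow> x * y \<in> R" for x y
    using assms by (auto simp: subrng_def)
  show 0: "0 \<in> R" using 2[OF 1 1] by simp
  show 3: "x \<in> R \<Longrightarrow> - x \<in> R" for x using 2[OF 0, of x] by simp
  show "x \<in> R \<Longrightarrow> y \<in> R \<Longrightarrow> x + y \<in> R" using 2[of x "- y"] 3[of y] by simp
qed

lemma subrng_sum: "subrng R \<Longrightarrow> (\<And>x. x \<in> S \<Longrightarrow> f x \<in> R) \<Longrightarrow> sum f S \<in> R"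
  by (induction S rule: infinite_finite_induct) (auto intro: subrngD)

lemma subrng_power: "subrng R \<Longrightarrow> x \<in> R \<Longrightarrow> x ^ k \<in> R"
  by (induction k) (auto intro: subrngD)

definition over :: "'a::comm_ring_1 set \<Rightarrow> 'a cf set" where
  "over R = {A. \<forall>i j. ent A i j \<in> R}"

lemma overD: "A \<in> over R \<Longrightarrow> ent A i j \<in> R" by (simp add: over_def)

lemma over_one: "subrng R \<Longrightarrow> 1 \<in> over R"
  by (auto simp: over_def ent_one intro: subrngD)

lemma over_mult: "subrng R \<Longrightarrow> A \<in> over R \<Longrightarrow> B \<in> over R \<Longrightarrow> A * B \<in> over R"
  unfolding over_def by (auto simp: ent_mult_raw intro!: subrng_sum subrngD(4))

lemma over_add: "subrng R \<Longrightarrow> A \<in> over R \<Longrightarrow> B \<in> over R \<Longrightarrow> A + B \<in> over R"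
  unfolding over_def by (auto intro!: subrngD)

lemma over_mun: "subrng R \<Longrightarrow> a \<in> R \<Longrightarrow> mun i j a \<in> over R"
  by (auto simp: over_def ent_mun intro: subrngD)

text \<open>Indices range over all naturals, so for a subring this is the stable elementary group.
  Generators are added on the left only, which keeps inductions short; closure under products and
  inverses is derived afterwards.\<close>

inductive_set elm :: "'a::comm_ring_1 set \<Rightarrow> 'a cf set" for R where
  one: "1 \<in> elm R"
| step: "g \<in> elm R \<Longrightarrow> i \<noteq> j \<Longrightarrow> a \<in> R \<Longrightarrow> (1 + mun i j a) * g \<in> elm R"

lemma elm_gen: "i \<noteq> j \<Longrightarrow> a \<in> R \<Longrightarrow> 1 + mun i j a \<in> elm R"
  using elm.step[OF elm.one] by simp

lemma elm_mult:
  assumes "g \<in> elm R" "h \<in> elm R" shows "g * h \<in> elm R"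
  using assms(1) by (induction rule: elm.induct) (auto simp: assms mult.assoc intro: elm.step)

lemma elm_mono: assumes "R \<subseteq> R'" shows "elm R \<subseteq> elm R'"
proof
  fix g assume "g \<in> elm R"
  then show "g \<in> elm R'"
    by (induction rule: elm.induct) (use assms in \<open>auto intro: elm.one elm.step\<close>)
qed

lemma elem_inverse: "i \<noteq> j \<Longrightarrow> (1 + mun i j a) * (1 + mun i j (- a)) = 1"
  by (simp add: algebra_simps mun_mult_mun) (simp add: mun_add)

lemma elm_inverse:
  assumes "subrng R" "g \<in> elm R"
  obtains h where "h \<in> elm R" "g * h = 1" "h * g = 1"
proof -
  have "\<exists>h\<in>elm R. g * h = 1 \<and> h * g = 1"
    using assms(2)
  proof (induction rule: elm.induct)
    case one then show ?case using elm.one by force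
  next
    case (step g i j a)
    then obtain h where h: "h \<in> elm R" "g * h = 1" "h * g = 1" by blast
    have e: "1 + mun i j (- a) \<in> elm R" using step assms by (auto intro!: elm_gen subrngD)
    have 1: "(1 + mun i j a) * g * (h * (1 + mun i j (- a))) = 1"
      using h(2) elem_inverse[OF step(2), of a] by (metis mult.assoc mult_1_right)
    have 2: "h * (1 + mun i j (- a)) * ((1 + mun i j a) * g) = 1"
      using h(3) elem_inverse[OF step(2), of "- a"] by (metis mult.assoc mult_1_right minus_minus)
    show ?case using elm_mult[OF h(1) e] 1 2 by blast
  qed
  then show thesis using that by blast
qed

lemma elm_over:
  assumes "subrng R" "g \<in> elm R" shows "g \<in> over R"
  using assms(2) by (induction rule: elm.induct)
    (auto intro!: over_one over_mult over_add over_mun assms(1))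

lemma elm_bdd: "g \<in> elm R \<Longrightarrow> \<exists>r. g \<in> bdd r"
proof (induction rule: elm.induct)
  case one then show ?case by auto
next
  case (step g i j a)
  then obtain r where r: "g \<in> bdd r" by blast
  define s where "s = Max {r, Suc i, Suc j}"
  have "r \<le> s" "i < s" "j < s" unfolding s_def by (auto simp: less_max_iff_disj)
  then have "(1 + mun i j a) * g \<in> bdd s"
    using r by (auto intro!: bdd_elem bdd_mult intro: bdd_mono)
  then show ?case by blast
qed

lemma elm_cancel_left:
  assumes "subrng R" "g \<in> elm R" "g * x \<in> elm R" shows "x \<in> elm R"
proof -
  obtain h where h: "h \<in> elm R" "h * g = 1" using elm_inverse[OF assms(1,2)] by blast
  have "x = h * (g * x)" using h by (simp flip: mult.assoc)
  then show ?thesis using elm_mult[OF h(1) assms(3)] by simp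
qed

lemma elm_cancel_right:
  assumes "subrng R" "g \<in> elm R" "x * g \<in> elm R" shows "x \<in> elm R"
proof -
  obtain h where h: "h \<in> elm R" "g * h = 1" using elm_inverse[OF assms(1,2)] by blast
  have "x = (x * g) * h" using h by (simp add: mult.assoc)
  then show ?thesis using elm_mult[OF assms(3) h(1)] by simp
qed

text \<open>Peel off one entry in a nonzero row of minimal rank: the row indexed by its column vanishes.\<close>

lemma elm_unitriangular:
  fixes rk :: "nat \<Rightarrow> nat"
  assumes "finite {(i, j). ent X i j \<noteq> 0}" "subrng R" "X \<in> over R"
    and "\<And>i j. ent X i j \<noteq> 0 \<Longrightarrow> rk j < rk i"
  shows "1 + X \<in> elm R"
  using assms
proof (induction "card {(i, j). ent X i j \<noteq> 0}" arbitrary: X)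
  case 0
  then have "{(i, j). ent X i j \<noteq> 0} = {}" by simp
  then have "X = 0" by (intro cf_eqI) auto
  then show ?case by (simp add: elm.one)
next
  case (Suc m)
  let ?S = "{(i, j). ent X i j \<noteq> 0}"
  have "?S \<noteq> {}" using Suc.hyps(2) by (metis card.empty nat.distinct(1))
  then obtain p where p: "p \<in> ?S" "\<And>q. q \<in> ?S \<Longrightarrow> rk (fst p) \<le> rk (fst q)"
    using ex_has_least_nat[of "\<lambda>p. p \<in> ?S" _ "\<lambda>p. rk (fst p)"] by blast
  obtain i j where ij: "p = (i, j)" by force
  define a where "a = ent X i j"
  define X' where "X' = X - mun i j a"
  have a: "a \<noteq> 0" "a \<in> R" using p(1) ij Suc.prems(3) by (auto simp: a_def over_def)
  have X': "ent X' k l = (if k = i \<and> l = j then 0 else ent X k l)" for k l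
    by (simp add: X'_def ent_mun a_def)
  have S': "{(i, j). ent X' i j \<noteq> 0} = ?S - {p}" by (auto simp: X' ij)
  have rowj: "ent X' j l = 0" for l
  proof (rule ccontr)
    assume "ent X' j l \<noteq> 0"
    then have "(j, l) \<in> ?S" by (auto simp: X' split: if_splits)
    then have "rk i \<le> rk j" using p(2) ij by fastforce
    moreover have "rk j < rk i" using Suc.prems(4)[of i j] p(1) ij by auto
    ultimately show False by simp
  qed
  have "1 + X' \<in> elm R"
  proof (rule Suc.hyps(1))
    show "m = card {(i, j). ent X' i j \<noteq> 0}"
      using Suc.hyps(2) p(1) Suc.prems(1) unfolding S' by (subst card_Diff_singleton) auto
    show "finite {(i, j). ent X' i j \<noteq> 0}" using Suc.prems(1) unfolding S' by simp
    show "subrng R" by fact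
    show "X' \<in> over R" using Suc.prems(2,3) by (auto simp: over_def X' intro: subrngD)
    show "\<And>i j. ent X' i j \<noteq> 0 \<Longrightarrow> rk j < rk i" using Suc.prems(4) by (auto simp: X' split: if_splits)
  qed
  moreover have "i \<noteq> j" using Suc.prems(4)[of i j] p(1) ij by auto
  ultimately have "(1 + mun i j a) * (1 + X') \<in> elm R" using a(2) by (intro elm.step)
  moreover have "mun i j a * X' = 0"
    by (rule cf_eqI) (simp add: ent_mun_mult rowj)
  then have "(1 + mun i j a) * (1 + X') = 1 + X"
    by (simp add: algebra_simps X'_def)
  ultimately show ?case by simp
qed

text \<open>Both sides equal \<open>1 + X + Y\<close>.\<close>

lemma whitehead_swap:
  fixes X Y :: "'a::ring_1"
  assumes "X * X = 0" "Y * Y = 0"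
  shows "(1 + X) * (1 - X * Y) * (1 + Y) = (1 + Y) * (1 - Y * X) * (1 + X)"
proof -
  have "X * (X * Z) = 0" "Y * (Y * Z) = 0" for Z using assms by (simp_all flip: mult.assoc)
  then show ?thesis by (simp add: algebra_simps assms)
qed

text \<open>The stable analogue of det (1 - X Y) = det (1 - Y X): cancel the outer elementary
  factors in \<open>whitehead_swap\<close>. It lets a matrix be traded for one of another size on
  another block.\<close>

lemma elm_swap:
  assumes "subrng R" "X * X = 0" "Y * Y = 0" "1 + X \<in> elm R" "1 + Y \<in> elm R" "1 - Y * X \<in> elm R"
  shows "1 - X * Y \<in> elm R"
proof -
  have "(1 + X) * (1 - X * Y) * (1 + Y) \<in> elm R"
    unfolding whitehead_swap[OF assms(2,3)] by (intro elm_mult assms)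
  then show ?thesis using assms by (metis elm_cancel_left elm_cancel_right mult.assoc)
qed


section \<open>Block matrices\<close>

text \<open>Offsets place rectangular blocks in disjoint intervals of one index set, so a
  rectangular factorisation becomes a product \<open>X * Y\<close> with \<open>X * X = 0\<close> and
  \<open>Y * Y = 0\<close>, the setting of \<open>elm_swap\<close>.\<close>

lift_definition bm :: "nat \<Rightarrow> nat \<Rightarrow> nat \<Rightarrow> nat \<Rightarrow> (nat \<Rightarrow> nat \<Rightarrow> 'a) \<Rightarrow> 'a::zero cf" is
  "\<lambda>a p b q f k l. if a \<le> k \<and> k < a + p \<and> b \<le> l \<and> l < b + q then f (k - a) (l - b) else 0"
  by (rule finite_subset[of _ "{..< _ + _}"]) auto

lemma ent_bm: "ent (bm a p b q f) k l =
    (if a \<le> k \<and> k < a + p \<and> b \<le> l \<and> l < b + q then f (k - a) (l - b) else 0)"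
  by transfer simp

lemma bm_cong: "(\<And>i j. i < p \<Longrightarrow> j < q \<Longrightarrow> f i j = g i j) \<Longrightarrow> bm a p b q f = bm a p b q g"
  by (rule cf_eqI) (auto simp: ent_bm)

lemma sum_shift_lessThan: "(\<Sum>k\<in>{b..<b + q}. h k) = (\<Sum>j<(q::nat). h (b + j))"
  using sum.shift_bounds_nat_ivl[of h 0 b q] by (simp add: lessThan_atLeast0 add.commute)

lemma bm_mult:
  fixes f g :: "nat \<Rightarrow> nat \<Rightarrow> 'a::comm_ring_1"
  shows "bm a p b q f * bm b q c u g = bm a p c u (\<lambda>i k. \<Sum>j<q. f i j * g j k)"
proof (rule cf_eqI)
  fix i k
  have "ent (bm a p b q f * bm b q c u g) i k
      = (\<Sum>j\<in>{b..<b + q}. ent (bm a p b q f) i j * ent (bm b q c u g) j k)"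
    by (rule ent_mult) (auto simp: ent_bm split: if_splits)
  also have "\<dots> = (\<Sum>j<q. ent (bm a p b q f) i (b + j) * ent (bm b q c u g) (b + j) k)"
    by (rule sum_shift_lessThan)
  also have "\<dots> = ent (bm a p c u (\<lambda>i k. \<Sum>j<q. f i j * g j k)) i k"
    by (auto simp: ent_bm intro!: sum.cong)
  finally show "ent (bm a p b q f * bm b q c u g) i k
      = ent (bm a p c u (\<lambda>i k. \<Sum>j<q. f i j * g j k)) i k" .
qed

lemma bm_mult_disjoint:
  fixes f g :: "nat \<Rightarrow> nat \<Rightarrow> 'a::comm_ring_1"
  assumes "b + q \<le> c \<or> c + u \<le> b"
  shows "bm a p b q f * bm c u d v g = 0"
  by (rule cf_eqI) (use assms in \<open>auto simp: ent_mult_raw ent_bm intro!: sum.neutral\<close>)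

lemma over_bm:
  assumes "subrng R" "\<And>i j. i < p \<Longrightarrow> j < q \<Longrightarrow> f i j \<in> R"
  shows "bm a p b q f \<in> over R"
  using assms subrngD(2)[OF assms(1)] by (auto simp: over_def ent_bm)

lemma finite_supp_bm: "finite {(i, j). ent (bm a p b q f) i j \<noteq> 0}"
  by (rule finite_subset[of _ "{..<a + p} \<times> {..<b + q}"]) (auto simp: ent_bm split: if_splits)

text \<open>The columns of the block lie outside its row interval, so a rank that is 1 on that
  interval and 0 elsewhere already drops from row to column.\<close>

lemma elm_bm_disjoint:
  assumes "subrng R" "\<And>i j. i < p \<Longrightarrow> j < q \<Longrightarrow> f i j \<in> R" "a + p \<le> b \<or> b + q \<le> a"
  shows "1 + bm a p b q f \<in> elm R"
proof (rule elm_unitriangular[where rk = "\<lambda>i. if a \<le> i \<and> i < a + p then 1 else 0"])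
  show "bm a p b q f \<in> over R" by (rule over_bm) (use assms in auto)
  show "finite {(i, j). ent (bm a p b q f) i j \<noteq> 0}" by (rule finite_supp_bm)
qed (use assms in \<open>auto simp: ent_bm split: if_splits\<close>)

section \<open>Polynomials in an element over a subring\<close>

text \<open>Horner form inside the ambient ring: rule induction is induction on the degree.
  Independence of the powers of \<open>t\<close> is a separate matter; at a place it comes from
  \<open>tP_coeffs\<close>.\<close>

inductive_set pol :: "'a::comm_ring_1 set \<Rightarrow> 'a \<Rightarrow> 'a set" for A t where
  const: "a \<in> A \<Longrightarrow> a \<in> pol A t"
| step: "a \<in> A \<Longrightarrow> p \<in> pol A t \<Longrightarrow> a + t * p \<in> pol A t"

lemma pol_times: "0 \<in> A \<Longrightarrow> p \<in> pol A t \<Longrightarrow> t * p \<in> pol A t"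
  using pol.step[of 0 A p t] by simp

lemma subrng_pol:
  assumes A: "subrng A" shows "subrng (pol A t)"
proof -
  note D = subrngD[OF A]
  have scal: "a * p \<in> pol A t" if "p \<in> pol A t" "a \<in> A" for a p
    using that
  proof (induction rule: pol.induct)
    case (step b p)
    have "a * (b + t * p) = a * b + t * (a * p)" by (simp add: algebra_simps)
    then show ?case using step D(4) pol.step[of "a * b" A "a * p" t] by metis
  qed (auto intro: pol.const D)
  have addc: "b - p \<in> pol A t" if "p \<in> pol A t" "b \<in> A" for b p
    using that
  proof (cases rule: pol.cases)
    case (step a q)
    have "b - p = (b - a) + t * ((-1) * q)" using step by (simp add: algebra_simps)
    then show ?thesis using step that D(1,3,5) scal[of q "-1"] pol.step[of "b - a" A "(-1) * q" t] by metis
  qed (auto intro: pol.const D)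
  have diff: "p - q \<in> pol A t" if "p \<in> pol A t" "q \<in> pol A t" for p q
    using that
  proof (induction arbitrary: q rule: pol.induct)
    case (step a p)
    note st = step
    from step(4) show ?case
    proof (cases rule: pol.cases)
      case const
      have "a + t * p - q = (a - q) + t * p" by simp
      then show ?thesis using pol.step[of "a - q"] D const st by metis
    next
      case (step b q')
      have "a + t * p - q = (a - b) + t * (p - q')" using step by (simp add: algebra_simps)
      then show ?thesis using pol.step[of "a - b"] D step st by metis
    qed
  qed (rule addc)
  have "p * q \<in> pol A t" if "p \<in> pol A t" "q \<in> pol A t" for p q
    using that
  proof (induction rule: pol.induct)
    case (step a p)
    have "(a + t * p) * q = a * q - t * ((-1) * (p * q))" by (simp add: algebra_simps)
    then show ?case using step scal[of q a] scal[of "p * q" "-1"] pol_times[OF D(2)] diff D(1,5) by metis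
  qed (auto intro: scal)
  then show ?thesis using diff D(1) by (auto simp: subrng_def intro: pol.const)
qed

lemma pol_power_mult: "0 \<in> A \<Longrightarrow> p \<in> pol A t \<Longrightarrow> t ^ k * p \<in> pol A t"
  by (induction k) (auto simp: mult.assoc intro: pol_times)

text \<open>The threshold \<open>N\<close>, with zero padding beyond it, lets the finitely many
  relevant entries of a matrix be expanded with a common number of terms.\<close>

lemma pol_coeffs:
  assumes "p \<in> pol A t" "0 \<in> A"
  shows "\<exists>f N. (\<forall>k. f k \<in> A) \<and> (\<forall>M\<ge>N. p = (\<Sum>k<M. t ^ k * f k))"
  using assms(1)
proof (induction rule: pol.induct)
  case (const a)
  define f where "f = (\<lambda>k::nat. if k = 0 then a else 0)"
  have "a = (\<Sum>k<M. t ^ k * f k)" if "M \<ge> 1" for M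
  proof -
    have "(\<Sum>k<M. t ^ k * f k) = (\<Sum>k\<in>{0}. t ^ k * f k)"
      by (rule sum.mono_neutral_right) (use that in \<open>auto simp: f_def\<close>)
    then show ?thesis by (simp add: f_def)
  qed
  moreover have "\<forall>k. f k \<in> A" using const assms(2) by (simp add: f_def)
  ultimately show ?case by (intro exI[of _ f] exI[of _ 1]) blast
next
  case (step a p)
  then obtain f N where f: "\<forall>k. f k \<in> A" "\<And>M. M \<ge> N \<Longrightarrow> p = (\<Sum>k<M. t ^ k * f k)" by blast
  define g where "g = (\<lambda>k. case k of 0 \<Rightarrow> a | Suc j \<Rightarrow> f j)"
  have "a + t * p = (\<Sum>k<M. t ^ k * g k)" if "M \<ge> Suc N" for M
  proof -
    define M' where "M' = M - 1"
    have M': "M = Suc M'" "M' \<ge> N" using that by (auto simp: M'_def)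
    show ?thesis unfolding M'(1) sum.lessThan_Suc_shift using f(2)[OF M'(2)]
      by (simp add: g_def sum_distrib_left mult.assoc)
  qed
  moreover have "\<forall>k. g k \<in> A" using f step by (simp add: g_def split: nat.split)
  ultimately show ?case by blast
qed

lemma sum_in_pol:
  assumes "subrng A" "\<And>k. f k \<in> A"
  shows "(\<Sum>k<(N::nat). t ^ k * f k) \<in> pol A t"
  by (rule subrng_sum[OF subrng_pol[OF assms(1)]])
    (rule pol_power_mult[OF subrngD(2)[OF assms(1)] pol.const[OF assms(2)]])

section \<open>Free flags of lattices\<close>

fun spn :: "'f::field set \<Rightarrow> (nat \<Rightarrow> 'f) list \<Rightarrow> (nat \<Rightarrow> 'f) set \<Rightarrow> (nat \<Rightarrow> 'f) set" where
  "spn A [] U = U"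
| "spn A (v # vs) U = {(\<lambda>i. a * v i + m i) | a m. a \<in> A \<and> m \<in> spn A vs U}"

text \<open>Each vector is free over \<open>A\<close> modulo the span of the later ones and
  \<open>U\<close>, and \<open>s\<close> pushes it into that span. Thus \<open>spn A vs U\<close>
  modulo \<open>U\<close> is free on \<open>vs\<close>, and \<open>s\<close> maps each basis vector
  to a combination of later ones.\<close>

fun flag :: "'f::field set \<Rightarrow> 'f \<Rightarrow> (nat \<Rightarrow> 'f) list \<Rightarrow> (nat \<Rightarrow> 'f) set \<Rightarrow> bool" where
  "flag A s [] U = True"
| "flag A s (v # vs) U = ((\<lambda>i. s * v i) \<in> spn A vs U
     \<and> (\<forall>a\<in>A. (\<lambda>i. a * v i) \<in> spn A vs U \<longrightarrow> a = 0) \<and> flag A s vs U)"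

definition smod :: "'f::field set \<Rightarrow> (nat \<Rightarrow> 'f) set \<Rightarrow> bool" where
  "smod A U \<longleftrightarrow> (\<lambda>_. 0) \<in> U \<and> (\<forall>a\<in>A. \<forall>x\<in>U. \<forall>y\<in>U. (\<lambda>i. x i + a * y i) \<in> U)"

lemma smodD:
  assumes "smod A U"
  shows "(\<lambda>_. 0) \<in> U" "a \<in> A \<Longrightarrow> x \<in> U \<Longrightarrow> y \<in> U \<Longrightarrow> (\<lambda>i. x i + a * y i) \<in> U"
    "a \<in> A \<Longrightarrow> y \<in> U \<Longrightarrow> (\<lambda>i. a * y i) \<in> U"
proof -
  show 1: "(\<lambda>_. 0) \<in> U" and 2: "\<And>a x y. a \<in> A \<Longrightarrow> x \<in> U \<Longrightarrow> y \<in> U \<Longrightarrow> (\<lambda>i. x i + a * y i) \<in> U"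
    using assms by (auto simp: smod_def)
  show "a \<in> A \<Longrightarrow> y \<in> U \<Longrightarrow> (\<lambda>i. a * y i) \<in> U" using 2[OF _ 1] by simp
qed

lemma smod_add: "smod A U \<Longrightarrow> subrng A \<Longrightarrow> x \<in> U \<Longrightarrow> y \<in> U \<Longrightarrow> (\<lambda>i. x i + y i) \<in> U"
  using smodD(2)[of A U 1 x y] subrngD(1) by force

lemma smod_diff: "smod A U \<Longrightarrow> subrng A \<Longrightarrow> x \<in> U \<Longrightarrow> y \<in> U \<Longrightarrow> (\<lambda>i. x i - y i) \<in> U"
  using smodD(2)[of A U "-1" x y] subrngD(1,5) by force

lemma smod_sum:
  assumes "smod A U" "\<And>k. k \<in> S \<Longrightarrow> c k \<in> A" "\<And>k. k \<in> S \<Longrightarrow> x k \<in> U"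
  shows "(\<lambda>i. \<Sum>k\<in>S. c k * x k i) \<in> U"
  using assms(2,3)
proof (induction S rule: infinite_finite_induct)
  case (insert k S)
  then have "(\<lambda>i. (\<Sum>k\<in>S. c k * x k i) + c k * x k i) \<in> U"
    by (intro smodD(2)[OF assms(1)]) auto
  then show ?case using insert.hyps by (simp add: add.commute)
qed (auto intro: smodD[OF assms(1)])

lemma smod_spn:
  assumes A: "subrng A" and U: "smod A U" shows "smod A (spn A vs U)"
proof (induction vs)
  case (Cons v vs)
  note D = subrngD[OF A]
  show ?case
    unfolding smod_def
  proof (intro conjI ballI)
    show "(\<lambda>_. 0) \<in> spn A (v # vs) U"
      using smodD(1)[OF Cons] D(2) by (auto intro!: exI[of _ 0] exI[of _ "\<lambda>_. 0"])
    fix a x y assume a: "a \<in> A" and "x \<in> spn A (v # vs) U" "y \<in> spn A (v # vs) U"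
    then obtain b m c k where x: "x = (\<lambda>i. b * v i + m i)" "b \<in> A" "m \<in> spn A vs U"
      and y: "y = (\<lambda>i. c * v i + k i)" "c \<in> A" "k \<in> spn A vs U" by auto
    have "(\<lambda>i. x i + a * y i) = (\<lambda>i. (b + a * c) * v i + (m i + a * k i))"
      by (simp add: x y algebra_simps)
    moreover have "b + a * c \<in> A" using a x y D by auto
    moreover have "(\<lambda>i. m i + a * k i) \<in> spn A vs U" using a x y by (intro smodD(2)[OF Cons])
    ultimately show "(\<lambda>i. x i + a * y i) \<in> spn A (v # vs) U" by fastforce
  qed
qed (use U in simp)

lemma subset_spn: assumes "0 \<in> A" shows "U \<subseteq> spn A vs U"
proof (induction vs)
  case (Cons v vs)
  then show ?case using assms by (force intro!: exI[of _ 0])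
qed simp

lemma spn_append: "spn A (vs @ ws) U = spn A vs (spn A ws U)"
  by (induction vs) auto

lemma flag_append: "flag A s (vs @ ws) U = (flag A s vs (spn A ws U) \<and> flag A s ws U)"
  by (induction vs) (auto simp: spn_append)

lemma spn_image:
  assumes "\<And>a v m. \<phi> (\<lambda>i. a * v i + m i) = (\<lambda>i. a * \<phi> v i + \<phi> m i)"
  shows "spn A (map \<phi> vs) (\<phi> ` U) = \<phi> ` spn A vs U"
proof (induction vs)
  case (Cons v vs)
  show ?case
  proof (intro equalityI subsetI)
    fix x assume "x \<in> spn A (map \<phi> (v # vs)) (\<phi> ` U)"
    then obtain a m where "x = (\<lambda>i. a * \<phi> v i + m i)" "a \<in> A" "m \<in> \<phi> ` spn A vs U"
      using Cons by auto
    then obtain m' where "x = \<phi> (\<lambda>i. a * v i + m' i)" "a \<in> A" "m' \<in> spn A vs U"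
      using assms by auto
    then show "x \<in> \<phi> ` spn A (v # vs) U" by auto
  next
    fix x assume "x \<in> \<phi> ` spn A (v # vs) U"
    then obtain a m where "x = \<phi> (\<lambda>i. a * v i + m i)" "a \<in> A" "m \<in> spn A vs U" by auto
    then show "x \<in> spn A (map \<phi> (v # vs)) (\<phi> ` U)" using Cons assms by auto
  qed
qed simp

lemma flag_image:
  assumes lin: "\<And>a v m. \<phi> (\<lambda>i. a * v i + m i) = (\<lambda>i. a * \<phi> v i + \<phi> m i)"
    and inj: "inj \<phi>" and "flag A s vs U"
  shows "flag A s (map \<phi> vs) (\<phi> ` U)"
  using assms(3)
proof (induction vs)
  case (Cons v vs)
  have z: "\<phi> (\<lambda>i. 0) = (\<lambda>i. 0)" using lin[of 1 "\<lambda>i. 0" "\<lambda>i. 0"]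
    by (metis (no_types, lifting) add_cancel_right_left lambda_one mult_1 ext)
  have sc: "\<phi> (\<lambda>i. a * v i) = (\<lambda>i. a * \<phi> v i)" for a using lin[of a v "\<lambda>i. 0"] z by simp
  show ?case using Cons unfolding list.map flag.simps spn_image[of \<phi>, OF lin]
    by (auto simp: sc[symmetric] inj_image_mem_iff[OF inj])
qed simp

text \<open>Filtrations from \<open>U\<close> up to \<open>M\<close> by free steps of rank one.
  Hiding the list makes them easy to concatenate and to transport along injective linear
  maps.\<close>

definition reach :: "'f::field set \<Rightarrow> 'f \<Rightarrow> (nat \<Rightarrow> 'f) set \<Rightarrow> (nat \<Rightarrow> 'f) set \<Rightarrow> bool" where
  "reach A s M U \<longleftrightarrow> (\<exists>vs. flag A s vs U \<and> spn A vs U = M)"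

lemma reach_refl: "reach A s M M"
  unfolding reach_def by (rule exI[of _ "[]"]) simp

lemma reach_trans: "reach A s M N \<Longrightarrow> reach A s N U \<Longrightarrow> reach A s M U"
  unfolding reach_def by (metis flag_append spn_append)

lemma reach_image:
  assumes "\<And>a v m. \<phi> (\<lambda>i. a * v i + m i) = (\<lambda>i. a * \<phi> v i + \<phi> m i)" "inj \<phi>" "reach A s M U"
  shows "reach A s (\<phi> ` M) (\<phi> ` U)"
  using assms(3) flag_image[of \<phi>, OF assms(1,2)] spn_image[of \<phi>, OF assms(1)] unfolding reach_def by metis

lemma spn_coords:
  assumes A: "subrng A" and "x \<in> spn A vs U"
  shows "\<exists>c. (\<forall>k. c k \<in> A) \<and> (\<lambda>i. x i - (\<Sum>k<length vs. c k * (vs ! k) i)) \<in> U"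
  using assms(2)
proof (induction vs arbitrary: x)
  case Nil
  then show ?case using subrngD(2)[OF A] by (auto intro!: exI[of _ "\<lambda>_. 0"])
next
  case (Cons v vs)
  then obtain a m where x: "x = (\<lambda>i. a * v i + m i)" "a \<in> A" "m \<in> spn A vs U" by auto
  obtain c where c: "\<forall>k. c k \<in> A" "(\<lambda>i. m i - (\<Sum>k<length vs. c k * (vs ! k) i)) \<in> U"
    using Cons.IH[OF x(3)] by blast
  define d where "d = (\<lambda>k. case k of 0 \<Rightarrow> a | Suc j \<Rightarrow> c j)"
  have "(\<lambda>i. x i - (\<Sum>k<length (v # vs). d k * ((v # vs) ! k) i))
      = (\<lambda>i. m i - (\<Sum>k<length vs. c k * (vs ! k) i))"
    by (simp add: d_def x sum.lessThan_Suc_shift del: sum.lessThan_Suc)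
  moreover have "\<forall>k. d k \<in> A" using c x by (simp add: d_def split: nat.split)
  ultimately show ?case using c(2) by (intro exI[of _ d]) simp
qed

lemma nth_in_spn:
  assumes A: "subrng A" and U: "smod A U" and "k < length vs"
  shows "vs ! k \<in> spn A vs U"
  using assms(3)
proof (induction vs arbitrary: k)
  case (Cons v vs)
  show ?case
  proof (cases k)
    case 0
    then show ?thesis using smodD(1)[OF smod_spn[OF A U]] subrngD(1)[OF A]
      by (auto intro!: exI[of _ 1] exI[of _ "\<lambda>_. 0"])
  next
    case (Suc j)
    then show ?thesis using Cons subrngD(2)[OF A]
      by (auto intro!: exI[of _ 0] exI[of _ "vs ! j"])
  qed
qed simp

text \<open>The tail of the combination lies in the span of the later vectors, hence so does the
  head term; the freeness clause kills the head coefficient, and the tail is handled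
  recursively.\<close>

lemma flag_indep:
  assumes A: "subrng A" and U: "smod A U" and "flag A s vs U"
    and "\<And>k. c k \<in> A" "(\<lambda>i. \<Sum>k<length vs. c k * (vs ! k) i) \<in> U" "k < length vs"
  shows "c k = 0"
  using assms(3-6)
proof (induction vs arbitrary: c k)
  case (Cons v vs)
  let ?W = "\<lambda>i. \<Sum>k<length vs. c (Suc k) * (vs ! k) i"
  have eq: "(\<lambda>i. \<Sum>k<length (v # vs). c k * ((v # vs) ! k) i) = (\<lambda>i. c 0 * v i + ?W i)"
    by (simp add: sum.lessThan_Suc_shift del: sum.lessThan_Suc)
  have sm: "smod A (spn A vs U)" by (rule smod_spn[OF A U])
  have W: "?W \<in> spn A vs U"
    by (rule smod_sum[OF sm]) (use Cons.prems nth_in_spn[OF A U] in auto)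
  have "(\<lambda>i. c 0 * v i + ?W i) \<in> spn A vs U"
    using Cons.prems(3) subset_spn[of A U vs] subrngD(2)[OF A] unfolding eq by blast
  from smod_diff[OF sm A this W] have "(\<lambda>i. c 0 * v i) \<in> spn A vs U" by simp
  then have c0: "c 0 = 0" using Cons.prems(1,2) by auto
  then have "?W \<in> U" using Cons.prems(3) unfolding eq by simp
  then show ?case using Cons.IH[of "\<lambda>k. c (Suc k)" "k - 1"] Cons.prems c0 by (cases k) auto
qed simp

text \<open>Coordinates of \<open>s\<close> times a flag vector in terms of strictly later ones,
  padded with zeros at the other positions so that they form a square strictly triangular
  matrix.\<close>

lemma flag_triangular:
  assumes A: "subrng A" and "flag A s vs U" "k < length vs"
  shows "\<exists>c. (\<forall>j. c j \<in> A) \<and> (\<forall>j\<le>k. c j = 0) \<and>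
    (\<lambda>i. s * (vs ! k) i - (\<Sum>j<length vs. c j * (vs ! j) i)) \<in> U"
  using assms(2,3)
proof (induction vs arbitrary: k)
  case (Cons v vs)
  have "\<exists>c. (\<forall>j. c j \<in> A) \<and> (\<forall>j<k. c j = 0) \<and>
    (\<lambda>i. s * ((v # vs) ! k) i - (\<Sum>j<length vs. c j * (vs ! j) i)) \<in> U"
  proof (cases k)
    case 0
    then show ?thesis using Cons.prems spn_coords[OF A] by fastforce
  next
    case (Suc l)
    then show ?thesis using Cons.IH[of l] Cons.prems by (auto simp: less_Suc_eq_le)
  qed
  then obtain c where c: "\<forall>j. c j \<in> A" "\<forall>j<k. c j = 0"
    "(\<lambda>i. s * ((v # vs) ! k) i - (\<Sum>j<length vs. c j * (vs ! j) i)) \<in> U" by blast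
  define d where "d = (\<lambda>k. case k of 0 \<Rightarrow> 0 | Suc j \<Rightarrow> c j)"
  have "(\<lambda>i. s * ((v # vs) ! k) i - (\<Sum>j<length (v # vs). d j * ((v # vs) ! j) i))
      = (\<lambda>i. s * ((v # vs) ! k) i - (\<Sum>j<length vs. c j * (vs ! j) i))"
    by (simp add: d_def sum.lessThan_Suc_shift del: sum.lessThan_Suc)
  moreover have "\<forall>j. d j \<in> A" "\<forall>j\<le>k. d j = 0"
    using c subrngD(2)[OF A] by (auto simp: d_def split: nat.split)
  ultimately show ?case using c(3) by (intro exI[of _ d]) simp
qed simp

text \<open>Coordinates from \<open>r\<close> on are left alone, so an invertible matrix of
  \<open>bdd r\<close> acts injectively on all vectors and images of lattices can be taken without
  restricting the domain.\<close>

definition mv :: "nat \<Rightarrow> 'f::field cf \<Rightarrow> (nat \<Rightarrow> 'f) \<Rightarrow> nat \<Rightarrow> 'f" where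
  "mv r g v i = (if i < r then \<Sum>j<r. ent g i j * v j else v i)"

lemma mv_linear: "r > 0 \<Longrightarrow> mv r g (\<lambda>i. a * v i + m i) i = (a * mv r g v i + mv r g m i)"
  by (simp add: mv_def sum.distrib algebra_simps sum_distrib_left)

lemma mv_one: "mv r 1 v = v"
proof
  fix i show "mv r 1 v i = v i"
  proof (cases "i < r")
    case True
    have "(\<Sum>j<r. ent 1 i j * v j) = (\<Sum>j\<in>{i}. ent 1 i j * v j)"
      by (rule sum.mono_neutral_right) (use True in \<open>auto simp: ent_one\<close>)
    then show ?thesis using True by (simp add: mv_def ent_one)
  qed (simp add: mv_def)
qed

lemma mv_mult:
  assumes "h \<in> bdd r" shows "mv r (g * h) v = mv r g (mv r h v)"
proof
  fix i show "mv r (g * h) v i = mv r g (mv r h v) i"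
  proof (cases "i < r")
    case True
    have "mv r (g * h) v i = (\<Sum>j<r. (\<Sum>k<r. ent g i k * ent h k j) * v j)"
      using True assms by (simp add: mv_def ent_mult_bdd)
    also have "\<dots> = (\<Sum>j<r. \<Sum>k<r. ent g i k * (ent h k j * v j))"
      by (simp add: sum_distrib_right mult.assoc)
    also have "\<dots> = (\<Sum>k<r. ent g i k * (\<Sum>j<r. ent h k j * v j))"
      by (subst sum.swap) (simp add: sum_distrib_left)
    also have "\<dots> = mv r g (mv r h v) i" using True by (simp add: mv_def)
    finally show ?thesis .
  qed (simp add: mv_def)
qed

lemma mv_elem:
  assumes "i < r" "j < r"
  shows "mv r (1 + mun i j q) v = v(i := v i + q * v j)"
proof
  fix k show "mv r (1 + mun i j q) v k = (v(i := v i + q * v j)) k"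
  proof (cases "k < r")
    case True
    have "mv r (1 + mun i j q) v k = mv r 1 v k + (\<Sum>l<r. (if k = i \<and> l = j then q else 0) * v l)"
      using True by (simp add: mv_def ent_mun algebra_simps sum.distrib)
    also have "(\<Sum>l<r. (if k = i \<and> l = j then q else 0) * v l)
        = (\<Sum>l\<in>{j}. (if k = i \<and> l = j then q else 0) * v l)"
      by (rule sum.mono_neutral_right) (use assms in auto)
    finally show ?thesis by (simp add: mv_one)
  qed (use assms in \<open>auto simp: mv_def\<close>)
qed


section \<open>Places and monic inversion for elementary matrices\<close>

text \<open>Model: \<open>B\<close> consists of the elements of \<open>Q\<close> without pole at a
  place with uniformiser \<open>s\<close>, and \<open>A\<close> represents the values there.
  \<open>dec\<close> and \<open>sep\<close> say that \<open>B\<close> is the direct sum of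
  \<open>A\<close> and \<open>s * B\<close>; \<open>bound\<close> says that poles have finite
  order.\<close>

locale place =
  fixes A B Q :: "'f::field set" and s :: 'f
  assumes A: "subrng A" and B: "subrng B" and Q: "subrng Q"
    and AB: "A \<subseteq> B" and BQ: "B \<subseteq> Q"
    and s: "s \<in> B" "s \<noteq> 0" and t: "inverse s \<in> Q"
    and dec: "b \<in> B \<Longrightarrow> \<exists>a\<in>A. \<exists>b'\<in>B. b = a + s * b'"
    and sep: "b \<in> B \<Longrightarrow> s * b \<in> A \<Longrightarrow> b = 0"
    and bound: "q \<in> Q \<Longrightarrow> \<exists>k. s ^ k * q \<in> B"
begin

abbreviation t where "t \<equiv> inverse s"
abbreviation P where "P \<equiv> pol A t"

lemmas AD = subrngD[OF A] and BD = subrngD[OF B] and QD = subrngD[OF Q]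

lemma st [simp]: "s * t = 1" "t * s = 1" "s * (t * x) = x" "t * (s * x) = x"
  using s(2) by simp_all

lemma P_subrng: "subrng P" by (rule subrng_pol[OF A])
lemmas PD = subrngD[OF P_subrng]

lemma P_Q: "p \<in> P \<Longrightarrow> p \<in> Q"
  by (induction rule: pol.induct) (use AB BQ t QD in auto)

lemma t_P: "t \<in> P"
  using pol.step[of 0 A 1 t] AD by (auto intro: pol.const)

definition Lat :: "nat \<Rightarrow> (nat \<Rightarrow> nat) \<Rightarrow> (nat \<Rightarrow> 'f) set" where
  "Lat r f = {v. (\<forall>i<r. s ^ f i * v i \<in> B) \<and> (\<forall>i\<ge>r. v i = 0)}"

lemma smod_Lat: "smod A (Lat r f)"
proof -
  have "s ^ k * (x + a * y) \<in> B" if "s ^ k * x \<in> B" "s ^ k * y \<in> B" "a \<in> A" for k x y a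
  proof -
    have "s ^ k * (x + a * y) = s ^ k * x + a * (s ^ k * y)" by (simp add: algebra_simps)
    then show ?thesis using that AB BD by auto
  qed
  then show ?thesis by (auto simp: smod_def Lat_def BD)
qed

text \<open>Allowing one more pole in coordinate \<open>i\<close> adds a single free generator,
  \<open>t ^ Suc (f i)\<close> in that coordinate; \<open>s\<close> sends it back into the smaller
  lattice.\<close>

lemma reach_Lat_step:
  assumes "i < r" shows "reach A s (Lat r (f(i := Suc (f i)))) (Lat r f)"
  unfolding reach_def
proof (intro exI conjI)
  let ?v = "\<lambda>k. if k = i then t ^ Suc (f i) else 0"
  have st': "s ^ k * t ^ k = 1" for k using s(2) by (simp flip: power_mult_distrib)
  have sv: "(\<lambda>k. s * ?v k) = (\<lambda>k. if k = i then t ^ f i else 0)" by (auto simp: power_Suc)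
  show "flag A s [?v] (Lat r f)"
    unfolding flag.simps spn.simps
  proof (intro conjI ballI impI)
    show "(\<lambda>k. s * ?v k) \<in> Lat r f" unfolding sv using assms by (auto simp: Lat_def st' BD)
    fix a assume a: "a \<in> A" "(\<lambda>k. a * ?v k) \<in> Lat r f"
    then have "s ^ f i * (a * t ^ Suc (f i)) \<in> B" using assms by (auto simp: Lat_def)
    also have "s ^ f i * (a * t ^ Suc (f i)) = t * a * (s ^ f i * t ^ f i)" by (simp add: mult_ac)
    finally have "t * a \<in> B" by (simp add: st')
    from sep[OF this] a have "t * a = 0" by simp
    then show "a = 0" using s(2) by simp
  qed simp
  show "spn A [?v] (Lat r f) = Lat r (f(i := Suc (f i)))"
  proof (intro equalityI subsetI)
    fix x assume "x \<in> spn A [?v] (Lat r f)"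
    then obtain a m where x: "x = (\<lambda>k. a * ?v k + m k)" "a \<in> A" "m \<in> Lat r f" by auto
    have "s ^ Suc (f i) * x i = a * (s ^ Suc (f i) * t ^ Suc (f i)) + s * (s ^ f i * m i)"
      by (simp add: x algebra_simps)
    then have "s ^ Suc (f i) * x i = a + s * (s ^ f i * m i)" unfolding st' by simp
    then have "s ^ Suc (f i) * x i \<in> B" using x assms AB s BD by (auto simp: Lat_def)
    then show "x \<in> Lat r (f(i := Suc (f i)))" using x assms by (auto simp: Lat_def)
  next
    fix x assume x: "x \<in> Lat r (f(i := Suc (f i)))"
    then have "s ^ Suc (f i) * x i \<in> B" using assms by (auto simp: Lat_def)
    then obtain a b where ab: "a \<in> A" "b \<in> B" "s ^ Suc (f i) * x i = a + s * b" using dec by blast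
    define m where "m = (\<lambda>k. x k - a * ?v k)"
    have "s * (s ^ f i * m i) = s ^ Suc (f i) * x i - a * (s ^ Suc (f i) * t ^ Suc (f i))"
      by (simp add: m_def algebra_simps)
    then have "s * (s ^ f i * m i) = s * b" unfolding st' ab(3) by simp
    then have "s ^ f i * m i = b" using s(2) by simp
    then have "m \<in> Lat r f" using x ab assms unfolding Lat_def m_def by (auto split: if_splits)
    moreover have "x = (\<lambda>k. a * ?v k + m k)" by (simp add: m_def)
    ultimately show "x \<in> spn A [?v] (Lat r f)" using ab(1) by auto
  qed
qed

lemma reach_Lat_le:
  assumes "\<And>i. i < r \<Longrightarrow> f i \<le> g i"
  shows "reach A s (Lat r g) (Lat r f)"
  using assms
proof (induction "\<Sum>i<r. g i - f i" arbitrary: g)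
  case 0
  then have "g i = f i" if "i < r" for i using that by (simp add: le_antisym)
  then have "Lat r g = Lat r f" by (auto simp: Lat_def)
  then show ?case by (simp add: reach_refl)
next
  case (Suc n)
  have "(\<Sum>i<r. g i - f i) \<noteq> 0" using Suc.hyps(2) by linarith
  then obtain i where "i \<in> {..<r}" "g i - f i \<noteq> 0" by (rule sum.not_neutral_contains_not_neutral)
  then have i: "i < r" "f i < g i" by auto
  define h where "h = g(i := g i - 1)"
  have gh: "g = h(i := Suc (h i))" using i by (auto simp: h_def)
  have "(\<Sum>k<r. g k - f k) = Suc (\<Sum>k<r. h k - f k)"
    using i by (simp add: sum.remove[of "{..<r}" i] h_def)
  then have "n = (\<Sum>k<r. h k - f k)" using Suc.hyps(2) by simp
  then have "reach A s (Lat r h) (Lat r f)"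
    using Suc.prems i by (intro Suc.hyps(1)) (auto simp: h_def)
  moreover have "reach A s (Lat r g) (Lat r h)" by (subst gh) (rule reach_Lat_step[OF i(1)])
  ultimately show ?case by (rule reach_trans[rotated])
qed

text \<open>The extra pole order \<open>k\<close> granted to coordinate \<open>i\<close> is the room
  needed for adding \<open>q\<close> times coordinate \<open>j\<close>. The same holds for
  \<open>- q\<close>, which gives equality.\<close>

lemma mv_elem_Lat:
  assumes "i < r" "j < r" "i \<noteq> j" "s ^ k * q \<in> B"
  shows "mv r (1 + mun i j q) ` Lat r ((\<lambda>_. N)(i := N + k)) = Lat r ((\<lambda>_. N)(i := N + k))"
proof -
  have sub: "mv r (1 + mun i j q) v \<in> Lat r ((\<lambda>_. N)(i := N + k))"
    if "v \<in> Lat r ((\<lambda>_. N)(i := N + k))" "s ^ k * q \<in> B" for q v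
  proof -
    have "s ^ (N + k) * (v i + q * v j) = s ^ (N + k) * v i + (s ^ k * q) * (s ^ N * v j)"
      by (simp add: algebra_simps power_add)
    also have "\<dots> \<in> B"
    proof (rule BD(6)[OF _ BD(4)])
      show "s ^ (N + k) * v i \<in> B" "s ^ N * v j \<in> B" "s ^ k * q \<in> B"
        using that assms by (auto simp: Lat_def)
    qed
    finally show ?thesis using that assms by (auto simp: mv_elem Lat_def)
  qed
  have neg: "s ^ k * (- q) \<in> B" using assms(4) BD(5)[of "s ^ k * q"] by simp
  show ?thesis
  proof (intro equalityI subsetI)
    fix v assume v: "v \<in> Lat r ((\<lambda>_. N)(i := N + k))"
    have "mv r (1 + mun i j q) (mv r (1 + mun i j (- q)) v) = v"
      by (subst mv_mult[symmetric]) (use assms in \<open>auto simp: elem_inverse mv_one bdd_elem\<close>)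
    then show "v \<in> mv r (1 + mun i j q) ` Lat r ((\<lambda>_. N)(i := N + k))"
      using sub[OF v neg] by (metis imageI)
  qed (use sub assms in auto)
qed

lemma inj_mv:
  assumes "h * g = 1" "g \<in> bdd r" shows "inj (mv r g)"
  by (rule inj_on_inverseI[of _ "mv r h"]) (use assms in \<open>simp add: mv_mult[symmetric] mv_one\<close>)

text \<open>The factors are read one by one. A lattice stable under the new factor contains the
  image of the previous uniform lattice and lies in a larger uniform one, so the filtrations can be
  joined. Size and pole order appear as thresholds because later factors raise both.\<close>

lemma elm_reach:
  assumes "g \<in> elm Q"
  shows "\<exists>r0. \<forall>r\<ge>r0. g \<in> bdd r \<and>
    (\<exists>N0. \<forall>N\<ge>N0. reach A s (Lat r (\<lambda>_. N)) (mv r g ` Lat r (\<lambda>_. 0)))"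
  using assms
proof (induction rule: elm.induct)
  case one
  then show ?case by (auto simp: mv_one intro!: reach_Lat_le)
next
  case (step g i j q)
  then obtain r0 where r0: "\<And>r. r \<ge> r0 \<Longrightarrow> g \<in> bdd r"
    "\<And>r. r \<ge> r0 \<Longrightarrow> \<exists>N0. \<forall>N\<ge>N0. reach A s (Lat r (\<lambda>_. N)) (mv r g ` Lat r (\<lambda>_. 0))" by blast
  obtain k where k: "s ^ k * q \<in> B" using bound step by blast
  show ?case
  proof (rule exI[of _ "max r0 (max (Suc i) (Suc j))"], intro allI impI conjI)
    fix r assume "max r0 (max (Suc i) (Suc j)) \<le> r"
    then have r: "r0 \<le> r" "i < r" "j < r" by auto
    let ?e = "1 + mun i j q"
    show "?e * g \<in> bdd r" using r r0 by (auto intro!: bdd_mult bdd_elem)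
    obtain N where N: "reach A s (Lat r (\<lambda>_. N)) (mv r g ` Lat r (\<lambda>_. 0))" using r0(2)[OF r(1)] by blast
    have lin: "mv r ?e (\<lambda>i. a * v i + m i) = (\<lambda>i. a * mv r ?e v i + mv r ?e m i)" for a v m
      using r by (auto simp: mv_linear)
    have inj: "inj (mv r ?e)"
      using elem_inverse[OF step(2), of "- q"] r by (intro inj_mv[of "1 + mun i j (- q)"]) (auto simp: bdd_elem)
    have 1: "reach A s (mv r ?e ` Lat r (\<lambda>_. N)) (mv r ?e ` mv r g ` Lat r (\<lambda>_. 0))"
      by (rule reach_image[OF lin inj N])
    have 2: "reach A s (Lat r ((\<lambda>_. N)(i := N + k))) (mv r ?e ` Lat r (\<lambda>_. N))"
      using reach_image[OF lin inj reach_Lat_le[of r "\<lambda>_. N" "(\<lambda>_. N)(i := N + k)"]]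
      by (simp add: mv_elem_Lat[OF r(2,3) step(2) k])
    have 3: "mv r ?e ` mv r g ` Lat r (\<lambda>_. 0) = mv r (?e * g) ` Lat r (\<lambda>_. 0)"
      using r0(1)[OF r(1)] by (simp add: mv_mult image_image)
    show "\<exists>N0. \<forall>N\<ge>N0. reach A s (Lat r (\<lambda>_. N)) (mv r (?e * g) ` Lat r (\<lambda>_. 0))"
    proof (intro exI[of _ "N + k"] allI impI)
      fix M assume "N + k \<le> M"
      then have "reach A s (Lat r (\<lambda>_. M)) (Lat r ((\<lambda>_. N)(i := N + k)))"
        by (intro reach_Lat_le) auto
      then show "reach A s (Lat r (\<lambda>_. M)) (mv r (?e * g) ` Lat r (\<lambda>_. 0))"
        using reach_trans[OF _ reach_trans[OF 2 1]] unfolding 3 by blast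
    qed
  qed
qed

text \<open>Multiply by \<open>s ^ M\<close>, where \<open>M\<close> is the top degree: all other
  terms become divisible by \<open>s\<close> in \<open>B\<close>, hence so is the top coefficient,
  and \<open>sep\<close> makes it 0.\<close>

lemma tP_coeffs:
  assumes f: "\<And>k. f k \<in> A" and "t * (\<Sum>k<N. t ^ k * f k) \<in> B" "k < N"
  shows "f k = 0"
  using assms(2,3)
proof (induction N)
  case (Suc M)
  let ?p = "\<Sum>k<Suc M. t ^ k * f k"
  have 1: "s ^ M * (\<Sum>k<M. t ^ k * f k) = s * (\<Sum>k<M. s ^ (M - 1 - k) * f k)"
  proof -
    have "s ^ M * (t ^ k * f k) = s * (s ^ (M - 1 - k) * f k)" if "k < M" for k
    proof -
      have M: "s ^ M = s * (s ^ (M - 1 - k) * s ^ k)"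
      proof -
        have "M = Suc ((M - 1 - k) + k)" using that by simp
        then show ?thesis by (metis power_Suc power_add)
      qed
      have st1: "s ^ k * t ^ k = 1" using s(2) by (simp flip: power_mult_distrib)
      have "s ^ M * (t ^ k * f k) = s * s ^ (M - 1 - k) * (s ^ k * t ^ k) * f k"
        unfolding M by (simp add: mult_ac)
      then show ?thesis unfolding st1 by (simp add: mult_ac)
    qed
    then show ?thesis unfolding sum_distrib_left by (intro sum.cong) auto
  qed
  define b where "b = s ^ M * (t * ?p) - (\<Sum>k<M. s ^ (M - 1 - k) * f k)"
  have "s ^ k \<in> B" for k by (rule subrng_power[OF B s(1)])
  moreover have "(\<Sum>k<M. s ^ (M - 1 - k) * f k) \<in> B"
    by (rule subrng_sum[OF B]) (use f AB in \<open>auto intro!: BD(4) subrng_power[OF B s(1)]\<close>)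
  ultimately have b: "b \<in> B" unfolding b_def using Suc.prems(1) by (intro BD(3) BD(4)[of "s ^ M"])
  have "s ^ M * t ^ M = 1" using s(2) by (simp flip: power_mult_distrib)
  then have "f M = s ^ M * (t ^ M * f M)" by (simp flip: mult.assoc)
  also have "\<dots> = s ^ M * ?p - s ^ M * (\<Sum>k<M. t ^ k * f k)" by (simp add: algebra_simps)
  also have "\<dots> = s * b" unfolding 1 b_def by (simp add: right_diff_distrib mult.left_commute)
  finally have "f M = s * b" .
  then have "f M = 0" using sep[OF b] f(1)[of M] by simp
  then show ?case using Suc by (cases "k = M") auto
qed simp

lemma tP_B_disjoint:
  assumes "p \<in> P" "t * p \<in> B" shows "p = 0"
proof -
  obtain f N where f: "\<And>k. f k \<in> A" "p = (\<Sum>k<N. t ^ k * f k)"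
    using pol_coeffs[OF assms(1) AD(2)] by blast
  have "f k = 0" if "k < N" for k using tP_coeffs[OF f(1), where N = N and k = k] assms(2) that by (simp add: f(2))
  then show ?thesis by (simp add: f(2))
qed

text \<open>Partial fractions at the place: \<open>dec\<close> strips the pole of top order, and
  induction on the order separates principal and regular part. With \<open>tP_B_disjoint\<close> the
  splitting of \<open>Q\<close> into \<open>t * P\<close> and \<open>B\<close> is direct.\<close>

lemma Q_decomp:
  assumes "s ^ N * q \<in> B"
  shows "\<exists>f b. (\<forall>k. f k \<in> A) \<and> b \<in> B \<and> q = (\<Sum>k<N. t ^ Suc k * f k) + b"
  using assms
proof (induction N arbitrary: q)
  case 0
  then show ?case using AD by (intro exI[of _ "\<lambda>_. 0"] exI[of _ q]) auto
next
  case (Suc N)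
  obtain a b where ab: "a \<in> A" "b \<in> B" "s ^ Suc N * q = a + s * b" using dec[OF Suc.prems] by blast
  have ts: "t ^ k * s ^ k = 1" for k using s(2) by (simp flip: power_mult_distrib)
  have "s * (s ^ N * (q - t ^ Suc N * a)) = s ^ Suc N * q - (t ^ Suc N * s ^ Suc N) * a"
    by (simp add: algebra_simps)
  also have "\<dots> = s * b" unfolding ts ab(3) by simp
  finally have "s ^ N * (q - t ^ Suc N * a) \<in> B" using ab(2) s(2) by simp
  then obtain f c where f: "\<forall>k. f k \<in> A" "c \<in> B" "q - t ^ Suc N * a = (\<Sum>k<N. t ^ Suc k * f k) + c"
    using Suc.IH by blast
  have "q = (\<Sum>k<Suc N. t ^ Suc k * (f(N := a)) k) + c"
    using f(3) by (simp add: algebra_simps)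
  moreover have "\<forall>k. (f(N := a)) k \<in> A" using f ab by auto
  ultimately show ?case using f(2) by blast
qed

end

lemma mult_add_less_mult:
  fixes i l r N :: nat
  assumes "l < N" "i < r" shows "l * r + i < r * N"
proof -
  have "l * r + i < Suc l * r" using assms by simp
  also have "\<dots> \<le> N * r" using assms by (intro mult_le_mono1) simp
  finally show ?thesis by (simp add: mult.commute)
qed

text \<open>An index below \<open>r * N\<close> stands for a pair: its remainder modulo
  \<open>r\<close> is a coordinate, its quotient an exponent.\<close>

lemma sum_mod_reindex:
  fixes i r N :: nat
  assumes "i < r"
  shows "(\<Sum>m<r * N. if i = m mod r then h m else 0) = (\<Sum>l<N. h (l * r + i) :: 'a::comm_monoid_add)"
proof -
  have "(\<Sum>m<r * N. if i = m mod r then h m else 0) = sum h {m\<in>{..<r * N}. i = m mod r}"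
    by (subst sum.inter_filter) auto
  also have "{m\<in>{..<r * N}. i = m mod r} = (\<lambda>l. l * r + i) ` {..<N}"
  proof (intro equalityI subsetI)
    fix m assume m: "m \<in> {m\<in>{..<r * N}. i = m mod r}"
    then have "m = (m div r) * r + i" "m div r < N"
      using assms by (auto simp: less_mult_imp_div_less mult.commute)
    then show "m \<in> (\<lambda>l. l * r + i) ` {..<N}" by blast
  next
    fix m assume "m \<in> (\<lambda>l. l * r + i) ` {..<N}"
    then obtain l where l: "l < N" "m = l * r + i" by auto
    then show "m \<in> {m\<in>{..<r * N}. i = m mod r}" using l assms mult_add_less_mult by auto
  qed
  also have "sum h ((\<lambda>l. l * r + i) ` {..<N}) = (\<Sum>l<N. h (l * r + i))"
    by (subst sum.reindex) (use assms in \<open>auto simp: inj_on_def\<close>)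
  finally show ?thesis .
qed


context place
begin

text \<open>The lattice \<open>t\<^sup>N B\<^sup>r\<close> modulo \<open>\<alpha> B\<^sup>r\<close> has two bases: a flag coming from the elementary
  factorisation of \<open>\<alpha>\<close> over \<open>Q\<close>, on which \<open>s\<close> is strictly triangular, and the basis \<open>t\<^sup>l e\<^sub>i\<close>
  with \<open>1 \<le> l \<le> N\<close>, on which \<open>s\<close> acts by the companion matrix of \<open>\<alpha>\<close>.\<close>

theorem monic_inversion:
  assumes \<alpha>: "\<alpha> \<in> elm Q" "\<alpha> * \<beta> = 1" "\<beta> * \<alpha> = 1" "\<beta> \<in> over P"
    and al: "\<And>k i j. al k i j \<in> A"
    and \<alpha>_al: "\<And>i j. ent \<alpha> i j = ent 1 i j + (\<Sum>k<N1. t ^ Suc k * al k i j)"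
  shows "\<alpha> \<in> elm P"
proof -
  obtain r0 where r0: "\<And>r. r \<ge> r0 \<Longrightarrow> \<alpha> \<in> bdd r"
    "\<And>r. r \<ge> r0 \<Longrightarrow> \<exists>N0. \<forall>N\<ge>N0. reach A s (Lat r (\<lambda>_. N)) (mv r \<alpha> ` Lat r (\<lambda>_. 0))"
    using elm_reach[OF \<alpha>(1)] by blast
  obtain \<beta>' where \<beta>': "\<beta>' \<in> elm Q" "\<alpha> * \<beta>' = 1" "\<beta>' * \<alpha> = 1" using elm_inverse[OF Q \<alpha>(1)] by blast
  \<comment> \<open>The entries of \<beta> are controlled, its support is not: agreement with the
    inverse over \<open>Q\<close> shows that \<beta> differs from 1 only in a finite block.\<close>
  have "\<beta>' = \<beta>" by (metis \<alpha>(2) \<beta>'(3) mult.assoc mult_1_left mult_1_right)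
  then obtain r1 where r1: "\<beta> \<in> bdd r1" using elm_bdd \<beta>'(1) by blast
  define r where "r = Suc (max r0 r1)"
  have r: "r > 0" "\<alpha> \<in> bdd r" "\<beta> \<in> bdd r" using r0(1)[of r] bdd_mono[OF r1, of r] by (auto simp: r_def)
  obtain N0 where N0: "\<And>N. N \<ge> N0 \<Longrightarrow> reach A s (Lat r (\<lambda>_. N)) (mv r \<alpha> ` Lat r (\<lambda>_. 0))"
    using r0(2)[of r] unfolding r_def by (meson le_SucI max.cobounded1)
  \<comment> \<open>\<open>N\<close> passes the threshold of the flag and the degree of \<alpha>,
    and it is positive so that \<open>r \<le> r * N\<close>.\<close>
  define N where "N = Suc (max N0 N1)"
  define a where "a k i j = (if k < N1 then al k i j else 0)" for k i j
  have aA: "a k i j \<in> A" for k i j using al AD by (simp add: a_def)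
  have \<alpha>_a: "ent \<alpha> i j = ent 1 i j + (\<Sum>k<N. t ^ Suc k * a k i j)" for i j
  proof -
    have "(\<Sum>k<N. t ^ Suc k * a k i j) = (\<Sum>k<N1. t ^ Suc k * a k i j)"
      by (rule sum.mono_neutral_right) (auto simp: N_def a_def)
    then show ?thesis by (simp add: \<alpha>_al a_def)
  qed
  have \<alpha>P: "\<alpha> \<in> over P"
  proof -
    have "ent \<alpha> i j = ent 1 i j + t * (\<Sum>k<N. t ^ k * a k i j)" for i j
      unfolding \<alpha>_a by (simp add: sum_distrib_left mult.assoc)
    moreover have "ent 1 i j + t * (\<Sum>k<N. t ^ k * a k i j) \<in> P" for i j
      by (intro PD(6) pol_times sum_in_pol[OF A] AD(2) overD[OF over_one[OF P_subrng]] aA)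
    ultimately show ?thesis by (simp add: over_def)
  qed
  define U where "U = mv r \<alpha> ` Lat r (\<lambda>_. 0)"
  have lin: "mv r g (\<lambda>i. a * v i + m i) = (\<lambda>i. a * mv r g v i + mv r g m i)" for g a v m
    using r by (auto simp: mv_linear)
  have mv_scale: "mv r g (\<lambda>i. c * v i) = (\<lambda>i. c * mv r g v i)" for g c v
    by (auto simp: mv_def sum_distrib_left mult_ac)
  have \<alpha>\<beta>v: "mv r \<alpha> (mv r \<beta> v) = v" "mv r \<beta> (mv r \<alpha> v) = v" for v
    using r \<alpha> by (simp_all add: mv_mult[symmetric] mv_one)
  have sU: "smod A U"
    unfolding smod_def
  proof (intro conjI ballI)
    show "(\<lambda>_. 0) \<in> U" unfolding U_def
      by (rule image_eqI[OF _ smodD(1)[OF smod_Lat]]) (auto simp: mv_def)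
    fix c x y assume "c \<in> A" "x \<in> U" "y \<in> U"
    then obtain x' y' where x: "x = mv r \<alpha> x'" "y = mv r \<alpha> y'" "x' \<in> Lat r (\<lambda>_. 0)" "y' \<in> Lat r (\<lambda>_. 0)"
      by (auto simp: U_def)
    have "mv r \<alpha> (\<lambda>i. c * y' i + x' i) = (\<lambda>i. c * y i + x i)" unfolding lin x ..
    then have "(\<lambda>i. x i + c * y i) = mv r \<alpha> (\<lambda>i. c * y' i + x' i)" by (simp add: add.commute)
    moreover have "(\<lambda>i. c * y' i + x' i) \<in> Lat r (\<lambda>_. 0)"
      using smodD(2)[OF smod_Lat \<open>c \<in> A\<close> x(3,4)] by (simp add: add.commute)
    ultimately show "(\<lambda>i. x i + c * y i) \<in> U" by (auto simp: U_def)
  qed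
  have sUs: "(\<lambda>i. s * u i) \<in> U" if u: "u \<in> U" for u
  proof -
    obtain v where v: "u = mv r \<alpha> v" "v \<in> Lat r (\<lambda>_. 0)" using u unfolding U_def by blast
    then have "(\<lambda>i. s * v i) \<in> Lat r (\<lambda>_. 0)" using s BD by (auto simp: Lat_def)
    moreover have "(\<lambda>i. s * u i) = mv r \<alpha> (\<lambda>i. s * v i)" by (simp add: v mv_scale)
    ultimately show ?thesis by (auto simp: U_def)
  qed
  note sU2 = smodD(2)[OF sU] and sU3 = smodD(3)[OF sU]
  note Udiff = smod_diff[OF sU A] and Uadd = smod_add[OF sU A]
  have "reach A s (Lat r (\<lambda>_. N)) U" using N0[of N] by (simp add: N_def U_def)
  then obtain vs where vs: "flag A s vs U" "spn A vs U = Lat r (\<lambda>_. N)" unfolding reach_def by blast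
  define n where "n = length vs"
  have U_Lat: "U \<subseteq> Lat r (\<lambda>_. N)" using subset_spn[of A U vs] AD vs by simp
  \<comment> \<open>For \<open>m = l * r + i\<close> with \<open>i < r\<close> this is
    \<open>t ^ (l + 1)\<close> in coordinate \<open>i\<close>: the second basis of the
    quotient.\<close>
  define w where "w m i = (if i = m mod r then t ^ Suc (m div r) else 0)" for m i
  have comb: "(\<Sum>m<r * N. c m * w m i) = (if i < r then t * (\<Sum>l<N. t ^ l * c (l * r + i)) else 0)" for c i
  proof (cases "i < r")
    case True
    have "(\<Sum>m<r * N. c m * w m i) = (\<Sum>m<r * N. if i = m mod r then c m * t ^ Suc (m div r) else 0)"
      by (auto simp: w_def intro!: sum.cong)
    also have "\<dots> = (\<Sum>l<N. c (l * r + i) * t ^ Suc ((l * r + i) div r))"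
      by (rule sum_mod_reindex[OF True])
    also have "\<dots> = t * (\<Sum>l<N. t ^ l * c (l * r + i))"
      using True by (simp add: sum_distrib_left mult_ac)
    finally show ?thesis using True by simp
  next
    case False
    then have "i \<noteq> m mod r" for m using r(1) by (metis mod_less_divisor)
    then show ?thesis using False by (simp add: w_def)
  qed
  \<comment> \<open>Apply \<beta>, split the coordinates into \<open>t * P\<close> and
    \<open>B\<close>, and apply \<alpha>: the regular part lands in \<open>U\<close>, while the
    other part lies in \<open>t * P\<close> and in the lattice, so it has at most \<open>N\<close>
    coefficients.\<close>
  have w_span: "\<exists>c. (\<forall>m. c m \<in> A) \<and> (\<lambda>i. x i - (\<Sum>m<r * N. c m * w m i)) \<in> U"
    if x: "x \<in> Lat r (\<lambda>_. N)" for x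
  proof -
    define y where "y = mv r \<beta> x"
    have xQ: "x i \<in> Q" for i
    proof (cases "i < r")
      case True
      have "s ^ N * x i \<in> Q" using x True BQ by (auto simp: Lat_def)
      then have "t ^ N * (s ^ N * x i) \<in> Q" by (rule QD(4)[OF subrng_power[OF Q t]])
      moreover have "t ^ N * s ^ N = 1" using s(2) by (simp flip: power_mult_distrib)
      ultimately show ?thesis by (simp flip: mult.assoc)
    qed (use x QD in \<open>auto simp: Lat_def\<close>)
    have "\<exists>p b. p \<in> P \<and> b \<in> B \<and> y i = t * p + b" for i
    proof -
      have "y i \<in> Q" unfolding y_def mv_def using xQ overD[OF \<alpha>(4)] P_Q
        by (auto intro!: subrng_sum[OF Q] QD)
      then obtain k where "s ^ k * y i \<in> B" using bound by blast
      from Q_decomp[OF this] obtain f b where f: "\<forall>k. f k \<in> A" "b \<in> B" "y i = (\<Sum>j<k. t ^ Suc j * f j) + b"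
        by blast
      have "(\<Sum>j<k. t ^ Suc j * f j) = t * (\<Sum>j<k. t ^ j * f j)" by (simp add: sum_distrib_left mult.assoc)
      then show ?thesis using f sum_in_pol[OF A, where f = f and N = k and t = t] by metis
    qed
    then obtain p b where pb: "\<And>i. p i \<in> P" "\<And>i. b i \<in> B" "\<And>i. y i = t * p i + b i" by metis
    define p' where "p' i = (if i < r then p i else 0)" for i
    define b' where "b' i = (if i < r then b i else 0)" for i
    have b': "b' \<in> Lat r (\<lambda>_. 0)" using pb by (auto simp: b'_def Lat_def)
    have "y i = t * p' i + b' i" for i
      using pb(3)[of i] x by (auto simp: p'_def b'_def y_def mv_def Lat_def)
    then have "y = (\<lambda>i. t * p' i + b' i)" by blast
    then have xeq: "x = (\<lambda>i. t * mv r \<alpha> p' i + mv r \<alpha> b' i)"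
      using \<alpha>\<beta>v(1)[of x] lin[of \<alpha> t p' b'] by (simp add: y_def)
    have Ub: "mv r \<alpha> b' \<in> U" using b' by (auto simp: U_def)
    define z where "z i = t * mv r \<alpha> p' i" for i
    have zP: "mv r \<alpha> p' i \<in> P" for i unfolding mv_def
      using overD[OF \<alpha>P] pb(1) PD by (auto intro!: subrng_sum[OF P_subrng] PD simp: p'_def)
    have "(\<lambda>i. x i - mv r \<alpha> b' i) \<in> Lat r (\<lambda>_. N)"
      by (rule smod_diff[OF smod_Lat A x]) (use Ub U_Lat in auto)
    then have zL: "z \<in> Lat r (\<lambda>_. N)" by (subst (asm) xeq) (simp add: z_def[abs_def])
    have "\<exists>f. (\<forall>k. f k \<in> A) \<and> z i = t * (\<Sum>k<N. t ^ k * f k)" if i: "i < r" for i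
    proof -
      have "s ^ N * z i \<in> B" using zL i by (auto simp: Lat_def)
      from Q_decomp[OF this] obtain f b where f: "\<forall>k. f k \<in> A" "b \<in> B" "z i = (\<Sum>j<N. t ^ Suc j * f j) + b"
        by blast
      have e: "(\<Sum>j<N. t ^ Suc j * f j) = t * (\<Sum>j<N. t ^ j * f j)" by (simp add: sum_distrib_left mult.assoc)
      have "t * (mv r \<alpha> p' i - (\<Sum>j<N. t ^ j * f j)) = b" using f(3) unfolding e z_def by (simp add: algebra_simps)
      then have "mv r \<alpha> p' i - (\<Sum>j<N. t ^ j * f j) = 0"
        using f zP sum_in_pol[OF A, where f = f and N = N and t = t] by (intro tP_B_disjoint PD) auto
      then show ?thesis using f(1) by (auto simp: z_def intro!: exI[of _ f])
    qed
    then obtain f where f: "\<And>i k. i < r \<Longrightarrow> f i k \<in> A" "\<And>i. i < r \<Longrightarrow> z i = t * (\<Sum>k<N. t ^ k * f i k)" by metis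
    define c where "c m = f (m mod r) (m div r)" for m
    have "z i = (\<Sum>m<r * N. c m * w m i)" for i
      using f(2)[of i] zL r(1) by (auto simp: comb c_def Lat_def)
    then have "(\<lambda>i. x i - (\<Sum>m<r * N. c m * w m i)) = mv r \<alpha> b'"
      by (subst xeq) (simp add: z_def[symmetric])
    moreover have "\<forall>m. c m \<in> A" using f(1) r(1) by (auto simp: c_def)
    ultimately show ?thesis using Ub by (intro exI[of _ c]) simp
  qed
  \<comment> \<open>If the combination \<open>t * p\<close> equals \<alpha> applied to a regular
    vector, applying \<beta> puts that vector into \<open>t * P\<close> as well, so it is 0.\<close>
  have w_indep: "c m = 0" if c: "\<And>m. c m \<in> A" "(\<lambda>i. \<Sum>m<r * N. c m * w m i) \<in> U" "m < r * N" for c m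
  proof -
    obtain v where v: "(\<lambda>i. \<Sum>m<r * N. c m * w m i) = mv r \<alpha> v" "v \<in> Lat r (\<lambda>_. 0)"
      using c(2) by (auto simp: U_def)
    define p where "p i = (if i < r then \<Sum>l<N. t ^ l * c (l * r + i) else 0)" for i
    have pP: "p i \<in> P" for i unfolding p_def using c(1) PD by (auto intro!: sum_in_pol[OF A])
    have tp: "(\<lambda>i. t * p i) = mv r \<alpha> v" unfolding v(1)[symmetric] comb by (auto simp: p_def)
    have "v = (\<lambda>i. t * mv r \<beta> p i)" using \<alpha>\<beta>v(2)[of v] unfolding tp[symmetric] mv_scale by simp
    moreover have "mv r \<beta> p i \<in> P" for i unfolding mv_def
      using overD[OF \<alpha>(4)] pP by (auto intro!: subrng_sum[OF P_subrng] PD)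
    ultimately have "v i = 0" for i using v(2) tP_B_disjoint[of "mv r \<beta> p i"]
      by (cases "i < r") (auto simp: Lat_def)
    then have "(\<lambda>i. t * p i) = (\<lambda>_. 0)" unfolding tp by (auto simp: mv_def)
    then have "t * p (m mod r) = 0" by metis
    then have "t * (\<Sum>l<N. t ^ l * c (l * r + m mod r)) = 0" using r(1) by (simp add: p_def)
    then have "t * (\<Sum>l<N. t ^ l * c (l * r + m mod r)) \<in> B" using BD(2) by (simp only:)
    from tP_coeffs[OF _ this, of "m div r"] c(1)
    show ?thesis using c(3) by (simp add: less_mult_imp_div_less mult.commute)
  qed
  have wL: "w m \<in> Lat r (\<lambda>_. N)" if "m < r * N" for m
  proof -
    have "Suc (m div r) \<le> N" using that by (simp add: less_mult_imp_div_less mult.commute Suc_le_eq)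
    then have "s ^ N * t ^ Suc (m div r) = s ^ (N - Suc (m div r))"
      using s(2) by (simp add: power_diff field_simps)
    then have "s ^ N * t ^ Suc (m div r) \<in> B" using subrng_power[OF B s(1)] by (simp only:)
    then have "s ^ N * w m i \<in> B" for i
      unfolding w_def using BD(2) by (simp only: mult_zero_right split: if_split) blast
    moreover have "w m i = 0" if "r \<le> i" for i
      using that mod_less_divisor[OF r(1), of m] by (auto simp: w_def)
    ultimately show ?thesis by (simp add: Lat_def)
  qed
  have vL: "vs ! k \<in> Lat r (\<lambda>_. N)" if "k < n" for k
    using nth_in_spn[OF A sU, of k vs] that vs by (simp add: n_def)
  \<comment> \<open>\<open>C'\<close> writes the second basis in terms of the flag and
    \<open>C\<close> the flag in terms of the second basis, both modulo \<open>U\<close>.\<close>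
  have "\<forall>m. \<exists>c. m < r * N \<longrightarrow> (\<forall>k. c k \<in> A) \<and> (\<lambda>i. w m i - (\<Sum>k<n. c k * (vs ! k) i)) \<in> U"
    using spn_coords[OF A, of _ vs U] wL vs(2) unfolding n_def by metis
  then obtain C' where C': "\<And>m k. m < r * N \<Longrightarrow> C' m k \<in> A"
    "\<And>m. m < r * N \<Longrightarrow> (\<lambda>i. w m i - (\<Sum>k<n. C' m k * (vs ! k) i)) \<in> U" by metis
  have "\<forall>k. \<exists>c. k < n \<longrightarrow> (\<forall>m. c m \<in> A) \<and> (\<lambda>i. (vs ! k) i - (\<Sum>m<r * N. c m * w m i)) \<in> U"
    using w_span vL by metis
  then obtain C where C: "\<And>k m. k < n \<Longrightarrow> C k m \<in> A"
    "\<And>k. k < n \<Longrightarrow> (\<lambda>i. (vs ! k) i - (\<Sum>m<r * N. C k m * w m i)) \<in> U" by metis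
  have "\<forall>k. \<exists>c. k < n \<longrightarrow> (\<forall>j. c j \<in> A) \<and> (\<forall>j\<le>k. c j = 0) \<and>
      (\<lambda>i. s * (vs ! k) i - (\<Sum>j<n. c j * (vs ! j) i)) \<in> U"
    using flag_triangular[OF A vs(1)] unfolding n_def by blast
  from choice[OF this] obtain \<tau> where "\<forall>k. k < n \<longrightarrow> (\<forall>j. \<tau> k j \<in> A) \<and> (\<forall>j\<le>k. \<tau> k j = 0) \<and>
      (\<lambda>i. s * (vs ! k) i - (\<Sum>j<n. \<tau> k j * (vs ! j) i)) \<in> U" by blast
  then have \<tau>: "\<And>k j. k < n \<Longrightarrow> \<tau> k j \<in> A" "\<And>k j. k < n \<Longrightarrow> j \<le> k \<Longrightarrow> \<tau> k j = 0"
    "\<And>k. k < n \<Longrightarrow> (\<lambda>i. s * (vs ! k) i - (\<Sum>j<n. \<tau> k j * (vs ! j) i)) \<in> U" by auto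
  define y0 where "y0 m e = (if m < r * N then a (m div r) (m mod r) e else 0)" for m e
  \<comment> \<open>Multiplication by \<open>s\<close> on the second basis modulo \<open>U\<close>:
    exponents drop by one, and from exponent 1 the standard vector \<open>e_m\<close> is reached,
    which modulo \<alpha> \<open>e_m\<close> is minus the nonconstant part of column
    \<open>m\<close>. This is a companion matrix.\<close>
  define \<sigma> where "\<sigma> m m' = (if r \<le> m then if m' + r = m then 1 else 0 else - y0 m' m)" for m m'
  have y0A: "y0 m e \<in> A" for m e using aA AD by (simp add: y0_def)
  have \<sigma>A: "\<sigma> m m' \<in> A" for m m' using y0A AD by (simp add: \<sigma>_def)
  have \<sigma>: "(\<lambda>i. s * w m i - (\<Sum>m'<r * N. \<sigma> m m' * w m' i)) \<in> U" if m: "m < r * N" for m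
  proof (cases "r \<le> m")
    case True
    have "(\<Sum>m'<r * N. \<sigma> m m' * w m' i) = (\<Sum>m'\<in>{m - r}. \<sigma> m m' * w m' i)" for i
      by (rule sum.mono_neutral_right) (use m True in \<open>auto simp: \<sigma>_def\<close>)
    moreover have "w (m - r) i = s * w m i" for i
    proof -
      have "m mod r = (m - r) mod r" "m div r = Suc ((m - r) div r)" using True r(1)
        by (auto simp: le_mod_geq le_div_geq)
      then show ?thesis by (simp add: w_def)
    qed
    ultimately have "(\<lambda>i. s * w m i - (\<Sum>m'<r * N. \<sigma> m m' * w m' i)) = (\<lambda>_. 0)"
      using True by (simp add: \<sigma>_def)
    then show ?thesis using smodD(1)[OF sU] by simp
  next
    case False
    define e where "e i = (if i = m then 1 else 0 :: 'f)" for i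
    have "e \<in> Lat r (\<lambda>_. 0)" using False BD by (auto simp: Lat_def e_def)
    then have "mv r \<alpha> e \<in> U" by (auto simp: U_def)
    moreover have "mv r \<alpha> e = (\<lambda>i. s * w m i - (\<Sum>m'<r * N. \<sigma> m m' * w m' i))"
    proof
      fix i
      show "mv r \<alpha> e i = s * w m i - (\<Sum>m'<r * N. \<sigma> m m' * w m' i)"
      proof (cases "i < r")
        case True
        have "mv r \<alpha> e i = (\<Sum>j<r. ent \<alpha> i j * e j)" using True by (simp add: mv_def)
        also have "\<dots> = (\<Sum>j\<in>{m}. ent \<alpha> i j * e j)"
          by (rule sum.mono_neutral_right) (use False in \<open>auto simp: e_def\<close>)
        finally have "mv r \<alpha> e i = ent \<alpha> i m" by (simp add: e_def)
        moreover have "(\<Sum>m'<r * N. \<sigma> m m' * w m' i) = t * (\<Sum>l<N. t ^ l * (- a l i m))"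
        proof -
          have "(\<Sum>l<N. t ^ l * \<sigma> m (l * r + i)) = (\<Sum>l<N. t ^ l * (- a l i m))"
          proof (rule sum.cong[OF refl])
            fix l assume "l \<in> {..<N}"
            then have "l * r + i < r * N" using True mult_add_less_mult by simp
            then show "t ^ l * \<sigma> m (l * r + i) = t ^ l * (- a l i m)" using True False by (simp add: \<sigma>_def y0_def)
          qed
          then show ?thesis by (simp only: comb True if_True)
        qed
        ultimately show ?thesis using True False
          by (simp add: \<alpha>_a ent_one w_def sum_distrib_left sum_negf mult_ac)
      next
        case i: False
        have "i \<noteq> m" "m mod r = m" using i False by auto
        then show ?thesis using i unfolding comb by (simp add: mv_def e_def w_def)
      qed
    qed
    ultimately show ?thesis by simp
  qed
  \<comment> \<open>Passing from the flag to the second basis and back is the identity, because the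
    flag is independent modulo \<open>U\<close>.\<close>
  have CC: "(\<Sum>m<r * N. C k m * C' m j) = (if j = k then 1 else 0)" if k: "k < n" "j < n" for j k
  proof -
    define d where "d j = (\<Sum>m<r * N. C k m * (if m < r * N then C' m j else 0)) - (if j = k then 1 else 0)" for j
    have "d j \<in> A" for j unfolding d_def using C C' k AD by (auto intro!: AD(3) subrng_sum[OF A] AD(4))
    moreover have "(\<lambda>i. \<Sum>j<n. d j * (vs ! j) i) \<in> U"
    proof -
      have "(\<lambda>i. \<Sum>m<r * N. C k m * (w m i - (\<Sum>j<n. C' m j * (vs ! j) i))) \<in> U"
        by (rule smod_sum[OF sU]) (use C C' k in auto)
      from Uadd[OF this C(2)[OF k(1)]]
      have "(\<lambda>i. (vs ! k) i - (\<Sum>m<r * N. C k m * (\<Sum>j<n. C' m j * (vs ! j) i))) \<in> U"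
        by (simp add: right_diff_distrib sum_subtractf)
      from sU3[OF _ this, of "-1"]
      have "(\<lambda>i. (\<Sum>m<r * N. C k m * (\<Sum>j<n. C' m j * (vs ! j) i)) - (vs ! k) i) \<in> U" using AD by simp
      moreover have "(\<Sum>m<r * N. C k m * (\<Sum>j<n. C' m j * (vs ! j) i)) - (vs ! k) i = (\<Sum>j<n. d j * (vs ! j) i)" for i
      proof -
        have "(\<Sum>j<n. d j * (vs ! j) i) = (\<Sum>j<n. \<Sum>m<r * N. C k m * (C' m j * (vs ! j) i))
            - (\<Sum>j<n. (if j = k then 1 else 0) * (vs ! j) i)"
          by (simp add: d_def left_diff_distrib sum_subtractf sum_distrib_right mult.assoc)
        also have "(\<Sum>j<n. (if j = k then 1 else 0) * (vs ! j) i) = (\<Sum>j\<in>{k}. (if j = k then 1 else 0) * (vs ! j) i)"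
          by (rule sum.mono_neutral_right) (use k in auto)
        finally show ?thesis by (subst (asm) sum.swap) (simp add: sum_distrib_left)
      qed
      ultimately show ?thesis by simp
    qed
    ultimately have "d j = 0" using flag_indep[OF A sU vs(1)] k by (simp add: n_def)
    then show ?thesis by (simp add: d_def)
  qed
  \<comment> \<open>Multiplication by \<open>s\<close> is computed through the flag: change to it,
    apply the triangular matrix \<tau>, change back.\<close>
  have \<sigma>C: "\<sigma> m m' = (\<Sum>k<n. \<Sum>j<n. C' m k * \<tau> k j * C j m')" if m: "m < r * N" "m' < r * N" for m m'
  proof -
    define S where "S m' = (\<Sum>k<n. \<Sum>j<n. C' m k * \<tau> k j * C j m')" for m'
    have SA: "S m' \<in> A" for m' unfolding S_def using C C' \<tau> m by (auto intro!: subrng_sum[OF A] AD(4))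
    define V where "V i = (\<Sum>k<n. C' m k * (vs ! k) i)" for i
    have "(\<lambda>i. s * (w m i - V i)) \<in> U" using sUs[OF C'(2)[OF m(1)]] by (simp add: V_def)
    from Udiff[OF this \<sigma>[OF m(1)]]
    have 1: "(\<lambda>i. (\<Sum>m'<r * N. \<sigma> m m' * w m' i) - s * V i) \<in> U" by (simp add: right_diff_distrib)
    have "(\<lambda>i. \<Sum>k<n. C' m k * (s * (vs ! k) i - (\<Sum>j<n. \<tau> k j * (vs ! j) i))) \<in> U"
      by (rule smod_sum[OF sU]) (use C' \<tau> m in auto)
    then have 2: "(\<lambda>i. s * V i - (\<Sum>k<n. C' m k * (\<Sum>j<n. \<tau> k j * (vs ! j) i))) \<in> U"
      by (simp add: right_diff_distrib sum_subtractf V_def sum_distrib_left mult.left_commute)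
    have "(\<lambda>i. \<Sum>k<n. C' m k * (\<Sum>j<n. \<tau> k j * ((vs ! j) i - (\<Sum>m'<r * N. C j m' * w m' i)))) \<in> U"
      by (rule smod_sum[OF sU _ smod_sum[OF sU]]) (use C C' \<tau> m in auto)
    then have 3: "(\<lambda>i. (\<Sum>k<n. C' m k * (\<Sum>j<n. \<tau> k j * (vs ! j) i)) -
        (\<Sum>k<n. C' m k * (\<Sum>j<n. \<tau> k j * (\<Sum>m'<r * N. C j m' * w m' i)))) \<in> U"
      by (simp add: right_diff_distrib sum_subtractf)
    have "(\<Sum>k<n. C' m k * (\<Sum>j<n. \<tau> k j * (\<Sum>m'<r * N. C j m' * w m' i))) = (\<Sum>m'<r * N. S m' * w m' i)" for i
    proof -
      have "(\<Sum>k<n. C' m k * (\<Sum>j<n. \<tau> k j * (\<Sum>m'<r * N. C j m' * w m' i)))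
          = (\<Sum>k<n. \<Sum>j<n. \<Sum>m'<r * N. C' m k * \<tau> k j * C j m' * w m' i)"
        by (simp add: sum_distrib_left mult.assoc)
      also have "\<dots> = (\<Sum>k<n. \<Sum>m'<r * N. \<Sum>j<n. C' m k * \<tau> k j * C j m' * w m' i)"
        by (rule sum.cong[OF refl]) (rule sum.swap)
      also have "\<dots> = (\<Sum>m'<r * N. \<Sum>k<n. \<Sum>j<n. C' m k * \<tau> k j * C j m' * w m' i)"
        by (rule sum.swap)
      finally show ?thesis by (simp add: S_def sum_distrib_right)
    qed
    with Uadd[OF Uadd[OF 1 2] 3]
    have "(\<lambda>i. \<Sum>m'<r * N. (\<sigma> m m' - S m') * w m' i) \<in> U"
      by (simp add: left_diff_distrib sum_subtractf)
    then have "\<sigma> m m' - S m' = 0" using w_indep[of "\<lambda>m'. \<sigma> m m' - S m'" m'] \<sigma>A SA m AD by auto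
    then show ?thesis by (simp add: S_def)
  qed
  define M where "M = r * N"
  have rM: "r \<le> M" by (simp add: M_def N_def)
  \<comment> \<open>Tails of a Horner evaluation, one for each index; in the first \<open>r\<close>
    rows they are the complete sums, that is, the entries of \<open>1 - \<alpha>\<close>.\<close>
  define y1 where "y1 m e = - (\<Sum>d<N. t ^ Suc d * y0 (m + d * r) e)" for m e
  have y1P: "y1 m e \<in> P" for m e
  proof -
    have "y1 m e = - (t * (\<Sum>d<N. t ^ d * y0 (m + d * r) e))" by (simp add: y1_def sum_distrib_left mult.assoc)
    then show ?thesis using sum_in_pol[OF A, where f = "\<lambda>d. y0 (m + d * r) e" and N = N and t = t] y0A pol_times PD(5) AD(2) by metis
  qed
  have AP: "x \<in> P" if "x \<in> A" for x using that by (rule pol.const)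
  \<comment> \<open>Consecutive intervals of lengths \<open>r\<close>, \<open>M\<close>,
    \<open>n\<close> carry \<alpha>, its linearisation and the flag; \<open>X1\<close>,
    \<open>Y1\<close> pass between the first two, \<open>X2\<close>, \<open>Y2\<close> between the
    last two.\<close>
  define X1 where "X1 = bm 0 r r M (\<lambda>i m. if m = i then 1 else 0 :: 'f)"
  define Y1 where "Y1 = bm r M 0 r y1"
  define Z where "Z = bm r M r M (\<lambda>m' m. if m' + r = m then t else 0)"
  define T where "T = bm r M r M (\<lambda>m' m. t * \<sigma> m m')"
  define X2 where "X2 = bm r M (r + M) n (\<lambda>m k. \<Sum>j<n. t * \<tau> k j * C j m)"
  define Y2 where "Y2 = bm (r + M) n r M (\<lambda>k m. C' m k)"
  have e1: "X1 * Y1 = bm 0 r 0 r y1"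
    unfolding X1_def Y1_def bm_mult
  proof (rule bm_cong)
    fix i j assume "i < r" "j < r"
    have "(\<Sum>k<M. (if k = i then 1 else 0) * y1 k j) = (\<Sum>k\<in>{i}. (if k = i then 1 else 0) * y1 k j)"
      by (rule sum.mono_neutral_right) (use \<open>i < r\<close> rM in auto)
    then show "(\<Sum>k<M. (if k = i then 1 else 0) * y1 k j) = y1 i j" by simp
  qed
  have \<alpha>1: "\<alpha> = 1 - X1 * Y1"
  proof (rule cf_eqI)
    fix i j
    show "ent \<alpha> i j = ent (1 - X1 * Y1) i j"
    proof (cases "i < r \<and> j < r")
      case True
      have "y0 (i + d * r) j = a d i j" if "d < N" for d
      proof -
        have "i + d * r < r * N" using True that mult_add_less_mult[of d N i r] by (simp add: add.commute)
        then show ?thesis using True by (simp add: y0_def)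
      qed
      then show ?thesis using True by (simp add: e1 ent_bm \<alpha>_a y1_def)
    next
      case False
      then show ?thesis using r(2) by (auto simp: e1 ent_bm bdd_def not_less)
    qed
  qed
  have e2: "Y1 * X1 = bm r M r M (\<lambda>m' m. if m < r then y1 m' m else 0)"
    unfolding X1_def Y1_def bm_mult
  proof (rule bm_cong)
    fix m' m
    have "(\<Sum>j<r. y1 m' j * (if m = j then 1 else 0)) = (\<Sum>j\<in>(if m < r then {m} else {}). y1 m' j * (if m = j then 1 else 0))"
      by (rule sum.mono_neutral_right) auto
    then show "(\<Sum>j<r. y1 m' j * (if m = j then 1 else 0)) = (if m < r then y1 m' m else 0)" by simp
  qed
  have e3: "Z * (Y1 * X1) = bm r M r M (\<lambda>m' m. if m < r then t * y1 (m' + r) m else 0)"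
    unfolding e2 unfolding Z_def bm_mult
  proof (rule bm_cong)
    fix m' m assume "m' < M" "m < M"
    let ?h = "\<lambda>j. (if m' + r = j then t else 0) * (if m < r then y1 j m else 0)"
    have "sum ?h {..<M} = sum ?h (if m' + r < M then {m' + r} else {})"
      by (rule sum.mono_neutral_right) auto
    moreover have "y1 (m' + r) m = 0" if "\<not> m' + r < M"
      using that by (auto simp: y1_def y0_def M_def intro!: sum.neutral)
    ultimately show "sum ?h {..<M} = (if m < r then t * y1 (m' + r) m else 0)" by auto
  qed
  have y1_rec: "y1 m e - t * y1 (m + r) e = - (t * y0 m e)" for m e
  proof -
    let ?g = "\<lambda>d. t ^ Suc d * y0 (m + d * r) e"
    have "t * y1 (m + r) e = - (\<Sum>d<N. ?g (Suc d))"
      by (simp add: y1_def sum_distrib_left sum_negf mult_ac add_ac)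
    also have "(\<Sum>d<N. ?g (Suc d)) = (\<Sum>d<N. ?g d) + ?g N - ?g 0"
      using sum.lessThan_Suc_shift[of ?g N] by simp
    also have "?g N = 0" by (simp add: y0_def mult.commute)
    finally show ?thesis by (simp add: y1_def)
  qed
  \<comment> \<open>The unitriangular factor \<open>1 - Z\<close> performs the recursion
    \<open>y1_rec\<close>, which leaves \<open>t\<close> times the transposed companion
    matrix.\<close>
  have e4: "(1 - Z) * (1 - Y1 * X1) = 1 - T"
  proof -
    have "(1 - Z) * (1 - Y1 * X1) = 1 - Z - Y1 * X1 + Z * (Y1 * X1)" by (simp add: algebra_simps)
    also have "\<dots> = 1 - T"
    proof (rule cf_eqI)
      fix i j
      let ?x = "\<lambda>m' m. (if m' + r = m then t else 0)" and ?y = "\<lambda>m' m. (if m < r then y1 m' m else 0)"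
        and ?z = "\<lambda>m' m. (if m < r then t * y1 (m' + r) m else 0)"
      have eq: "?x m' m + ?y m' m - ?z m' m = t * \<sigma> m m'" for m m'
        using y1_rec[of m' m] by (auto simp: \<sigma>_def)
      have "ent (1 - Z - Y1 * X1 + Z * (Y1 * X1)) i j = ent 1 i j - ent Z i j - ent (Y1 * X1) i j + ent (Z * (Y1 * X1)) i j"
        by simp
      also have "\<dots> = ent 1 i j - ent T i j"
      proof (cases "r \<le> i \<and> i < r + M \<and> r \<le> j \<and> j < r + M")
        case True
        have "ent Z i j = ?x (i - r) (j - r)" unfolding Z_def ent_bm using True by (simp only: if_True simp_thms)
        moreover have "ent (Y1 * X1) i j = ?y (i - r) (j - r)" unfolding e2 ent_bm using True by (simp only: if_True simp_thms)
        moreover have "ent (Z * (Y1 * X1)) i j = ?z (i - r) (j - r)" unfolding e3 ent_bm using True by (simp only: if_True simp_thms)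
        moreover have "ent T i j = t * \<sigma> (j - r) (i - r)" unfolding T_def ent_bm using True by (simp only: if_True simp_thms)
        moreover have "c - x - y + z = c - (x + y - z)" for c x y z :: 'f by simp
        ultimately show ?thesis using eq[of "i - r" "j - r"] by (simp only:)
      next
        case False
        then show ?thesis unfolding e3 unfolding e2 unfolding Z_def T_def ent_bm by (simp only: if_not_P[OF False]) simp
      qed
      also have "\<dots> = ent (1 - T) i j" by simp
      finally show "ent (1 - Z - Y1 * X1 + Z * (Y1 * X1)) i j = ent (1 - T) i j" .
    qed
    finally show ?thesis .
  qed
  have e5: "T = X2 * Y2"
    unfolding X2_def Y2_def bm_mult T_def
  proof (rule bm_cong)
    fix m' m assume "m' < M" "m < M"
    then have "t * \<sigma> m m' = t * (\<Sum>k<n. \<Sum>j<n. C' m k * \<tau> k j * C j m')" using \<sigma>C by (simp add: M_def)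
    also have "\<dots> = (\<Sum>k<n. (\<Sum>j<n. t * \<tau> k j * C j m') * C' m k)"
      by (simp add: sum_distrib_left sum_distrib_right mult_ac)
    finally show "t * \<sigma> m m' = (\<Sum>k<n. (\<Sum>j<n. t * \<tau> k j * C j m') * C' m k)" .
  qed
  have e6: "Y2 * X2 = bm (r + M) n (r + M) n (\<lambda>i k. t * \<tau> k i)"
    unfolding X2_def Y2_def bm_mult
  proof (rule bm_cong)
    fix i k assume ik: "i < n" "k < n"
    have "(\<Sum>m<M. C' m i * (\<Sum>j<n. t * \<tau> k j * C j m)) = (\<Sum>m<M. \<Sum>j<n. t * \<tau> k j * (C j m * C' m i))"
      by (simp add: sum_distrib_left mult_ac)
    also have "\<dots> = (\<Sum>j<n. t * \<tau> k j * (\<Sum>m<M. C j m * C' m i))"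
      by (subst sum.swap) (simp add: sum_distrib_left)
    also have "\<dots> = (\<Sum>j<n. t * \<tau> k j * (if i = j then 1 else 0))"
      by (rule sum.cong) (use CC ik in \<open>auto simp: M_def\<close>)
    also have "\<dots> = (\<Sum>j\<in>{i}. t * \<tau> k j * (if i = j then 1 else 0))"
      by (rule sum.mono_neutral_right) (use ik in auto)
    finally show "(\<Sum>m<M. C' m i * (\<Sum>j<n. t * \<tau> k j * C j m)) = t * \<tau> k i" by simp
  qed
  \<comment> \<open>By \<open>e6\<close> the product in the other order is \<open>t\<close> times
    the transpose of \<tau>, which is strictly triangular.\<close>
  have tri: "1 - Y2 * X2 \<in> elm P"
  proof -
    have "1 + (- (Y2 * X2)) \<in> elm P"
    proof (rule elm_unitriangular[where rk = "\<lambda>i. i"])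
      show "finite {(i, j). ent (- (Y2 * X2)) i j \<noteq> 0}" unfolding e6 by (simp add: finite_supp_bm)
      show "- (Y2 * X2) \<in> over P" unfolding e6 using \<tau>(1) t_P PD AP by (auto simp: over_def ent_bm)
      show "j < i" if "ent (- (Y2 * X2)) i j \<noteq> 0" for i j
      proof -
        from that have *: "r + M \<le> i" "r + M \<le> j" "j < r + M + n" "\<tau> (j - (r + M)) (i - (r + M)) \<noteq> 0"
          unfolding e6 by (auto simp: ent_bm split: if_splits)
        then show ?thesis using \<tau>(2)[of "j - (r + M)" "i - (r + M)"] by force
      qed
    qed (rule P_subrng)
    then show ?thesis by simp
  qed
  have "1 - X2 * Y2 \<in> elm P"
  proof (rule elm_swap[OF P_subrng _ _ _ _ tri])
    show "X2 * X2 = 0" "Y2 * Y2 = 0" unfolding X2_def Y2_def by (simp_all add: bm_mult_disjoint)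
    show "1 + X2 \<in> elm P" unfolding X2_def using \<tau>(1) C(1) t_P AP
      by (intro elm_bm_disjoint P_subrng) (auto intro!: subrng_sum[OF P_subrng] PD(4) simp: M_def)
    show "1 + Y2 \<in> elm P" unfolding Y2_def using C' AP
      by (intro elm_bm_disjoint P_subrng) (auto simp: M_def)
  qed
  then have "(1 - Z) * (1 - Y1 * X1) \<in> elm P" unfolding e4 e5 .
  moreover have "1 - Z \<in> elm P"
  proof -
    have "1 + (- Z) \<in> elm P"
    proof (rule elm_unitriangular[where rk = "\<lambda>i. r + M - i"])
      show "finite {(i, j). ent (- Z) i j \<noteq> 0}" unfolding Z_def by (simp add: finite_supp_bm)
      show "- Z \<in> over P" unfolding Z_def using t_P PD by (auto simp: over_def ent_bm)
      show "r + M - j < r + M - i" if "ent (- Z) i j \<noteq> 0" for i j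
        using that r(1) unfolding Z_def by (auto simp: ent_bm split: if_splits)
    qed (rule P_subrng)
    then show ?thesis by simp
  qed
  ultimately have swapped: "1 - Y1 * X1 \<in> elm P" by (metis elm_cancel_left P_subrng)
  have "1 - X1 * Y1 \<in> elm P"
  proof (rule elm_swap[OF P_subrng _ _ _ _ swapped])
    show "X1 * X1 = 0" "Y1 * Y1 = 0" unfolding X1_def Y1_def by (simp_all add: bm_mult_disjoint)
    show "1 + X1 \<in> elm P" unfolding X1_def using PD by (intro elm_bm_disjoint P_subrng) auto
    show "1 + Y1 \<in> elm P" unfolding Y1_def using y1P by (intro elm_bm_disjoint P_subrng) auto
  qed
  then show ?thesis by (simp add: \<alpha>1)
qed

end


section \<open>Descent from rational functions to Laurent polynomials\<close>

text \<open>The places 0 and \<infinity> of one variable over the same \<open>A\<close> and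
  \<open>Q\<close>. The first serves to split off denominators, the second to apply monic inversion,
  where the inverse of the uniformiser is \<open>x\<close> itself.\<close>

locale two_places = Z: place A B0 Q x + I: place A Bi Q "inverse x"
  for A B0 Bi Q :: "'f::field set" and x :: 'f
begin

definition LA :: "'f set" where "LA = {q. \<exists>k. x ^ k * q \<in> pol A x}"

lemma x0: "x \<noteq> 0" by (rule Z.s)

lemma P_LA: "pol A x \<subseteq> LA"
  unfolding LA_def by (auto intro!: exI[of _ 0])

lemma A_LA: "A \<subseteq> LA"
  using P_LA by (auto intro: pol.const)

lemma P_B0: "pol A x \<subseteq> B0"
proof
  fix p assume "p \<in> pol A x"
  then show "p \<in> B0"
    by (induction rule: pol.induct) (use Z.AB Z.BD Z.s in auto)
qed

lemma P_rng: "subrng (pol A x)" by (rule subrng_pol[OF Z.A])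

lemma LA_rng: "subrng LA"
proof -
  have up: "x ^ (k + l) * q \<in> pol A x" if "x ^ k * q \<in> pol A x" for k l q
  proof -
    have "x ^ (k + l) * q = x ^ l * (x ^ k * q)" by (simp add: power_add mult_ac)
    then show ?thesis using pol_power_mult[OF Z.AD(2) that, of l] by (simp only:)
  qed
  show ?thesis
    unfolding subrng_def
  proof (intro conjI ballI)
    show "1 \<in> LA" using A_LA Z.AD(1) by blast
    fix p q assume "p \<in> LA" "q \<in> LA"
    then obtain k l where k: "x ^ k * p \<in> pol A x" and l: "x ^ l * q \<in> pol A x" by (auto simp: LA_def)
    have "x ^ (k + l) * (p - q) = x ^ (k + l) * p - x ^ (l + k) * q" by (simp add: algebra_simps)
    then have "x ^ (k + l) * (p - q) \<in> pol A x"
      using subrngD(3)[OF P_rng up[OF k, of l] up[OF l, of k]] by simp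
    then show "p - q \<in> LA" by (auto simp: LA_def)
    have "x ^ (k + l) * (p * q) = (x ^ k * p) * (x ^ l * q)" by (simp add: power_add mult_ac)
    then have "x ^ (k + l) * (p * q) \<in> pol A x" using subrngD(4)[OF P_rng k l] by (simp only:)
    then show "p * q \<in> LA" by (auto simp: LA_def)
  qed
qed

lemma LA_B0: "q \<in> LA \<Longrightarrow> \<exists>k. x ^ k * q \<in> B0"
  using P_B0 by (auto simp: LA_def)

text \<open>Divide by \<open>x\<close> step by step: the constant coefficient of
  \<open>x ^ Suc k * q\<close> lies in \<open>A\<close> and in \<open>x * B0\<close>, hence vanishes
  by \<open>sep\<close>.\<close>

lemma LA_Int_B0:
  assumes "q \<in> LA" "q \<in> B0" shows "q \<in> pol A x"
proof -
  have "x ^ k * q \<in> pol A x \<Longrightarrow> q \<in> pol A x" for k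
  proof (induction k)
    case (Suc k)
    have b: "x ^ k * q \<in> B0" by (rule Z.BD(4)[OF subrng_power[OF Z.B Z.s(1)] assms(2)])
    from Suc.prems have "x ^ k * q \<in> pol A x"
    proof (cases rule: pol.cases)
      case const
      then have "x * (x ^ k * q) \<in> A" by (simp add: mult.assoc)
      then have "x ^ k * q = 0" using Z.sep[OF b] by blast
      then show ?thesis using Z.AD by (metis pol.const)
    next
      case (step a p)
      have "x * (x ^ k * q - p) = a" using step(1) by (simp add: algebra_simps)
      moreover have "p \<in> B0" using step P_B0 by blast
      then have "x ^ k * q - p \<in> B0" by (rule Z.BD(3)[OF b])
      ultimately have "x ^ k * q - p = 0" using Z.sep step(2) by metis
      then show ?thesis using step by simp
    qed
    then show ?case by (rule Suc.IH)
  qed simp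
  then show ?thesis using assms(1) by (auto simp: LA_def)
qed

text \<open>After clearing the pole by \<open>x ^ k\<close>, expand the regular element to order
  \<open>k + N\<close>. The polynomial part divided by \<open>x ^ k\<close> is \<open>c\<close>, and
  the remainder keeps a factor \<open>x ^ N\<close>.\<close>

lemma Q_approx:
  assumes "q \<in> Q" shows "\<exists>c\<in>LA. \<exists>b\<in>B0. q = c + x ^ N * b"
proof -
  obtain k where k: "x ^ k * q \<in> B0" using Z.bound[OF assms] by blast
  have "\<exists>p\<in>pol A x. \<exists>b'\<in>B0. b = p + x ^ n * b'" if "b \<in> B0" for b n
    using that
  proof (induction n arbitrary: b)
    case 0
    then show ?case using Z.AD(2) by (rule_tac bexI[of _ 0], rule_tac bexI[of _ b]) (auto intro: pol.const)
  next
    case (Suc n)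
    obtain a b1 where a: "a \<in> A" "b1 \<in> B0" "b = a + x * b1" using Z.dec[OF Suc.prems] by blast
    obtain p b2 where p: "p \<in> pol A x" "b2 \<in> B0" "b1 = p + x ^ n * b2" using Suc.IH[OF a(2)] by blast
    have "b = (a + x * p) + x ^ Suc n * b2" by (simp add: a p algebra_simps)
    then show ?case using p a by (blast intro: pol.step)
  qed
  from this[OF k, of "k + N"] obtain p b where p: "p \<in> pol A x" "b \<in> B0" "x ^ k * q = p + x ^ (k + N) * b"
    by blast
  define c where "c = q - x ^ N * b"
  have "x ^ k * c = p" using p(3) by (simp add: c_def algebra_simps power_add)
  then have "c \<in> LA" using p by (auto simp: LA_def)
  then show ?thesis using p(2) by (rule_tac bexI[of _ c], rule_tac bexI[of _ b]) (auto simp: c_def)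
qed

lemma common_denominator:
  assumes "h \<in> over LA" "h \<in> bdd r"
  shows "\<exists>M. \<forall>i j. x ^ M * ent h i j \<in> B0"
proof -
  obtain f where f: "\<And>i j. x ^ f i j * ent h i j \<in> B0" using LA_B0[OF overD[OF assms(1)]] by metis
  define M where "M = (\<Sum>i<r. \<Sum>j<r. f i j)"
  have "x ^ M * ent h i j \<in> B0" for i j
  proof (cases "i < r \<and> j < r")
    case True
    have "f i j \<le> (\<Sum>j<r. f i j)" using True by (intro member_le_sum) auto
    also have "\<dots> \<le> M" unfolding M_def using True
      by (intro member_le_sum[of i "{..<r}" "\<lambda>i. \<Sum>j<r. f i j"]) auto
    finally have "x ^ M * ent h i j = x ^ (M - f i j) * (x ^ f i j * ent h i j)"
      by (simp flip: power_add mult.assoc)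
    then show ?thesis using f[of i j] Z.BD(4)[OF subrng_power[OF Z.B Z.s(1)]] by (simp only:)
  next
    case False
    then have "ent h i j \<in> B0" using bddD[OF assms(2)] Z.BD by (auto simp: not_less)
    then show ?thesis using Z.BD(4)[OF subrng_power[OF Z.B Z.s(1)]] by simp
  qed
  then show ?thesis by blast
qed

lemma commutator_mun:
  fixes a b :: "'a::comm_ring_1"
  assumes "i \<noteq> j" "k \<noteq> i" "k \<noteq> j"
  shows "(1 + mun i k a) * (1 + mun k j b) * (1 + mun i k (- a)) * (1 + mun k j (- b)) = 1 + mun i j (a * b)"
proof -
  have "(1 + mun i k a) * (1 + mun k j b) = 1 + mun i k a + mun k j b + mun i j (a * b)"
    using assms by (simp add: algebra_simps mun_mult_mun)
  moreover have "(1 + mun i k (- a)) * (1 + mun k j (- b)) = 1 - mun i k a - mun k j b + mun i j (a * b)"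
    using assms by (simp add: algebra_simps mun_mult_mun flip: mun_uminus)
  ultimately have "(1 + mun i k a) * (1 + mun k j b) * (1 + mun i k (- a)) * (1 + mun k j (- b)) =
      (1 + mun i k a + mun k j b + mun i j (a * b)) * (1 - mun i k a - mun k j b + mun i j (a * b))"
    by (simp add: mult.assoc)
  also have "\<dots> = 1 + mun i j (a * b)"
    using assms by (simp add: algebra_simps mun_mult_mun)
  finally show ?thesis .
qed

text \<open>Conjugating a commutator through a fresh index \<open>k\<close> only produces a column and a row.\<close>

lemma conj_elementary:
  assumes h: "h \<in> elm LA" "h * h' = 1" "h' * h = 1" "h' \<in> elm LA" and ij: "i \<noteq> j"
  shows "\<exists>N. \<forall>b\<in>B0. h * (1 + mun i j (x ^ N * b)) * h' \<in> elm B0"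
proof -
  obtain r1 r2 where r12: "h \<in> bdd r1" "h' \<in> bdd r2" using elm_bdd h by metis
  \<comment> \<open>This index lies beyond the blocks of \<open>h\<close> and \<open>h'\<close> and
    differs from \<open>i\<close> and \<open>j\<close>, so both matrices are trivial in its row and
    column.\<close>
  define r where "r = r1 + r2 + i + j + 1"
  have r: "h \<in> bdd r" "h' \<in> bdd r" "i < r" "j < r" using bdd_mono[OF r12(1), of r] bdd_mono[OF r12(2), of r] by (auto simp: r_def)
  have hL: "h \<in> over LA" "h' \<in> over LA" using h elm_over[OF LA_rng] by auto
  obtain M M' where M: "\<And>i j. x ^ M * ent h i j \<in> B0" "\<And>i j. x ^ M' * ent h' i j \<in> B0"
    using common_denominator hL r by metis
  have row: "ent h' r q = (if r = q then 1 else 0)" for q using bddD[OF r(2), of r q] by simp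
  have col: "ent h p r = (if p = r then 1 else 0)" for p using bddD[OF r(1), of p r] by simp
  have C1: "h * (1 + mun i r (c * x ^ M)) * h' \<in> elm B0" if c: "c \<in> B0" for c
  proof -
    have m: "mun i r (c * x ^ M) * h' = mun i r (c * x ^ M)"
      by (rule cf_eqI) (simp add: ent_mun_mult ent_mun row)
    have "h * (1 + mun i r (c * x ^ M)) * h' = 1 + h * (mun i r (c * x ^ M) * h')"
      by (simp add: algebra_simps h)
    also have "\<dots> = 1 + h * mun i r (c * x ^ M)" unfolding m ..
    also have "\<dots> \<in> elm B0"
    proof (rule elm_unitriangular[where rk = "\<lambda>p. if p = r then 0 else 1"])
      show "finite {(p, q). ent (h * mun i r (c * x ^ M)) p q \<noteq> 0}"
        by (rule finite_subset[of _ "{p. ent h p i \<noteq> 0} \<times> {r}"]) (auto simp: ent_mult_mun)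
      show "h * mun i r (c * x ^ M) \<in> over B0"
        using Z.BD(4)[OF c M(1)] Z.BD(2) by (auto simp: over_def ent_mult_mun mult_ac)
      show "(if q = r then 0 else 1) < (if p = r then 0 else 1 :: nat)"
        if "ent (h * mun i r (c * x ^ M)) p q \<noteq> 0" for p q
        using that bddD[OF r(1), of p i] r(3) by (auto simp: ent_mult_mun split: if_splits)
    qed (rule Z.B)
    finally show ?thesis .
  qed
  have C2: "h * (1 + mun r j (c * x ^ M')) * h' \<in> elm B0" if c: "c \<in> B0" for c
  proof -
    have m: "h * mun r j (c * x ^ M') = mun r j (c * x ^ M')"
      by (rule cf_eqI) (simp add: ent_mult_mun ent_mun col)
    have "h * (1 + mun r j (c * x ^ M')) * h' = 1 + h * mun r j (c * x ^ M') * h'"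
      by (simp add: algebra_simps h)
    also have "\<dots> = 1 + mun r j (c * x ^ M') * h'" unfolding m ..
    also have "\<dots> \<in> elm B0"
    proof (rule elm_unitriangular[where rk = "\<lambda>p. if p = r then 1 else 0"])
      show "finite {(p, q). ent (mun r j (c * x ^ M') * h') p q \<noteq> 0}"
      proof (rule finite_subset[of _ "{r} \<times> {..<r}"])
        show "{(p, q). ent (mun r j (c * x ^ M') * h') p q \<noteq> 0} \<subseteq> {r} \<times> {..<r}"
        proof clarify
          fix p q assume "ent (mun r j (c * x ^ M') * h') p q \<noteq> 0"
          then have "p = r" "ent h' j q \<noteq> 0" by (auto simp: ent_mun_mult split: if_splits)
          moreover have "q < r" using bddD[OF r(2), of j q] r(4) \<open>ent h' j q \<noteq> 0\<close>
            by (cases "q < r") auto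
          ultimately show "p \<in> {r} \<and> q \<in> {..<r}" by simp
        qed
      qed simp
      show "mun r j (c * x ^ M') * h' \<in> over B0"
        using Z.BD(4)[OF c M(2)] Z.BD(2) by (auto simp: over_def ent_mun_mult mult_ac)
      show "(if q = r then 1 else 0) < (if p = r then 1 else 0 :: nat)"
        if "ent (mun r j (c * x ^ M') * h') p q \<noteq> 0" for p q
        using that bddD[OF r(2), of j q] r(4) by (auto simp: ent_mun_mult split: if_splits)
    qed (rule Z.B)
    finally show ?thesis .
  qed
  \<comment> \<open>The power of \<open>x\<close> splits into the part that clears the denominators
    of \<open>h\<close> in the column at \<open>r\<close> and the part that clears those of
    \<open>h'\<close> in the row at \<open>r\<close>.\<close>
  have "h * (1 + mun i j (x ^ (M + M') * b)) * h' \<in> elm B0" if b: "b \<in> B0" for b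
  proof -
    have rij: "r \<noteq> i" "r \<noteq> j" using r by auto
    let ?a = "1 * x ^ M" and ?b = "b * x ^ M'"
    have eq: "x ^ (M + M') * b = ?a * ?b" by (simp add: power_add mult_ac)
    have n: "- ?a = (-1) * x ^ M" "- ?b = (- b) * x ^ M'" by simp_all
    have cj: "h * (p * q) * h' = (h * p * h') * (h * q * h')" for p q
    proof -
      have "(h * p * h') * (h * q * h') = h * p * (h' * h) * q * h'" by (simp only: mult.assoc)
      then show ?thesis by (simp add: h mult.assoc)
    qed
    show ?thesis
      unfolding eq commutator_mun[OF ij rij, symmetric] cj n
      by (rule elm_mult[OF elm_mult[OF elm_mult[OF C1 C2] C1] C2]) (intro b Z.BD(1) Z.BD(5))+
  qed
  then show ?thesis by blast
qed

text \<open>The new factor is approximated by one over \<open>LA\<close>; the error carries a power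
  of \<open>x\<close> large enough for its conjugate by \<open>g1\<close> to be elementary over
  \<open>B0\<close>.\<close>

lemma elm_factor:
  assumes "g \<in> elm Q" shows "\<exists>g1\<in>elm LA. \<exists>g2\<in>elm B0. g = g1 * g2"
  using assms
proof (induction rule: elm.induct)
  case one
  then show ?case using elm.one by force
next
  case (step g i j q)
  then obtain g1 g2 where g: "g1 \<in> elm LA" "g2 \<in> elm B0" "g = g1 * g2" by blast
  obtain h where h: "h \<in> elm LA" "g1 * h = 1" "h * g1 = 1" using elm_inverse[OF LA_rng g(1)] by blast
  obtain N where N: "\<forall>b\<in>B0. h * (1 + mun i j (x ^ N * b)) * g1 \<in> elm B0"
    using conj_elementary[OF h(1,3,2) g(1) step(2)] by blast
  obtain c b where cb: "c \<in> LA" "b \<in> B0" "q = c + x ^ N * b" using Q_approx[OF step(3)] by blast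
  have "1 + mun i j q = (1 + mun i j c) * (1 + mun i j (x ^ N * b))"
    using step(2) by (simp add: algebra_simps mun_mult_mun cb(3) flip: mun_add)
  then have "(1 + mun i j q) * g = (1 + mun i j c) * (g1 * h) * (1 + mun i j (x ^ N * b)) * (g1 * g2)"
    by (simp add: h g)
  also have "\<dots> = ((1 + mun i j c) * g1) * ((h * (1 + mun i j (x ^ N * b)) * g1) * g2)"
    by (simp add: mult.assoc)
  finally show ?case
    using elm.step[OF g(1) step(2) cb(1)] elm_mult[OF N[rule_format, OF cb(2)] g(2)] by blast
qed

text \<open>Reduction modulo \<open>x\<close> is applied to each elementary factor:
  \<open>dec\<close> replaces its entry by the value in \<open>A\<close>.\<close>

lemma elm_constant_term:
  assumes "g \<in> elm B0" shows "\<exists>e\<in>elm A. \<forall>i j. \<exists>b\<in>B0. ent g i j - ent e i j = x * b"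
  using assms
proof (induction rule: elm.induct)
  case one
  then show ?case using Z.BD(2) elm.one[of A] by (intro bexI[of _ 1]) (auto intro!: bexI[of _ 0])
next
  case (step g i j b)
  then obtain e where e: "e \<in> elm A" "\<And>i j. \<exists>b\<in>B0. ent g i j - ent e i j = x * b" by blast
  obtain a b' where ab: "a \<in> A" "b' \<in> B0" "b = a + x * b'" using Z.dec[OF step(3)] by blast
  have gB: "ent g k l \<in> B0" for k l using overD[OF elm_over[OF Z.B step(1)]] .
  have "\<exists>c\<in>B0. ent ((1 + mun i j b) * g) k l - ent ((1 + mun i j a) * e) k l = x * c" for k l
  proof -
    obtain c1 c2 where c: "c1 \<in> B0" "ent g k l - ent e k l = x * c1" "c2 \<in> B0" "ent g j l - ent e j l = x * c2"
      using e(2) by metis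
    have "ent ((1 + mun i j b) * g) k l - ent ((1 + mun i j a) * e) k l
        = (ent g k l - ent e k l) + (if k = i then a * (ent g j l - ent e j l) + x * (b' * ent g j l) else 0)"
      by (simp add: distrib_right ent_mun_mult ab(3) algebra_simps)
    also have "\<dots> = x * (c1 + (if k = i then a * c2 + b' * ent g j l else 0))"
      unfolding c by (simp add: algebra_simps)
    finally show ?thesis
    proof (rule bexI)
      show "c1 + (if k = i then a * c2 + b' * ent g j l else 0) \<in> B0"
        using c ab gB Z.AB Z.BD(2) by (auto intro!: Z.BD(6) Z.BD(4))
    qed
  qed
  then show ?case using elm.step[OF e(1) step(2) ab(1)] by blast
qed

text \<open>In the factorisation \<alpha> = \<open>g1 * g2\<close> the second factor and its inverse
  are over \<open>LA\<close> and over \<open>B0\<close>, hence polynomial. Divided by its constant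
  term, \<open>g2\<close> becomes 1 plus multiples of \<open>x\<close>, the shape required by monic
  inversion at \<infinity>.\<close>

theorem laurent_descent:
  assumes \<alpha>: "\<alpha> \<in> elm Q" "\<alpha> \<in> over LA" "\<beta> \<in> over LA" "\<alpha> * \<beta> = 1" "\<beta> * \<alpha> = 1"
  shows "\<alpha> \<in> elm LA"
proof -
  obtain g1 g2 where g: "g1 \<in> elm LA" "g2 \<in> elm B0" "\<alpha> = g1 * g2" using elm_factor[OF \<alpha>(1)] by blast
  obtain h1 where h1: "h1 \<in> elm LA" "g1 * h1 = 1" "h1 * g1 = 1" using elm_inverse[OF LA_rng g(1)] by blast
  obtain h2 where h2: "h2 \<in> elm B0" "g2 * h2 = 1" "h2 * g2 = 1" using elm_inverse[OF Z.B g(2)] by blast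
  have g2': "g2 = h1 * \<alpha>" using h1 g by (simp flip: mult.assoc)
  have "\<beta> * g1 * g2 = 1" using \<alpha>(5) g(3) by (simp add: mult.assoc)
  then have h2': "h2 = \<beta> * g1" by (metis h2(2) mult.assoc mult_1_left mult_1_right)
  note LAo = elm_over[OF LA_rng] and B0o = elm_over[OF Z.B]
  have "g2 \<in> over LA" unfolding g2' using LAo h1 \<alpha> by (intro over_mult LA_rng) auto
  then have g2P: "g2 \<in> over (pol A x)" using B0o[OF g(2)] LA_Int_B0 by (auto simp: over_def)
  have "h2 \<in> over LA" unfolding h2' using LAo g \<alpha> by (intro over_mult LA_rng) auto
  then have h2P: "h2 \<in> over (pol A x)" using B0o[OF h2(1)] LA_Int_B0 by (auto simp: over_def)
  obtain e where e: "e \<in> elm A" "\<And>i j. \<exists>b\<in>B0. ent g2 i j - ent e i j = x * b"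
    using elm_constant_term[OF g(2)] by blast
  obtain e' where e': "e' \<in> elm A" "e * e' = 1" "e' * e = 1" using elm_inverse[OF Z.A e(1)] by blast
  have eP: "e \<in> over (pol A x)" "e' \<in> over (pol A x)"
    using elm_over[OF Z.A] e e' by (auto simp: over_def intro: pol.const)
  define \<gamma> where "\<gamma> = e' * g2"
  have \<gamma>P: "\<gamma> \<in> over (pol A x)" unfolding \<gamma>_def using eP g2P by (intro over_mult P_rng)
  have "\<exists>b\<in>B0. ent \<gamma> i j - ent 1 i j = x * b" for i j
  proof -
    have "ent \<gamma> i j - ent 1 i j = ent (e' * (g2 - e)) i j" by (simp add: \<gamma>_def algebra_simps e')
    also have "\<dots> = (\<Sum>k\<in>{k. ent (g2 - e) k j \<noteq> 0}. ent e' i k * (ent g2 k j - ent e k j))"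
      by (simp add: ent_mult_raw)
    also have "\<dots> \<in> {x * b | b. b \<in> B0}"
    proof -
      have "\<forall>k. \<exists>b. b \<in> B0 \<and> ent g2 k j - ent e k j = x * b" using e(2) by blast
      from choice[OF this] obtain c where c: "\<And>k. c k \<in> B0" "\<And>k. ent g2 k j - ent e k j = x * c k" by blast
      have "(\<Sum>k\<in>S. ent e' i k * (ent g2 k j - ent e k j)) = x * (\<Sum>k\<in>S. ent e' i k * c k)" for S
        by (simp add: c sum_distrib_left mult_ac)
      moreover have "(\<Sum>k\<in>S. ent e' i k * c k) \<in> B0" for S
        using c overD[OF eP(2)] P_B0 by (intro subrng_sum[OF Z.B] Z.BD(4)) auto
      ultimately show ?thesis by blast
    qed
    finally show ?thesis by auto
  qed
  then obtain d where d: "\<And>i j. d i j \<in> B0" "\<And>i j. ent \<gamma> i j - ent 1 i j = x * d i j" by metis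
  have dP: "d i j \<in> pol A x" for i j
  proof (rule LA_Int_B0[OF _ d(1)])
    have "x * d i j \<in> pol A x"
      using overD[OF \<gamma>P] overD[OF over_one[OF P_rng]] subrngD(3)[OF P_rng] by (simp flip: d(2))
    then show "d i j \<in> LA" unfolding LA_def by (auto intro!: exI[of _ 1])
  qed
  have "\<exists>f N. (\<forall>k. f k \<in> A) \<and> (\<forall>M\<ge>N. d i j = (\<Sum>k<M. x ^ k * f k))" for i j
    by (rule pol_coeffs[OF dP Z.AD(2)])
  then obtain f N where f: "\<And>i j k. f i j k \<in> A" "\<And>i j M. M \<ge> N i j \<Longrightarrow> d i j = (\<Sum>k<M. x ^ k * f i j k)"
    by metis
  obtain r1 r2 where "e' \<in> bdd r1" "g2 \<in> bdd r2" using elm_bdd[OF e'(1)] elm_bdd[OF g(2)] by blast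
  then have "e' \<in> bdd (r1 + r2)" "g2 \<in> bdd (r1 + r2)" by (auto elim: bdd_mono)
  then have r: "\<gamma> \<in> bdd (r1 + r2)" unfolding \<gamma>_def by (rule bdd_mult)
  define r where "r = r1 + r2"
  define K where "K = (\<Sum>i<r. \<Sum>j<r. N i j)"
  define al where "al k i j = (if i < r \<and> j < r then f i j k else 0)" for k i j
  have al: "al k i j \<in> A" for k i j using f Z.AD by (simp add: al_def)
  have \<gamma>al: "ent \<gamma> i j = ent 1 i j + (\<Sum>k<K. x ^ Suc k * al k i j)" for i j
  proof (cases "i < r \<and> j < r")
    case True
    have "N i j \<le> (\<Sum>j<r. N i j)" using True by (intro member_le_sum) auto
    also have "\<dots> \<le> K" unfolding K_def using True
      by (intro member_le_sum[of i "{..<r}" "\<lambda>i. \<Sum>j<r. N i j"]) auto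
    finally have "d i j = (\<Sum>k<K. x ^ k * f i j k)" by (rule f(2))
    then have "ent \<gamma> i j - ent 1 i j = (\<Sum>k<K. x ^ Suc k * al k i j)"
      unfolding d(2) using True by (simp add: al_def sum_distrib_left mult.assoc)
    then show ?thesis by (simp add: algebra_simps)
  next
    case False
    then have "ent \<gamma> i j = ent 1 i j" using bddD[OF r, of i j] by (auto simp: ent_one r_def not_less)
    then show ?thesis using False by (auto simp: al_def)
  qed
  have AQ: "A \<subseteq> Q" using Z.AB Z.BQ by blast
  have "\<gamma> \<in> elm (pol A (inverse (inverse x)))"
  proof (rule I.monic_inversion[where \<beta> = "h2 * e" and al = al and ?N1.0 = K])
    show "\<gamma> \<in> elm Q" unfolding \<gamma>_def
      using elm_mono[OF AQ] elm_mono[OF Z.BQ] e' g(2) by (intro elm_mult) auto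
    have "\<gamma> * (h2 * e) = e' * (g2 * h2) * e" by (simp add: \<gamma>_def mult.assoc)
    then show "\<gamma> * (h2 * e) = 1" using h2 e' by simp
    have "(h2 * e) * \<gamma> = h2 * (e * e') * g2" by (simp add: \<gamma>_def mult.assoc)
    then show "(h2 * e) * \<gamma> = 1" using h2 e' by simp
    show "h2 * e \<in> over (pol A (inverse (inverse x)))" using h2P eP by (simp add: over_mult P_rng)
    show "ent \<gamma> i j = ent 1 i j + (\<Sum>k<K. inverse (inverse x) ^ Suc k * al k i j)" for i j
      using \<gamma>al[of i j] by simp
  qed (rule al)
  then have "\<gamma> \<in> elm LA" using elm_mono[OF P_LA] by auto
  then have "e * \<gamma> \<in> elm LA" using elm_mono[OF A_LA] e by (intro elm_mult) auto
  moreover have "e * \<gamma> = g2" using e' by (simp add: \<gamma>_def flip: mult.assoc)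
  ultimately show ?thesis using elm_mult[OF g(1)] g(3) by simp
qed

end


section \<open>Stable determinants\<close>

definition dt :: "nat \<Rightarrow> 'a::comm_ring_1 cf \<Rightarrow> 'a" where
  "dt N A = det (mat N N (\<lambda>(i, j). ent A i j))"

lemma dt_mult:
  assumes "B \<in> bdd N" shows "dt N (A * B) = dt N A * dt N B"
proof -
  have "mat N N (\<lambda>(i, j). ent (A * B) i j) = mat N N (\<lambda>(i, j). ent A i j) * mat N N (\<lambda>(i, j). ent B i j)"
    using assms by (intro eq_matI) (auto simp: ent_mult_bdd scalar_prod_def lessThan_atLeast0)
  then show ?thesis unfolding dt_def by (simp only: det_mult[OF mat_carrier mat_carrier])
qed

lemma dt_diag:
  assumes "p < N" shows "dt N (1 + mun p p (c - 1)) = c"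
proof -
  let ?M = "mat N N (\<lambda>(i, j). ent (1 + mun p p (c - 1)) i j)"
  have "det ?M = prod_list (diag_mat ?M)"
    by (rule det_upper_triangular[of _ N]) (auto simp: upper_triangular_def ent_one ent_mun)
  also have "\<dots> = (\<Prod>i = 0..<N. if i = p then c else 1)"
    unfolding prod_list_diag_prod by (intro prod.cong) (auto simp: ent_one ent_mun)
  also have "\<dots> = c" using assms by (simp add: prod.delta)
  finally show ?thesis by (simp add: dt_def)
qed

lemma dt_elem:
  assumes "i \<noteq> j" shows "dt N (1 + mun i j a) = 1"
proof -
  have "mat N N (\<lambda>(k, l). ent (1 + mun i j a) k l) = addrow_mat N a i j"
    by (rule eq_matI) (auto simp: addrow_mat_def ent_one ent_mun)
  then show ?thesis using det_addrow_mat[OF assms] by (simp add: dt_def)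
qed

lemma dt_Suc:
  assumes "A \<in> bdd N" shows "dt (Suc N) A = dt N A"
proof -
  let ?M = "mat (Suc N) (Suc N) (\<lambda>(i, j). ent A i j)"
  have "det ?M = (\<Sum>j<Suc N. ?M $$ (N, j) * cofactor ?M N j)"
    by (rule laplace_expansion_row) auto
  also have "\<dots> = (\<Sum>j\<in>{N}. ?M $$ (N, j) * cofactor ?M N j)"
    by (rule sum.mono_neutral_right) (use bddD[OF assms, of N] in auto)
  also have "\<dots> = cofactor ?M N N" using bddD[OF assms, of N N] by simp
  also have "\<dots> = det (mat_delete ?M N N)" by (simp add: cofactor_def)
  also have "mat_delete ?M N N = mat N N (\<lambda>(i, j). ent A i j)"
    by (rule eq_matI) (auto simp: mat_delete_def)
  finally show ?thesis by (simp add: dt_def)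
qed

lemma dt_mono:
  assumes "A \<in> bdd N" "N \<le> M" shows "dt M A = dt N A"
  using assms(2)
proof (induction M rule: dec_induct)
  case (step M)
  then show ?case using dt_Suc[of A M] bdd_mono[OF assms(1)] by simp
qed simp

text \<open>The least size is a canonical choice; by \<open>dt_mono\<close> every larger size gives
  the same value, so matrices with blocks of different sizes can be compared.\<close>

definition Dt :: "'a::comm_ring_1 cf \<Rightarrow> 'a" where
  "Dt A = dt (LEAST r. A \<in> bdd r) A"

lemma Dt_eq: "A \<in> bdd N \<Longrightarrow> Dt A = dt N A"
  unfolding Dt_def by (rule dt_mono[symmetric]) (auto intro: LeastI Least_le)

lemma Dt_mult:
  assumes "A \<in> bdd r" "B \<in> bdd r'" shows "Dt (A * B) = Dt A * Dt B"
proof -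
  have *: "A \<in> bdd (r + r')" "B \<in> bdd (r + r')" using assms by (auto elim: bdd_mono)
  then show ?thesis using bdd_mult[OF *] by (simp add: Dt_eq dt_mult)
qed

lemma Dt_diag: "Dt (1 + mun p p (c - 1)) = c"
  using Dt_eq[of "1 + mun p p (c - 1)" "Suc p"] by (simp add: bdd_elem dt_diag)

lemma Dt_one: "Dt 1 = 1"
  using Dt_diag[of 0 1] by simp

lemma Dt_elem: "i \<noteq> j \<Longrightarrow> Dt (1 + mun i j a) = 1"
  using Dt_eq[of "1 + mun i j a" "Suc (i + j)"] by (simp add: bdd_elem dt_elem)

lemma Dt_elm: "g \<in> elm R \<Longrightarrow> Dt g = 1"
proof (induction rule: elm.induct)
  case (step g i j a)
  obtain r where "g \<in> bdd r" using elm_bdd step by blast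
  moreover have "1 + mun i j a \<in> bdd (Suc (i + j))" by (simp add: bdd_elem)
  ultimately show ?case using step by (simp add: Dt_mult Dt_elem)
qed (rule Dt_one)

lemma Dt_in:
  assumes R: "subrng R" and A: "A \<in> over R" "A \<in> bdd N" shows "Dt A \<in> R"
proof -
  have pr: "(\<Prod>i\<in>S. f i) \<in> R" if "\<And>i. i \<in> S \<Longrightarrow> f i \<in> R" for S :: "nat set" and f
    using that by (induction S rule: infinite_finite_induct) (auto intro: subrngD[OF R])
  have "det (mat N N (\<lambda>(i, j). ent A i j)) \<in> R"
  proof (subst det_def'[of _ N])
    have "signof p \<in> R" for p by (cases p rule: sign_cases) (auto intro: subrngD[OF R])
    moreover have "p i < N" if "p permutes {0..<N}" "i < N" for p i
      using permutes_in_image[OF that(1), of i] that(2) by auto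
    ultimately show "(\<Sum>p | p permutes {0..<N}. signof p * (\<Prod>i = 0..<N. mat N N (\<lambda>(i, j). ent A i j) $$ (i, p i))) \<in> R"
      by (auto intro!: subrng_sum[OF R] subrngD(4)[OF R] pr simp: overD[OF A(1)])
  qed simp
  then show ?thesis using Dt_eq[OF A(2)] by (simp add: dt_def)
qed

lemma col_nonzero:
  assumes "A \<in> bdd (Suc N)" "Dt A \<noteq> 0" shows "\<exists>i\<le>N. ent A i N \<noteq> 0"
proof (rule ccontr)
  assume *: "\<not> ?thesis"
  let ?M = "mat (Suc N) (Suc N) (\<lambda>(i, j). ent A i j)"
  have "det ?M = (\<Sum>i<Suc N. ?M $$ (i, N) * cofactor ?M i N)"
    by (rule laplace_expansion_column) auto
  also have "\<dots> = 0" by (rule sum.neutral) (use * in auto)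
  finally show False using assms Dt_eq[OF assms(1)] by (simp add: dt_def)
qed

text \<open>Bring the corner to 1 by adding a multiple of another row, clear the last column and
  row, and descend to size \<open>N\<close>. If the corner is the only nonzero entry of its column,
  a second one is first created in row 0; at size 1 the determinant leaves only the
  identity.\<close>

lemma gauss:
  fixes K :: "'f::field set"
  assumes K: "subrng K" "\<And>x. x \<in> K \<Longrightarrow> inverse x \<in> K"
    and "A \<in> bdd N" "A \<in> over K" "Dt A = 1"
  shows "A \<in> elm K"
  using assms(3-5)
proof (induction N arbitrary: A)
  case 0
  then have "A = 1" by (intro cf_eqI) (auto simp: bdd_def)
  then show ?case by (simp add: elm.one)
next
  case (Suc N)
  note KD = subrngD[OF K(1)]
  show ?case
  proof (cases "N = 0")
    case True
    have "A = 1 + mun 0 0 (ent A 0 0 - 1)"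
      using Suc.prems(1) True by (intro cf_eqI) (auto simp: bdd_def ent_mun ent_one)
    then have "A = 1" using Dt_diag[of 0 "ent A 0 0"] Suc.prems(3) by simp
    then show ?thesis by (simp add: elm.one)
  next
    case N: False
    have mulE: "(1 + mun i j a) * B \<in> bdd (Suc N) \<and> (1 + mun i j a) * B \<in> over K \<and> Dt ((1 + mun i j a) * B) = 1"
      if "B \<in> bdd (Suc N)" "B \<in> over K" "Dt B = 1" "i \<noteq> j" "a \<in> K" "i \<le> N" "j \<le> N" for B i j a
      using that bdd_elem[of i "Suc N" j a] Dt_mult[of "1 + mun i j a" "Suc N" B "Suc N"] Dt_elem[of i j a]
      by (auto intro!: bdd_mult over_mult over_add over_one over_mun K)
    have case1: "B \<in> elm K" if B: "B \<in> bdd (Suc N)" "B \<in> over K" "Dt B = 1" and BN: "ent B N N = 1" for B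
    proof -
      define X where "X = bm 0 N N 1 (\<lambda>i _. - ent B i N)"
      have Xe: "1 + X \<in> elm K" unfolding X_def using overD[OF B(2)] KD by (intro elm_bm_disjoint K) auto
      have entX: "ent X i k = (if i < N \<and> k = N then - ent B i N else 0)" for i k
        by (auto simp: X_def ent_bm)
      have entXB: "ent ((1 + X) * B) i j = ent B i j - (if i < N then ent B i N * ent B N j else 0)" for i j
      proof -
        have "ent (X * B) i j = (\<Sum>k\<in>insert N {k. ent B k j \<noteq> 0}. ent X i k * ent B k j)"
          by (rule ent_mult) auto
        also have "\<dots> = (\<Sum>k\<in>{N}. ent X i k * ent B k j)"
          by (rule sum.mono_neutral_right) (auto simp: entX)
        finally show ?thesis by (simp add: distrib_right entX)
      qed
      define C where "C = (1 + X) * B"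
      define Y where "Y = bm N 1 0 N (\<lambda>_ j. - ent C N j)"
      have CK: "C \<in> over K" unfolding C_def using elm_over[OF K(1) Xe] B(2) by (intro over_mult K)
      have Ye: "1 + Y \<in> elm K" unfolding Y_def using overD[OF CK] KD by (intro elm_bm_disjoint K) auto
      have CN: "ent C i N = (if i = N then 1 else 0)" for i
        using bddD[OF B(1), of i N] BN by (auto simp: C_def entXB)
      have entY: "ent Y k j = (if k = N \<and> j < N then - ent C N j else 0)" for k j
        by (auto simp: Y_def ent_bm)
      define D where "D = C * (1 + Y)"
      have entD: "ent D i j = ent C i j - (if j < N then ent C i N * ent C N j else 0)" for i j
      proof -
        have "ent (C * Y) i j = (\<Sum>k\<in>{N}. ent C i k * ent Y k j)"
          by (rule ent_mult) (auto simp: entY split: if_splits)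
        then show ?thesis by (simp add: D_def distrib_left entY)
      qed
      have "D \<in> bdd N"
        unfolding bdd_def
      proof (intro CollectI allI impI)
        fix i j assume "N \<le> i \<or> N \<le> j"
        then consider "i = N" | "i > N" | "j = N" | "j > N" by force
        then show "ent D i j = ent 1 i j"
        proof cases
          case 1
          then show ?thesis using CN BN bddD[OF B(1), of N j]
            by (cases j N rule: linorder_cases) (auto simp: entD C_def entXB ent_one)
        next
          case 2
          then show ?thesis using bddD[OF B(1), of i N] bddD[OF B(1), of i j] by (auto simp: entD C_def entXB ent_one)
        next
          case 3
          then show ?thesis by (simp add: entD CN ent_one)
        next
          case 4
          then show ?thesis using bddD[OF B(1), of i j] bddD[OF B(1), of N j] by (auto simp: entD C_def entXB ent_one)
        qed
      qed
      moreover have "D \<in> over K" unfolding D_def using elm_over[OF K(1) Ye] CK by (intro over_mult K)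
      moreover have "Dt D = 1"
      proof -
        obtain r1 r2 where "1 + X \<in> bdd r1" "1 + Y \<in> bdd r2" using elm_bdd Xe Ye by metis
        then have "(1 + X) \<in> bdd (r1 + r2 + Suc N)" "1 + Y \<in> bdd (r1 + r2 + Suc N)" "B \<in> bdd (r1 + r2 + Suc N)"
          using B(1) by (auto elim: bdd_mono)
        moreover from this have "C \<in> bdd (r1 + r2 + Suc N)" unfolding C_def by (intro bdd_mult)
        ultimately have "Dt D = Dt (1 + X) * Dt B * Dt (1 + Y)" by (simp add: D_def C_def Dt_mult)
        then show ?thesis using Dt_elm[OF Xe] Dt_elm[OF Ye] B(3) by simp
      qed
      ultimately have "D \<in> elm K" by (rule Suc.IH)
      then have "C \<in> elm K" unfolding D_def by (rule elm_cancel_right[OF K(1) Ye])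
      then show ?thesis unfolding C_def by (rule elm_cancel_left[OF K(1) Xe])
    qed
    have case2: "B \<in> elm K" if B: "B \<in> bdd (Suc N)" "B \<in> over K" "Dt B = 1" and i: "i < N" "ent B i N \<noteq> 0" for B i
    proof -
      define a where "a = (1 - ent B N N) * inverse (ent B i N)"
      have a: "a \<in> K" unfolding a_def using overD[OF B(2)] K KD by auto
      have "ent ((1 + mun N i a) * B) N N = 1"
        using i by (simp add: distrib_right ent_mun_mult a_def mult.assoc)
      then have "(1 + mun N i a) * B \<in> elm K" using mulE[OF B, of N i a] a i by (intro case1) auto
      then show ?thesis using elm_cancel_left[OF K(1) elm_gen[of N i a K]] a i by auto
    qed
    obtain i where i: "i \<le> N" "ent A i N \<noteq> 0" using col_nonzero[OF Suc.prems(1)] Suc.prems(3) by auto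
    show ?thesis
    proof (cases "\<exists>i<N. ent A i N \<noteq> 0")
      case True
      then show ?thesis using case2[OF Suc.prems] by blast
    next
      case False
      then have i: "ent A N N \<noteq> 0" "ent A 0 N = 0" using i N by (auto simp: le_less)
      have "ent ((1 + mun 0 N 1) * A) 0 N \<noteq> 0" using i by (simp add: distrib_right ent_mun_mult)
      then have "(1 + mun 0 N 1) * A \<in> elm K"
        using mulE[OF Suc.prems, of 0 N 1] KD N by (intro case2[of _ 0]) auto
      then show ?thesis using elm_cancel_left[OF K(1) elm_gen[of 0 N 1 K]] KD N by auto
    qed
  qed
qed


section \<open>Laurent polynomials and their fractions\<close>

type_synonym 'k lau = "(nat \<Rightarrow>\<^sub>0 int) \<Rightarrow>\<^sub>0 'k"

abbreviation ky :: "('a \<Rightarrow>\<^sub>0 'b::zero) \<Rightarrow> 'a set" where "ky \<equiv> Poly_Mapping.keys"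
abbreviation lk :: "('a \<Rightarrow>\<^sub>0 'b::zero) \<Rightarrow> 'a \<Rightarrow> 'b" where "lk \<equiv> Poly_Mapping.lookup"
abbreviation sg :: "'a \<Rightarrow> 'b \<Rightarrow> 'a \<Rightarrow>\<^sub>0 'b::zero" where "sg \<equiv> Poly_Mapping.single"

lemma pm_sum_singles: "p = (\<Sum>k\<in>ky p. sg k (lk p k))"
proof (rule poly_mapping_eqI)
  fix k
  have "lk (\<Sum>k\<in>ky p. sg k (lk p k)) k = (\<Sum>m\<in>ky p. if m = k then lk p m else 0)"
    by (simp add: lookup_sum lookup_single when_def)
  also have "\<dots> = lk p k" by (simp add: sum.delta in_keys_iff)
  finally show "lk p k = lk (\<Sum>k\<in>ky p. sg k (lk p k)) k" by simp
qed

text \<open>The premise on single terms is restricted to those occurring in \<open>p\<close>, so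
  conditions on the support of \<open>p\<close> can be used there.\<close>

lemma pm_induct_sum:
  fixes p :: "'a \<Rightarrow>\<^sub>0 'b::comm_monoid_add"
  assumes "P 0" "\<And>f g. P f \<Longrightarrow> P g \<Longrightarrow> P (f + g)" "\<And>k. k \<in> ky p \<Longrightarrow> P (sg k (lk p k))"
  shows "P p"
proof -
  have "P (\<Sum>k\<in>S. sg k (lk p k))" if "finite S" "S \<subseteq> ky p" for S
    using that by (induction S rule: finite_induct) (auto intro: assms)
  from this[of "ky p"] show ?thesis using pm_sum_singles[of p] by simp
qed

lemma keys_mult_subset: "ky (p * q) \<subseteq> {a + b | a b. a \<in> ky p \<and> b \<in> ky q}"
  for p q :: "'a::monoid_add \<Rightarrow>\<^sub>0 'b::semiring_0"
  using keys_mult[of p q] by auto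

definition Lv :: "nat set \<Rightarrow> 'k::field lau set" where
  "Lv X = {p. \<forall>\<kappa>\<in>ky p. ky \<kappa> \<subseteq> X}"

lemma Lv_mono: "X \<subseteq> Y \<Longrightarrow> Lv X \<subseteq> Lv Y"
  unfolding Lv_def by blast

lemma Lv_rng: "subrng (Lv X)"
  unfolding subrng_def
proof (intro conjI ballI)
  show "1 \<in> Lv X" by (auto simp: Lv_def)
  fix p q :: "'a lau" assume p: "p \<in> Lv X" and q: "q \<in> Lv X"
  show "p - q \<in> Lv X" using p q keys_diff[of p q] by (auto simp: Lv_def)
  show "p * q \<in> Lv X" unfolding Lv_def
  proof (intro CollectI ballI)
    fix \<kappa> assume "\<kappa> \<in> ky (p * q)"
    then obtain a b where ab: "\<kappa> = a + b" "a \<in> ky p" "b \<in> ky q" using keys_mult_subset by fastforce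
    have "ky \<kappa> \<subseteq> ky a \<union> ky b" unfolding ab(1) by (rule Poly_Mapping.keys_add)
    then show "ky \<kappa> \<subseteq> X" using ab p q by (auto simp: Lv_def)
  qed
qed

lemmas LvD = subrngD[OF Lv_rng]

lemma Lv_single: "ky \<kappa> \<subseteq> X \<Longrightarrow> sg \<kappa> c \<in> Lv X"
  by (auto simp: Lv_def)

definition emb :: "'k::field lau \<Rightarrow> 'k lau fract" where "emb p = Fract p 1"

lemma emb_simps [simp]:
  "emb 0 = 0" "emb 1 = 1" "emb (p + q) = emb p + emb q" "emb (p * q) = emb p * emb q"
  "emb (p - q) = emb p - emb q" "emb (- p) = - emb p"
  by (simp_all add: emb_def Zero_fract_def One_fract_def)

lemma emb_eq_iff [simp]: "emb p = emb q \<longleftrightarrow> p = q"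
  by (simp add: emb_def eq_fract)

lemma emb_eq_0_iff [simp]: "emb p = 0 \<longleftrightarrow> p = 0"
  by (metis emb_eq_iff emb_simps(1))

lemma emb_power [simp]: "emb (p ^ k) = emb p ^ k"
  by (induction k) auto

lemma emb_sum [simp]: "emb (sum f S) = (\<Sum>x\<in>S. emb (f x))"
  by (induction S rule: infinite_finite_induct) auto

text \<open>\<open>RR X Y\<close> is the ring \<open>K(X)[Y\<^sup>\<plusminus>]\<close>.\<close>

definition RR :: "nat set \<Rightarrow> nat set \<Rightarrow> 'k::field lau fract set" where
  "RR X Y = {emb p / emb q | p q. p \<in> Lv (X \<union> Y) \<and> q \<in> Lv X \<and> q \<noteq> 0}"

lemma RR_I: "p \<in> Lv (X \<union> Y) \<Longrightarrow> q \<in> Lv X \<Longrightarrow> q \<noteq> 0 \<Longrightarrow> emb p / emb q \<in> RR X Y"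
  by (auto simp: RR_def)

lemma emb_RR: "p \<in> Lv (X \<union> Y) \<Longrightarrow> emb p \<in> RR X Y"
  using RR_I[of p X Y 1] by (simp add: LvD(1))

lemma RR_rng: "subrng (RR X Y)"
  unfolding subrng_def
proof (intro conjI ballI)
  show "1 \<in> RR X Y" using emb_RR[of 1 X Y] by (simp add: LvD(1))
  fix a b :: "'a lau fract" assume "a \<in> RR X Y" "b \<in> RR X Y"
  then obtain p q p' q' where a: "a = emb p / emb q" "p \<in> Lv (X \<union> Y)" "q \<in> Lv X" "q \<noteq> 0"
    and b: "b = emb p' / emb q'" "p' \<in> Lv (X \<union> Y)" "q' \<in> Lv X" "q' \<noteq> 0" by (auto simp: RR_def)
  have qq: "q \<in> Lv (X \<union> Y)" "q' \<in> Lv (X \<union> Y)" using a b Lv_mono[of X "X \<union> Y"] by auto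
  have "a - b = emb (p * q' - p' * q) / emb (q * q')" using a(4) b(4) by (simp add: a(1) b(1) diff_frac_eq)
  then show "a - b \<in> RR X Y" using a b qq by (auto intro!: RR_I LvD(3) LvD(4) simp del: emb_simps)
  have "a * b = emb (p * p') / emb (q * q')" using a b by simp
  then show "a * b \<in> RR X Y" using a b by (auto intro!: RR_I LvD(4) simp del: emb_simps)
qed

lemma RR_mono: "X \<union> Y \<subseteq> X' \<union> Y' \<Longrightarrow> X \<subseteq> X' \<Longrightarrow> RR X Y \<subseteq> (RR X' Y' :: 'a::field lau fract set)"
  using Lv_mono[of "X \<union> Y" "X' \<union> Y'", where 'a = 'a] Lv_mono[of X X', where 'a = 'a] unfolding RR_def by blast

lemma RR_field: "x \<in> RR X {} \<Longrightarrow> inverse x \<in> RR X {}"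
proof -
  assume "x \<in> RR X {}"
  then obtain p q where x: "x = emb p / emb q" "p \<in> Lv X" "q \<in> Lv X" "q \<noteq> 0" by (auto simp: RR_def)
  show ?thesis
  proof (cases "p = 0")
    case True then show ?thesis using x by (simp add: subrngD(2)[OF RR_rng])
  next
    case False
    have "inverse x = emb q / emb p" using x by simp
    then show ?thesis using RR_I[of q X "{}" p] x False by simp
  qed
qed

section \<open>Powers of one variable and regularity at its two ends\<close>

definition xv :: "nat \<Rightarrow> int \<Rightarrow> 'k::field lau" where "xv t e = sg (sg t e) 1"

lemma xv_mult: "xv t e * xv t d = xv t (e + d)"
  by (simp add: xv_def mult_single single_add)

lemma xv_0: "xv t 0 = 1" by (simp add: xv_def)

lemma xv_nz: "xv t e \<noteq> 0"
  unfolding xv_def by (metis lookup_single_eq lookup_zero zero_neq_one)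

lemma xv_power: "xv t e ^ k = xv t (int k * e)"
  by (induction k) (simp_all add: xv_0 xv_mult algebra_simps)

lemma xv_Lv: "t \<in> X \<Longrightarrow> xv t e \<in> Lv X"
  unfolding xv_def by (rule Lv_single) simp

lemma emb_xv_inverse: "inverse (emb (xv t e)) = emb (xv t (- e))"
  by (rule inverse_unique) (simp add: xv_mult xv_0 flip: emb_simps(4))

text \<open>The sign \<open>e\<close> selects the end: no negative powers of \<open>t\<close> for
  \<open>e = 1\<close>, no positive ones for \<open>e = -1\<close>. One development then serves both
  places.\<close>

definition NN :: "nat \<Rightarrow> int \<Rightarrow> nat set \<Rightarrow> 'k::field lau set" where
  "NN t e X = {p \<in> Lv X. \<forall>\<kappa>\<in>ky p. 0 \<le> e * lk \<kappa> t}"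

lemma NN_rng: "subrng (NN t e X)"
  unfolding subrng_def
proof (intro conjI ballI)
  show "1 \<in> NN t e X" using LvD(1) by (auto simp: NN_def)
  fix p q :: "'a lau" assume p: "p \<in> NN t e X" and q: "q \<in> NN t e X"
  show "p - q \<in> NN t e X" using p q keys_diff[of p q] LvD(3) by (auto simp: NN_def)
  have "0 \<le> e * lk \<kappa> t" if "\<kappa> \<in> ky (p * q)" for \<kappa>
  proof -
    obtain a b where ab: "\<kappa> = a + b" "a \<in> ky p" "b \<in> ky q" using keys_mult_subset \<open>\<kappa> \<in> ky (p * q)\<close> by fastforce
    then show ?thesis using p q by (auto simp: NN_def lookup_add distrib_left)
  qed
  then show "p * q \<in> NN t e X" using p q LvD(4) by (auto simp: NN_def)
qed

lemmas NND = subrngD[OF NN_rng]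

lemma Lv_NN:
  assumes "t \<notin> X" "X \<subseteq> Y" "p \<in> Lv X" shows "p \<in> NN t e Y"
proof -
  have "lk \<kappa> t = 0" if "\<kappa> \<in> ky p" for \<kappa>
    using that assms(1,3) unfolding Lv_def by (metis (mono_tags, lifting) in_keys_iff mem_Collect_eq subsetD)
  then show ?thesis using Lv_mono[OF assms(2)] assms(3) by (auto simp: NN_def)
qed

lemma NN_mono: "X \<subseteq> Y \<Longrightarrow> NN t e X \<subseteq> NN t e Y"
  unfolding NN_def Lv_def by blast

lemma keys_xv_mult: "\<kappa> \<in> ky (xv t e * p) \<Longrightarrow> \<kappa> - sg t e \<in> ky p"
  using keys_mult_subset[of "xv t e" p] by (auto simp: xv_def)

lemma xv_NN: "e * d \<ge> 0 \<Longrightarrow> t \<in> X \<Longrightarrow> xv t d \<in> NN t e X"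
  unfolding NN_def using xv_Lv by (auto simp: xv_def)

lemma NN_split:
  assumes "p \<in> NN t e X" "e = 1 \<or> e = -1" "t \<in> X"
  shows "\<exists>p0\<in>Lv (X - {t}). \<exists>p1\<in>NN t e X. p = p0 + xv t e * p1"
proof (rule pm_induct_sum[of "\<lambda>p. \<exists>p0\<in>Lv (X - {t}). \<exists>p1\<in>NN t e X. p = p0 + xv t e * p1"])
  show "\<exists>p0\<in>Lv (X - {t}). \<exists>p1\<in>NN t e X. 0 = p0 + xv t e * p1"
    by (rule bexI[of _ 0], rule bexI[of _ 0]) (simp_all add: LvD(2) NND(2))
next
  fix f g :: "'a lau"
  assume "\<exists>p0\<in>Lv (X - {t}). \<exists>p1\<in>NN t e X. f = p0 + xv t e * p1"
    and "\<exists>p0\<in>Lv (X - {t}). \<exists>p1\<in>NN t e X. g = p0 + xv t e * p1"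
  then obtain p0 p1 q0 q1 where "p0 \<in> Lv (X - {t})" "p1 \<in> NN t e X" "f = p0 + xv t e * p1"
    "q0 \<in> Lv (X - {t})" "q1 \<in> NN t e X" "g = q0 + xv t e * q1" by blast
  then show "\<exists>p0\<in>Lv (X - {t}). \<exists>p1\<in>NN t e X. f + g = p0 + xv t e * p1"
    by (rule_tac bexI[of _ "p0 + q0"], rule_tac bexI[of _ "p1 + q1"]) (simp_all add: algebra_simps LvD(6) NND(6))
next
  fix \<kappa> assume k: "\<kappa> \<in> ky p"
  define c where "c = lk p \<kappa>"
  have kX: "ky \<kappa> \<subseteq> X" "0 \<le> e * lk \<kappa> t" using k assms(1) by (auto simp: NN_def Lv_def)
  show "\<exists>p0\<in>Lv (X - {t}). \<exists>p1\<in>NN t e X. sg \<kappa> c = p0 + xv t e * p1"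
  proof (cases "lk \<kappa> t = 0")
    case True
    then have "t \<notin> ky \<kappa>" by (simp add: in_keys_iff)
    then have "sg \<kappa> c \<in> Lv (X - {t})" using kX by (intro Lv_single) auto
    then show ?thesis by (rule_tac bexI[of _ "sg \<kappa> c"], rule_tac bexI[of _ 0]) (simp_all add: NND(2))
  next
    case False
    have "sg \<kappa> c = xv t e * sg (\<kappa> - sg t e) c" by (simp add: xv_def mult_single)
    moreover have "ky (\<kappa> - sg t e) \<subseteq> X"
    proof -
      have "ky (\<kappa> - sg t e) \<subseteq> ky \<kappa> \<union> ky (sg t e)" by (rule keys_diff)
      also have "\<dots> \<subseteq> X" using kX assms(3) by simp
      finally show ?thesis .
    qed
    moreover have "0 \<le> e * lk (\<kappa> - sg t e) t"
      using kX(2) False assms(2) by (auto simp: lookup_minus lookup_single)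
    ultimately have "sg (\<kappa> - sg t e) c \<in> NN t e X" "sg \<kappa> c = 0 + xv t e * sg (\<kappa> - sg t e) c"
      by (auto simp: NN_def Lv_def split: if_splits)
    then show ?thesis by (rule_tac bexI[of _ 0], rule_tac bexI[of _ "sg (\<kappa> - sg t e) c"]) (simp_all add: LvD(2))
  qed
qed

text \<open>The exponent of \<open>t\<close> is 0 in every monomial of \<open>a\<close>, while in
  those of the product \<open>e\<close> times the exponent is at least \<open>e * e\<close>, which
  is positive.\<close>

lemma Lv_xv_disjoint:
  assumes "a \<in> Lv X" "t \<notin> X" "a = xv t e * p" "p \<in> NN t e Y" "e \<noteq> 0" shows "a = 0"
proof (rule ccontr)
  assume "a \<noteq> 0"
  then obtain \<kappa> where k: "\<kappa> \<in> ky a" by (metis ex_in_conv keys_eq_empty)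
  then have "t \<notin> ky \<kappa>" using assms(1,2) by (auto simp: Lv_def)
  then have "lk \<kappa> t = 0" by (simp add: in_keys_iff)
  moreover have "\<kappa> - sg t e \<in> ky p" using k assms(3) keys_xv_mult by blast
  then have "0 \<le> e * lk (\<kappa> - sg t e) t" using assms(4) by (auto simp: NN_def)
  ultimately have "0 \<le> - (e * e)" by (simp add: lookup_minus)
  moreover have "0 < e * e" using assms(5) by (simp add: zero_less_mult_iff) linarith
  ultimately show False by linarith
qed

lemma xv_shift_NN:
  assumes "p \<in> Lv X" "t \<in> X" "e = 1 \<or> e = -1"
  shows "\<exists>k0. \<forall>k\<ge>k0. xv t e ^ k * p \<in> NN t e X"
proof -
  define k0 where "k0 = nat (Max ((\<lambda>\<kappa>. \<bar>lk \<kappa> t\<bar>) ` insert 0 (ky p)))"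
  have le: "\<bar>lk \<kappa> t\<bar> \<le> int k0" if "\<kappa> \<in> ky p" for \<kappa>
  proof -
    have "\<bar>lk \<kappa> t\<bar> \<le> Max ((\<lambda>\<kappa>. \<bar>lk \<kappa> t\<bar>) ` insert 0 (ky p))" using that by (intro Max_ge) auto
    then show ?thesis by (simp add: k0_def)
  qed
  have "xv t e ^ k * p \<in> NN t e X" if "k \<ge> k0" for k
  proof -
    have "0 \<le> e * lk \<kappa> t" if "\<kappa> \<in> ky (xv t (int k * e) * p)" for \<kappa>
    proof -
      have "\<kappa> - sg t (int k * e) \<in> ky p" using that by (rule keys_xv_mult)
      from le[OF this] have "\<bar>lk \<kappa> t - int k * e\<bar> \<le> int k" using \<open>k \<ge> k0\<close> by (simp add: lookup_minus)
      then show ?thesis using assms(3) by auto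
    qed
    then show ?thesis unfolding xv_power NN_def using LvD(4)[OF xv_Lv[OF assms(2)] assms(1)] by auto
  qed
  then show ?thesis by blast
qed

text \<open>Elements of \<open>K(X, t)[Y\<^sup>\<plusminus>]\<close> that are regular at \<open>t = 0\<close> (for \<open>e = 1\<close>) or \<open>t = \<infinity>\<close> (for \<open>e = -1\<close>).\<close>

definition BB :: "nat \<Rightarrow> int \<Rightarrow> nat set \<Rightarrow> nat set \<Rightarrow> 'k::field lau fract set" where
  "BB t e X Y = {emb p / emb (q0 + xv t e * q1) | p q0 q1.
     p \<in> NN t e (insert t (X \<union> Y)) \<and> q0 \<in> Lv X \<and> q0 \<noteq> 0 \<and> q1 \<in> NN t e (insert t X)}"

text \<open>A denominator has nonzero value \<open>q0\<close> at the place, a property stable under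
  products. The value of an element is \<open>p0 / q0\<close>, which gives \<open>dec\<close>;
  \<open>sep\<close> compares terms free of \<open>t\<close>; \<open>bound\<close> divides a
  denominator by its lowest power of the uniformiser.\<close>

lemma place_BB:
  fixes X Y :: "nat set"
  assumes tX: "t \<notin> X" "t \<notin> Y" and e: "e = 1 \<or> e = -1"
  shows "place (RR X Y) (BB t e X Y) (RR (insert t X) Y :: 'k::field lau fract set) (emb (xv t e))"
proof -
  let ?p = "xv t e :: 'k lau"
  let ?U = "insert t (X \<union> Y)"
  have e0: "e \<noteq> 0" "e * e \<ge> 0" using e by auto
  have den: "q0 + ?p * q1 \<noteq> 0" if "q0 \<in> Lv X" "q0 \<noteq> 0" "q1 \<in> NN t e (insert t X)" for q0 q1
  proof
    assume "q0 + ?p * q1 = 0"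
    then have "q0 = ?p * (- q1)" by (simp add: eq_neg_iff_add_eq_0)
    from Lv_xv_disjoint[OF that(1) tX(1) this NND(5)[OF that(3)] e0(1)] that(2) show False by simp
  qed
  have pN: "?p \<in> NN t e Z" if "t \<in> Z" for Z using xv_NN[OF e0(2) that] .
  have BI: "emb p / emb (q0 + ?p * q1) \<in> BB t e X Y"
    if "p \<in> NN t e ?U" "q0 \<in> Lv X" "q0 \<noteq> 0" "q1 \<in> NN t e (insert t X)" for p q0 q1
    using that by (auto simp: BB_def)
  have NU: "q \<in> NN t e ?U" if "q \<in> NN t e (insert t X)" for q using that NN_mono[of "insert t X" ?U] by auto
  have LN: "q \<in> NN t e (insert t X)" if "q \<in> Lv X" for q using that Lv_NN[OF tX(1), of "insert t X"] by blast
  have LNU: "q \<in> NN t e ?U" if "q \<in> Lv (X \<union> Y)" for q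
    using that Lv_NN[of t "X \<union> Y" ?U q e] tX by blast
  show ?thesis
  proof
    show "subrng (RR X Y :: 'k lau fract set)" by (rule RR_rng)
    show "subrng (RR (insert t X) Y :: 'k lau fract set)" by (rule RR_rng)
    show "(RR X Y :: 'k lau fract set) \<subseteq> BB t e X Y"
    proof
      fix a :: "'k lau fract" assume "a \<in> RR X Y"
      then obtain p q where "a = emb p / emb q" "p \<in> Lv (X \<union> Y)" "q \<in> Lv X" "q \<noteq> 0" by (auto simp: RR_def)
      then show "a \<in> BB t e X Y" using BI[of p q 0] by (simp add: LNU NND(2))
    qed
    show "(BB t e X Y :: 'k lau fract set) \<subseteq> RR (insert t X) Y"
    proof
      fix a :: "'k lau fract" assume "a \<in> BB t e X Y"
      then obtain p q0 q1 where a: "a = emb p / emb (q0 + ?p * q1)" "p \<in> NN t e ?U" "q0 \<in> Lv X" "q0 \<noteq> 0"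
        "q1 \<in> NN t e (insert t X)" by (auto simp: BB_def simp del: emb_simps)
      have "q0 \<in> Lv (insert t X)" "q1 \<in> Lv (insert t X)" "p \<in> Lv (insert t X \<union> Y)"
        using a LN[OF a(3)] by (simp_all add: NN_def)
      then have "p \<in> Lv (insert t X \<union> Y)" "q0 + ?p * q1 \<in> Lv (insert t X)"
        by (simp_all add: LvD(6) LvD(4) xv_Lv)
      then show "a \<in> RR (insert t X) Y" unfolding a(1) using den[OF a(3,4,5)] by (intro RR_I)
    qed
    show "subrng (BB t e X Y :: 'k lau fract set)"
      unfolding subrng_def
    proof (intro conjI ballI)
      show "(1 :: 'k lau fract) \<in> BB t e X Y" using BI[of 1 1 0] by (simp add: NND(1,2) LvD(1))
      fix a b :: "'k lau fract" assume "a \<in> BB t e X Y" "b \<in> BB t e X Y"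
      then obtain p q0 q1 r s0 s1 where a: "a = emb p / emb (q0 + ?p * q1)" "p \<in> NN t e ?U" "q0 \<in> Lv X" "q0 \<noteq> 0"
        "q1 \<in> NN t e (insert t X)" and b: "b = emb r / emb (s0 + ?p * s1)" "r \<in> NN t e ?U" "s0 \<in> Lv X" "s0 \<noteq> 0"
        "s1 \<in> NN t e (insert t X)" unfolding BB_def by blast
      define q s where "q = q0 + ?p * q1" and "s = s0 + ?p * s1"
      have "q \<noteq> 0" "s \<noteq> 0" unfolding q_def s_def by (rule den[OF a(3,4,5)], rule den[OF b(3,4,5)])
      then have nz: "emb q \<noteq> 0" "emb s \<noteq> 0" by simp_all
      note N1 = LN[OF a(3)] a(5) LN[OF b(3)] b(5) pN[OF insertI1]
      have qs: "q \<in> NN t e ?U" "s \<in> NN t e ?U" unfolding q_def s_def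
        by (rule NU[OF NND(6)[OF N1(1) NND(4)[OF N1(5,2)]]], rule NU[OF NND(6)[OF N1(3) NND(4)[OF N1(5,4)]]])
      have qseq: "q * s = q0 * s0 + ?p * (q0 * s1 + q1 * s0 + ?p * (q1 * s1))"
        by (simp add: q_def s_def algebra_simps)
      have m: "q0 * s1 + q1 * s0 + ?p * (q1 * s1) \<in> NN t e (insert t X)"
        by (rule NND(6)[OF NND(6)[OF NND(4)[OF N1(1,4)] NND(4)[OF N1(2,3)]] NND(4)[OF N1(5) NND(4)[OF N1(2,4)]]])
      have m': "q0 * s0 \<in> Lv X" "q0 * s0 \<noteq> 0" using a b by (simp_all add: LvD(4))
      have "a - b = emb (p * s - r * q) / emb (q * s)" using nz unfolding a(1) b(1)
        unfolding q_def[symmetric] s_def[symmetric] by (simp add: diff_frac_eq)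
      moreover have "p * s - r * q \<in> NN t e ?U" using a b qs by (intro NND(3) NND(4))
      ultimately show "a - b \<in> BB t e X Y" unfolding qseq using BI[OF _ m' m] by metis
      have "a * b = emb (p * r) / emb (q * s)" unfolding a(1) b(1)
        unfolding q_def[symmetric] s_def[symmetric] by simp
      moreover have "p * r \<in> NN t e ?U" using a b by (intro NND(4))
      ultimately show "a * b \<in> BB t e X Y" unfolding qseq using BI[OF _ m' m] by metis
    qed
    show "emb ?p \<in> BB t e X Y" using BI[of ?p 1 0] pN[of ?U] by (simp add: LvD(1) NND(2))
    show "emb ?p \<noteq> 0" by (simp add: xv_nz)
    show "inverse (emb ?p) \<in> RR (insert t X) Y"
      unfolding emb_xv_inverse by (intro emb_RR xv_Lv) simp
    fix b :: "'k lau fract"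
    {
      assume "b \<in> BB t e X Y"
      then obtain p q0 q1 where b: "b = emb p / emb (q0 + ?p * q1)" "p \<in> NN t e ?U" "q0 \<in> Lv X" "q0 \<noteq> 0"
        "q1 \<in> NN t e (insert t X)" unfolding BB_def by blast
      define q where "q = q0 + ?p * q1"
      have "q \<noteq> 0" unfolding q_def by (rule den[OF b(3,4,5)])
      then have nz: "emb q \<noteq> 0" by simp
      obtain p0 p1 where p: "p0 \<in> Lv (?U - {t})" "p1 \<in> NN t e ?U" "p = p0 + ?p * p1"
        using NN_split[OF b(2) e] by blast
      have U: "?U - {t} = X \<union> Y" using tX by auto
      \<comment> \<open>\<open>n / d\<close> is the difference between the element and its value,
        divided by the uniformiser.\<close>
      define n where "n = p1 * q0 - p0 * q1"
      define d where "d = q0 * q0 + ?p * (q0 * q1)"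
      have dq: "d = q * q0" by (simp add: d_def q_def algebra_simps)
      have "emb p / emb q - emb p0 / emb q0 = emb (p * q0 - p0 * q) / emb d"
        using nz b(4) by (simp add: dq diff_frac_eq)
      also have "p * q0 - p0 * q = ?p * n" by (simp add: p(3) q_def n_def algebra_simps)
      finally have "emb p / emb q = emb p0 / emb q0 + emb (?p * n) / emb d"
        by (metis add.commute diff_eq_eq)
      then have "b = emb p0 / emb q0 + emb ?p * (emb n / emb d)"
        unfolding b(1) q_def[symmetric] by simp
      moreover have "emb p0 / emb q0 \<in> RR X Y" using p(1) b unfolding U by (intro RR_I)
      moreover have "emb n / emb d \<in> BB t e X Y"
        unfolding d_def
      proof (rule BI)
        have "p0 \<in> NN t e ?U" "q0 \<in> NN t e ?U" "q1 \<in> NN t e ?U"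
          by (rule LNU[OF p(1)[unfolded U]], rule NU[OF LN[OF b(3)]], rule NU[OF b(5)])
        then show "n \<in> NN t e ?U" unfolding n_def using p(2) by (intro NND(3) NND(4))
        show "q0 * q0 \<in> Lv X" "q0 * q0 \<noteq> 0" using b by (auto intro: LvD(4))
        show "q0 * q1 \<in> NN t e (insert t X)" by (rule NND(4)[OF LN[OF b(3)] b(5)])
      qed
      ultimately show "\<exists>a\<in>RR X Y. \<exists>b'\<in>BB t e X Y. b = a + emb ?p * b'" by blast
    }
    {
      assume "b \<in> BB t e X Y" and bA: "emb ?p * b \<in> RR X Y"
      then obtain p q0 q1 where b: "b = emb p / emb (q0 + ?p * q1)" "p \<in> NN t e ?U" "q0 \<in> Lv X" "q0 \<noteq> 0"
        "q1 \<in> NN t e (insert t X)" unfolding BB_def by blast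
      define q where "q = q0 + ?p * q1"
      have "q \<noteq> 0" unfolding q_def by (rule den[OF b(3,4,5)])
      then have nz: "emb q \<noteq> 0" by simp
      obtain r s where rs: "emb ?p * b = emb r / emb s" "r \<in> Lv (X \<union> Y)" "s \<in> Lv X" "s \<noteq> 0"
        using bA by (auto simp: RR_def)
      have "emb ?p * emb p / emb q = emb r / emb s" using rs(1) b(1) by (simp add: q_def[symmetric])
      then have "emb (?p * p * s) = emb (r * q)" using nz rs(4) by (simp add: field_simps)
      then have "?p * p * s = r * q" by (simp only: emb_eq_iff)
      then have "r * q0 = ?p * (p * s - r * q1)" by (simp add: q_def algebra_simps)
      moreover have "r * q0 \<in> Lv (X \<union> Y)" using rs b Lv_mono[of X "X \<union> Y"] by (intro LvD(4)) auto
      moreover have "s \<in> NN t e ?U" "r \<in> NN t e ?U" "q1 \<in> NN t e ?U"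
        by (rule NU[OF LN[OF rs(3)]], rule LNU[OF rs(2)], rule NU[OF b(5)])
      then have "p * s - r * q1 \<in> NN t e ?U" using b(2) by (intro NND(3) NND(4))
      ultimately have "r * q0 = 0" using Lv_xv_disjoint[of "r * q0" "X \<union> Y" t e] tX e0 by auto
      then have "emb ?p * b = 0" using b(4) rs(1) by simp
      then show "b = 0" by (simp add: xv_nz)
    }
    {
      assume "b \<in> RR (insert t X) Y"
      then obtain p q where b: "b = emb p / emb q" "p \<in> Lv ?U" "q \<in> Lv (insert t X)" "q \<noteq> 0"
        by (auto simp: RR_def)
      \<comment> \<open>The order of \<open>q\<close> at the place. After shifting by it the value
        of the denominator is nonzero: a monomial attaining the minimum gets exponent 0 in
        \<open>t\<close>.\<close>
      define m where "m = Min ((\<lambda>\<kappa>. e * lk \<kappa> t) ` ky q)"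
      have ne: "ky q \<noteq> {}" using b(4) by simp
      define q' where "q' = xv t (- (e * m)) * q"
      have ee: "e * (e * z) = z" for z using e by auto
      have q'N: "q' \<in> NN t e (insert t X)"
        unfolding NN_def
      proof (intro CollectI conjI ballI)
        show "q' \<in> Lv (insert t X)" unfolding q'_def by (intro LvD(4) xv_Lv b) simp
        fix \<kappa> assume "\<kappa> \<in> ky q'"
        then have "\<kappa> - sg t (- (e * m)) \<in> ky q" unfolding q'_def by (rule keys_xv_mult)
        then have "m \<le> e * lk (\<kappa> - sg t (- (e * m))) t" unfolding m_def by (intro Min_le) auto
        then show "0 \<le> e * lk \<kappa> t" by (simp add: lookup_minus distrib_left ee)
      qed
      obtain q0 q1 where q01: "q0 \<in> Lv (insert t X - {t})" "q1 \<in> NN t e (insert t X)" "q' = q0 + ?p * q1"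
        using NN_split[OF q'N e] by blast
      have X: "insert t X - {t} = X" using tX by auto
      have "q0 \<noteq> 0"
      proof
        assume "q0 = 0"
        have "m \<in> (\<lambda>\<kappa>. e * lk \<kappa> t) ` ky q" unfolding m_def using ne by (intro Min_in) auto
        then obtain \<kappa> where k: "\<kappa> \<in> ky q" "m = e * lk \<kappa> t" by blast
        have "q = xv t (e * m) * q'" unfolding q'_def by (simp add: xv_mult xv_0 flip: mult.assoc)
        also have "\<dots> = xv t (e * m + e) * q1" using q01(3) \<open>q0 = 0\<close> by (simp add: xv_mult flip: mult.assoc)
        finally have "\<kappa> - sg t (e * m + e) \<in> ky q1" using k keys_xv_mult by blast
        then have "0 \<le> e * lk (\<kappa> - sg t (e * m + e)) t" using q01(2) by (auto simp: NN_def)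
        then show False using k(2) e by (auto simp: lookup_minus)
      qed
      obtain k where k: "\<And>k'. k' \<ge> k \<Longrightarrow> ?p ^ k' * (xv t (- (e * m)) * p) \<in> NN t e ?U"
        using xv_shift_NN[of "xv t (- (e * m)) * p" ?U t e] LvD(4)[OF xv_Lv[of t ?U] b(2)] e by blast
      have "emb ?p ^ k * b = emb (?p ^ k * (xv t (- (e * m)) * p)) / emb q'"
        unfolding b(1) q'_def using xv_nz[of t "- (e * m)", where 'a = 'k] by simp
      also have "\<dots> \<in> BB t e X Y" unfolding q01(3) using q01 \<open>q0 \<noteq> 0\<close> k[of k] X by (intro BI) auto
      finally show "\<exists>k. emb ?p ^ k * b \<in> BB t e X Y" by blast
    }
  qed
qed


section \<open>Stable linear groups over Laurent polynomial rings\<close>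

lemma two_places_BB:
  assumes "t \<notin> X" "t \<notin> Y"
  shows "two_places (RR X Y) (BB t 1 X Y) (BB t (-1) X Y) (RR (insert t X) Y :: 'k::field lau fract set) (emb (xv t 1))"
  unfolding two_places_def emb_xv_inverse by (intro conjI place_BB[OF assms]) auto

text \<open>Sorting a numerator by the exponent of \<open>t\<close> exhibits it, after a shift, as a
  polynomial in \<open>t\<close> over the smaller ring; denominators do not contain
  \<open>t\<close>.\<close>

lemma LA_eq_RR:
  assumes "t \<notin> X" "t \<notin> Y"
  shows "two_places.LA (RR X Y) (emb (xv t 1)) = (RR X (insert t Y) :: 'k::field lau fract set)"
proof -
  interpret two_places "RR X Y" "BB t 1 X Y" "BB t (-1) X Y" "RR (insert t X) Y :: 'k lau fract set" "emb (xv t 1)"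
    by (rule two_places_BB[OF assms])
  let ?x = "emb (xv t 1) :: 'k lau fract" and ?R = "RR X (insert t Y) :: 'k lau fract set"
  note RD = subrngD[OF RR_rng]
  have x: "emb (xv t e) \<in> ?R" for e by (rule emb_RR) (simp add: xv_Lv)
  have AR: "RR X Y \<subseteq> ?R" by (rule RR_mono) auto
  show ?thesis
  proof (intro equalityI subsetI)
    fix q assume "q \<in> LA"
    then obtain k where k: "?x ^ k * q \<in> pol (RR X Y) ?x" unfolding LA_def by blast
    have "p \<in> ?R" if "p \<in> pol (RR X Y) ?x" for p
      using that by (induction rule: pol.induct) (use AR x in \<open>auto intro!: RD(6) RD(4)\<close>)
    from RD(4)[OF subrng_power[OF RR_rng x] this[OF k]] have "emb (xv t (-1)) ^ k * (?x ^ k * q) \<in> ?R" .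
    also have "emb (xv t (-1)) ^ k * (?x ^ k * q) = q"
      unfolding emb_xv_inverse[symmetric] using x0 by (simp flip: mult.assoc power_mult_distrib)
    finally show "q \<in> ?R" .
  next
    fix q assume "q \<in> ?R"
    then obtain p r where q: "q = emb p / emb r" "p \<in> Lv (insert t (X \<union> Y))" "r \<in> Lv X" "r \<noteq> 0"
      by (auto simp: RR_def)
    obtain k where k: "xv t 1 ^ k * p \<in> NN t 1 (insert t (X \<union> Y))"
      using xv_shift_NN[OF q(2), of t 1] by auto
    have "emb p / emb r \<in> pol (RR X Y) ?x" if p: "p \<in> NN t 1 (insert t (X \<union> Y))" for p
    proof (rule pm_induct_sum[of "\<lambda>p. emb p / emb r \<in> pol (RR X Y) ?x"])
      show "emb 0 / emb r \<in> pol (RR X Y) ?x" by (simp add: pol.const RD(2))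
      fix f g assume "emb f / emb r \<in> pol (RR X Y) ?x" "emb g / emb r \<in> pol (RR X Y) ?x"
      from subrngD(6)[OF P_rng this] show "emb (f + g) / emb r \<in> pol (RR X Y) ?x"
        by (simp add: add_divide_distrib)
    next
      fix \<kappa> assume "\<kappa> \<in> ky p"
      define n c where "n = nat (lk \<kappa> t)" and "c = lk p \<kappa>"
      have k: "ky \<kappa> \<subseteq> insert t (X \<union> Y)" "int n = lk \<kappa> t"
        using p \<open>\<kappa> \<in> ky p\<close> by (auto simp: NN_def Lv_def n_def)
      define \<mu> where "\<mu> = \<kappa> - sg t (int n)"
      have "sg \<kappa> c = xv t 1 ^ n * sg \<mu> c" by (simp add: xv_power) (simp add: xv_def mult_single \<mu>_def)
      then have eq: "emb (sg \<kappa> c) / emb r = ?x ^ n * (emb (sg \<mu> c) / emb r)" by simp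
      have "ky \<mu> \<subseteq> X \<union> Y"
      proof
        fix i assume i: "i \<in> ky \<mu>"
        then have "i \<noteq> t" using k(2) by (auto simp: \<mu>_def in_keys_iff lookup_minus)
        then show "i \<in> X \<union> Y" using i k(1) by (auto simp: \<mu>_def in_keys_iff lookup_minus lookup_single subset_iff)
      qed
      then have "emb (sg \<mu> c) / emb r \<in> RR X Y" using q by (intro RR_I Lv_single)
      then show "emb (sg \<kappa> (lk p \<kappa>)) / emb r \<in> pol (RR X Y) ?x"
        unfolding c_def[symmetric] eq by (intro pol_power_mult RD(2) pol.const)
    qed
    from this[OF k] have "?x ^ k * q \<in> pol (RR X Y) ?x" by (simp add: q(1))
    then show "q \<in> LA" unfolding LA_def by blast
  qed
qed

text \<open>Induction on the Laurent variables for all \<open>X\<close> at once: \<open>t\<close> is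
  first moved into the field of coefficients, where the hypothesis applies with one variable fewer,
  and \<open>laurent_descent\<close> moves it back. Without Laurent variables the ring is a
  field.\<close>

theorem elm_RR:
  assumes "finite Y" "X \<inter> Y = {}" "\<alpha> \<in> bdd N" "\<alpha> \<in> over (RR X Y)" "\<beta> \<in> over (RR X Y)"
    "\<alpha> * \<beta> = 1" "\<beta> * \<alpha> = 1" "Dt \<alpha> = 1"
  shows "\<alpha> \<in> elm (RR X Y)"
  using assms
proof (induction Y arbitrary: X rule: finite_induct)
  case empty
  show ?case by (rule gauss[OF RR_rng RR_field]) (use empty in auto)
next
  case (insert t Y)
  have t: "t \<notin> X" "t \<notin> Y" using insert by auto
  interpret two_places "RR X Y" "BB t 1 X Y" "BB t (-1) X Y" "RR (insert t X) Y" "emb (xv t 1)"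
    by (rule two_places_BB[OF t])
  have sub: "RR X (insert t Y) \<subseteq> RR (insert t X) Y" by (rule RR_mono) auto
  have "\<alpha> \<in> elm (RR (insert t X) Y)"
    by (rule insert.IH) (use insert.prems insert.hyps sub in \<open>auto simp: over_def\<close>)
  then show ?case using laurent_descent[of \<alpha> \<beta>] insert.prems unfolding LA_eq_RR[OF t] by blast
qed

lemma RR_empty: "RR {} Y = emb ` (Lv Y :: 'k::field lau set)"
proof (intro equalityI subsetI)
  fix x :: "'k lau fract" assume "x \<in> RR {} Y"
  then obtain p q where x: "x = emb p / emb q" "p \<in> Lv Y" "q \<in> Lv {}" "q \<noteq> 0" by (auto simp: RR_def)
  have "ky q \<subseteq> {0}" using x(3) by (auto simp: Lv_def)
  then have q: "q = sg 0 (lk q 0)"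
    by (intro poly_mapping_eqI) (auto simp: lookup_single when_def in_keys_iff subset_iff)
  define c where "c = lk q 0"
  have c: "q = sg 0 c" "c \<noteq> 0" using q x(4) by (auto simp: c_def)
  have "emb q * emb (sg 0 (inverse c)) = 1"
    using c by (simp add: mult_single flip: emb_simps(4))
  then have "x = emb (p * sg 0 (inverse c))" using x(1) by (simp add: divide_inverse inverse_unique)
  moreover have "p * sg 0 (inverse c) \<in> Lv Y" by (intro LvD(4) x Lv_single) simp
  ultimately show "x \<in> emb ` Lv Y" by blast
next
  fix x :: "'k lau fract" assume "x \<in> emb ` Lv Y"
  then show "x \<in> RR {} Y" using emb_RR[of _ "{}" Y] by auto
qed

section \<open>Units of Laurent polynomial rings and the stable K1 statement\<close>

lemma lookup_mult_extremal:
  fixes p q :: "'a::cancel_comm_monoid_add \<Rightarrow>\<^sub>0 'b::semiring_0"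
  assumes "a0 \<in> ky p" "b0 \<in> ky q"
    and uniq: "\<And>a b. a \<in> ky p \<Longrightarrow> b \<in> ky q \<Longrightarrow> a + b = a0 + b0 \<Longrightarrow> a = a0 \<and> b = b0"
  shows "lk (p * q) (a0 + b0) = lk p a0 * lk q b0"
proof -
  have "p * q = (\<Sum>a\<in>ky p. \<Sum>b\<in>ky q. sg (a + b) (lk p a * lk q b))"
  proof -
    have "p * q = (\<Sum>a\<in>ky p. sg a (lk p a)) * (\<Sum>b\<in>ky q. sg b (lk q b))"
      by (simp only: pm_sum_singles[symmetric])
    then show ?thesis by (simp add: sum_product mult_single)
  qed
  then have "lk (p * q) (a0 + b0) = (\<Sum>a\<in>ky p. \<Sum>b\<in>ky q. if a + b = a0 + b0 then lk p a * lk q b else 0)"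
    by (simp add: lookup_sum lookup_single when_def)
  also have "\<dots> = (\<Sum>a\<in>ky p. \<Sum>b\<in>ky q. if a = a0 \<and> b = b0 then lk p a * lk q b else 0)"
    using uniq by (intro sum.cong refl) auto
  also have "\<dots> = (\<Sum>a\<in>ky p. if a = a0 then lk p a * lk q b0 else 0)"
    by (intro sum.cong refl) (use assms(2) in \<open>auto simp: sum.delta\<close>)
  also have "\<dots> = lk p a0 * lk q b0" using assms(1) by (simp add: sum.delta)
  finally show ?thesis .
qed

text \<open>Exponent vectors are linearly ordered compatibly with addition, so the products of the
  leading and of the trailing terms cannot cancel. Both sums of exponents are therefore 0, which
  forces leading and trailing exponent to agree.\<close>

lemma laurent_unit:
  fixes p q :: "'k::field lau"
  assumes "p * q = 1" shows "\<exists>\<kappa> c. c \<noteq> 0 \<and> p = sg \<kappa> c"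
proof -
  have nz: "ky p \<noteq> {}" "ky q \<noteq> {}" using assms by auto
  have k1: "k = 0" if "lk (p * q) k \<noteq> 0" for k using that assms by (auto simp: lookup_one when_def split: if_splits)
  define a b c d where "a = Max (ky p)" and "b = Max (ky q)" and "c = Min (ky p)" and "d = Min (ky q)"
  have in_: "a \<in> ky p" "b \<in> ky q" "c \<in> ky p" "d \<in> ky q" using nz by (auto simp: a_def b_def c_def d_def)
  have le: "x \<le> a" "c \<le> x" if "x \<in> ky p" for x using that by (auto simp: a_def c_def)
  have le': "x \<le> b" "d \<le> x" if "x \<in> ky q" for x using that by (auto simp: b_def d_def)
  have sq: "x = y \<and> x' = y'" if "x \<le> y" "x' \<le> y'" "x + x' = y + y'" for x y x' y' :: "nat \<Rightarrow>\<^sub>0 int"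
    using that by (metis add_le_cancel_left add_le_cancel_right add_left_cancel add_mono order_antisym order_refl order_trans)
  have "lk (p * q) (a + b) = lk p a * lk q b"
    by (rule lookup_mult_extremal[OF in_(1,2)]) (use le le' sq in blast)
  then have ab: "a + b = 0" using in_ by (intro k1) (auto simp: in_keys_iff)
  have "lk (p * q) (c + d) = lk p c * lk q d"
    by (rule lookup_mult_extremal[OF in_(3,4)]) (use le le' sq in metis)
  then have "c + d = 0" using in_ by (intro k1) (auto simp: in_keys_iff)
  then have "c = a" using sq[of c a d b] le[OF in_(1)] le'[OF in_(2)] ab by simp
  then have "x = a" if "x \<in> ky p" for x using le[OF that] by (simp add: antisym)
  then have "ky p = {a}" using in_(1) by blast
  then have "p = sg a (lk p a)" "lk p a \<noteq> 0" using pm_sum_singles[of p] by (auto simp: in_keys_iff[symmetric])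
  then show ?thesis by blast
qed

text \<open>The determinant is a unit, hence a monomial, and dividing by a diagonal matrix with this
  entry leaves determinant 1. The position \<open>p\<close> stays free so that it can later be that
  of the idempotent \<open>e_I\<close> in an enumeration of the basis.\<close>

theorem stable_K1_laurent:
  fixes \<alpha> \<beta> :: "'k::field lau fract cf"
  assumes "finite Y" "\<alpha> \<in> bdd N" "\<beta> \<in> bdd N" "\<alpha> \<in> over (emb ` Lv Y)" "\<beta> \<in> over (emb ` Lv Y)"
    "\<alpha> * \<beta> = 1" "\<beta> * \<alpha> = 1"
  obtains \<kappa> c where "c \<noteq> 0" "ky \<kappa> \<subseteq> Y" "Dt \<alpha> = emb (sg \<kappa> c)"
    "\<And>p. \<exists>\<epsilon>\<in>elm (emb ` Lv Y). \<alpha> = (1 + mun p p (emb (sg \<kappa> c) - 1)) * \<epsilon>"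
proof -
  have R: "subrng (emb ` (Lv Y :: 'k lau set))" using RR_rng[of "{}" Y] by (simp add: RR_empty)
  have "Dt \<alpha> \<in> emb ` Lv Y" "Dt \<beta> \<in> emb ` Lv Y" by (rule Dt_in[OF R assms(4,2)], rule Dt_in[OF R assms(5,3)])
  then obtain u v where u: "Dt \<alpha> = emb u" "u \<in> Lv Y" and v: "Dt \<beta> = emb v" "v \<in> Lv Y" by blast
  have "emb (u * v) = 1" using Dt_mult[OF assms(2,3)] assms(6) by (simp add: u v Dt_one)
  then have uv: "u * v = 1" by (metis emb_eq_iff emb_simps(2))
  then obtain \<kappa> c where k: "c \<noteq> 0" "u = sg \<kappa> c" using laurent_unit by blast
  have "ky \<kappa> \<subseteq> Y" using u(2) k by (auto simp: Lv_def)
  moreover have "\<exists>\<epsilon>\<in>elm (emb ` Lv Y). \<alpha> = (1 + mun p p (emb (sg \<kappa> c) - 1)) * \<epsilon>" for p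
  proof -
    define D D' where "D = 1 + mun p p (emb u - 1)" and "D' = 1 + mun p p (emb v - 1)"
    have uv': "emb u * emb v = 1" using uv by (simp flip: emb_simps(4))
    have "(emb u - 1) * (emb v - 1) = 2 - emb u - emb v" using uv' by (simp add: algebra_simps)
    then have DD: "D * D' = 1" "D' * D = 1"
      unfolding D_def D'_def by (simp_all add: algebra_simps mun_mult_mun mun_add uv')
    have uvR: "emb u - 1 \<in> emb ` Lv Y" "emb v - 1 \<in> emb ` Lv Y"
      using subrngD(3)[OF R _ subrngD(1)[OF R]] u v by auto
    have DR: "D \<in> over (emb ` Lv Y)" "D' \<in> over (emb ` Lv Y)"
      unfolding D_def D'_def using uvR by (auto intro!: over_add over_one over_mun R)
    have Db: "D \<in> bdd (Suc p)" "D' \<in> bdd (Suc p)" unfolding D_def D'_def by (simp_all add: bdd_elem)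
    have "D' * \<alpha> \<in> elm (emb ` Lv Y)"
      unfolding RR_empty[symmetric]
    proof (rule elm_RR[OF assms(1), where \<beta> = "\<beta> * D" and N = "N + Suc p"])
      show "D' * \<alpha> \<in> bdd (N + Suc p)"
        using bdd_mono[OF Db(2), of "N + Suc p"] bdd_mono[OF assms(2), of "N + Suc p"] by (intro bdd_mult) auto
      have "(D' * \<alpha>) * (\<beta> * D) = D' * (\<alpha> * \<beta>) * D" "(\<beta> * D) * (D' * \<alpha>) = \<beta> * (D * D') * \<alpha>"
        by (simp_all add: mult.assoc)
      then show "(D' * \<alpha>) * (\<beta> * D) = 1" "(\<beta> * D) * (D' * \<alpha>) = 1" using DD assms by simp_all
      have "Dt D' = emb v" unfolding D'_def by (rule Dt_diag)
      then show "Dt (D' * \<alpha>) = 1" using Dt_mult[OF Db(2) assms(2)] u uv' by (simp add: mult.commute)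
    qed (use DR assms over_mult[OF R] in \<open>auto simp: RR_empty\<close>)
    moreover have "\<alpha> = D * (D' * \<alpha>)" using DD by (simp flip: mult.assoc)
    ultimately show ?thesis unfolding D_def k(2)[symmetric] by blast
  qed
  ultimately show thesis using that k u by blast
qed


section \<open>The ring structure\<close>

lemma pm_zero_minus [simp]: "0 - a = (0 :: nat \<Rightarrow>\<^sub>0 nat)"
  by (rule poly_mapping_eqI) (simp add: lookup_minus)

lemma bmul_assoc: "bmul (bmul p q) r = bmul p (bmul q r)"
proof (rule prod_eqI)
  show "fst (bmul (bmul p q) r) = fst (bmul p (bmul q r))"
    by (rule poly_mapping_eqI) (simp add: bmul_def lookup_add lookup_minus)
  show "snd (bmul (bmul p q) r) = snd (bmul p (bmul q r))"
    by (rule poly_mapping_eqI) (simp add: bmul_def lookup_add lookup_minus)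
qed

lemma bmul_unit [simp]: "bmul (0, 0) q = q" "bmul q (0, 0) = q"
  by (simp_all add: bmul_def)

lemma smul_superset:
  assumes "finite K" "ky f \<subseteq> K" "finite M" "ky g \<subseteq> M"
  shows "f \<star> g = (\<Sum>p\<in>K. \<Sum>q\<in>M. sg (bmul p q) (lk f p * lk g q))"
proof -
  have "(\<Sum>q\<in>ky g. sg (bmul p q) (lk f p * lk g q)) = (\<Sum>q\<in>M. sg (bmul p q) (lk f p * lk g q))" for p
    by (rule sum.mono_neutral_left) (use assms in \<open>auto simp: in_keys_iff\<close>)
  moreover have "(\<Sum>p\<in>ky f. \<Sum>q\<in>M. sg (bmul p q) (lk f p * lk g q))
      = (\<Sum>p\<in>K. \<Sum>q\<in>M. sg (bmul p q) (lk f p * lk g q))"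
    by (rule sum.mono_neutral_left) (use assms in \<open>auto simp: in_keys_iff\<close>)
  ultimately show ?thesis by (simp add: smul_def)
qed

lemma smul_add_left: "(f + g) \<star> h = f \<star> h + g \<star> h"
proof -
  have K: "finite (ky f \<union> ky g)" "ky (f + g) \<subseteq> ky f \<union> ky g" by (simp_all add: Poly_Mapping.keys_add)
  show ?thesis
    by (simp add: smul_superset[OF K finite_keys order_refl] smul_superset[of "ky f \<union> ky g" _ "ky h" h]
        lookup_add distrib_right single_add sum.distrib)
qed

lemma smul_add_right: "h \<star> (f + g) = h \<star> f + h \<star> g"
proof -
  have K: "finite (ky f \<union> ky g)" "ky (f + g) \<subseteq> ky f \<union> ky g" by (simp_all add: Poly_Mapping.keys_add)
  show ?thesis
    by (simp add: smul_superset[OF finite_keys order_refl K] smul_superset[of "ky h" h "ky f \<union> ky g"]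
        lookup_add distrib_left single_add sum.distrib)
qed

lemma smul_zero [simp]: "0 \<star> f = 0" "f \<star> 0 = 0"
  by (simp_all add: smul_def)

lemma smul_uminus [simp]: "(- f) \<star> g = - (f \<star> g)" "f \<star> (- g) = - (f \<star> g)"
  using smul_add_left[of f "- f" g] smul_add_right[of f g "- g"]
  by (simp_all add: eq_neg_iff_add_eq_0 add.commute)

lemma smul_diff_left: "(f - g) \<star> h = f \<star> h - g \<star> h"
  using smul_add_left[of f "- g" h] by simp

lemma smul_diff_right: "h \<star> (f - g) = h \<star> f - h \<star> g"
  using smul_add_right[of h f "- g"] by simp

lemma smul_sum_left: "sum f S \<star> g = (\<Sum>x\<in>S. f x \<star> g)"
  by (induction S rule: infinite_finite_induct) (auto simp: smul_add_left)

lemma smul_sum_right: "g \<star> sum f S = (\<Sum>x\<in>S. g \<star> f x)"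
  by (induction S rule: infinite_finite_induct) (auto simp: smul_add_right)

lemma smul_single: "sg p a \<star> sg q b = sg (bmul p q) (a * b)"
  by (simp add: smul_superset[of "{p}" _ "{q}"])

lemma smul_assoc: "f \<star> g \<star> h = f \<star> (g \<star> h)"
proof (rule pm_induct_sum[of "\<lambda>f. f \<star> g \<star> h = f \<star> (g \<star> h)"])
  fix k
  show "sg k (lk f k) \<star> g \<star> h = sg k (lk f k) \<star> (g \<star> h)"
  proof (rule pm_induct_sum[of "\<lambda>g. sg k (lk f k) \<star> g \<star> h = sg k (lk f k) \<star> (g \<star> h)"])
    fix l
    show "sg k (lk f k) \<star> sg l (lk g l) \<star> h = sg k (lk f k) \<star> (sg l (lk g l) \<star> h)"
      by (rule pm_induct_sum[of "\<lambda>h. sg k (lk f k) \<star> sg l (lk g l) \<star> h = sg k (lk f k) \<star> (sg l (lk g l) \<star> h)"])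
        (simp_all add: smul_add_right smul_single bmul_assoc mult.assoc)
  qed (simp_all add: smul_add_left smul_add_right)
qed (simp_all add: smul_add_left)

lemma smul_one [simp]: "sone \<star> f = f" "f \<star> sone = f"
proof -
  show "sone \<star> f = f"
    by (rule pm_induct_sum[of "\<lambda>f. sone \<star> f = f"]) (simp_all add: smul_add_right sone_def sc_def smul_single)
  show "f \<star> sone = f"
    by (rule pm_induct_sum[of "\<lambda>f. f \<star> sone = f"]) (simp_all add: smul_add_left sone_def sc_def smul_single)
qed

lemma smul_left_commute: "a \<star> b = b \<star> a \<Longrightarrow> a \<star> (b \<star> c) = b \<star> (a \<star> c)"
  by (simp flip: smul_assoc)

lemma smul_interchange: "b \<star> c = c \<star> b \<Longrightarrow> (a \<star> b) \<star> (c \<star> d) = (a \<star> c) \<star> (b \<star> d)"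
  by (simp add: smul_assoc smul_left_commute[of b c d])

lemmas smul_simps = smul_add_left smul_add_right smul_diff_left smul_diff_right smul_assoc

lemma keys_smul: "ky (f \<star> g) \<subseteq> {bmul p q | p q. p \<in> ky f \<and> q \<in> ky g}"
proof -
  have "ky (f \<star> g) \<subseteq> (\<Union>p\<in>ky f. ky (\<Sum>q\<in>ky g. sg (bmul p q) (lk f p * lk g q)))"
    unfolding smul_def by (rule keys_sum)
  also have "\<dots> \<subseteq> (\<Union>p\<in>ky f. \<Union>q\<in>ky g. ky (sg (bmul p q) (lk f p * lk g q)))"
    using keys_sum by fast
  also have "\<dots> \<subseteq> {bmul p q | p q. p \<in> ky f \<and> q \<in> ky g}" by (auto split: if_splits)
  finally show ?thesis .
qed

section \<open>Subalgebras generated by sets of variables\<close>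

lemma keys_add_nat: "ky (a + b) \<subseteq> ky a \<union> ky b" for a b :: "nat \<Rightarrow>\<^sub>0 nat"
  by (rule Poly_Mapping.keys_add)

lemma keys_minus_nat: "ky (a - b) \<subseteq> ky a" for a b :: "nat \<Rightarrow>\<^sub>0 nat"
  by (auto simp: in_keys_iff lookup_minus)

definition mon_in :: "nat set \<Rightarrow> mon set" where
  "mon_in A = {m. ky (fst m) \<subseteq> A \<and> ky (snd m) \<subseteq> A}"

lemma mon_in_bmul: "p \<in> mon_in A \<Longrightarrow> q \<in> mon_in A \<Longrightarrow> bmul p q \<in> mon_in A"
  using keys_add_nat[of "fst p" "fst q - snd p"] keys_add_nat[of "snd q" "snd p - fst q"]
    keys_minus_nat[of "fst q" "snd p"] keys_minus_nat[of "snd p" "fst q"]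
  unfolding mon_in_def bmul_def mem_Collect_eq fst_conv snd_conv by blast

lemma single_x_alg_gen: "ky a \<subseteq> A \<Longrightarrow> sg (a, 0) 1 \<in> alg_gen A"
proof (rule pm_induct_sum[of "\<lambda>a. sg (a, 0) 1 \<in> alg_gen A"])
  show "sg (0, 0) 1 \<in> alg_gen A" using alg_gen.scal[of 1 A] by (simp add: sc_def)
  fix f g :: "nat \<Rightarrow>\<^sub>0 nat" assume "sg (f, 0) (1::'a) \<in> alg_gen A" "sg (g, 0) (1::'a) \<in> alg_gen A"
  from alg_gen.mul[OF this] show "sg (f + g, 0) (1::'a) \<in> alg_gen A" by (simp add: smul_single bmul_def)
next
  fix k assume k: "ky a \<subseteq> A" "k \<in> ky a"
  have "sg (sg k n, 0) (1::'a) \<in> alg_gen A" for n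
  proof (induction n)
    case 0
    show ?case using alg_gen.scal[of 1 A] by (simp add: sc_def)
  next
    case (Suc n)
    have "Xg k \<in> alg_gen A" using k by (auto intro: alg_gen.genx)
    from alg_gen.mul[OF this Suc] show ?case by (simp add: Xg_def smul_single bmul_def flip: single_add)
  qed
  then show "sg (sg k (lk a k), 0) (1::'a) \<in> alg_gen A" .
qed

lemma single_y_alg_gen: "ky a \<subseteq> A \<Longrightarrow> sg (0, a) 1 \<in> alg_gen A"
proof (rule pm_induct_sum[of "\<lambda>a. sg (0, a) 1 \<in> alg_gen A"])
  show "sg (0, 0) 1 \<in> alg_gen A" using alg_gen.scal[of 1 A] by (simp add: sc_def)
  fix f g :: "nat \<Rightarrow>\<^sub>0 nat" assume "sg (0, f) (1::'a) \<in> alg_gen A" "sg (0, g) (1::'a) \<in> alg_gen A"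
  from alg_gen.mul[OF this] show "sg (0, f + g) (1::'a) \<in> alg_gen A" by (simp add: smul_single bmul_def add.commute)
next
  fix k assume k: "ky a \<subseteq> A" "k \<in> ky a"
  have "sg (0, sg k n) (1::'a) \<in> alg_gen A" for n
  proof (induction n)
    case 0
    show ?case using alg_gen.scal[of 1 A] by (simp add: sc_def)
  next
    case (Suc n)
    have "Yg k \<in> alg_gen A" using k by (auto intro: alg_gen.geny)
    from alg_gen.mul[OF this Suc] show ?case by (simp add: Yg_def smul_single bmul_def add.commute flip: single_add)
  qed
  then show "sg (0, sg k (lk a k)) (1::'a) \<in> alg_gen A" .
qed

lemma single_alg_gen: assumes "m \<in> mon_in A" shows "sg m c \<in> alg_gen A"
proof -
  have "sg m c = sc c \<star> (sg (fst m, 0) 1 \<star> sg (0, snd m) 1)"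
    by (simp add: sc_def smul_single bmul_def)
  then show ?thesis using assms single_x_alg_gen[of "fst m" A] single_y_alg_gen[of "snd m" A]
    by (auto simp: mon_in_def intro!: alg_gen.mul alg_gen.scal)
qed

text \<open>Membership in a generated subalgebra becomes a condition on the variables of each word,
  from which monotonicity and the commutation of disjoint subalgebras are read off.\<close>

lemma alg_gen_iff: "w \<in> alg_gen A \<longleftrightarrow> ky w \<subseteq> mon_in A"
proof
  assume "w \<in> alg_gen A"
  then show "ky w \<subseteq> mon_in A"
  proof (induction rule: alg_gen.induct)
    case (add a b)
    then show ?case using Poly_Mapping.keys_add[of a b] by blast
  next
    case (mul a b)
    then show ?case using keys_smul[of a b] mon_in_bmul by blast
  qed (auto simp: sc_def Xg_def Yg_def mon_in_def split: if_splits)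
next
  assume w: "ky w \<subseteq> mon_in A"
  show "w \<in> alg_gen A"
    by (rule pm_induct_sum[of "\<lambda>w. w \<in> alg_gen A"])
      (use w alg_gen.scal[of 0 A] in \<open>auto simp: sc_def intro: alg_gen.add single_alg_gen\<close>)
qed

lemma alg_gen_mono: "A \<subseteq> B \<Longrightarrow> alg_gen A \<subseteq> alg_gen B"
  unfolding subset_iff[of "alg_gen A"] alg_gen_iff mon_in_def by blast

lemma alg_gen_zero: "0 \<in> alg_gen A" by (simp add: alg_gen_iff)

lemma alg_gen_one: "sone \<in> alg_gen A"
  unfolding sone_def by (rule alg_gen.scal)

lemma alg_gen_uminus: "a \<in> alg_gen A \<Longrightarrow> - a \<in> alg_gen A"
  using alg_gen.mul[OF alg_gen.scal[of "-1" A]] alg_gen_iff by (metis keys_minus)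

lemma alg_gen_diff: "a \<in> alg_gen A \<Longrightarrow> b \<in> alg_gen A \<Longrightarrow> a - b \<in> alg_gen A"
  using alg_gen.add[of a A "- b"] alg_gen_uminus[of b A] by simp

lemma alg_gen_sum: "(\<And>x. x \<in> S \<Longrightarrow> f x \<in> alg_gen A) \<Longrightarrow> sum f S \<in> alg_gen A"
  by (induction S rule: infinite_finite_induct) (auto intro: alg_gen_zero alg_gen.add)

lemma bmul_commute_disjoint:
  assumes "p \<in> mon_in A" "q \<in> mon_in B" "A \<inter> B = {}"
  shows "bmul p q = bmul q p"
proof -
  have z: "lk (fst p) i = 0 \<and> lk (snd p) i = 0 \<or> lk (fst q) i = 0 \<and> lk (snd q) i = 0" for i
    using assms by (auto simp: mon_in_def in_keys_iff subset_iff disjoint_iff)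
  show ?thesis
  proof (rule prod_eqI; rule poly_mapping_eqI)
    fix i
    show "lk (fst (bmul p q)) i = lk (fst (bmul q p)) i"
      using z[of i] by (auto simp: bmul_def lookup_add lookup_minus)
    show "lk (snd (bmul p q)) i = lk (snd (bmul q p)) i"
      using z[of i] by (auto simp: bmul_def lookup_add lookup_minus)
  qed
qed

lemma alg_gen_commute:
  assumes "a \<in> alg_gen A" "b \<in> alg_gen B" "A \<inter> B = {}"
  shows "a \<star> b = b \<star> a"
proof -
  have "a \<star> b = (\<Sum>p\<in>ky a. \<Sum>q\<in>ky b. sg (bmul q p) (lk b q * lk a p))"
    unfolding smul_def
  proof (intro sum.cong refl)
    fix p q assume "p \<in> ky a" "q \<in> ky b"
    then have "bmul p q = bmul q p" using assms by (intro bmul_commute_disjoint[of p A q B]) (auto simp: alg_gen_iff)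
    then show "sg (bmul p q) (lk a p * lk b q) = sg (bmul q p) (lk b q * lk a p)" by (simp add: mult.commute)
  qed
  also have "\<dots> = b \<star> a" unfolding smul_def by (rule sum.swap)
  finally show ?thesis .
qed

lemma spow_X: "spow (Xg i) s = sg (sg i s, 0) 1"
  by (induction s) (simp_all add: spow_def sone_def sc_def Xg_def smul_single bmul_def flip: single_add)

lemma spow_Y: "spow (Yg i) s = sg (0, sg i s) 1"
  by (induction s) (simp_all add: spow_def sone_def sc_def Yg_def smul_single bmul_def add.commute flip: single_add)

lemma Est_eq: "Est s t i = sg (sg i s, sg i t) 1 - sg (sg i (Suc s), sg i (Suc t)) 1"
  by (simp add: Est_def spow_X spow_Y smul_single bmul_def)

lemma Est_alg_gen: "i \<in> A \<Longrightarrow> Est s t i \<in> alg_gen A"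
  unfolding Est_eq by (intro alg_gen_diff single_alg_gen) (auto simp: mon_in_def)

text \<open>The product rule of matrix units. When the inner indices differ, the four words of the
  product coincide in pairs of opposite sign.\<close>

lemma Est_mult: "Est s t i \<star> Est u v i = (if t = u then Est s v i else 0)"
proof -
  have b: "bmul (sg i s, sg i t) (sg i u, sg i v) = (sg i (s + (u - t)), sg i (v + (t - u)))" for s t u v
    by (simp add: bmul_def single_add single_diff)
  consider "t = u" | "t < u" | "t > u" by linarith
  then show ?thesis
  proof cases
    case 2
    then have "Suc (s + (u - Suc t)) = s + (u - t)" "Suc t - u = 0" "t - u = 0" by auto
    then show ?thesis using 2 by (simp add: Est_eq smul_simps smul_single b Suc_diff_le)
  next
    case 3
    then have "Suc (v + (t - Suc u)) = v + (t - u)" "Suc u - t = 0" "u - t = 0" by auto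
    then show ?thesis using 3 by (simp add: Est_eq smul_simps smul_single b Suc_diff_le)
  qed (simp add: Est_eq smul_simps smul_single b)
qed

lemma sprod_list_Nil [simp]: "sprod_list [] = sone"
  and sprod_list_Cons [simp]: "sprod_list (x # xs) = x \<star> sprod_list xs"
  by (simp_all add: sprod_list_def)

lemma sprod_list_alg_gen: "(\<And>x. x \<in> set xs \<Longrightarrow> x \<in> alg_gen A) \<Longrightarrow> sprod_list xs \<in> alg_gen A"
  by (induction xs) (auto intro: alg_gen_one alg_gen.mul)

lemma EI_alg_gen: "finite I \<Longrightarrow> I \<subseteq> A \<Longrightarrow> EI \<alpha> \<beta> I \<in> alg_gen A"
  unfolding EI_def by (rule sprod_list_alg_gen) (auto intro!: Est_alg_gen)

lemma eI_EI: "eI I = EI (\<lambda>_. 0) (\<lambda>_. 0) I"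
  by (simp add: eI_def EI_def ee_def[abs_def])

lemma EI_empty [simp]: "EI \<alpha> \<beta> {} = sone"
  by (simp add: EI_def)

lemma EI_cong: "(\<And>i. i \<in> I \<Longrightarrow> \<alpha> i = \<alpha>' i) \<Longrightarrow> (\<And>i. i \<in> I \<Longrightarrow> \<beta> i = \<beta>' i) \<Longrightarrow> EI \<alpha> \<beta> I = EI \<alpha>' \<beta>' I"
proof (cases "finite I")
  case True
  assume "\<And>i. i \<in> I \<Longrightarrow> \<alpha> i = \<alpha>' i" "\<And>i. i \<in> I \<Longrightarrow> \<beta> i = \<beta>' i"
  then show ?thesis unfolding EI_def using True by (intro arg_cong[where f = sprod_list] map_cong) auto
qed (simp add: EI_def)

text \<open>The sorted order of the product is harmless because factors with different indices
  commute.\<close>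

lemma EI_insert:
  assumes "finite I" "i \<notin> I"
  shows "EI \<alpha> \<beta> (insert i I) = (Est (\<alpha> i) (\<beta> i) i \<star> EI \<alpha> \<beta> I :: 'k::field sn)"
proof -
  let ?f = "\<lambda>i. Est (\<alpha> i) (\<beta> i) i :: 'k sn"
  have "sprod_list (map ?f (insort i xs)) = ?f i \<star> sprod_list (map ?f xs)" if "i \<notin> set xs" for xs
    using that
  proof (induction xs)
    case (Cons x xs)
    have "?f x \<star> ?f i = ?f i \<star> ?f x"
      by (rule alg_gen_commute[of _ "{x}" _ "{i}"]) (use Cons.prems in \<open>auto intro: Est_alg_gen\<close>)
    from smul_left_commute[OF this] show ?case using Cons by auto
  qed simp
  from this[of "sorted_list_of_set I"] show ?thesis using assms by (simp add: EI_def)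
qed

lemma EI_mult:
  assumes "finite I"
  shows "EI \<alpha> \<beta> I \<star> EI \<gamma> \<delta> I = (if \<forall>i\<in>I. \<beta> i = \<gamma> i then EI \<alpha> \<delta> I else 0)"
  using assms
proof (induction I rule: finite_induct)
  case (insert i I)
  have "EI \<alpha> \<beta> I \<star> Est (\<gamma> i) (\<delta> i) i = Est (\<gamma> i) (\<delta> i) i \<star> EI \<alpha> \<beta> I"
    by (rule alg_gen_commute[of _ I _ "{i}"]) (use insert in \<open>auto intro: Est_alg_gen EI_alg_gen\<close>)
  then have "EI \<alpha> \<beta> (insert i I) \<star> EI \<gamma> \<delta> (insert i I)
      = (Est (\<alpha> i) (\<beta> i) i \<star> Est (\<gamma> i) (\<delta> i) i) \<star> (EI \<alpha> \<beta> I \<star> EI \<gamma> \<delta> I)"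
    unfolding EI_insert[OF insert.hyps] by (rule smul_interchange)
  then show ?case using insert by (auto simp: Est_mult EI_insert)
qed simp


section \<open>Representations over Laurent polynomial rings\<close>

text \<open>For a set \<open>I\<close> of variables, \<open>R I\<close> lets \<open>x\<^sub>i, y\<^sub>i\<close> with \<open>i \<in> I\<close> act by shifts on the free module
  with basis \<open>\<nat>\<^sup>I\<close> and maps the remaining \<open>x\<^sub>i, y\<^sub>i\<close> to the Laurent variable \<open>t\<^sub>i\<close> and its inverse.\<close>

definition NI :: "nat set \<Rightarrow> (nat \<Rightarrow> nat) set" where "NI I = PiE I (\<lambda>_. UNIV)"

lemma NI_eqI: "\<alpha> \<in> NI I \<Longrightarrow> \<beta> \<in> NI I \<Longrightarrow> (\<And>i. i \<in> I \<Longrightarrow> \<alpha> i = \<beta> i) \<Longrightarrow> \<alpha> = \<beta>"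
  unfolding NI_def by (rule PiE_ext)

text \<open>\<open>None\<close> plays the role of the zero vector: a word kills a basis vector when
  some \<open>y_i\<close> is applied more often than its exponent allows. The restriction to
  \<open>I\<close> keeps results in \<open>NI I\<close>.\<close>

definition act :: "nat set \<Rightarrow> mon \<Rightarrow> (nat \<Rightarrow> nat) \<Rightarrow> (nat \<Rightarrow> nat) option" where
  "act I m \<beta> = (if \<forall>i\<in>I. lk (snd m) i \<le> \<beta> i
     then Some (\<lambda>i\<in>I. \<beta> i - lk (snd m) i + lk (fst m) i) else None)"

definition dg :: "nat set \<Rightarrow> mon \<Rightarrow> (nat \<Rightarrow>\<^sub>0 int)" where
  "dg I m = (\<Sum>i\<in>(ky (fst m) \<union> ky (snd m)) - I. sg i (int (lk (fst m) i) - int (lk (snd m) i)))"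

lemma lookup_dg: "lk (dg I m) i = (if i \<in> I then 0 else int (lk (fst m) i) - int (lk (snd m) i))"
proof -
  have "lk (dg I m) i = (\<Sum>j\<in>(ky (fst m) \<union> ky (snd m)) - I. if j = i then int (lk (fst m) j) - int (lk (snd m) j) else 0)"
    by (simp add: dg_def lookup_sum lookup_single when_def)
  then show ?thesis by (auto simp: sum.delta in_keys_iff)
qed

lemma dg_bmul: "dg I (bmul m m') = dg I m + dg I m'"
  by (rule poly_mapping_eqI) (auto simp: lookup_dg lookup_add bmul_def lookup_minus)

lemma act_bmul: "act I (bmul m m') \<beta> = Option.bind (act I m' \<beta>) (act I m)"
proof (cases "\<forall>i\<in>I. lk (snd m') i \<le> \<beta> i")
  case True
  let ?g = "\<lambda>i\<in>I. \<beta> i - lk (snd m') i + lk (fst m') i"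
  have 1: "act I m' \<beta> = Some ?g" using True by (simp add: act_def)
  have eq: "(lk (snd (bmul m m')) i \<le> \<beta> i) = (lk (snd m) i \<le> ?g i)" if "i \<in> I" for i
    using True that by (auto simp: bmul_def lookup_add lookup_minus)
  have val: "\<beta> i - lk (snd (bmul m m')) i + lk (fst (bmul m m')) i = ?g i - lk (snd m) i + lk (fst m) i"
    if "i \<in> I" "lk (snd m) i \<le> ?g i" for i
    using True that by (auto simp: bmul_def lookup_add lookup_minus)
  have "act I (bmul m m') \<beta> = act I m ?g"
  proof (cases "\<forall>i\<in>I. lk (snd m) i \<le> ?g i")
    case c: True
    then have "\<forall>i\<in>I. lk (snd (bmul m m')) i \<le> \<beta> i" using eq by blast
    moreover have "(\<lambda>i\<in>I. \<beta> i - lk (snd (bmul m m')) i + lk (fst (bmul m m')) i) = (\<lambda>i\<in>I. ?g i - lk (snd m) i + lk (fst m) i)"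
      by (rule restrict_ext) (use val c in blast)
    ultimately show ?thesis using c unfolding act_def by presburger
  next
    case False
    then have "\<not> (\<forall>i\<in>I. lk (snd (bmul m m')) i \<le> \<beta> i)" using eq by blast
    then show ?thesis using False unfolding act_def by presburger
  qed
  then show ?thesis using 1 by simp
next
  case False
  then obtain i where i: "i \<in> I" "\<beta> i < lk (snd m') i" by (auto simp: not_le)
  then have "\<not> lk (snd (bmul m m')) i \<le> \<beta> i" by (simp add: bmul_def lookup_add)
  then have "act I (bmul m m') \<beta> = None" "act I m' \<beta> = None" using i False by (auto simp: act_def)
  then show ?thesis by simp
qed

lemma act_NI: "act I m \<beta> = Some \<alpha> \<Longrightarrow> \<alpha> \<in> NI I"
  by (auto simp: act_def NI_def split: if_splits)

text \<open>Entries vanish in rows outside \<open>NI I\<close>, whereas columns have a meaning for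
  \<open>\<beta> \<in> NI I\<close>; this is why many statements bound \<beta> and leave \<alpha>
  free.\<close>

definition R :: "nat set \<Rightarrow> 'k::field sn \<Rightarrow> (nat \<Rightarrow> nat) \<Rightarrow> (nat \<Rightarrow> nat) \<Rightarrow> 'k lau" where
  "R I w \<alpha> \<beta> = (\<Sum>m\<in>ky w. if act I m \<beta> = Some \<alpha> then sg (dg I m) (lk w m) else 0)"

lemma R_superset:
  assumes "finite K" "ky w \<subseteq> K"
  shows "R I w \<alpha> \<beta> = (\<Sum>m\<in>K. if act I m \<beta> = Some \<alpha> then sg (dg I m) (lk w m) else 0)"
  unfolding R_def by (rule sum.mono_neutral_left) (use assms in \<open>auto simp: in_keys_iff\<close>)

lemma R_add [simp]: "R I (u + v) \<alpha> \<beta> = R I u \<alpha> \<beta> + R I v \<alpha> \<beta>"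
proof -
  have K: "finite (ky u \<union> ky v)" "ky (u + v) \<subseteq> ky u \<union> ky v" by (simp_all add: Poly_Mapping.keys_add)
  show ?thesis unfolding R_superset[OF K] R_superset[OF K(1) Un_upper1] R_superset[OF K(1) Un_upper2]
    by (simp add: sum.distrib[symmetric] lookup_add single_add cong: if_cong) (intro sum.cong, auto)
qed

lemma R_zero [simp]: "R I 0 \<alpha> \<beta> = 0" by (simp add: R_def)

lemma R_uminus [simp]: "R I (- u) \<alpha> \<beta> = - R I u \<alpha> \<beta>"
  using R_add[of I u "- u" \<alpha> \<beta>] by (simp add: eq_neg_iff_add_eq_0 add.commute)

lemma R_diff [simp]: "R I (u - v) \<alpha> \<beta> = R I u \<alpha> \<beta> - R I v \<alpha> \<beta>"
  using R_add[of I u "- v" \<alpha> \<beta>] by simp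

lemma R_sum [simp]: "R I (sum f S) \<alpha> \<beta> = (\<Sum>x\<in>S. R I (f x) \<alpha> \<beta>)"
  by (induction S rule: infinite_finite_induct) auto

lemma R_single: "R I (sg m c) \<alpha> \<beta> = (if act I m \<beta> = Some \<alpha> then sg (dg I m) c else 0)"
  by (simp add: R_superset[of "{m}"])

lemma R_nonzero:
  assumes "R I w \<alpha> \<beta> \<noteq> 0" obtains m where "m \<in> ky w" "act I m \<beta> = Some \<alpha>"
proof -
  obtain m where "m \<in> ky w" "(if act I m \<beta> = Some \<alpha> then sg (dg I m) (lk w m) else 0) \<noteq> 0"
    using assms unfolding R_def by (rule sum.not_neutral_contains_not_neutral)
  then show thesis using that[of m] by (cases "act I m \<beta> = Some \<alpha>") auto
qed

lemma R_NI: "R I w \<alpha> \<beta> \<noteq> 0 \<Longrightarrow> \<alpha> \<in> NI I"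
  by (meson R_nonzero act_NI)

lemma finite_R_col: "finite {\<gamma>. R I v \<gamma> \<beta> \<noteq> 0}"
proof (rule finite_subset)
  show "{\<gamma>. R I v \<gamma> \<beta> \<noteq> 0} \<subseteq> (\<lambda>m. the (act I m \<beta>)) ` ky v"
  proof clarify
    fix \<gamma> assume "R I v \<gamma> \<beta> \<noteq> 0"
    then obtain m where "m \<in> ky v" "act I m \<beta> = Some \<gamma>" by (rule R_nonzero)
    then show "\<gamma> \<in> (\<lambda>m. the (act I m \<beta>)) ` ky v" by (intro image_eqI[of _ _ m]) auto
  qed
qed simp

lemma R_mult:
  assumes "finite G" "{\<gamma>. R I v \<gamma> \<beta> \<noteq> 0} \<subseteq> G"
  shows "R I (u \<star> v) \<alpha> \<beta> = (\<Sum>\<gamma>\<in>G. R I u \<alpha> \<gamma> * R I v \<gamma> \<beta>)"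
proof -
  define H where "H = G \<union> (\<lambda>m. the (act I m \<beta>)) ` ky v"
  have H: "finite H" "G \<subseteq> H" using assms by (auto simp: H_def)
  let ?u = "\<lambda>m \<gamma>. if act I m \<gamma> = Some \<alpha> then sg (dg I m) (lk u m) else 0"
  let ?v = "\<lambda>m \<gamma>. if act I m \<beta> = Some \<gamma> then sg (dg I m) (lk v m) else 0"
  have key: "R I (sg (bmul m m') (lk u m * lk v m')) \<alpha> \<beta> = (\<Sum>\<gamma>\<in>H. ?u m \<gamma> * ?v m' \<gamma>)" if m': "m' \<in> ky v" for m m'
  proof (cases "act I m' \<beta>")
    case None
    then show ?thesis by (simp add: R_single act_bmul)
  next
    case (Some \<gamma>)
    then have "\<gamma> \<in> (\<lambda>m. the (act I m \<beta>)) ` ky v" using m' by (intro image_eqI[of _ _ m']) auto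
    then have "\<gamma> \<in> H" by (simp add: H_def)
    have "(\<Sum>\<gamma>\<in>H. ?u m \<gamma> * ?v m' \<gamma>) = (\<Sum>\<delta>\<in>{\<gamma>}. ?u m \<delta> * ?v m' \<delta>)"
      by (rule sum.mono_neutral_right) (use Some \<open>\<gamma> \<in> H\<close> H in auto)
    then show ?thesis using Some by (simp add: R_single act_bmul dg_bmul mult_single)
  qed
  have "R I (u \<star> v) \<alpha> \<beta> = (\<Sum>m\<in>ky u. \<Sum>m'\<in>ky v. \<Sum>\<gamma>\<in>H. ?u m \<gamma> * ?v m' \<gamma>)"
    unfolding smul_def R_sum by (intro sum.cong refl key)
  also have "\<dots> = (\<Sum>\<gamma>\<in>H. \<Sum>m\<in>ky u. \<Sum>m'\<in>ky v. ?u m \<gamma> * ?v m' \<gamma>)"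
  proof -
    have "(\<Sum>m\<in>ky u. \<Sum>m'\<in>ky v. \<Sum>\<gamma>\<in>H. ?u m \<gamma> * ?v m' \<gamma>) = (\<Sum>m\<in>ky u. \<Sum>\<gamma>\<in>H. \<Sum>m'\<in>ky v. ?u m \<gamma> * ?v m' \<gamma>)"
      by (rule sum.cong[OF refl]) (rule sum.swap)
    also have "\<dots> = (\<Sum>\<gamma>\<in>H. \<Sum>m\<in>ky u. \<Sum>m'\<in>ky v. ?u m \<gamma> * ?v m' \<gamma>)" by (rule sum.swap)
    finally show ?thesis .
  qed
  also have "\<dots> = (\<Sum>\<gamma>\<in>H. R I u \<alpha> \<gamma> * R I v \<gamma> \<beta>)"
    unfolding R_def by (simp add: sum_product)
  also have "\<dots> = (\<Sum>\<gamma>\<in>G. R I u \<alpha> \<gamma> * R I v \<gamma> \<beta>)"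
    by (rule sum.mono_neutral_right) (use H assms in auto)
  finally show ?thesis .
qed

lemma R_mult_right_zero: "(\<And>\<gamma>. R I v \<gamma> \<beta> = 0) \<Longrightarrow> R I (u \<star> v) \<alpha> \<beta> = 0"
  by (subst R_mult[of "{}"]) auto

lemma R_mult_single_col:
  assumes "\<And>\<gamma>. \<gamma> \<noteq> \<delta> \<Longrightarrow> R I v \<gamma> \<beta> = 0"
  shows "R I (u \<star> v) \<alpha> \<beta> = R I u \<alpha> \<delta> * R I v \<delta> \<beta>"
  by (subst R_mult[of "{\<delta>}"]) (use assms in auto)

lemma act_unit: "\<beta> \<in> NI I \<Longrightarrow> (\<And>i. i \<in> I \<Longrightarrow> lk (fst m) i = 0 \<and> lk (snd m) i = 0) \<Longrightarrow> act I m \<beta> = Some \<beta>"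
  by (auto simp: act_def NI_def restrict_def PiE_def extensional_def fun_eq_iff)

lemma R_one: "\<beta> \<in> NI I \<Longrightarrow> R I sone \<alpha> \<beta> = (if \<alpha> = \<beta> then 1 else 0)"
proof -
  assume "\<beta> \<in> NI I"
  moreover have "dg I (0, 0) = 0" by (rule poly_mapping_eqI) (simp add: lookup_dg)
  ultimately show ?thesis by (auto simp: sone_def sc_def R_single act_unit)
qed

text \<open>For \<open>i\<close> outside \<open>I\<close> the images of \<open>x_i\<close> and
  \<open>y_i\<close> are inverse to each other, so both terms have the same image. Inside
  \<open>I\<close> the two terms cancel on every basis vector with exponent above \<open>t\<close>,
  and both kill those below.\<close>

lemma R_Est:
  assumes "\<beta> \<in> NI I"
  shows "R I (Est s t i) \<alpha> \<beta> = (if i \<in> I \<and> \<beta> i = t \<and> \<alpha> = \<beta>(i := s) then 1 else 0)"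
proof (cases "i \<in> I")
  case False
  have "act I (sg i s, sg i t) \<beta> = Some \<beta>" for s t
    by (rule act_unit[OF assms]) (use False in \<open>auto simp: lookup_single when_def\<close>)
  moreover have "dg I (sg i s, sg i t) = dg I (sg i (Suc s), sg i (Suc t))"
    by (rule poly_mapping_eqI) (auto simp: lookup_dg lookup_single when_def)
  ultimately show ?thesis using False by (simp add: Est_eq R_single)
next
  case True
  have d: "dg I (sg i s, sg i t) = 0" for s t
    by (rule poly_mapping_eqI) (use True in \<open>auto simp: lookup_dg lookup_single when_def\<close>)
  have a: "act I (sg i s, sg i t) \<beta> = (if t \<le> \<beta> i then Some (\<beta>(i := \<beta> i - t + s)) else None)" for s t
  proof (cases "t \<le> \<beta> i")
    case t: True
    have "(\<lambda>j\<in>I. \<beta> j - lk (sg i t) j + lk (sg i s) j) = \<beta>(i := \<beta> i - t + s)"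
      using assms True by (auto simp: fun_eq_iff lookup_single when_def NI_def PiE_def extensional_def)
    moreover have "\<forall>j\<in>I. lk (sg i t) j \<le> \<beta> j" using t by (auto simp: lookup_single when_def)
    ultimately show ?thesis using t by (simp add: act_def)
  next
    case False
    then show ?thesis using True by (auto simp: act_def lookup_single when_def intro!: bexI[of _ i])
  qed
  show ?thesis
  proof (cases "\<beta> i = t")
    case eq: True
    then show ?thesis using True by (auto simp: Est_eq R_single a d)
  next
    case False
    then have "(t \<le> \<beta> i) = (Suc t \<le> \<beta> i)" "Suc t \<le> \<beta> i \<Longrightarrow> \<beta> i - t + s = \<beta> i - Suc t + Suc s" by auto
    then show ?thesis using False by (auto simp: Est_eq R_single a d)
  qed
qed

lemma R_EI_zero:
  assumes "finite I" "\<not> I \<subseteq> J" "\<beta> \<in> NI J" shows "R J (EI a b I :: 'k::field sn) \<alpha> \<beta> = 0"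
proof -
  obtain i where i: "i \<in> I" "i \<notin> J" using assms by blast
  have eq: "EI a b I = (Est (a i) (b i) i \<star> EI a b (I - {i}) :: 'k sn)"
    using EI_insert[of "I - {i}" i a b] i assms(1) by (simp add: insert_absorb)
  show ?thesis unfolding eq
  proof (subst R_mult[OF finite_R_col order_refl], rule sum.neutral, safe)
    fix \<gamma> assume "R J (EI a b (I - {i})) \<gamma> \<beta> \<noteq> 0"
    then have "\<gamma> \<in> NI J" by (rule R_NI)
    then show "R J (Est (a i) (b i) i) \<alpha> \<gamma> * R J (EI a b (I - {i})) \<gamma> \<beta> = 0" using i by (simp add: R_Est)
  qed
qed

lemma R_EI:
  assumes "finite I" "I \<subseteq> J" "\<beta> \<in> NI J"
  shows "R J (EI a b I :: 'k::field sn) \<alpha> \<beta> =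
    (if (\<forall>k\<in>I. \<beta> k = b k) \<and> \<alpha> = (\<lambda>k. if k \<in> I then a k else \<beta> k) then 1 else 0)"
  using assms(1,2)
proof (induction I arbitrary: \<alpha> rule: finite_induct)
  case empty
  then show ?case using assms(3) by (simp add: R_one)
next
  case (insert i I)
  define \<delta> where "\<delta> = (\<lambda>k. if k \<in> I then a k else \<beta> k)"
  have \<delta>: "\<delta> \<in> NI J" using insert.prems assms(3) by (auto simp: NI_def \<delta>_def PiE_def extensional_def)
  have e1: "R J (EI a b (insert i I) :: 'k sn) \<alpha> \<beta> = R J (Est (a i) (b i) i) \<alpha> \<delta> * R J (EI a b I) \<delta> \<beta>"
    unfolding EI_insert[OF insert.hyps]
    by (rule R_mult_single_col) (use insert.IH insert.prems in \<open>simp add: \<delta>_def\<close>)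
  have "\<delta> i = \<beta> i" using insert.hyps by (simp add: \<delta>_def)
  moreover have "i \<in> J" using insert.prems by simp
  ultimately have e2: "R J (Est (a i) (b i) i :: 'k sn) \<alpha> \<delta> = (if \<beta> i = b i \<and> \<alpha> = \<delta>(i := a i) then 1 else 0)"
    by (simp add: R_Est[OF \<delta>])
  have e3: "R J (EI a b I :: 'k sn) \<delta> \<beta> = (if \<forall>k\<in>I. \<beta> k = b k then 1 else 0)"
    using insert.IH[of \<delta>] insert.prems by (simp add: \<delta>_def)
  have e4: "\<delta>(i := a i) = (\<lambda>k. if k \<in> insert i I then a k else \<beta> k)" by (auto simp: \<delta>_def)
  show ?case unfolding e1 e2 e3 e4 by simp
qed

text \<open>Positive part of an exponent vector; applied to \<kappa> and to
  \<open>- \<kappa>\<close> it yields the exponents of the \<open>x_i\<close> and of the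
  \<open>y_i\<close>.\<close>

definition pp :: "(nat \<Rightarrow>\<^sub>0 int) \<Rightarrow> (nat \<Rightarrow>\<^sub>0 nat)" where
  "pp \<kappa> = (\<Sum>i\<in>ky \<kappa>. sg i (nat (lk \<kappa> i)))"

lemma lookup_pp: "lk (pp \<kappa>) i = nat (lk \<kappa> i)"
proof -
  have "lk (pp \<kappa>) i = (\<Sum>j\<in>ky \<kappa>. if j = i then nat (lk \<kappa> j) else 0)"
    by (simp add: pp_def lookup_sum lookup_single when_def)
  then show ?thesis by (auto simp: sum.delta in_keys_iff)
qed

text \<open>A linear section of the map from the subalgebra to Laurent polynomials:
  \<open>t\<^sub>i\<^sup>k\<close> is lifted to \<open>x\<^sub>i\<^sup>k\<close> or \<open>y\<^sub>i\<^sup>-\<^sup>k\<close>.\<close>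

definition lift :: "'k::field lau \<Rightarrow> 'k sn" where
  "lift l = (\<Sum>\<kappa>\<in>ky l. sg (pp \<kappa>, pp (- \<kappa>)) (lk l \<kappa>))"

lemma lift_superset:
  assumes "finite K" "ky l \<subseteq> K" shows "lift l = (\<Sum>\<kappa>\<in>K. sg (pp \<kappa>, pp (- \<kappa>)) (lk l \<kappa>))"
  unfolding lift_def by (rule sum.mono_neutral_left) (use assms in \<open>auto simp: in_keys_iff\<close>)

lemma lift_add: "lift (l + m) = lift l + lift m"
proof -
  have K: "finite (ky l \<union> ky m)" "ky (l + m) \<subseteq> ky l \<union> ky m" by (simp_all add: Poly_Mapping.keys_add)
  show ?thesis unfolding lift_superset[OF K] lift_superset[OF K(1) Un_upper1] lift_superset[OF K(1) Un_upper2]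
    by (simp add: sum.distrib[symmetric] lookup_add single_add)
qed

lemma lift_zero [simp]: "lift 0 = 0" by (simp add: lift_def)

lemma lift_single: "lift (sg \<kappa> c) = sg (pp \<kappa>, pp (- \<kappa>)) c"
  by (simp add: lift_superset[of "{\<kappa>}"])

lemma lift_one [simp]: "lift 1 = sone"
proof -
  have "pp 0 = 0" by (rule poly_mapping_eqI) (simp add: lookup_pp)
  then show ?thesis using lift_single[of 0 1] by (simp add: sone_def sc_def)
qed

lemma pp_mon_in: "ky \<kappa> \<subseteq> A \<Longrightarrow> (pp \<kappa>, pp (- \<kappa>)) \<in> mon_in A"
proof -
  assume *: "ky \<kappa> \<subseteq> A"
  have "i \<in> A" if "nat (lk \<kappa> i) \<noteq> 0 \<or> nat (- lk \<kappa> i) \<noteq> 0" for i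
  proof -
    have "lk \<kappa> i \<noteq> 0" using that by auto
    then show ?thesis using * by (auto simp flip: in_keys_iff)
  qed
  then show ?thesis by (auto simp: mon_in_def in_keys_iff lookup_pp)
qed

lemma lift_alg_gen: "l \<in> Lv A \<Longrightarrow> lift l \<in> alg_gen A"
  unfolding lift_def by (intro alg_gen_sum single_alg_gen pp_mon_in) (auto simp: Lv_def)

lemma R_lift:
  assumes "\<beta> \<in> NI I" "l \<in> Lv A" "A \<inter> I = {}"
  shows "R I (lift l) \<alpha> \<beta> = (if \<alpha> = \<beta> then l else 0)"
proof -
  have z: "lk \<kappa> i = 0" if "\<kappa> \<in> ky l" "i \<in> I" for \<kappa> i
  proof -
    have "i \<notin> ky \<kappa>" using assms(2,3) that by (auto simp: Lv_def)
    then show ?thesis by (simp add: in_keys_iff)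
  qed
  have "act I (pp \<kappa>, pp (- \<kappa>)) \<beta> = Some \<beta>" if "\<kappa> \<in> ky l" for \<kappa>
    by (rule act_unit[OF assms(1)]) (use z that in \<open>auto simp: lookup_pp\<close>)
  moreover have "dg I (pp \<kappa>, pp (- \<kappa>)) = \<kappa>" if "\<kappa> \<in> ky l" for \<kappa>
    by (rule poly_mapping_eqI) (use z that in \<open>auto simp: lookup_dg lookup_pp\<close>)
  ultimately have "R I (lift l) \<alpha> \<beta> = (\<Sum>\<kappa>\<in>ky l. if \<alpha> = \<beta> then sg \<kappa> (lk l \<kappa>) else 0)"
    unfolding lift_def R_sum R_single by (intro sum.cong refl) auto
  then show ?thesis by (simp flip: pm_sum_singles)
qed

lemma R_Lv: "w \<in> alg_gen A \<Longrightarrow> R I w \<alpha> \<beta> \<in> Lv (A - I)"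
  unfolding R_def
proof (rule subrng_sum[OF Lv_rng])
  fix m assume w: "w \<in> alg_gen A" and "m \<in> ky w"
  then have "m \<in> mon_in A" by (auto simp: alg_gen_iff)
  have "ky (dg I m) \<subseteq> A - I"
  proof
    fix i assume "i \<in> ky (dg I m)"
    then have "lk (dg I m) i \<noteq> 0" by (simp add: in_keys_iff)
    then have "i \<notin> I" "i \<in> ky (fst m) \<or> i \<in> ky (snd m)" by (auto simp: lookup_dg in_keys_iff split: if_splits)
    then show "i \<in> A - I" using \<open>m \<in> mon_in A\<close> by (auto simp: mon_in_def)
  qed
  then show "(if act I m \<beta> = Some \<alpha> then sg (dg I m) (lk w m) else 0) \<in> Lv (A - I)"
    by (auto intro: Lv_single LvD(2))
qed


section \<open>A graded basis\<close>

text \<open>The graded piece of \<open>I\<close>: Laurent polynomials in the other variables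
  tensored with matrix units on \<open>I\<close>. The grading is one of vector spaces, since
  \<open>lift\<close> is linear but not multiplicative.\<close>

inductive_set gsp :: "nat \<Rightarrow> nat set \<Rightarrow> 'k::field sn set" for n I where
  zero: "0 \<in> gsp n I"
| step: "w \<in> gsp n I \<Longrightarrow> l \<in> Lv ({1..n} - I) \<Longrightarrow> lift l \<star> EI a b I + w \<in> gsp n I"

lemma gsp_gen: "l \<in> Lv ({1..n} - I) \<Longrightarrow> lift l \<star> EI a b I \<in> gsp n I"
  using gsp.step[OF gsp.zero, of l n I a b] by simp

lemma gsp_add: "v \<in> gsp n I \<Longrightarrow> w \<in> gsp n I \<Longrightarrow> v + w \<in> gsp n I"
  by (induction rule: gsp.induct) (auto simp: add.assoc intro: gsp.step)

lemma R_gsp_zero: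
  assumes "v \<in> gsp n I" "finite I" "\<not> I \<subseteq> J" "\<beta> \<in> NI J" shows "R J v \<alpha> \<beta> = 0"
  using assms(1)
  by (induction rule: gsp.induct) (auto intro!: R_mult_right_zero R_EI_zero assms)

lemma R_gen:
  assumes "finite I" "l \<in> Lv A" "A \<inter> I = {}" "\<beta> \<in> NI I"
  shows "R I (lift l \<star> EI a b I) \<alpha> \<beta> = (if \<alpha> = restrict a I \<and> \<beta> = restrict b I then l else 0)"
proof -
  define \<delta> where "\<delta> = restrict a I"
  have \<delta>: "\<delta> \<in> NI I" by (simp add: \<delta>_def NI_def)
  have eq: "R I (EI a b I :: 'a sn) \<gamma> \<beta> = (if \<beta> = restrict b I \<and> \<gamma> = \<delta> then 1 else 0)" for \<gamma>
  proof -
    have "(\<forall>k\<in>I. \<beta> k = b k) = (\<beta> = restrict b I)" using assms(4)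
      by (auto simp: NI_def PiE_def extensional_def fun_eq_iff restrict_def)
    moreover have "(\<lambda>k. if k \<in> I then a k else \<beta> k) = \<delta>" using assms(4)
      by (auto simp: NI_def PiE_def extensional_def fun_eq_iff restrict_def \<delta>_def)
    ultimately show ?thesis using R_EI[OF assms(1) order_refl assms(4), of a b \<gamma>] by simp
  qed
  have "R I (lift l \<star> EI a b I) \<alpha> \<beta> = R I (lift l) \<alpha> \<delta> * R I (EI a b I) \<delta> \<beta>"
    by (rule R_mult_single_col) (simp add: eq)
  then show ?thesis using R_lift[OF \<delta> assms(2,3)] by (auto simp: eq \<delta>_def)
qed

text \<open>The coefficients are read off by the representation at \<open>I\<close> itself. A
  threshold set \<open>F\<close> with arbitrary larger \<open>G\<close> allows expansions to be
  added over a common range.\<close>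

lemma gsp_normal_form:
  assumes "v \<in> gsp n I" "finite I"
  shows "\<exists>F. finite F \<and> F \<subseteq> NI I \<times> NI I \<and> (\<forall>G. finite G \<and> F \<subseteq> G \<and> G \<subseteq> NI I \<times> NI I \<longrightarrow>
    v = (\<Sum>(\<alpha>, \<beta>)\<in>G. lift (R I v \<alpha> \<beta>) \<star> EI \<alpha> \<beta> I))"
  using assms(1)
proof (induction rule: gsp.induct)
  case zero
  show ?case by (intro exI[of _ "{}"]) (auto intro!: sum.neutral[symmetric])
next
  case (step w l a b)
  from step.IH obtain F where F: "finite F" "F \<subseteq> NI I \<times> NI I"
    "\<forall>G. finite G \<and> F \<subseteq> G \<and> G \<subseteq> NI I \<times> NI I \<longrightarrow> w = (\<Sum>(\<alpha>, \<beta>)\<in>G. lift (R I w \<alpha> \<beta>) \<star> EI \<alpha> \<beta> I)"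
    by (elim exE conjE) (rule that)
  define p where "p = (restrict a I, restrict b I)"
  have p: "p \<in> NI I \<times> NI I" by (simp add: p_def NI_def)
  have "lift l \<star> EI a b I + w = (\<Sum>(\<alpha>, \<beta>)\<in>G. lift (R I (lift l \<star> EI a b I + w) \<alpha> \<beta>) \<star> EI \<alpha> \<beta> I)"
    if G: "finite G" "insert p F \<subseteq> G" "G \<subseteq> NI I \<times> NI I" for G
  proof -
    let ?g = "lift l \<star> EI a b I"
    have g: "R I ?g \<alpha> \<beta> = (if (\<alpha>, \<beta>) = p then l else 0)" if "(\<alpha>, \<beta>) \<in> G" for \<alpha> \<beta>
    proof -
      have \<beta>: "\<beta> \<in> NI I" using that G(3) by blast
      have dis: "({1..n} - I) \<inter> I = {}" by blast
      show ?thesis using R_gen[OF assms(2) step(2) dis \<beta>, of a b \<alpha>] by (simp only: p_def prod.inject)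
    qed
    have "(\<Sum>(\<alpha>, \<beta>)\<in>G. lift (R I ?g \<alpha> \<beta>) \<star> EI \<alpha> \<beta> I) = (\<Sum>q\<in>G. if q = p then lift l \<star> EI (fst p) (snd p) I else 0)"
      by (rule sum.cong[OF refl]) (use g in auto)
    also have "\<dots> = lift l \<star> EI (fst p) (snd p) I" using G by (simp add: sum.delta)
    also have "EI (fst p) (snd p) I = (EI a b I :: 'a sn)" by (rule EI_cong) (simp_all add: p_def)
    finally have 1: "(\<Sum>(\<alpha>, \<beta>)\<in>G. lift (R I ?g \<alpha> \<beta>) \<star> EI \<alpha> \<beta> I) = ?g" .
    have 2: "w = (\<Sum>(\<alpha>, \<beta>)\<in>G. lift (R I w \<alpha> \<beta>) \<star> EI \<alpha> \<beta> I)" by (rule F(3)[rule_format]) (use G in auto)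
    have "(\<Sum>(\<alpha>, \<beta>)\<in>G. lift (R I (?g + w) \<alpha> \<beta>) \<star> EI \<alpha> \<beta> I)
        = (\<Sum>(\<alpha>, \<beta>)\<in>G. lift (R I ?g \<alpha> \<beta>) \<star> EI \<alpha> \<beta> I) + (\<Sum>(\<alpha>, \<beta>)\<in>G. lift (R I w \<alpha> \<beta>) \<star> EI \<alpha> \<beta> I)"
      by (simp add: lift_add smul_add_left case_prod_unfold sum.distrib)
    then show ?thesis unfolding 1 2[symmetric] by simp
  qed
  then show ?case using F(1,2) p by (intro exI[of _ "insert p F"]) auto
qed

lemma gsp_eq_0:
  assumes "v \<in> gsp n I" "finite I" "\<And>\<alpha> \<beta>. \<beta> \<in> NI I \<Longrightarrow> R I v \<alpha> \<beta> = 0" shows "v = 0"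
proof -
  from gsp_normal_form[OF assms(1,2)] obtain F where F: "finite F" "F \<subseteq> NI I \<times> NI I"
    "\<forall>G. finite G \<and> F \<subseteq> G \<and> G \<subseteq> NI I \<times> NI I \<longrightarrow> v = (\<Sum>(\<alpha>, \<beta>)\<in>G. lift (R I v \<alpha> \<beta>) \<star> EI \<alpha> \<beta> I)"
    by (elim exE conjE) (rule that)
  have v: "v = (\<Sum>(\<alpha>, \<beta>)\<in>F. lift (R I v \<alpha> \<beta>) \<star> EI \<alpha> \<beta> I)"
    by (rule F(3)[rule_format]) (use F(1,2) in simp)
  have "(\<Sum>(\<alpha>, \<beta>)\<in>F. lift (R I v \<alpha> \<beta>) \<star> EI \<alpha> \<beta> I) = 0"
    by (rule sum.neutral) (use F(2) assms(3) in auto)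
  then show ?thesis using v by simp
qed

definition graded :: "nat \<Rightarrow> 'k::field sn set" where
  "graded n = {\<Sum>I\<in>Pow {1..n}. v I | v. \<forall>I. I \<subseteq> {1..n} \<longrightarrow> v I \<in> gsp n I}"

lemma graded_add: "v \<in> graded n \<Longrightarrow> w \<in> graded n \<Longrightarrow> v + w \<in> graded n"
proof -
  assume "v \<in> graded n" "w \<in> graded n"
  then obtain f g where "v = (\<Sum>I\<in>Pow {1..n}. f I)" "w = (\<Sum>I\<in>Pow {1..n}. g I)"
    "\<forall>I. I \<subseteq> {1..n} \<longrightarrow> f I \<in> gsp n I" "\<forall>I. I \<subseteq> {1..n} \<longrightarrow> g I \<in> gsp n I" by (auto simp: graded_def)
  then show ?thesis unfolding graded_def
    by (intro CollectI exI[of _ "\<lambda>I. f I + g I"]) (auto simp: sum.distrib intro: gsp_add)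
qed

lemma gsp_graded: "w \<in> gsp n I \<Longrightarrow> I \<subseteq> {1..n} \<Longrightarrow> w \<in> graded n"
  unfolding graded_def
  by (intro CollectI exI[of _ "\<lambda>J. if J = I then w else 0"]) (auto simp: sum.delta intro: gsp.zero)

lemma graded_zero: "0 \<in> graded n"
  by (rule gsp_graded[where I = "{}"]) (auto intro: gsp.zero)

lemma graded_sum: "(\<And>x. x \<in> S \<Longrightarrow> f x \<in> graded n) \<Longrightarrow> sum f S \<in> graded n"
  by (induction S rule: infinite_finite_induct) (auto intro: graded_zero graded_add)

lemma gsp_uminus: "w \<in> gsp n I \<Longrightarrow> - w \<in> gsp n I"
proof (induction rule: gsp.induct)
  case (step w l a b)
  have "lift (- l) + lift l = 0" by (simp flip: lift_add)
  then have "lift (- l) = - lift l" by (simp add: eq_neg_iff_add_eq_0)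
  then have "- (lift l \<star> EI a b I + w) = lift (- l) \<star> EI a b I + - w" by simp
  then show ?case using gsp.step[OF step(3), of "- l" a b] step(2) LvD(5) by metis
qed (simp add: gsp.zero)

lemma graded_uminus: "w \<in> graded n \<Longrightarrow> - w \<in> graded n"
  unfolding graded_def
proof clarify
  fix v assume "\<forall>I. I \<subseteq> {1..n} \<longrightarrow> v I \<in> gsp n I"
  then show "\<exists>va. - sum v (Pow {1..n}) = sum va (Pow {1..n}) \<and> (\<forall>I. I \<subseteq> {1..n} \<longrightarrow> va I \<in> gsp n I)"
    by (intro exI[of _ "\<lambda>I. - v I"]) (auto simp: sum_negf intro: gsp_uminus)
qed

lemma lift_mult_var:
  assumes "l \<in> Lv A" "N \<notin> A"
  shows "lift l \<star> lift (sg (sg N k) 1) = lift (l * sg (sg N k) 1)"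
proof (rule pm_induct_sum[of "\<lambda>l. lift l \<star> lift (sg (sg N k) 1) = lift (l * sg (sg N k) 1)"])
  fix \<kappa> assume "\<kappa> \<in> ky l"
  then have "N \<notin> ky \<kappa>" using assms by (auto simp: Lv_def)
  then have z: "lk \<kappa> N = 0" by (simp add: in_keys_iff)
  have "bmul (pp \<kappa>, pp (- \<kappa>)) (pp (sg N k), pp (- sg N k)) = (pp (\<kappa> + sg N k), pp (- (\<kappa> + sg N k)))"
    by (rule prod_eqI; rule poly_mapping_eqI)
      (use z in \<open>auto simp: bmul_def lookup_add lookup_minus lookup_pp lookup_single when_def\<close>)
  then show "lift (sg \<kappa> (lk l \<kappa>)) \<star> lift (sg (sg N k) 1) = lift (sg \<kappa> (lk l \<kappa>) * sg (sg N k) 1)"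
    by (simp add: lift_single smul_single mult_single)
qed (simp_all add: lift_add smul_add_left distrib_right)

lemma graded_mult_var:
  assumes "w \<in> gsp n I" "I \<subseteq> {1..n}"
  shows "w \<star> sg (sg (Suc n) p, sg (Suc n) q) 1 \<in> graded (Suc n)"
  using assms(1)
proof (induction rule: gsp.induct)
  case zero
  show ?case by (simp add: graded_zero)
next
  case (step w l a b)
  let ?N = "Suc n"
  define r k where "r = min p q" and "k = int p - int q"
  have fI: "finite I" "?N \<notin> I" using assms(2) finite_subset by auto
  have lA: "l \<in> Lv ({1..?N} - insert ?N I)"
    using step(2) Lv_mono[of "{1..n} - I" "{1..?N} - insert ?N I"] fI by force
  \<comment> \<open>Telescoping: removing the common power of \<open>x\<close> and \<open>y\<close>
    from a word in one variable costs a sum of matrix units, which separates the Laurent part from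
    the matrix part.\<close>
  have mon: "sg (sg ?N p, sg ?N q) 1 = lift (sg (sg ?N k) 1) - (\<Sum>i<r. Est (p - r + i) (q - r + i) ?N :: 'a sn)"
  proof -
    let ?h = "\<lambda>i. sg (sg ?N (p - r + i), sg ?N (q - r + i)) 1 :: 'a sn"
    have "(\<Sum>i<r. Est (p - r + i) (q - r + i) ?N) = (\<Sum>i<r. ?h i - ?h (Suc i))" by (simp add: Est_eq)
    also have "\<dots> = ?h 0 - ?h r" by (rule sum_lessThan_telescope')
    also have "?h r = sg (sg ?N p, sg ?N q) 1" by (simp add: r_def)
    also have "?h 0 = lift (sg (sg ?N k) 1)"
    proof -
      have "pp (sg ?N j) = sg ?N (nat j)" for j
        by (rule poly_mapping_eqI) (simp add: lookup_pp lookup_single when_def)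
      moreover have "nat k = p - r" "nat (- k) = q - r" unfolding k_def r_def min_def by (cases "p \<le> q"; simp)+
      ultimately show ?thesis by (simp add: lift_single flip: single_uminus)
    qed
    finally show ?thesis by simp
  qed
  have A1: "lift l \<star> EI a b I \<star> lift (sg (sg ?N k) 1) \<in> graded ?N"
  proof -
    have "lift (sg (sg ?N k) (1::'a)) \<in> alg_gen {?N}" by (rule lift_alg_gen) (simp add: Lv_single)
    from alg_gen_commute[OF this EI_alg_gen[OF fI(1) order_refl, of a b]]
    have comm: "lift (sg (sg ?N k) (1::'a)) \<star> EI a b I = EI a b I \<star> lift (sg (sg ?N k) 1)" using fI by simp
    have "lift l \<star> EI a b I \<star> lift (sg (sg ?N k) 1) = (lift l \<star> lift (sg (sg ?N k) 1)) \<star> EI a b I"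
      by (simp only: smul_assoc comm)
    also have "lift l \<star> lift (sg (sg ?N k) 1) = lift (l * sg (sg ?N k) 1)"
      by (rule lift_mult_var[OF step(2)]) simp
    finally have "lift l \<star> EI a b I \<star> lift (sg (sg ?N k) 1) = lift (l * sg (sg ?N k) 1) \<star> EI a b I" .
    moreover have "l * sg (sg ?N k) 1 \<in> Lv ({1..?N} - I)"
      using lA Lv_mono[of "{1..?N} - insert ?N I" "{1..?N} - I"] fI by (intro LvD(4) Lv_single) auto
    ultimately show ?thesis using gsp_graded[OF gsp_gen, of "l * sg (sg ?N k) 1" ?N I] assms(2) by force
  qed
  have A2: "lift l \<star> EI a b I \<star> Est u v ?N \<in> graded ?N" for u v
  proof -
    have "EI (a(?N := u)) (b(?N := v)) (insert ?N I) = (Est u v ?N \<star> EI (a(?N := u)) (b(?N := v)) I :: 'a sn)"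
      by (simp add: EI_insert[OF fI])
    also have "EI (a(?N := u)) (b(?N := v)) I = (EI a b I :: 'a sn)" by (rule EI_cong) (use fI in auto)
    also have "Est u v ?N \<star> EI a b I = (EI a b I \<star> Est u v ?N :: 'a sn)"
      by (rule alg_gen_commute[OF Est_alg_gen[of ?N "{?N}"] EI_alg_gen[OF fI(1) order_refl]]) (use fI in auto)
    finally have "lift l \<star> EI a b I \<star> Est u v ?N = lift l \<star> EI (a(?N := u)) (b(?N := v)) (insert ?N I)"
      by (simp only: smul_assoc)
    also have "\<dots> \<in> graded ?N" using assms(2) by (intro gsp_graded[OF gsp_gen[OF lA]]) auto
    finally show ?thesis .
  qed
  have "lift l \<star> EI a b I \<star> sg (sg ?N p, sg ?N q) 1 = lift l \<star> EI a b I \<star> lift (sg (sg ?N k) 1)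
      + - (\<Sum>i<r. lift l \<star> EI a b I \<star> Est (p - r + i) (q - r + i) ?N)"
    unfolding mon smul_diff_right smul_sum_right by simp
  also have "\<dots> \<in> graded ?N" by (intro graded_add A1 graded_uminus graded_sum A2)
  finally show ?case unfolding smul_add_left by (rule graded_add) (rule step.IH)
qed

lemma Sn_graded: "w \<in> Sn n \<Longrightarrow> w \<in> graded n"
proof -
  have mon: "sg m c \<in> graded n" if "m \<in> mon_in {1..n}" for m and c :: 'a
    using that
  proof (induction n arbitrary: m)
    case 0
    then have "m = (0, 0)" by (auto simp: mon_in_def prod_eq_iff)
    then have "sg m c = lift (sg 0 c) \<star> EI (\<lambda>_. 0) (\<lambda>_. 0) {}"
      using lift_single[of 0 c] pp_mon_in[of 0 "{}"] by (auto simp: mon_in_def)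
    then show ?case using gsp_graded[OF gsp_gen[of "sg 0 c" 0 "{}"]] Lv_single[of 0 "{}" c] by simp
  next
    case (Suc n)
    let ?N = "Suc n"
    define p q where "p = lk (fst m) ?N" and "q = lk (snd m) ?N"
    define m' where "m' = (fst m - sg ?N p, snd m - sg ?N q)"
    have m': "m' \<in> mon_in {1..n}"
    proof -
      have "ky (fst m) \<subseteq> {1..?N}" "ky (snd m) \<subseteq> {1..?N}" using Suc.prems by (auto simp: mon_in_def)
      then have "i \<in> {1..n}" if "i \<in> ky (fst m') \<or> i \<in> ky (snd m')" for i
      proof -
        have "i \<noteq> ?N" using that by (auto simp: m'_def in_keys_iff lookup_minus p_def q_def)
        moreover have "i \<in> ky (fst m) \<or> i \<in> ky (snd m)" using that by (auto simp: m'_def in_keys_iff lookup_minus)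
        ultimately show ?thesis using \<open>ky (fst m) \<subseteq> _\<close> \<open>ky (snd m) \<subseteq> _\<close> by force
      qed
      then show ?thesis unfolding mon_in_def by blast
    qed
    have "bmul m' (sg ?N p, sg ?N q) = m"
      by (rule prod_eqI; rule poly_mapping_eqI)
        (auto simp: bmul_def m'_def lookup_add lookup_minus lookup_single when_def p_def q_def)
    then have eq: "sg m c = sg m' c \<star> sg (sg ?N p, sg ?N q) 1" by (simp add: smul_single)
    obtain v where v: "sg m' c = (\<Sum>I\<in>Pow {1..n}. v I)" "\<forall>I. I \<subseteq> {1..n} \<longrightarrow> v I \<in> gsp n I"
      using Suc.IH[OF m'] by (auto simp: graded_def)
    show ?case unfolding eq v(1) smul_sum_left using v(2) by (intro graded_sum graded_mult_var) auto
  qed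
  assume "w \<in> Sn n"
  then have "ky w \<subseteq> mon_in {1..n}" by (simp add: Sn_def alg_gen_iff)
  then show ?thesis by (subst pm_sum_singles) (intro graded_sum mon, auto)
qed

section \<open>Ideals attached to up-closed families\<close>

text \<open>An ideal is recorded by the index sets whose representations may see it. Inclusions and
  intersections of ideals then become statements about families of sets.\<close>

definition idl :: "nat \<Rightarrow> nat set set \<Rightarrow> 'k::field sn set" where
  "idl n JJ = {w \<in> Sn n. \<forall>I. I \<subseteq> {1..n} \<longrightarrow> I \<notin> JJ \<longrightarrow> (\<forall>\<alpha>. \<forall>\<beta>\<in>NI I. R I w \<alpha> \<beta> = 0)}"

text \<open>By induction on the size of \<open>I\<close>: pieces not below \<open>I\<close> are
  invisible at \<open>I\<close>, and those strictly below vanish already, as their index sets are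
  outside the up-closed family too. So the representation at \<open>I\<close> sees the piece of
  \<open>I\<close> alone, on which it is faithful.\<close>

lemma idl_decomp:
  assumes "w \<in> idl n JJ" and up: "\<And>I I'. I \<in> JJ \<Longrightarrow> I \<subseteq> I' \<Longrightarrow> I' \<subseteq> {1..n} \<Longrightarrow> I' \<in> JJ"
  obtains v where "\<And>I. I \<subseteq> {1..n} \<Longrightarrow> v I \<in> gsp n I" "\<And>I. I \<subseteq> {1..n} \<Longrightarrow> I \<notin> JJ \<Longrightarrow> v I = 0"
    "w = (\<Sum>I\<in>Pow {1..n}. v I)"
proof -
  have "w \<in> graded n" using assms(1) Sn_graded by (auto simp: idl_def)
  then obtain v where v: "w = (\<Sum>I\<in>Pow {1..n}. v I)" "\<And>I. I \<subseteq> {1..n} \<Longrightarrow> v I \<in> gsp n I"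
    by (auto simp: graded_def)
  have "v I = 0" if "I \<subseteq> {1..n}" "I \<notin> JJ" for I
    using that
  proof (induction "card I" arbitrary: I rule: less_induct)
    case less
    have fI: "finite I" using less.prems finite_subset by auto
    have "R I (v I) \<alpha> \<beta> = 0" if \<beta>: "\<beta> \<in> NI I" for \<alpha> \<beta>
    proof -
      have "R I w \<alpha> \<beta> = (\<Sum>I'\<in>Pow {1..n}. R I (v I') \<alpha> \<beta>)" by (simp add: v(1))
      also have "\<dots> = (\<Sum>I'\<in>{I}. R I (v I') \<alpha> \<beta>)"
      proof (rule sum.mono_neutral_right)
        show "\<forall>I'\<in>Pow {1..n} - {I}. R I (v I') \<alpha> \<beta> = 0"
        proof
          fix I' assume I': "I' \<in> Pow {1..n} - {I}"
          show "R I (v I') \<alpha> \<beta> = 0"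
          proof (cases "I' \<subseteq> I")
            case True
            then have "card I' < card I" using I' fI by (intro psubset_card_mono) auto
            moreover have "I' \<notin> JJ" using up[OF _ True] less.prems by blast
            ultimately show ?thesis using less.hyps[of I'] I' by auto
          next
            case False
            then show ?thesis using R_gsp_zero[OF v(2), of I' I \<beta> \<alpha>] I' \<beta> finite_subset[of I' "{1..n}"] by auto
          qed
        qed
      qed (use less.prems in auto)
      finally show ?thesis using assms(1) less.prems \<beta> by (auto simp: idl_def)
    qed
    then show ?case using gsp_eq_0[OF v(2) fI] less.prems by blast
  qed
  then show thesis using that v by blast
qed

lemma idl_Sn: "w \<in> idl n JJ \<Longrightarrow> w \<in> Sn n" by (simp add: idl_def)

lemma idl_zero: "0 \<in> idl n JJ" by (simp add: idl_def Sn_def alg_gen_zero)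

lemma idl_add: "u \<in> idl n JJ \<Longrightarrow> v \<in> idl n JJ \<Longrightarrow> u + v \<in> idl n JJ"
  by (auto simp: idl_def Sn_def alg_gen.add)

lemma idl_uminus: "u \<in> idl n JJ \<Longrightarrow> - u \<in> idl n JJ"
  by (auto simp: idl_def Sn_def alg_gen_uminus)

lemma idl_mult_left: "u \<in> Sn n \<Longrightarrow> v \<in> idl n JJ \<Longrightarrow> u \<star> v \<in> idl n JJ"
  unfolding idl_def by (auto simp: Sn_def alg_gen.mul intro!: R_mult_right_zero)

lemma idl_mult_right: "u \<in> idl n JJ \<Longrightarrow> v \<in> Sn n \<Longrightarrow> u \<star> v \<in> idl n JJ"
  unfolding idl_def
proof (clarsimp simp: Sn_def alg_gen.mul)
  fix I \<alpha> \<beta> assume *: "\<forall>I\<subseteq>{Suc 0..n}. I \<notin> JJ \<longrightarrow> (\<forall>\<alpha>. \<forall>\<beta>\<in>NI I. R I u \<alpha> \<beta> = 0)"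
    "I \<subseteq> {Suc 0..n}" "I \<notin> JJ" "\<beta> \<in> NI I"
  show "R I (u \<star> v) \<alpha> \<beta> = 0"
    by (subst R_mult[OF finite_R_col order_refl]) (use * R_NI[of I v _ \<beta>] in \<open>auto intro!: sum.neutral\<close>)
qed

lemma idl_sum_list: "set xs \<subseteq> idl n JJ \<Longrightarrow> sum_list xs \<in> idl n JJ"
  by (induction xs) (auto intro: idl_zero idl_add)

lemma idl_mono: "(\<And>I. I \<subseteq> {1..n} \<Longrightarrow> I \<in> JJ \<Longrightarrow> I \<in> JJ') \<Longrightarrow> idl n JJ \<subseteq> idl n JJ'"
  by (auto simp: idl_def)


lemma Sn_mul: "a \<in> Sn n \<Longrightarrow> b \<in> Sn n \<Longrightarrow> a \<star> b \<in> Sn n"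
  and Sn_add: "a \<in> Sn n \<Longrightarrow> b \<in> Sn n \<Longrightarrow> a + b \<in> Sn n"
  and Sn_diff: "a \<in> Sn n \<Longrightarrow> b \<in> Sn n \<Longrightarrow> a - b \<in> Sn n"
  and Sn_one: "sone \<in> Sn n" and Sn_zero: "0 \<in> Sn n"
  and Sn_Est: "i \<in> {1..n} \<Longrightarrow> Est s t i \<in> Sn n"
  and Sn_EI: "I \<subseteq> {1..n} \<Longrightarrow> EI \<alpha> \<beta> I \<in> Sn n"
  and Sn_sum: "(\<And>x. x \<in> S \<Longrightarrow> f x \<in> Sn n) \<Longrightarrow> sum f S \<in> Sn n"
  using finite_subset[of I "{1..n}"]
  by (auto simp: Sn_def intro: alg_gen.mul alg_gen.add alg_gen_diff alg_gen_one alg_gen_zero Est_alg_gen EI_alg_gen alg_gen_sum)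

lemma Sn_mono: "m \<le> n \<Longrightarrow> Sn m \<subseteq> Sn n"
  unfolding Sn_def by (rule alg_gen_mono) auto

lemma Sn_lift: "l \<in> Lv ({1..n} - I) \<Longrightarrow> lift l \<in> Sn n"
  using lift_alg_gen[of l "{1..n} - I"] alg_gen_mono[of "{1..n} - I" "{1..n}"] by (auto simp: Sn_def)

lemma Est_ee: "Est s t i = sg (sg i s, 0) 1 \<star> ee i \<star> sg (0, sg i t) 1"
  by (simp add: ee_def Est_eq smul_simps smul_single bmul_def single_add[symmetric])

lemma pi_Est:
  assumes "i \<in> {1..n}" "u \<in> Sn n" "v \<in> Sn n"
  shows "u \<star> Est s t i \<star> v \<in> pi n i"
proof -
  have "u \<star> Est s t i \<star> v = (u \<star> sg (sg i s, 0) 1) \<star> ee i \<star> (sg (0, sg i t) 1 \<star> v)"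
    by (simp only: Est_ee smul_assoc)
  moreover have "sg (sg i s, 0) (1::'a) \<in> Sn n" "sg (0, sg i t) (1::'a) \<in> Sn n"
    unfolding Sn_def using assms(1) by (auto intro!: single_x_alg_gen single_y_alg_gen split: if_splits)
  then have "u \<star> sg (sg i s, 0) 1 \<in> Sn n" "sg (0, sg i t) 1 \<star> v \<in> Sn n"
    using assms by (auto intro: Sn_mul)
  ultimately show ?thesis unfolding pi_def gen_ideal_def
    by (intro CollectI exI[of _ "[(u \<star> sg (sg i s, 0) 1, ee i, sg (0, sg i t) 1 \<star> v)]"]) auto
qed

lemma ee_idl: "i \<in> {1..n} \<Longrightarrow> ee i \<in> idl n {I. i \<in> I}"
  by (auto simp: idl_def ee_def R_Est Sn_Est)

lemma gen_ideal_idl: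
  assumes "i \<in> {1..n}" "m \<le> n" "w \<in> gen_ideal (Sn m) {ee i}" shows "w \<in> idl n {I. i \<in> I}"
proof -
  obtain ts where ts: "w = sum_list (map (\<lambda>(a, x, b). a \<star> x \<star> b) ts)" "set ts \<subseteq> Sn m \<times> {ee i} \<times> Sn m"
    using assms(3) by (auto simp: gen_ideal_def)
  have "a \<star> ee i \<star> b \<in> idl n {I. i \<in> I}" if "a \<in> Sn m" "b \<in> Sn m" for a b
    by (rule idl_mult_right[OF idl_mult_left[OF _ ee_idl[OF assms(1)]]])
      (rule subsetD[OF Sn_mono[OF assms(2)] that(1)], rule subsetD[OF Sn_mono[OF assms(2)] that(2)])
  then show ?thesis unfolding ts(1) using ts(2) by (intro idl_sum_list) auto
qed

lemma pi_idl: "i \<in> {1..n} \<Longrightarrow> w \<in> pi n i \<Longrightarrow> w \<in> idl n {I. i \<in> I}"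
  unfolding pi_def by (rule gen_ideal_idl) auto

lemma idl_Int: "w \<in> idl n JJ \<Longrightarrow> w \<in> idl n JJ' \<Longrightarrow> w \<in> idl n (JJ \<inter> JJ')"
  by (auto simp: idl_def)

text \<open>The half of each identification of ideals that rests on the graded basis: only the basis
  elements with index sets in \<open>JJ\<close> have to be placed in \<open>X\<close>.\<close>

lemma idl_subset_gens:
  fixes X :: "'k::field sn set"
  assumes up: "\<And>I I'. I \<in> JJ \<Longrightarrow> I \<subseteq> I' \<Longrightarrow> I' \<subseteq> {1..n} \<Longrightarrow> I' \<in> JJ"
    and X: "0 \<in> X" "\<And>x y. x \<in> X \<Longrightarrow> y \<in> X \<Longrightarrow> x + y \<in> X"
    and gen: "\<And>I l a b. I \<subseteq> {1..n} \<Longrightarrow> I \<in> JJ \<Longrightarrow> l \<in> Lv ({1..n} - I) \<Longrightarrow> lift l \<star> EI a b I \<in> X"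
  shows "idl n JJ \<subseteq> X"
proof
  fix w :: "'k sn" assume "w \<in> idl n JJ"
  then obtain v :: "nat set \<Rightarrow> 'k sn" where v: "\<And>I. I \<subseteq> {1..n} \<Longrightarrow> v I \<in> gsp n I" "\<And>I. I \<subseteq> {1..n} \<Longrightarrow> I \<notin> JJ \<Longrightarrow> v I = 0"
    "w = (\<Sum>I\<in>Pow {1..n}. v I)" using idl_decomp up by metis
  have "z \<in> X" if "z \<in> gsp n I" "I \<subseteq> {1..n}" "I \<in> JJ" for z I
    using that(1)
  proof (induction rule: gsp.induct)
    case (step w l a b)
    show ?case by (rule X(2)[OF gen[OF that(2,3) step(2)] step.IH])
  qed (rule X(1))
  then have vX: "v I \<in> X" if "I \<subseteq> {1..n}" for I using that v X(1) by (cases "I \<in> JJ") auto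
  have sumX: "sum v S \<in> X" if "\<And>I. I \<in> S \<Longrightarrow> v I \<in> X" for S
    using that by (induction S rule: infinite_finite_induct) (auto intro: X)
  show "w \<in> X" unfolding v(3) by (rule sumX, rule vX) simp
qed

section \<open>Comparison with the ideals of the statement\<close>

lemma isum_zero: "0 \<in> isum F"
  by (auto simp: isum_def intro!: exI[of _ "[]"])

lemma isum_add: "x \<in> isum F \<Longrightarrow> y \<in> isum F \<Longrightarrow> x + y \<in> isum F"
proof -
  assume "x \<in> isum F" "y \<in> isum F"
  then obtain xs ys where "x = sum_list xs" "y = sum_list ys" "set xs \<subseteq> \<Union>F" "set ys \<subseteq> \<Union>F" by (auto simp: isum_def)
  then show ?thesis unfolding isum_def by (intro CollectI exI[of _ "xs @ ys"]) auto
qed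

lemma isum_mem: "x \<in> A \<Longrightarrow> A \<in> F \<Longrightarrow> x \<in> isum F"
  unfolding isum_def by (intro CollectI exI[of _ "[x]"]) auto

lemma isum_idl: "(\<And>A x. A \<in> F \<Longrightarrow> x \<in> A \<Longrightarrow> x \<in> idl n JJ) \<Longrightarrow> isum F \<subseteq> idl n JJ"
  unfolding isum_def by (auto intro!: idl_sum_list)

lemma iprod_mem: "a \<in> A \<Longrightarrow> b \<in> B \<Longrightarrow> a \<star> b \<in> iprod A B"
  unfolding iprod_def by (intro CollectI exI[of _ "[(a, b)]"]) auto

text \<open>A product is invisible wherever one of its factors is, so the families
  intersect.\<close>

lemma iprod_idl:
  assumes "\<And>a. a \<in> A \<Longrightarrow> a \<in> idl n JJ" "\<And>b. b \<in> B \<Longrightarrow> b \<in> idl n JJ'" "w \<in> iprod A B"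
  shows "w \<in> idl n (JJ \<inter> JJ')"
proof -
  obtain ts where ts: "w = sum_list (map (\<lambda>(a, b). a \<star> b) ts)" "set ts \<subseteq> A \<times> B"
    using assms(3) by (auto simp: iprod_def)
  have "a \<star> b \<in> idl n (JJ \<inter> JJ')" if "a \<in> A" "b \<in> B" for a b
    using idl_mult_right[OF assms(1)[OF that(1)] idl_Sn[OF assms(2)[OF that(2)]]]
      idl_mult_left[OF idl_Sn[OF assms(1)[OF that(1)]] assms(2)[OF that(2)]] by (rule idl_Int)
  then show ?thesis unfolding ts(1) using ts(2) by (intro idl_sum_list) auto
qed

lemma iprod_zero: "0 \<in> iprod A B"
  unfolding iprod_def by (auto intro!: exI[of _ "[]"])

lemma iprod_add: "x \<in> iprod A B \<Longrightarrow> y \<in> iprod A B \<Longrightarrow> x + y \<in> iprod A B"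
proof -
  assume "x \<in> iprod A B" "y \<in> iprod A B"
  then obtain xs ys where "x = sum_list (map (\<lambda>(a, b). a \<star> b) xs)" "y = sum_list (map (\<lambda>(a, b). a \<star> b) ys)"
    "set xs \<subseteq> A \<times> B" "set ys \<subseteq> A \<times> B" by (auto simp: iprod_def)
  then show ?thesis unfolding iprod_def by (intro CollectI exI[of _ "xs @ ys"]) auto
qed

lemma ppn_eq_idl:
  assumes "S \<subseteq> {1..n-1}" "1 \<le> n" shows "(ppn n S :: 'a::field sn set) = idl n (Jp n S)"
proof (rule equalityI)
  show "(ppn n S :: 'a sn set) \<subseteq> idl n (Jp n S)"
    unfolding ppn_def
  proof (rule isum_idl)
    fix A and x :: "'a sn" assume "A \<in> {iprod (pi n i) (pi n n) | i. i \<in> S}" "x \<in> A"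
    then obtain i where i: "i \<in> S" "x \<in> iprod (pi n i) (pi n n)" by auto
    have "S \<subseteq> {1..n}" using assms(1) by (rule order_trans) auto
    then have "i \<in> {1..n}" "n \<in> {1..n}" using i assms(2) by auto
    then have "x \<in> idl n ({I. i \<in> I} \<inter> {I. n \<in> I})" using iprod_idl[OF pi_idl pi_idl i(2)] by blast
    moreover have "idl n ({I. i \<in> I} \<inter> {I. n \<in> I}) \<subseteq> (idl n (Jp n S) :: 'a sn set)"
      by (rule idl_mono) (use i in \<open>auto simp: Jp_def\<close>)
    ultimately show "x \<in> idl n (Jp n S)" by blast
  qed
  show "(idl n (Jp n S) :: 'a sn set) \<subseteq> ppn n S"
  proof (rule idl_subset_gens)
    fix I I' assume "I \<in> Jp n S" "I \<subseteq> I'" "I' \<subseteq> {1..n}"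
    then show "I' \<in> Jp n S" by (auto simp: Jp_def)
  next
    fix I a b and l :: "'a lau" assume I: "I \<subseteq> {1..n}" "I \<in> Jp n S" and l: "l \<in> Lv ({1..n} - I)"
    have "n \<notin> S"
    proof
      assume "n \<in> S"
      then have "n \<in> {1..n-1}" using assms(1) by blast
      then show False using assms(2) by simp
    qed
    then obtain i where i: "i \<in> I" "i \<in> S" "n \<in> I" "i \<noteq> n" using I by (auto simp: Jp_def)
    have fI: "finite I" using I(1) finite_subset by auto
    have e1: "EI a b I = (Est (a i) (b i) i \<star> EI a b (I - {i}) :: 'a sn)"
      using EI_insert[of "I - {i}" i a b, where 'k = 'a] i fI by (simp add: insert_absorb)
    have e2: "EI a b (I - {i}) = (Est (a n) (b n) n \<star> EI a b (I - {i} - {n}) :: 'a sn)"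
      using EI_insert[of "I - {i} - {n}" n a b, where 'k = 'a] i fI by (simp add: insert_absorb)
    have "lift l \<star> EI a b I = (lift l \<star> Est (a i) (b i) i \<star> sone) \<star> (sone \<star> Est (a n) (b n) n \<star> EI a b (I - {i} - {n}))"
      by (simp add: e1 e2 smul_assoc)
    also have "\<dots> \<in> iprod (pi n i) (pi n n)"
    proof (rule iprod_mem; rule pi_Est)
      show "EI a b (I - {i} - {n}) \<in> Sn n" using I by (intro Sn_EI) auto
    qed (use i I l in \<open>auto intro: Sn_lift Sn_one\<close>)
    finally show "lift l \<star> EI a b I \<in> ppn n S" unfolding ppn_def using i(2) by (auto intro: isum_mem)
  qed (auto simp: ppn_def intro: isum_zero isum_add)
qed

lemma pI_list_idl:
  assumes "set xs \<subseteq> {1..n}" "w \<in> List.foldr iprod (map (pi n) xs) (Sn n)"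
  shows "w \<in> idl n {I. set xs \<subseteq> I}"
  using assms
proof (induction xs arbitrary: w)
  case Nil
  then show ?case by (auto simp: idl_def)
next
  case (Cons x xs)
  have "w \<in> idl n ({I. x \<in> I} \<inter> {I. set xs \<subseteq> I})"
    by (rule iprod_idl[OF pi_idl Cons.IH]) (use Cons.prems in auto)
  moreover have "{I. x \<in> I} \<inter> {I. set xs \<subseteq> I} = {I. set (x # xs) \<subseteq> I}" by auto
  ultimately show ?case by simp
qed

lemma pI_list_gen:
  assumes "set xs \<subseteq> {1..n}" "u \<in> Sn n" "v \<in> Sn n"
  shows "u \<star> sprod_list (map (\<lambda>i. Est (a i) (b i) i) xs) \<star> v \<in> List.foldr iprod (map (pi n) xs) (Sn n)"
  using assms
proof (induction xs arbitrary: u)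
  case (Cons x xs)
  let ?P = "sprod_list (map (\<lambda>i. Est (a i) (b i) i) xs)"
  have "u \<star> sprod_list (map (\<lambda>i. Est (a i) (b i) i) (x # xs)) \<star> v
      = (u \<star> Est (a x) (b x) x \<star> sone) \<star> (sone \<star> ?P \<star> v)" by (simp add: smul_assoc)
  also have "\<dots> \<in> iprod (pi n x) (List.foldr iprod (map (pi n) xs) (Sn n))"
    by (rule iprod_mem[OF pi_Est Cons.IH]) (use Cons.prems in \<open>auto intro: Sn_one\<close>)
  finally show ?case by simp
qed (auto intro: Sn_mul)

lemma pI_idl: "J \<subseteq> {1..n} \<Longrightarrow> w \<in> pI n J \<Longrightarrow> w \<in> idl n {I. J \<subseteq> I}"
  using pI_list_idl[of "sorted_list_of_set J" n w] finite_subset[of J "{1..n}"] by (auto simp: pI_def)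

lemma pI_gen: "J \<subseteq> {1..n} \<Longrightarrow> u \<in> Sn n \<Longrightarrow> v \<in> Sn n \<Longrightarrow> u \<star> EI a b J \<star> v \<in> pI n J"
  using pI_list_gen[of "sorted_list_of_set J" n u v a b] finite_subset[of J "{1..n}"] by (auto simp: pI_def EI_def)

lemma EI_Un:
  assumes "finite I" "finite J" "I \<inter> J = {}" shows "EI a b (I \<union> J) = EI a b I \<star> EI a b J"
  using assms(1,3)
  by (induction I rule: finite_induct) (auto simp: EI_insert assms(2) smul_assoc)

lemma ans_eq_idl: "(ans n s :: 'a::field sn set) = idl n {I. s \<le> card I}"
proof (rule equalityI)
  show "(ans n s :: 'a sn set) \<subseteq> idl n {I. s \<le> card I}"
    unfolding ans_def
  proof (rule isum_idl)
    fix A and x :: "'a sn" assume "A \<in> {pI n I | I. I \<subseteq> {1..n} \<and> card I = s}" "x \<in> A"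
    then obtain J where J: "J \<subseteq> {1..n}" "card J = s" "x \<in> pI n J" by auto
    then have "x \<in> idl n {I. J \<subseteq> I}" using pI_idl by blast
    moreover have "idl n {I. J \<subseteq> I} \<subseteq> (idl n {I. s \<le> card I} :: 'a sn set)"
    proof (rule idl_mono)
      fix I assume "I \<subseteq> {1..n}" "I \<in> {I. J \<subseteq> I}"
      then show "I \<in> {I. s \<le> card I}" using card_mono[of I J] finite_subset[of I "{1..n}"] J by auto
    qed
    ultimately show "x \<in> idl n {I. s \<le> card I}" by blast
  qed
  show "(idl n {I. s \<le> card I} :: 'a sn set) \<subseteq> ans n s"
  proof (rule idl_subset_gens)
    fix I I' :: "nat set" assume "I \<in> {I. s \<le> card I}" "I \<subseteq> I'" "I' \<subseteq> {1..n}"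
    then show "I' \<in> {I. s \<le> card I}" using card_mono[of I' I] finite_subset[of I' "{1..n}"] by auto
  next
    fix I a b and l :: "'a lau" assume I: "I \<subseteq> {1..n}" "I \<in> {I. s \<le> card I}" and l: "l \<in> Lv ({1..n} - I)"
    have fI: "finite I" using I(1) finite_subset by auto
    obtain J where J: "J \<subseteq> I" "card J = s" using I(2) fI by (metis mem_Collect_eq obtain_subset_with_card_n)
    have "J \<union> (I - J) = I" using J by auto
    then have "EI a b I = (EI a b J \<star> EI a b (I - J) :: 'a sn)"
      using EI_Un[of J "I - J" a b] J fI finite_subset[of J I] by (metis Diff_disjoint finite_Diff)
    then have "lift l \<star> EI a b I = lift l \<star> EI a b J \<star> EI a b (I - J)" by (simp add: smul_assoc)
    also have "\<dots> \<in> pI n J" using J I l by (intro pI_gen Sn_EI Sn_lift) auto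
    finally show "lift l \<star> EI a b I \<in> ans n s" unfolding ans_def using J I by (intro isum_mem) auto
  qed (auto simp: ans_def intro: isum_zero isum_add)
qed

lemma Fn_eq_idl: "(Fn n :: 'a::field sn set) = idl n {{1..n}}"
proof (rule equalityI)
  show "(Fn n :: 'a sn set) \<subseteq> idl n {{1..n}}"
  proof
    fix x :: "'a sn" assume "x \<in> Fn n"
    then have "x \<in> idl n {I. {1..n} \<subseteq> I}" unfolding Fn_def by (rule pI_idl[OF order_refl])
    moreover have "idl n {I. {1..n} \<subseteq> I} \<subseteq> (idl n {{1..n}} :: 'a sn set)" by (rule idl_mono) auto
    ultimately show "x \<in> idl n {{1..n}}" by blast
  qed
  have foldr_add: "0 \<in> List.foldr iprod As (Sn n) \<and> (\<forall>x\<in>List.foldr iprod As (Sn n). \<forall>y\<in>List.foldr iprod As (Sn n).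
      x + y \<in> List.foldr iprod As (Sn n))" for As :: "'a sn set list"
    by (cases As) (auto intro: iprod_zero iprod_add Sn_zero Sn_add)
  show "(idl n {{1..n}} :: 'a sn set) \<subseteq> Fn n"
  proof (rule idl_subset_gens)
    fix I a b and l :: "'a lau" assume I: "I \<subseteq> {1..n}" "I \<in> {{1..n}}" and l: "l \<in> Lv ({1..n} - I)"
    have I': "I = {1..n}" using I by simp
    have "lift l \<star> EI a b I \<star> sone \<in> pI n {1..n}"
      unfolding I' by (rule pI_gen[OF order_refl Sn_lift[OF l] Sn_one])
    then show "lift l \<star> EI a b I \<in> Fn n" by (simp add: Fn_def)
  qed (use foldr_add in \<open>auto simp: Fn_def pI_def\<close>)
qed

lemma frakp_supset_idl: "S \<subseteq> {1..n-1} \<Longrightarrow> idl (n - 1) {I. I \<inter> S \<noteq> {}} \<subseteq> (frakp n S :: 'a::field sn set)"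
proof (rule idl_subset_gens)
  fix I a b and l :: "'a lau" assume S: "S \<subseteq> {1..n-1}"
    and I: "I \<subseteq> {1..n-1}" "I \<in> {I. I \<inter> S \<noteq> {}}" and l: "l \<in> Lv ({1..n-1} - I)"
  obtain i where i: "i \<in> I" "i \<in> S" using I by auto
  have fI: "finite I" using I(1) finite_subset by auto
  have e1: "EI a b I = (Est (a i) (b i) i \<star> EI a b (I - {i}) :: 'a sn)"
    using EI_insert[of "I - {i}" i a b, where 'k = 'a] i fI by (simp add: insert_absorb)
  have "lift l \<star> EI a b I = lift l \<star> Est (a i) (b i) i \<star> EI a b (I - {i})" by (simp add: e1 smul_assoc)
  also have "\<dots> \<in> pi (n - 1) i" using i I l by (intro pi_Est Sn_lift[of l "n - 1" I] Sn_EI) auto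
  finally show "lift l \<star> EI a b I \<in> frakp n S"
    unfolding frakp_def pi_def using i(2) by (auto intro: isum_mem)
qed (auto simp: frakp_def intro: isum_zero isum_add)

text \<open>The ideal lives in the algebra of \<open>n - 1\<close> variables, but its elements are
  located inside the larger algebra, where they will be multiplied by
  \<open>Est k l n\<close>.\<close>

lemma frakp_idl: "S \<subseteq> {1..n-1} \<Longrightarrow> w \<in> frakp n S \<Longrightarrow> (w :: 'a::field sn) \<in> idl n {I. I \<inter> S \<noteq> {}}"
proof -
  assume S: "S \<subseteq> {1..n-1}" and w: "w \<in> frakp n S"
  have "frakp n S \<subseteq> (idl n {I. I \<inter> S \<noteq> {}} :: 'a sn set)"
    unfolding frakp_def
  proof (rule isum_idl)
    fix A and x :: "'a sn" assume "A \<in> {gen_ideal (Sn (n - 1)) {ee i} | i. i \<in> S}" "x \<in> A"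
    then obtain i where i: "i \<in> S" "x \<in> gen_ideal (Sn (n - 1)) {ee i}" by auto
    moreover have "i \<in> {1..n-1}" using S i(1) by blast
    then have "i \<in> {1..n}" by auto
    ultimately have "x \<in> idl n {I. i \<in> I}" by (intro gen_ideal_idl[of i n "n - 1"]) auto
    moreover have "idl n {I. i \<in> I} \<subseteq> (idl n {I. I \<inter> S \<noteq> {}} :: 'a sn set)" by (rule idl_mono) (use i in auto)
    ultimately show "x \<in> idl n {I. I \<inter> S \<noteq> {}}" by blast
  qed
  then show ?thesis using w by blast
qed


section \<open>The identification of the congruence subgroup\<close>

text \<open>A finite matrix written with matrix units in the last variable. The size
  \<open>N\<close> is explicit so that it can be enlarged by \<open>hat_mono\<close>.\<close>

definition hat :: "nat \<Rightarrow> nat \<Rightarrow> (nat \<Rightarrow> nat \<Rightarrow> 'k::field sn) \<Rightarrow> 'k sn" where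
  "hat n N C = (\<Sum>k<N. \<Sum>l<N. C k l \<star> Est k l n)"

definition msupp :: "nat \<Rightarrow> (nat \<Rightarrow> nat \<Rightarrow> 'k::field sn) \<Rightarrow> bool" where
  "msupp N C \<longleftrightarrow> (\<forall>k l. \<not> (k < N \<and> l < N) \<longrightarrow> C k l = 0)"

lemma hat_mono:
  assumes "msupp N C" "N \<le> M" shows "hat n M C = hat n N C"
proof -
  have "hat n M C = (\<Sum>k<M. \<Sum>l<N. C k l \<star> Est k l n)" unfolding hat_def
    by (rule sum.cong[OF refl], rule sum.mono_neutral_right) (use assms in \<open>auto simp: msupp_def\<close>)
  also have "\<dots> = hat n N C" unfolding hat_def
    by (rule sum.mono_neutral_right) (use assms in \<open>auto simp: msupp_def\<close>)
  finally show ?thesis .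
qed

lemma hat_add: "hat n N (\<lambda>k l. C k l + D k l) = hat n N C + hat n N D"
  by (simp add: hat_def smul_add_left sum.distrib)

lemma commute_last:
  assumes "1 \<le> n" "a \<in> Sn (n - 1)" shows "Est k l n \<star> a = a \<star> Est k l n"
  by (rule alg_gen_commute[OF Est_alg_gen[of n "{n}"] assms(2)[unfolded Sn_def]]) (use assms in auto)

lemma hat_mult:
  assumes n: "1 \<le> n" and D: "\<And>k l. D k l \<in> Sn (n - 1)"
  shows "hat n N C \<star> hat n N D = hat n N (\<lambda>k l. \<Sum>p<N. C k p \<star> D p l)"
proof -
  have trm: "(C k p \<star> Est k p n) \<star> (D q l \<star> Est q l n) = (if p = q then C k p \<star> D p l \<star> Est k l n else 0)" for k p q l
    using smul_interchange[OF commute_last[OF n D[of q l], of k p], of "C k p" "Est q l n"]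
    by (simp add: Est_mult)
  have "hat n N C \<star> hat n N D = (\<Sum>k<N. \<Sum>p<N. (C k p \<star> Est k p n) \<star> hat n N D)"
    by (simp only: hat_def[of n N C] smul_sum_left)
  also have "\<dots> = (\<Sum>k<N. \<Sum>p<N. \<Sum>q<N. \<Sum>l<N. if p = q then C k p \<star> D p l \<star> Est k l n else 0)"
    by (simp only: hat_def smul_sum_right trm)
  also have "\<dots> = (\<Sum>k<N. \<Sum>p<N. \<Sum>l<N. \<Sum>q<N. if p = q then C k p \<star> D p l \<star> Est k l n else 0)"
    by (rule sum.cong[OF refl], rule sum.cong[OF refl], rule sum.swap)
  also have "\<dots> = (\<Sum>k<N. \<Sum>p<N. \<Sum>l<N. C k p \<star> D p l \<star> Est k l n)"
    by (intro sum.cong refl) (simp add: sum.delta')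
  also have "\<dots> = (\<Sum>k<N. \<Sum>l<N. \<Sum>p<N. C k p \<star> D p l \<star> Est k l n)"
    by (rule sum.cong[OF refl]) (rule sum.swap)
  also have "\<dots> = hat n N (\<lambda>k l. \<Sum>p<N. C k p \<star> D p l)" by (simp add: hat_def smul_sum_left)
  finally show ?thesis .
qed

text \<open>Cutting with matrix units on both sides isolates one coefficient, up to the factor
  \<open>e_n\<close> that \<open>ee_cancel\<close> removes.\<close>

lemma hat_extract:
  assumes n: "1 \<le> n" and C: "\<And>k l. C k l \<in> Sn (n - 1)" and "k < N" "l < N"
  shows "Est 0 k n \<star> hat n N C \<star> Est l 0 n = C k l \<star> ee n"
proof -
  have trm: "Est 0 k n \<star> (C p q \<star> Est p q n) \<star> Est l 0 n = (if p = k then if q = l then C k l \<star> ee n else 0 else 0)" for p q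
  proof -
    have "Est 0 k n \<star> (C p q \<star> Est p q n) \<star> Est l 0 n = C p q \<star> ((Est 0 k n \<star> Est p q n) \<star> Est l 0 n)"
      using smul_left_commute[OF commute_last[OF n C[of p q], of 0 k], of "Est p q n"]
      by (simp only: smul_assoc)
    then show ?thesis by (auto simp: Est_mult ee_def)
  qed
  have "Est 0 k n \<star> hat n N C = (\<Sum>p<N. \<Sum>q<N. Est 0 k n \<star> (C p q \<star> Est p q n))"
    by (simp only: hat_def smul_sum_right)
  then have "Est 0 k n \<star> hat n N C \<star> Est l 0 n = (\<Sum>p<N. \<Sum>q<N. if p = k then if q = l then C k l \<star> ee n else 0 else 0)"
    by (simp only: smul_sum_left trm)
  also have "\<dots> = (\<Sum>p<N. if p = k then C k l \<star> ee n else 0)"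
    by (intro sum.cong refl) (use assms(4) in \<open>simp add: sum.delta\<close>)
  also have "\<dots> = C k l \<star> ee n" using assms(3) by (simp add: sum.delta)
  finally show ?thesis .
qed

text \<open>On basis vectors with coordinate 0 at \<open>n\<close> the idempotent \<open>e_n\<close>
  is the identity, and \<open>a\<close> does not touch that coordinate, so the representation at
  \<open>I\<close> is found inside the one at \<open>insert n I\<close>.\<close>

lemma R_extend:
  fixes a :: "'k::field sn"
  assumes a: "a \<in> Sn m" "m < n" and I: "I \<subseteq> {1..m}" and \<beta>: "\<beta> \<in> NI I" "\<alpha> \<in> NI I"
  shows "R (insert n I) (a \<star> ee n) (\<alpha>(n := 0)) (\<beta>(n := 0)) = R I a \<alpha> \<beta>"
proof -
  have nI: "n \<notin> I" using I a by auto
  let ?a = "\<alpha>(n := 0)" and ?b = "\<beta>(n := 0)"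
  have b: "?b \<in> NI (insert n I)" using \<beta> by (auto simp: NI_def PiE_def extensional_def)
  have "R (insert n I) (a \<star> ee n) ?a ?b = R (insert n I) a ?a ?b * R (insert n I) (ee n) ?b ?b"
    by (rule R_mult_single_col) (simp add: ee_def R_Est[OF b])
  also have "R (insert n I) (ee n) ?b ?b = (1 :: 'k lau)" by (simp add: ee_def R_Est[OF b])
  finally have "R (insert n I) (a \<star> ee n) ?a ?b = R (insert n I) a ?a ?b" by (simp only: mult_1_right)
  also have "\<dots> = R I a \<alpha> \<beta>"
    unfolding R_def
  proof (rule sum.cong[OF refl])
    fix p assume "p \<in> ky a"
    then have "p \<in> mon_in {1..m}" using a by (auto simp: Sn_def alg_gen_iff)
    then have "n \<notin> ky (fst p)" "n \<notin> ky (snd p)" using a(2) by (auto simp: mon_in_def)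
    then have z: "lk (fst p) n = 0" "lk (snd p) n = 0" by (simp_all add: in_keys_iff)
    have d: "dg (insert n I) p = dg I p" by (rule poly_mapping_eqI) (auto simp: lookup_dg z)
    have "(act (insert n I) p ?b = Some ?a) = (act I p \<beta> = Some \<alpha>)"
    proof -
      have c: "(\<forall>i\<in>insert n I. lk (snd p) i \<le> ?b i) = (\<forall>i\<in>I. lk (snd p) i \<le> \<beta> i)" using z nI by auto
      have r: "((\<lambda>i\<in>insert n I. ?b i - lk (snd p) i + lk (fst p) i) = ?a) = ((\<lambda>i\<in>I. \<beta> i - lk (snd p) i + lk (fst p) i) = \<alpha>)"
      proof
        assume *: "(\<lambda>i\<in>insert n I. ?b i - lk (snd p) i + lk (fst p) i) = ?a"
        show "(\<lambda>i\<in>I. \<beta> i - lk (snd p) i + lk (fst p) i) = \<alpha>"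
        proof (rule NI_eqI[OF _ \<beta>(2)])
          fix i assume i: "i \<in> I"
          then have "i \<noteq> n" using nI by blast
          then show "(\<lambda>i\<in>I. \<beta> i - lk (snd p) i + lk (fst p) i) i = \<alpha> i" using fun_cong[OF *, of i] i by simp
        qed (simp add: NI_def)
      next
        assume *: "(\<lambda>i\<in>I. \<beta> i - lk (snd p) i + lk (fst p) i) = \<alpha>"
        show "(\<lambda>i\<in>insert n I. ?b i - lk (snd p) i + lk (fst p) i) = ?a"
        proof (rule NI_eqI[of _ "insert n I"])
          fix i assume "i \<in> insert n I"
          then show "(\<lambda>i\<in>insert n I. ?b i - lk (snd p) i + lk (fst p) i) i = ?a i"
            using fun_cong[OF *, of i] nI z by (cases "i = n") auto
        next
          show "?a \<in> NI (insert n I)" using \<beta>(2) by (auto simp: NI_def PiE_def extensional_def)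
        qed (simp add: NI_def)
      qed
      show ?thesis
      proof (cases "\<forall>i\<in>I. lk (snd p) i \<le> \<beta> i")
        case True
        show ?thesis unfolding act_def c if_P[OF True] option.inject by (rule r)
      next
        case False
        show ?thesis unfolding act_def c if_not_P[OF False] by simp
      qed
    qed
    then show "(if act (insert n I) p ?b = Some ?a then sg (dg (insert n I) p) (lk a p) else 0) =
        (if act I p \<beta> = Some \<alpha> then sg (dg I p) (lk a p) else 0)" by (simp only: d)
  qed
  finally show ?thesis .
qed

text \<open>All representations vanish on \<open>a\<close> by \<open>R_extend\<close>; the
  decomposition for the empty family then has no nonzero piece.\<close>

lemma ee_cancel:
  assumes "a \<in> Sn m" "m < n" "a \<star> ee n = 0" shows "a = 0"
proof -
  have "a \<in> idl m {}"
    unfolding idl_def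
  proof (intro CollectI conjI allI impI ballI)
    fix I \<alpha> \<beta> assume I: "I \<subseteq> {1..m}" "\<beta> \<in> NI I"
    show "R I a \<alpha> \<beta> = 0"
      using R_extend[OF assms(1,2) I, of \<alpha>] assms(3) R_NI[of I a \<alpha> \<beta>] by fastforce
  qed (rule assms(1))
  then obtain v where "\<And>I. I \<subseteq> {1..m} \<Longrightarrow> v I = 0" "a = (\<Sum>I\<in>Pow {1..m}. v I)"
    using idl_decomp[of a m "{}"] by (metis empty_iff)
  then show ?thesis by (auto intro: sum.neutral)
qed

lemma hat_inj:
  assumes n: "1 \<le> n" and C: "\<And>k l. C k l \<in> Sn (n - 1)" and "msupp N C" "hat n N C = 0"
  shows "C k l = 0"
proof (cases "k < N \<and> l < N")
  case True
  then have "C k l \<star> ee n = 0" using hat_extract[of n C k N l, OF n C] assms(4) by simp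
  from ee_cancel[OF C _ this] n show ?thesis by simp
qed (use assms(3) in \<open>auto simp: msupp_def\<close>)

text \<open>Every index set in \<open>Jp n S\<close> contains \<open>n\<close>, so each basis
  element carries a matrix unit in the last variable; the rest of it is the coefficient.\<close>

lemma idl_hat:
  fixes w :: "'k::field sn"
  assumes n: "1 \<le> n" and w: "w \<in> idl n (Jp n S)"
  obtains N C where "\<And>k l. C k l \<in> Sn (n - 1)" "msupp N C" "w = hat n N C"
proof -
  let ?X = "{hat n N C | N (C :: nat \<Rightarrow> nat \<Rightarrow> 'k sn). (\<forall>k l. C k l \<in> Sn (n - 1)) \<and> msupp N C}"
  have sub: "idl n (Jp n S) \<subseteq> ?X"
  proof (rule idl_subset_gens)
    fix I I' assume "I \<in> Jp n S" "I \<subseteq> I'" "I' \<subseteq> {1..n}"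
    then show "I' \<in> Jp n S" by (auto simp: Jp_def)
  next
    show "0 \<in> ?X" by (intro CollectI exI[of _ 0] exI[of _ "\<lambda>_ _. 0"]) (simp add: hat_def msupp_def Sn_zero)
  next
    fix x y :: "'k sn" assume "x \<in> ?X" "y \<in> ?X"
    then obtain N C M D where x: "x = hat n N C" "\<forall>k l. C k l \<in> Sn (n - 1)" "msupp N C"
      and y: "y = hat n M D" "\<forall>k l. D k l \<in> Sn (n - 1)" "msupp M D" by blast
    have "x + y = hat n (max N M) C + hat n (max N M) D"
      using hat_mono[OF x(3), of "max N M" n] hat_mono[OF y(3), of "max N M" n] x y by simp
    also have "\<dots> = hat n (max N M) (\<lambda>k l. C k l + D k l)" by (simp add: hat_def smul_add_left sum.distrib)
    finally have "x + y = hat n (max N M) (\<lambda>k l. C k l + D k l)" .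
    moreover have "msupp (max N M) (\<lambda>k l. C k l + D k l)" using x(3) y(3) by (auto simp: msupp_def less_max_iff_disj)
    ultimately show "x + y \<in> ?X" using x(2) y(2) Sn_add by blast
  next
    fix I a b and l :: "'k lau" assume I: "I \<subseteq> {1..n}" "I \<in> Jp n S" and l: "l \<in> Lv ({1..n} - I)"
    have nI: "n \<in> I" "finite I" using I finite_subset by (auto simp: Jp_def)
    define c where "c = lift l \<star> EI a b (I - {n})"
    have "{1..n} - {n} = {1..n-1}" using n by auto
    then have sub: "{1..n} - I \<subseteq> {1..n-1}" "I - {n} \<subseteq> {1..n-1}"
      using Diff_mono[OF subset_refl, of "{n}" I "{1..n}"] Diff_mono[OF I(1), of "{n}" "{n}"] nI by simp_all
    have "lift l \<in> Sn (n - 1)" using lift_alg_gen[OF l] alg_gen_mono[OF sub(1)] by (auto simp: Sn_def)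
    then have c: "c \<in> Sn (n - 1)" unfolding c_def using Sn_EI[OF sub(2)] by (rule Sn_mul)
    have "EI a b I = (Est (a n) (b n) n \<star> EI a b (I - {n}) :: 'k sn)"
      using EI_insert[of "I - {n}" n a b, where 'k = 'k] nI by (simp add: insert_absorb)
    also have "\<dots> = EI a b (I - {n}) \<star> Est (a n) (b n) n" by (rule commute_last[OF n Sn_EI[OF sub(2)]])
    finally have g: "lift l \<star> EI a b I = c \<star> Est (a n) (b n) n" by (simp add: c_def smul_assoc)
    define N where "N = Suc (a n + b n)"
    define C where "C k l = (if k = a n \<and> l = b n then c else 0)" for k l
    have "hat n N C = (\<Sum>k<N. \<Sum>l<N. if k = a n then if l = b n then c \<star> Est (a n) (b n) n else 0 else 0)"
      unfolding hat_def by (intro sum.cong refl) (simp add: C_def)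
    also have "\<dots> = (\<Sum>k<N. if k = a n then c \<star> Est (a n) (b n) n else 0)"
      by (intro sum.cong refl) (simp add: sum.delta N_def)
    also have "\<dots> = c \<star> Est (a n) (b n) n" by (simp add: sum.delta N_def)
    finally have "lift l \<star> EI a b I = hat n N C" using g by simp
    moreover have "\<forall>k l. C k l \<in> Sn (n - 1)" "msupp N C" using c by (auto simp: C_def Sn_zero msupp_def N_def)
    ultimately show "lift l \<star> EI a b I \<in> ?X" by blast
  qed
  from subsetD[OF this w] show thesis using that by blast
qed

lemma fin_mat_bound:
  assumes "fin_mat Q A" obtains N where "\<And>k l. \<not> (k < N \<and> l < N) \<Longrightarrow> A k l = mdelta k l"
proof -
  let ?F = "{(k, l). A k l \<noteq> mdelta k l}"
  have fin: "finite ?F" using assms by (simp add: fin_mat_def)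
  define N where "N = Suc (Max (insert 0 (fst ` ?F \<union> snd ` ?F)))"
  have "A k l = mdelta k l" if "\<not> (k < N \<and> l < N)" for k l
  proof (rule ccontr)
    assume "A k l \<noteq> mdelta k l"
    then have "(k, l) \<in> ?F" by simp
    then have "fst (k, l) \<in> fst ` ?F" "snd (k, l) \<in> snd ` ?F" by (rule imageI)+
    then have "k \<in> fst ` ?F" "l \<in> snd ` ?F" by simp_all
    then have "k < N" "l < N" unfolding N_def less_Suc_eq_le using fin by (auto intro!: Max_ge)
    then show False using that by simp
  qed
  then show thesis using that by blast
qed

lemma fin_matI:
  assumes "\<And>k l. \<not> (k < M \<and> l < M) \<Longrightarrow> A k l = mdelta k l" "\<And>k l. A k l \<in> Q"
  shows "fin_mat Q A"
proof -
  have "{(k, l). A k l \<noteq> mdelta k l} \<subseteq> {..<M} \<times> {..<M}" using assms(1) by force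
  then show ?thesis using finite_subset[of _ "{..<M} \<times> {..<M}"] assms(2) by (simp add: fin_mat_def)
qed

lemma phiGL_hat:
  assumes "\<And>k l. \<not> (k < N \<and> l < N) \<Longrightarrow> A k l = mdelta k l"
  shows "phiGL n A = sone + hat n N (\<lambda>k l. A k l - mdelta k l)"
proof -
  have "(\<Sum>(k, l)\<in>{(k, l). A k l \<noteq> mdelta k l}. (A k l - mdelta k l) \<star> Est k l n)
      = (\<Sum>(k, l)\<in>{..<N} \<times> {..<N}. (A k l - mdelta k l) \<star> Est k l n)"
    by (rule sum.mono_neutral_left) (use assms in \<open>auto\<close>)
  also have "\<dots> = hat n N (\<lambda>k l. A k l - mdelta k l)"
    unfolding hat_def by (rule sum.cartesian_product[symmetric])
  finally show ?thesis by (simp add: phiGL_def)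
qed

text \<open>The product is expressed through the differences from the identity, which are finitely
  supported although the matrices themselves are infinite.\<close>

lemma mmul_eq:
  assumes A: "\<And>k l. \<not> (k < N \<and> l < N) \<Longrightarrow> A k l = mdelta k l"
    and B: "\<And>k l. \<not> (k < N \<and> l < N) \<Longrightarrow> B k l = mdelta k l"
  shows "mmul A B k l = mdelta k l + ((A k l - mdelta k l) + (B k l - mdelta k l)
    + (\<Sum>p<N. (A k p - mdelta k p) \<star> (B p l - mdelta p l)))"
proof -
  define K where "K = {..<N} \<union> {k, l}"
  have fK: "finite K" by (simp add: K_def)
  have "A k m = 0" if "m \<notin> K" for m using that A[of k m] by (auto simp: K_def mdelta_def)
  then have "mmul A B k l = (\<Sum>p\<in>K. A k p \<star> B p l)"
    unfolding mmul_def by (intro sum.mono_neutral_left fK) auto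
  also have "\<dots> = (\<Sum>p\<in>K. mdelta k p \<star> B p l) + (\<Sum>p\<in>K. (A k p - mdelta k p) \<star> mdelta p l)
      + (\<Sum>p\<in>K. (A k p - mdelta k p) \<star> (B p l - mdelta p l))"
    by (simp add: smul_simps flip: sum.distrib)
  also have "(\<Sum>p\<in>K. mdelta k p \<star> B p l) = (\<Sum>p\<in>K. if p = k then B k l else 0)"
    by (rule sum.cong) (auto simp: mdelta_def)
  also have "\<dots> = B k l" using fK by (simp add: sum.delta K_def)
  also have "(\<Sum>p\<in>K. (A k p - mdelta k p) \<star> mdelta p l) = (\<Sum>p\<in>K. if p = l then A k l - mdelta k l else 0)"
    by (rule sum.cong) (auto simp: mdelta_def)
  also have "\<dots> = A k l - mdelta k l" using fK by (simp add: sum.delta K_def)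
  also have "(\<Sum>p\<in>K. (A k p - mdelta k p) \<star> (B p l - mdelta p l)) = (\<Sum>p<N. (A k p - mdelta k p) \<star> (B p l - mdelta p l))"
    by (rule sum.mono_neutral_right) (use A fK in \<open>auto simp: K_def\<close>)
  finally show ?thesis by (simp add: algebra_simps)
qed

lemma mdelta_Sn: "mdelta k l \<in> Sn m"
  by (simp add: mdelta_def Sn_one Sn_zero)

lemma phiGL_mmul:
  assumes n: "1 \<le> n"
    and A: "\<And>k l. \<not> (k < N \<and> l < N) \<Longrightarrow> A k l = mdelta k l" "\<And>k l. A k l \<in> Sn (n - 1)"
    and B: "\<And>k l. \<not> (k < N \<and> l < N) \<Longrightarrow> B k l = mdelta k l" "\<And>k l. B k l \<in> Sn (n - 1)"
  shows "phiGL n A \<star> phiGL n B = sone + hat n N (\<lambda>k l. mmul A B k l - mdelta k l)"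
proof -
  let ?C = "\<lambda>k l. A k l - mdelta k l" and ?D = "\<lambda>k l. B k l - mdelta k l"
  have D: "?D k l \<in> Sn (n - 1)" for k l using B(2) mdelta_Sn by (rule Sn_diff)
  have "phiGL n A \<star> phiGL n B = (sone + hat n N ?C) \<star> (sone + hat n N ?D)"
    using phiGL_hat[of N A n] A(1) phiGL_hat[of N B n] B(1) by simp
  also have "\<dots> = sone + (hat n N ?C + hat n N ?D + hat n N ?C \<star> hat n N ?D)" by (simp add: smul_simps)
  also have "\<dots> = sone + hat n N (\<lambda>k l. mmul A B k l - mdelta k l)"
  proof -
    have "(\<lambda>k l. mmul A B k l - mdelta k l) = (\<lambda>k l. (?C k l + ?D k l) + (\<Sum>p<N. ?C k p \<star> ?D p l))"
      by (intro ext, subst mmul_eq[of N A B, OF A(1) B(1)]) simp_all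
    then show ?thesis unfolding hat_mult[of n ?D, OF n D] by (simp only: hat_add)
  qed
  finally show ?thesis .
qed

text \<open>The map is multiplicative because matrix units in the last variable commute with the
  coefficients. A unit congruent to 1 comes from a matrix by \<open>idl_hat\<close>, its inverse
  likewise, and injectivity of \<open>hat\<close> turns inverse units into inverse matrices.\<close>

theorem phiGL_GLcong:
  assumes n: "1 \<le> n" and S: "S \<subseteq> {1..n-1}"
  shows "phiGL n ` GLcong (Sn (n-1)) (frakp n S) = (onep (Sn n) (ppn n S) :: 'k::field sn set)"
proof (intro equalityI subsetI)
  fix u :: "'k sn" assume "u \<in> phiGL n ` GLcong (Sn (n-1)) (frakp n S)"
  then obtain A B where u: "u = phiGL n A" and A: "fin_mat (Sn (n-1)) A" "\<And>k l. A k l - mdelta k l \<in> frakp n S"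
    and B: "fin_mat (Sn (n-1)) B" "mmul A B = mdelta" "mmul B A = mdelta"
    by (auto simp: GLcong_def GLinf_def)
  obtain N1 N2 where N: "\<And>k l. \<not> (k < N1 \<and> l < N1) \<Longrightarrow> A k l = mdelta k l" "\<And>k l. \<not> (k < N2 \<and> l < N2) \<Longrightarrow> B k l = mdelta k l"
    using fin_mat_bound[OF A(1)] fin_mat_bound[OF B(1)] by metis
  define M where "M = max N1 N2"
  have M: "\<not> (k < M \<and> l < M) \<Longrightarrow> A k l = mdelta k l" "\<not> (k < M \<and> l < M) \<Longrightarrow> B k l = mdelta k l" for k l
    using N by (auto simp: M_def less_max_iff_disj)
  have AS: "A k l \<in> Sn (n - 1)" and BS: "B k l \<in> Sn (n - 1)" for k l using A(1) B(1) by (auto simp: fin_mat_def)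
  have in_Sn: "phiGL n X \<in> Sn n" if "\<And>k l. \<not> (k < M \<and> l < M) \<Longrightarrow> X k l = mdelta k l" "\<And>k l. X k l \<in> Sn (n - 1)" for X :: "'k mat"
  proof -
    have "X k l - mdelta k l \<in> Sn n" for k l
      by (rule Sn_diff[OF subsetD[OF Sn_mono[of "n - 1" n] that(2)] mdelta_Sn]) simp
    then have "hat n M (\<lambda>k l. X k l - mdelta k l) \<in> Sn n"
      unfolding hat_def by (intro Sn_sum Sn_mul Sn_Est) (use n in auto)
    then show ?thesis using Sn_add[OF Sn_one] phiGL_hat[of M X n] that(1) by simp
  qed
  have "phiGL n A \<star> phiGL n B = sone" "phiGL n B \<star> phiGL n A = sone"
    using phiGL_mmul[of n M A B, OF n M(1) AS M(2) BS] phiGL_mmul[of n M B A, OF n M(2) BS M(1) AS] B by (simp_all add: hat_def)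
  then have "u \<in> sunits (Sn n)" unfolding sunits_def u using in_Sn[of A, OF M(1) AS] in_Sn[of B, OF M(2) BS] by blast
  moreover have "u - sone \<in> idl n (Jp n S)"
  proof -
    have "(A k l - mdelta k l) \<star> Est k l n \<in> idl n (Jp n S)" for k l
    proof -
      have f: "A k l - mdelta k l \<in> idl n {I. I \<inter> S \<noteq> {}}" by (rule frakp_idl[OF S A(2)])
      have "ee n \<in> idl n {I. n \<in> I}" "Est k l n \<in> idl n {I. n \<in> I}"
        using n by (auto simp: idl_def ee_def R_Est Sn_Est)
      then have "(A k l - mdelta k l) \<star> Est k l n \<in> idl n ({I. I \<inter> S \<noteq> {}} \<inter> {I. n \<in> I})"
        by (intro idl_Int idl_mult_right[OF f] idl_mult_left[OF idl_Sn[OF f]]) (rule idl_Sn)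
      moreover have "idl n ({I. I \<inter> S \<noteq> {}} \<inter> {I. n \<in> I}) \<subseteq> (idl n (Jp n S) :: 'k sn set)"
        by (rule idl_mono) (auto simp: Jp_def)
      ultimately show ?thesis by blast
    qed
    then have "(\<Sum>k<M. \<Sum>l<M. (A k l - mdelta k l) \<star> Est k l n) \<in> idl n (Jp n S)"
    proof -
      assume *: "\<And>k l. (A k l - mdelta k l) \<star> Est k l n \<in> idl n (Jp n S)"
      have s: "sum f T \<in> idl n (Jp n S)" if "\<And>x. f x \<in> idl n (Jp n S)" for f :: "nat \<Rightarrow> 'k sn" and T
        using that by (induction T rule: infinite_finite_induct) (auto intro: idl_zero idl_add)
      show ?thesis by (intro s *)
    qed
    then show ?thesis using phiGL_hat[of M A n] M(1) unfolding u hat_def by simp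
  qed
  ultimately show "u \<in> onep (Sn n) (ppn n S)" unfolding onep_def ppn_eq_idl[OF S n] by simp
next
  fix u :: "'k sn" assume "u \<in> onep (Sn n) (ppn n S)"
  then obtain v where uv: "u \<in> Sn n" "v \<in> Sn n" "u \<star> v = sone" "v \<star> u = sone" "u - sone \<in> idl n (Jp n S)"
    unfolding onep_def sunits_def ppn_eq_idl[OF S n] by auto
  have "v - sone = - (v \<star> (u - sone))" using uv by (simp add: smul_diff_right)
  then have v1: "v - sone \<in> idl n (Jp n S)" using idl_mult_left[OF uv(2,5)] idl_uminus by metis
  obtain N1 C where C: "\<And>k l. C k l \<in> Sn (n - 1)" "msupp N1 C" "u - sone = hat n N1 C" by (rule idl_hat[OF n uv(5)], rule that)
  obtain N2 D where D: "\<And>k l. D k l \<in> Sn (n - 1)" "msupp N2 D" "v - sone = hat n N2 D" by (rule idl_hat[OF n v1], rule that)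
  define A B where "A = (\<lambda>k l. mdelta k l + C k l)" and "B = (\<lambda>k l. mdelta k l + D k l)"
  define M where "M = max N1 N2"
  have M: "\<not> (k < M \<and> l < M) \<Longrightarrow> A k l = mdelta k l" "\<not> (k < M \<and> l < M) \<Longrightarrow> B k l = mdelta k l" for k l
    using C(2) D(2) by (auto simp: A_def B_def M_def msupp_def less_max_iff_disj)
  have AS: "A k l \<in> Sn (n - 1)" and BS: "B k l \<in> Sn (n - 1)" for k l
    unfolding A_def B_def by (rule Sn_add[OF mdelta_Sn C(1)], rule Sn_add[OF mdelta_Sn D(1)])
  have uA: "u = phiGL n A" "v = phiGL n B"
    using C(3) D(3) hat_mono[OF C(2), of M n] hat_mono[OF D(2), of M n] phiGL_hat[of M A n] phiGL_hat[of M B n] M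
    by (simp_all add: A_def B_def M_def algebra_simps)
  have inv: "mmul X Y = mdelta"
    if "\<And>k l. \<not> (k < M \<and> l < M) \<Longrightarrow> X k l = mdelta k l" "\<And>k l. X k l \<in> Sn (n - 1)"
      "\<And>k l. \<not> (k < M \<and> l < M) \<Longrightarrow> Y k l = mdelta k l" "\<And>k l. Y k l \<in> Sn (n - 1)"
      "phiGL n X \<star> phiGL n Y = sone" for X Y :: "'k mat"
  proof (intro ext)
    fix k l
    have h: "hat n M (\<lambda>k l. mmul X Y k l - mdelta k l) = 0" using phiGL_mmul[of n M X Y, OF n that(1-4)] that(5) by simp
    have e: "mmul X Y k l - mdelta k l = (X k l - mdelta k l) + (Y k l - mdelta k l)
      + (\<Sum>p<M. (X k p - mdelta k p) \<star> (Y p l - mdelta p l))" for k l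
      using mmul_eq[of M X Y k l, OF that(1,3)] by simp
    have "mmul X Y k l - mdelta k l = 0"
    proof (rule hat_inj[of n "\<lambda>k l. mmul X Y k l - mdelta k l", OF n _ _ h])
      show "mmul X Y k l - mdelta k l \<in> Sn (n - 1)" for k l
        unfolding e by (intro Sn_add Sn_sum Sn_mul Sn_diff that(2,4) mdelta_Sn)
      show "msupp M (\<lambda>k l. mmul X Y k l - mdelta k l)"
        unfolding msupp_def e using that(1,3) by (auto intro!: sum.neutral)
    qed
    then show "mmul X Y k l = mdelta k l" by simp
  qed
  have fin: "fin_mat (Sn (n - 1)) A" "fin_mat (Sn (n - 1)) B"
    by (rule fin_matI, erule M(1), rule AS) (rule fin_matI, erule M(2), rule BS)
  have "mmul A B = mdelta"
    by (rule inv, erule M(1), rule AS, erule M(2), rule BS) (use uv uA in simp)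
  moreover have "mmul B A = mdelta"
    by (rule inv, erule M(2), rule BS, erule M(1), rule AS) (use uv uA in simp)
  moreover have "A k l - mdelta k l \<in> frakp n S" for k l
  proof (cases "k < N1 \<and> l < N1")
    case True
    \<comment> \<open>Cutting with matrix units stays in the ideal, and comparing
      \<open>insert n I\<close> with \<open>I\<close> translates membership in \<open>Jp n S\<close>
      into the condition that \<open>I\<close> meets \<open>S\<close>.\<close>
    have "C k l \<star> ee n = Est 0 k n \<star> (u - sone) \<star> Est l 0 n" using hat_extract[of n C k N1 l, OF n C(1)] True C(3) by simp
    moreover have "\<dots> \<in> idl n (Jp n S)" by (intro idl_mult_right idl_mult_left uv(5) Sn_Est) (use n in auto)
    ultimately have Ci: "C k l \<star> ee n \<in> idl n (Jp n S)" by simp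
    have "C k l \<in> idl (n - 1) {I. I \<inter> S \<noteq> {}}"
      unfolding idl_def
    proof (intro CollectI conjI allI impI ballI)
      fix I \<alpha> \<beta> assume I: "I \<subseteq> {1..n-1}" "I \<notin> {I. I \<inter> S \<noteq> {}}" "\<beta> \<in> NI I"
      have I2: "insert n I \<subseteq> {1..n}" "insert n I \<notin> Jp n S" "\<beta>(n := 0) \<in> NI (insert n I)"
        using subset_trans[OF I(1), of "{1..n}"] I(2,3) S n by (auto simp: Jp_def NI_def PiE_def extensional_def)
      have "R (insert n I) (C k l \<star> ee n) (\<alpha>(n := 0)) (\<beta>(n := 0)) = 0" using Ci I2(2,3) I2(1)[unfolded One_nat_def] by (simp add: idl_def)
      then show "R I (C k l) \<alpha> \<beta> = 0"
      proof (cases "\<alpha> \<in> NI I")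
        case True
        have "n - 1 < n" using n by simp
        from R_extend[OF C(1) this I(1,3) True] show ?thesis using \<open>R (insert n I) _ _ _ = 0\<close> by simp
      next
        case False
        then show ?thesis using R_NI[of I "C k l" \<alpha> \<beta>] by blast
      qed
    qed (rule C(1))
    then show ?thesis using subsetD[OF frakp_supset_idl[OF S]] by (simp add: A_def)
  next
    case False
    then have "C k l = 0" using C(2) by (auto simp: msupp_def)
    then show ?thesis using isum_zero by (simp add: A_def frakp_def)
  qed
  ultimately have "A \<in> GLcong (Sn (n-1)) (frakp n S)"
    using fin unfolding GLcong_def GLinf_def by (intro CollectI conjI exI[of _ B] allI) simp_all
  then show "u \<in> phiGL n ` GLcong (Sn (n-1)) (frakp n S)" using uA by blast
qed


section \<open>Congruence subgroups and their matrix representations\<close>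

text \<open>An arbitrary enumeration of the basis, as column-finite matrices are indexed by
  naturals. It is a bijection when \<open>I\<close> is finite and nonempty, the case of a countably
  infinite basis.\<close>

definition enc :: "nat set \<Rightarrow> nat \<Rightarrow> (nat \<Rightarrow> nat)" where "enc I = from_nat_into (NI I)"

lemma enc_bij:
  assumes "finite I" "I \<noteq> {}" shows "bij_betw (enc I) UNIV (NI I)"
  unfolding enc_def
proof (rule bij_betw_from_nat_into)
  have "inj_on (\<lambda>\<alpha>. map \<alpha> (sorted_list_of_set I)) (NI I)"
  proof (rule inj_onI)
    fix \<alpha> \<beta> assume "\<alpha> \<in> NI I" "\<beta> \<in> NI I" "map \<alpha> (sorted_list_of_set I) = map \<beta> (sorted_list_of_set I)"
    then show "\<alpha> = \<beta>" by (intro NI_eqI) (use assms(1) in auto)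
  qed
  then show "countable (NI I)" by (rule countableI')
  obtain i where i: "i \<in> I" using assms(2) by blast
  have "inj (\<lambda>x. (\<lambda>_\<in>I. x) :: nat \<Rightarrow> nat)"
  proof (rule injI)
    fix x y :: nat assume "(\<lambda>_\<in>I. x) = (\<lambda>_\<in>I. y)"
    from fun_cong[OF this, of i] show "x = y" using i by simp
  qed
  then have "infinite (range (\<lambda>x. (\<lambda>_\<in>I. x) :: nat \<Rightarrow> nat))" by (rule range_inj_infinite)
  moreover have "range (\<lambda>x. (\<lambda>_\<in>I. x) :: nat \<Rightarrow> nat) \<subseteq> NI I" by (auto simp: NI_def)
  ultimately show "infinite (NI I)" using infinite_super by blast
qed

lemma enc_NI: "finite I \<Longrightarrow> I \<noteq> {} \<Longrightarrow> enc I p \<in> NI I"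
  using bij_betwE[OF enc_bij, of I] by simp

lemma enc_eq_iff: "finite I \<Longrightarrow> I \<noteq> {} \<Longrightarrow> enc I p = enc I q \<longleftrightarrow> p = q"
  using bij_betw_imp_inj_on[OF enc_bij, of I] by (auto simp: inj_on_def)

lemma enc_surj: "finite I \<Longrightarrow> I \<noteq> {} \<Longrightarrow> \<alpha> \<in> NI I \<Longrightarrow> \<exists>p. enc I p = \<alpha>"
  using bij_betw_imp_surj_on[OF enc_bij, of I] by (metis imageE)

definition rho :: "nat set \<Rightarrow> 'k::field sn \<Rightarrow> 'k lau fract cf" where
  "rho I w = Abs_cf (\<lambda>p q. emb (R I w (enc I p) (enc I q)))"

lemma ent_rho:
  assumes "finite I" "I \<noteq> {}" shows "ent (rho I w) p q = emb (R I w (enc I p) (enc I q))"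
proof -
  have "finite {p. emb (R I w (enc I p) (enc I q)) \<noteq> 0}" for q
  proof -
    have "finite (enc I -` {\<gamma>. R I w \<gamma> (enc I q) \<noteq> 0})"
      using finite_R_col by (rule finite_vimageI) (simp add: inj_def enc_eq_iff[OF assms])
    then show ?thesis by (simp add: vimage_def)
  qed
  then show ?thesis unfolding rho_def by (subst Abs_cf_inverse) auto
qed

lemma rho_mult:
  assumes "finite I" "I \<noteq> {}" shows "rho I (u \<star> v) = rho I u * rho I v"
proof (rule cf_eqI)
  fix p q
  let ?K = "{k. ent (rho I v) k q \<noteq> 0}"
  have "R I (u \<star> v) (enc I p) (enc I q) = (\<Sum>\<gamma>\<in>enc I ` ?K. R I u (enc I p) \<gamma> * R I v \<gamma> (enc I q))"
  proof (rule R_mult)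
    show "{\<gamma>. R I v \<gamma> (enc I q) \<noteq> 0} \<subseteq> enc I ` ?K"
    proof
      fix \<gamma> assume g: "\<gamma> \<in> {\<gamma>. R I v \<gamma> (enc I q) \<noteq> 0}"
      then obtain k where "enc I k = \<gamma>" using enc_surj[OF assms] R_NI by blast
      then show "\<gamma> \<in> enc I ` ?K" using g by (auto simp: ent_rho[OF assms])
    qed
  qed simp
  also have "\<dots> = (\<Sum>k\<in>?K. R I u (enc I p) (enc I k) * R I v (enc I k) (enc I q))"
    by (subst sum.reindex) (auto simp: inj_on_def enc_eq_iff[OF assms])
  finally show "ent (rho I (u \<star> v)) p q = ent (rho I u * rho I v) p q"
    unfolding ent_mult_raw by (simp add: ent_rho[OF assms])
qed

lemma rho_one: "finite I \<Longrightarrow> I \<noteq> {} \<Longrightarrow> rho I sone = 1"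
  by (rule cf_eqI) (simp add: ent_rho ent_one R_one[OF enc_NI] enc_eq_iff)

lemma rho_eqD:
  assumes "finite I" "I \<noteq> {}" "rho I u = rho I v" "\<beta> \<in> NI I" shows "R I u \<alpha> \<beta> = R I v \<alpha> \<beta>"
proof (cases "\<alpha> \<in> NI I")
  case True
  then obtain p q where "enc I p = \<alpha>" "enc I q = \<beta>" using enc_surj[OF assms(1,2)] assms(4) by metis
  then show ?thesis using arg_cong[OF assms(3), of "\<lambda>A. ent A p q"] by (simp add: ent_rho[OF assms(1,2)])
next
  case False
  then show ?thesis using R_NI by metis
qed

lemma rho_eqI:
  assumes "finite I" "I \<noteq> {}" "\<And>\<alpha> \<beta>. \<beta> \<in> NI I \<Longrightarrow> R I u \<alpha> \<beta> = R I v \<alpha> \<beta>" shows "rho I u = rho I v"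
  by (rule cf_eqI) (simp add: ent_rho[OF assms(1,2)] assms(3)[OF enc_NI[OF assms(1,2)]])

lemma rho_over:
  assumes "finite I" "I \<noteq> {}" "w \<in> Sn n" shows "rho I w \<in> over (emb ` Lv ({1..n} - I))"
  unfolding over_def using R_Lv[OF assms(3)[unfolded Sn_def], of I] by (auto simp: ent_rho[OF assms(1,2)])

lemma rho_gen:
  assumes "finite I" "I \<noteq> {}" "l \<in> Lv A" "A \<inter> I = {}"
  shows "rho I (sone + lift l \<star> EI (enc I p) (enc I q) I) = 1 + mun p q (emb l)"
proof (rule cf_eqI)
  fix k m
  have r: "restrict (enc I x) I = enc I x" for x
    using enc_NI[OF assms(1,2), of x] by (simp add: NI_def PiE_restrict)
  show "ent (rho I (sone + lift l \<star> EI (enc I p) (enc I q) I)) k m = ent (1 + mun p q (emb l)) k m"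
    by (simp add: ent_rho[OF assms(1,2)] R_one[OF enc_NI[OF assms(1,2)]] ent_one ent_mun
        R_gen[OF assms(1,3,4) enc_NI[OF assms(1,2)]] r enc_eq_iff[OF assms(1,2)])
qed

text \<open>The position \<open>z\<close> of the zero multi-index is the same for all
  \<open>l\<close>, so a diagonal entry prescribed by a determinant can be lifted after
  \<open>z\<close> is fixed.\<close>

lemma rho_eI:
  assumes "finite I" "I \<noteq> {}"
  shows "\<exists>z. \<forall>(l :: 'k::field lau) A. l \<in> Lv A \<longrightarrow> A \<inter> I = {} \<longrightarrow> rho I (sone + lift l \<star> eI I) = 1 + mun z z (emb l)"
proof -
  obtain z where z: "enc I z = (\<lambda>_\<in>I. 0)" using enc_surj[OF assms, of "\<lambda>_\<in>I. 0"] by (auto simp: NI_def)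
  have e: "EI (enc I z) (enc I z) I = (eI I :: 'k sn)" unfolding eI_EI by (rule EI_cong) (simp_all add: z)
  show ?thesis
  proof (intro exI allI impI)
    fix l :: "'k lau" and A assume "l \<in> Lv A" "A \<inter> I = {}"
    from rho_gen[OF assms this, of z z] show "rho I (sone + lift l \<star> eI I) = 1 + mun z z (emb l)" by (simp only: e)
  qed
qed

lemma Dt_rho_eI:
  fixes l :: "'k::field lau"
  assumes "finite I" "I \<noteq> {}" "l \<in> Lv A" "A \<inter> I = {}"
  shows "Dt (rho I (sone + lift l \<star> eI I)) = emb (1 + l)"
proof -
  obtain z where "rho I (sone + lift l \<star> eI I) = 1 + mun z z (emb l)" using rho_eI[OF assms(1,2)] assms(3,4) by blast
  then show ?thesis using Dt_diag[of z "emb (1 + l)"] by simp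
qed

lemma emb_eq_1: "emb p = 1 \<longleftrightarrow> p = 1"
  by (metis emb_simps(2) emb_eq_iff)

section \<open>Units congruent to 1 modulo these ideals\<close>

abbreviation gp :: "nat \<Rightarrow> nat set set \<Rightarrow> 'k::field sn set" where
  "gp n JJ \<equiv> onep (Sn n) (idl n JJ)"

lemma gpI:
  assumes "u \<in> Sn n" "v \<in> Sn n" "u \<star> v = sone" "v \<star> u = sone" "u - sone \<in> idl n JJ"
  shows "u \<in> gp n JJ"
  using assms by (auto simp: onep_def sunits_def)

lemma gp_Sn: "u \<in> gp n JJ \<Longrightarrow> u \<in> Sn n"
  by (simp add: onep_def sunits_def)

lemma gp_idl: "u \<in> gp n JJ \<Longrightarrow> u - sone \<in> idl n JJ"
  by (simp add: onep_def)

lemma gp_inverse: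
  assumes "u \<in> gp n JJ" obtains v where "v \<in> gp n JJ" "u \<star> v = sone" "v \<star> u = sone"
proof -
  obtain v where v: "v \<in> Sn n" "u \<star> v = sone" "v \<star> u = sone" and u: "u \<in> Sn n" "u - sone \<in> idl n JJ"
    using assms by (auto simp: onep_def sunits_def)
  have "v - sone = - (v \<star> (u - sone))" by (simp add: smul_diff_right v)
  also have "\<dots> \<in> idl n JJ" by (intro idl_uminus idl_mult_left v u)
  finally have "v \<in> gp n JJ" by (rule gpI[OF v(1) u(1) v(3) v(2)])
  then show thesis using that v by blast
qed

lemma gp_one: "sone \<in> gp n JJ"
  by (rule gpI[of _ _ sone]) (simp_all add: Sn_one idl_zero)

lemma gp_mul:
  assumes "u \<in> gp n JJ" "v \<in> gp n JJ" shows "u \<star> v \<in> gp n JJ"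
proof -
  obtain u' where u': "u' \<in> gp n JJ" "u \<star> u' = sone" "u' \<star> u = sone" using gp_inverse[OF assms(1)] by metis
  obtain v' where v': "v' \<in> gp n JJ" "v \<star> v' = sone" "v' \<star> v = sone" using gp_inverse[OF assms(2)] by metis
  have "u \<star> v \<star> (v' \<star> u') = u \<star> (v \<star> v') \<star> u'" "v' \<star> u' \<star> (u \<star> v) = v' \<star> (u' \<star> u) \<star> v"
    by (simp_all only: smul_assoc)
  then have inv: "u \<star> v \<star> (v' \<star> u') = sone" "v' \<star> u' \<star> (u \<star> v) = sone" using u' v' by simp_all
  have "u \<star> v - sone = (u - sone) \<star> v + (v - sone)" by (simp add: smul_diff_left)
  also have "\<dots> \<in> idl n JJ" 
    by (rule idl_add[OF idl_mult_right[OF gp_idl[OF assms(1)] gp_Sn[OF assms(2)]] gp_idl[OF assms(2)]])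
  finally show ?thesis
    by (rule gpI[OF Sn_mul[OF gp_Sn[OF assms(1)] gp_Sn[OF assms(2)]] Sn_mul[OF gp_Sn[OF v'(1)] gp_Sn[OF u'(1)]] inv])
qed

lemma gp_sinv:
  assumes "u \<in> gp n JJ"
  shows "sinv (Sn n) u \<in> gp n JJ" "u \<star> sinv (Sn n) u = sone" "sinv (Sn n) u \<star> u = sone"
proof -
  obtain v where v: "v \<in> gp n JJ" "u \<star> v = sone" "v \<star> u = sone" using gp_inverse[OF assms] by metis
  have "sinv (Sn n) u = v"
    unfolding sinv_def
  proof (rule the_equality)
    show "v \<in> Sn n \<and> u \<star> v = sone \<and> v \<star> u = sone" using v gp_Sn by blast
    fix w assume "w \<in> Sn n \<and> u \<star> w = sone \<and> w \<star> u = sone"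
    then show "w = v" using smul_assoc[of w u v] v by simp
  qed
  then show "sinv (Sn n) u \<in> gp n JJ" "u \<star> sinv (Sn n) u = sone" "sinv (Sn n) u \<star> u = sone" using v by simp_all
qed

lemma gp_mono: "(\<And>I. I \<subseteq> {1..n} \<Longrightarrow> I \<in> JJ \<Longrightarrow> I \<in> JJ') \<Longrightarrow> gp n JJ \<subseteq> gp n JJ'"
  using idl_mono[of n JJ JJ'] by (auto simp: onep_def)

lemma gp_spow: "u \<in> gp n JJ \<Longrightarrow> spow u k \<in> gp n JJ"
  by (induction k) (simp_all add: spow_def gp_one gp_mul)

lemma gp_zpow: "u \<in> gp n JJ \<Longrightarrow> zpow (Sn n) u z \<in> gp n JJ"
  by (simp add: zpow_def gp_spow gp_sinv(1))

lemma gp_sprod_list: "(\<And>x. x \<in> set xs \<Longrightarrow> x \<in> gp n JJ) \<Longrightarrow> sprod_list xs \<in> gp n JJ"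
  by (induction xs) (simp_all add: gp_one gp_mul)

lemma rho_one_idl:
  assumes "w - sone \<in> idl n JJ" "I \<subseteq> {1..n}" "I \<notin> JJ" "I \<noteq> {}" shows "rho I w = 1"
proof -
  have fin: "finite I" using assms(2) finite_subset by blast
  have "rho I w = rho I sone"
  proof (rule rho_eqI[OF fin assms(4)])
    fix \<alpha> \<beta> assume b: "\<beta> \<in> NI I"
    have "R I (w - sone) \<alpha> \<beta> = 0" using assms(1-3) b unfolding idl_def by blast
    then show "R I w \<alpha> \<beta> = R I sone \<alpha> \<beta>" by simp
  qed
  then show ?thesis by (simp add: rho_one[OF fin assms(4)])
qed

lemma gp_rho_one:
  "u \<in> gp n JJ \<Longrightarrow> I \<subseteq> {1..n} \<Longrightarrow> I \<notin> JJ \<Longrightarrow> I \<noteq> {} \<Longrightarrow> rho I u = 1"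
  by (rule rho_one_idl[OF gp_idl])

lemma gsp_finite_support:
  assumes "v \<in> gsp n I" "finite I" shows "finite {(\<alpha>, \<beta>). \<beta> \<in> NI I \<and> R I v \<alpha> \<beta> \<noteq> 0}"
  using assms(1)
proof induction
  case (step w l a b)
  have "R I (lift l \<star> EI a b I) \<alpha> \<beta> = (if \<alpha> = restrict a I \<and> \<beta> = restrict b I then l else 0)" if "\<beta> \<in> NI I" for \<alpha> \<beta>
    by (rule R_gen[OF assms(2) step(2) _ that]) auto
  then have "{(\<alpha>, \<beta>). \<beta> \<in> NI I \<and> R I (lift l \<star> EI a b I + w) \<alpha> \<beta> \<noteq> 0}
      \<subseteq> insert (restrict a I, restrict b I) {(\<alpha>, \<beta>). \<beta> \<in> NI I \<and> R I w \<alpha> \<beta> \<noteq> 0}"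
    by (auto split: if_splits)
  then show ?case using step.IH finite_subset by blast
qed simp

text \<open>The graded components of \<open>u\<close> indexed by proper subsets of \<open>I\<close> vanish, and those not
  below \<open>I\<close> are invisible to \<open>rho I\<close>.\<close>

lemma idl_support:
  assumes u: "u \<in> idl n JJ" and up: "\<And>I I'. I \<in> JJ \<Longrightarrow> I \<subseteq> I' \<Longrightarrow> I' \<subseteq> {1..n} \<Longrightarrow> I' \<in> JJ"
    and I: "I \<subseteq> {1..n}" and min: "\<And>I'. I' \<subset> I \<Longrightarrow> I' \<notin> JJ"
  shows "finite {(\<alpha>, \<beta>). \<beta> \<in> NI I \<and> R I u \<alpha> \<beta> \<noteq> 0}"
proof -
  have fin: "finite I" using I finite_subset by blast
  obtain v where v: "\<And>I. I \<subseteq> {1..n} \<Longrightarrow> v I \<in> gsp n I" "\<And>I. I \<subseteq> {1..n} \<Longrightarrow> I \<notin> JJ \<Longrightarrow> v I = 0"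
    "u = (\<Sum>I\<in>Pow {1..n}. v I)" by (rule idl_decomp[OF u], rule up, assumption+, rule that)
  have eq: "R I u \<alpha> \<beta> = R I (v I) \<alpha> \<beta>" if b: "\<beta> \<in> NI I" for \<alpha> \<beta>
  proof -
    have "R I u \<alpha> \<beta> = (\<Sum>I'\<in>Pow {1..n}. R I (v I') \<alpha> \<beta>)" unfolding v(3) by (rule R_sum)
    also have "\<dots> = (\<Sum>I'\<in>Pow {1..n}. if I' = I then R I (v I) \<alpha> \<beta> else 0)"
    proof (rule sum.cong[OF refl])
      fix I' assume I': "I' \<in> Pow {1..n}"
      then have f': "finite I'" using finite_subset by blast
      consider "I' = I" | "I' \<subset> I" | "\<not> I' \<subseteq> I" by blast
      then show "R I (v I') \<alpha> \<beta> = (if I' = I then R I (v I) \<alpha> \<beta> else 0)"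
      proof cases
        case 2
        then show ?thesis using v(2)[of I'] min[of I'] I' by auto
      next
        case 3
        then show ?thesis using R_gsp_zero[OF v(1) f' 3 b] I' by auto
      qed simp
    qed
    also have "\<dots> = R I (v I) \<alpha> \<beta>" using I by (subst sum.delta) auto
    finally show ?thesis .
  qed
  have "{(\<alpha>, \<beta>). \<beta> \<in> NI I \<and> R I u \<alpha> \<beta> \<noteq> 0} = {(\<alpha>, \<beta>). \<beta> \<in> NI I \<and> R I (v I) \<alpha> \<beta> \<noteq> 0}"
    by (auto simp: eq simp del: R_diff)
  then show ?thesis using gsp_finite_support[OF v(1)[OF I] fin] by (simp only:)
qed

text \<open>Minimality of \<open>I\<close> makes the difference from the identity finitely
  supported, by \<open>idl_support\<close>; the enumeration turns this into a finite block, on which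
  stable determinants are defined.\<close>

lemma gp_rho_bdd:
  assumes "u \<in> gp n JJ" "\<And>I I'. I \<in> JJ \<Longrightarrow> I \<subseteq> I' \<Longrightarrow> I' \<subseteq> {1..n} \<Longrightarrow> I' \<in> JJ"
    "I \<subseteq> {1..n}" "\<And>I'. I' \<subset> I \<Longrightarrow> I' \<notin> JJ" "I \<noteq> {}"
  shows "\<exists>r. rho I u \<in> bdd r"
proof -
  have fin: "finite I" using assms(3) finite_subset by blast
  let ?F = "{(\<alpha>, \<beta>). \<beta> \<in> NI I \<and> R I (u - sone) \<alpha> \<beta> \<noteq> 0}"
  let ?P = "{(p, q). ent (rho I u) p q \<noteq> ent 1 p q}"
  have e: "ent (rho I u) p q = ent 1 p q \<longleftrightarrow> R I (u - sone) (enc I p) (enc I q) = 0" for p q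
    by (auto simp: emb_eq_1 ent_rho[OF fin assms(5)] ent_one R_one[OF enc_NI[OF fin assms(5)]] enc_eq_iff[OF fin assms(5)])
  have P: "?P = (\<lambda>(p, q). (enc I p, enc I q)) -` ?F" using enc_NI[OF fin assms(5)] by (auto simp: e)
  have i: "inj (\<lambda>(p, q). (enc I p, enc I q))" by (auto simp: inj_def enc_eq_iff[OF fin assms(5)])
  have "finite ?F" by (rule idl_support[OF gp_idl[OF assms(1)] _ assms(3)], rule assms(2), assumption+, rule assms(4))
  then have "finite ?P" unfolding P by (rule finite_vimageI[OF _ i])
  then have f: "finite (fst ` ?P \<union> snd ` ?P)" by simp
  define r where "r = Suc (Max (insert 0 (fst ` ?P \<union> snd ` ?P)))"
  have "ent (rho I u) p q = ent 1 p q" if "r \<le> p \<or> r \<le> q" for p q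
  proof (rule ccontr)
    assume "\<not> ?thesis"
    then have "(p, q) \<in> ?P" by simp
    then have "fst (p, q) \<in> fst ` ?P" "snd (p, q) \<in> snd ` ?P" by (rule imageI)+
    then have "p \<in> fst ` ?P \<union> snd ` ?P" "q \<in> fst ` ?P \<union> snd ` ?P" by simp_all
    then have "p < r" "q < r" unfolding r_def less_Suc_eq_le using f by (auto intro!: Max_ge)
    then show False using that by simp
  qed
  then show ?thesis by (auto simp: bdd_def)
qed

text \<open>Outside \<open>JJ\<close> both elements act as the identity, so their difference is
  killed by every representation and has no graded piece. The empty set is kept out of
  \<open>JJ\<close> because the enumeration behind \<open>rho\<close> needs an infinite
  basis.\<close>

lemma gp_faithful:
  fixes u v :: "'k::field sn"
  assumes "u \<in> gp n JJ" "v \<in> gp n JJ" "{} \<notin> JJ" "\<And>I. I \<subseteq> {1..n} \<Longrightarrow> I \<in> JJ \<Longrightarrow> rho I u = rho I v"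
  shows "u = v"
proof -
  have 0: "u - v \<in> idl n {}"
    unfolding idl_def
  proof (intro CollectI conjI allI impI ballI)
    show "u - v \<in> Sn n" by (rule Sn_diff[OF gp_Sn[OF assms(1)] gp_Sn[OF assms(2)]])
    fix I \<alpha> \<beta> assume I: "I \<subseteq> {1..n}" "\<beta> \<in> NI I"
    show "R I (u - v) \<alpha> \<beta> = 0"
    proof (cases "I \<in> JJ")
      case True
      then have "finite I" "I \<noteq> {}" using assms(3) finite_subset[OF I(1)] by auto
      then show ?thesis using rho_eqD[of I u v \<beta> \<alpha>] assms(4)[OF I(1) True] I(2) by simp
    next
      case False
      then have "R I (w - sone) \<alpha> \<beta> = 0" if "w \<in> gp n JJ" for w :: "'k sn"
        using gp_idl[OF that] I unfolding idl_def by blast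
      from this[OF assms(1)] this[OF assms(2)] show ?thesis by simp
    qed
  qed
  obtain w where "\<And>I. I \<subseteq> {1..n} \<Longrightarrow> I \<notin> {} \<Longrightarrow> w I = 0" "u - v = (\<Sum>I\<in>Pow {1..n}. w I)"
    by (rule idl_decomp[OF 0], erule emptyE, rule that)
  then have "u - v = 0" by (auto intro: sum.neutral)
  then show ?thesis by simp
qed

lemma idl_EI:
  assumes "I \<subseteq> {1..n}" "a \<in> Sn n" shows "a \<star> EI \<alpha> \<beta> I \<in> idl n {J. I \<subseteq> J}"
proof -
  have "finite I" using assms(1) finite_subset by blast
  then have "EI \<alpha> \<beta> I \<in> idl n {J. I \<subseteq> J}" unfolding idl_def using Sn_EI[OF assms(1)] R_EI_zero by blast
  then show ?thesis by (rule idl_mult_left[OF assms(2)])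
qed

section \<open>Elementary and diagonal elements\<close>

lemma EI_square_zero:
  assumes "finite I" "a \<in> alg_gen A" "A \<inter> I = {}" "\<exists>i\<in>I. \<alpha> i \<noteq> \<beta> i"
  shows "(a \<star> EI \<alpha> \<beta> I) \<star> (a \<star> EI \<alpha> \<beta> I) = 0"
proof -
  have "EI \<alpha> \<beta> I \<star> a = a \<star> EI \<alpha> \<beta> I"
    using alg_gen_commute[OF assms(2) EI_alg_gen[OF assms(1) subset_refl] assms(3)] by simp
  from smul_interchange[OF this] show ?thesis using assms(4) by (auto simp: EI_mult[OF assms(1)])
qed

lemma Einf_gen_gp:
  assumes "I \<subseteq> {1..n}" "a \<in> alg_gen ({1..n} - I)" "\<exists>i\<in>I. \<alpha> i \<noteq> \<beta> i"
  shows "sone + a \<star> EI \<alpha> \<beta> I \<in> gp n {J. I \<subseteq> J}"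
proof -
  have fin: "finite I" using assms(1) finite_subset by blast
  have a: "a \<in> Sn n" using subsetD[OF alg_gen_mono assms(2), of "{1..n}"] unfolding Sn_def by auto
  have sq: "(a \<star> EI \<alpha> \<beta> I) \<star> (a \<star> EI \<alpha> \<beta> I) = 0" by (rule EI_square_zero[OF fin assms(2) _ assms(3)]) auto
  have i: "a \<star> EI \<alpha> \<beta> I \<in> idl n {J. I \<subseteq> J}" by (rule idl_EI[OF assms(1) a])
  show ?thesis
  proof (rule gpI[of _ _ "sone - a \<star> EI \<alpha> \<beta> I"])
    show "sone + a \<star> EI \<alpha> \<beta> I \<in> Sn n" "sone - a \<star> EI \<alpha> \<beta> I \<in> Sn n"
      by (rule Sn_add[OF Sn_one idl_Sn[OF i]], rule Sn_diff[OF Sn_one idl_Sn[OF i]])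
  qed (simp_all add: smul_add_left smul_add_right smul_diff_left smul_diff_right sq i)
qed

lemma Einf_gp:
  assumes "I \<subseteq> {1..n}" "g \<in> Einf n I" shows "g \<in> gp n {J. I \<subseteq> J}"
  using assms(2)
proof induction
  case (gen a \<alpha> \<beta>)
  then show ?case by (rule Einf_gen_gp[OF assms(1)])
qed (simp_all add: gp_one gp_mul gp_sinv)

text \<open>Distinct positions in the enumeration differ in some coordinate of \<open>I\<close>, so
  each elementary factor is the image of a generator.\<close>

lemma Einf_lift:
  assumes I: "I \<subseteq> {1..n}" "I \<noteq> {}" and e: "\<epsilon> \<in> elm (emb ` (Lv ({1..n} - I) :: 'k::field lau set))"
  shows "\<exists>g\<in>Einf n I. rho I g = \<epsilon>"
  using e
proof induction
  have fin: "finite I" using I finite_subset by blast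
  {
    case one
    show ?case using Einf.one[of n I] rho_one[OF fin I(2)] by blast
  next
    case (step g i j a)
    then obtain h l where h: "h \<in> Einf n I" "rho I h = g" and l: "a = emb l" "l \<in> Lv ({1..n} - I)" by blast
    have "\<exists>k\<in>I. enc I i k \<noteq> enc I j k"
    proof (rule ccontr)
      assume "\<not> ?thesis"
      then have "enc I i = enc I j" using enc_NI[OF fin I(2)] by (intro NI_eqI) auto
      then show False using step by (simp add: enc_eq_iff[OF fin I(2)])
    qed
    then have "sone + lift l \<star> EI (enc I i) (enc I j) I \<in> Einf n I" by (rule Einf.gen[OF lift_alg_gen[OF l(2)]])
    then have "(sone + lift l \<star> EI (enc I i) (enc I j) I) \<star> h \<in> Einf n I" using h(1) by (rule Einf.mul)
    moreover have "({1..n} - I) \<inter> I = {}" by blast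
    ultimately show ?case using rho_mult[OF fin I(2)] rho_gen[OF fin I(2) l(2)] h(2) l(1) by metis
  }
qed

lemma lift_diff: "lift (a - b) = lift a - lift b"
  using lift_add[of "a - b" b] by (simp add: algebra_simps)

lemma lift_const: "lift (sg 0 c) = sc c"
proof -
  have "pp 0 = 0" by (simp add: pp_def)
  then show ?thesis by (simp add: lift_single sc_def)
qed

lemma mu_lift: "mu I c = sone + lift (sg 0 c - 1) \<star> eI I"
  by (simp add: mu_def lift_diff lift_const smul_diff_left)

lemma const_Lv: "sg 0 c - 1 \<in> Lv A"
  by (intro LvD(3) LvD(1) Lv_single) simp

lemma eI_idem: "finite I \<Longrightarrow> eI I \<star> eI I = eI I"
  by (simp add: eI_EI EI_mult)

lemma sc_mult: "sc c \<star> sc d = sc (c * d)"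
  by (simp add: sc_def smul_single)

lemma sc_commute: "f \<star> sc c = sc c \<star> f"
  by (rule pm_induct_sum[of "\<lambda>f. f \<star> sc c = sc c \<star> f"])
    (simp_all add: smul_add_left smul_add_right sc_def smul_single mult.commute)

lemma mu_mult:
  assumes "finite I" shows "mu I c \<star> mu I d = mu I (c * d)"
proof -
  have 1: "sc c \<star> (sc d \<star> eI I) = sc (c * d) \<star> eI I" by (simp add: sc_mult flip: smul_assoc)
  have 2: "eI I \<star> (sc d \<star> eI I) = sc d \<star> eI I"
    using smul_left_commute[OF sc_commute, of "eI I" d "eI I"] by (simp add: eI_idem[OF assms])
  show ?thesis unfolding mu_def
    by (simp add: smul_add_left smul_add_right smul_diff_left smul_diff_right 1 2 eI_idem[OF assms] smul_assoc)
qed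

lemma mu_one: "mu I 1 = sone"
  by (simp add: mu_def sone_def[symmetric])

lemma mu_gp:
  assumes "I \<subseteq> {1..n}" "c \<noteq> 0" shows "mu I c \<in> gp n {J. I \<subseteq> J}"
proof -
  have fin: "finite I" using assms(1) finite_subset by blast
  have i: "mu I c - sone \<in> idl n {J. I \<subseteq> J}" for c :: 'a
  proof -
    have "mu I c - sone = lift (sg 0 c - 1) \<star> EI (\<lambda>_. 0) (\<lambda>_. 0) I" by (simp add: mu_lift eI_EI)
    also have "\<dots> \<in> idl n {J. I \<subseteq> J}" by (rule idl_EI[OF assms(1) Sn_lift[of _ _ "{}"]]) (rule const_Lv)
    finally show ?thesis .
  qed
  have S: "mu I c \<in> Sn n" for c :: 'a using Sn_add[OF Sn_one idl_Sn[OF i[of c]]] by simp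
  show ?thesis by (rule gpI[OF S S[of "inverse c"] _ _ i]) (simp_all add: mu_mult[OF fin] assms(2) mu_one)
qed

lemma UE_gp: "I \<subseteq> {1..n} \<Longrightarrow> w \<in> UE n I \<Longrightarrow> w \<in> gp n {J. I \<subseteq> J}"
  unfolding UE_def using gp_mul[OF mu_gp Einf_gp] by blast

lemma UE_Einf: "w \<in> UE n I \<Longrightarrow> g \<in> Einf n I \<Longrightarrow> w \<star> g \<in> UE n I"
proof -
  assume "w \<in> UE n I" and g: "g \<in> Einf n I"
  then obtain c h where "w = mu I c \<star> h" "c \<noteq> 0" "h \<in> Einf n I" by (auto simp: UE_def)
  then show ?thesis unfolding UE_def using Einf.mul[OF _ g] smul_assoc by blast
qed

text \<open>Lifting the factorisation of the stable \<open>K\<^sub>1\<close>: at a minimal index set \<open>I\<close>, the matrix of \<open>u\<close> is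
  the one of an element of \<open>UE n I\<close> as soon as its determinant is a constant.\<close>

lemma gp_K1:
  fixes u :: "'k::field sn"
  assumes u: "u \<in> gp n JJ" and up: "\<And>I I'. I \<in> JJ \<Longrightarrow> I \<subseteq> I' \<Longrightarrow> I' \<subseteq> {1..n} \<Longrightarrow> I' \<in> JJ"
    and I: "I \<subseteq> {1..n}" "I \<noteq> {}" and min: "\<And>I'. I' \<subset> I \<Longrightarrow> I' \<notin> JJ"
  obtains \<kappa> c g where "c \<noteq> 0" "ky \<kappa> \<subseteq> {1..n} - I" "Dt (rho I u) = emb (sg \<kappa> c)" "g \<in> Einf n I"
    "rho I u = rho I ((sone + lift (sg \<kappa> c - 1) \<star> eI I) \<star> g)"
proof -
  have fin: "finite I" using I finite_subset by blast
  obtain v where v: "v \<in> gp n JJ" "u \<star> v = sone" "v \<star> u = sone" using gp_inverse[OF u] by metis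
  have "\<exists>r. rho I x \<in> bdd r" if "x \<in> gp n JJ" for x
    by (rule gp_rho_bdd[OF that _ I(1) _ I(2)], rule up, assumption+, rule min)
  then obtain r r' where r: "rho I u \<in> bdd r" and r': "rho I v \<in> bdd r'" using u v(1) by blast
  have b: "rho I u \<in> bdd (max r r')" "rho I v \<in> bdd (max r r')" using r r' by (auto intro: bdd_mono)
  have inv: "rho I u * rho I v = 1" "rho I v * rho I u = 1"
    by (simp_all add: rho_mult[OF fin I(2), symmetric] v rho_one[OF fin I(2)])
  have finY: "finite ({1..n} - I)" by simp
  obtain \<kappa> c where k: "c \<noteq> 0" "ky \<kappa> \<subseteq> {1..n} - I" "Dt (rho I u) = emb (sg \<kappa> c)"
    "\<And>p. \<exists>\<epsilon>\<in>elm (emb ` Lv ({1..n} - I)). rho I u = (1 + mun p p (emb (sg \<kappa> c) - 1)) * \<epsilon>"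
    by (rule stable_K1_laurent[OF finY b rho_over[OF fin I(2) gp_Sn[OF u]] rho_over[OF fin I(2) gp_Sn[OF v(1)]] inv]) blast
  obtain z where z: "\<And>l A. (l :: 'k lau) \<in> Lv A \<Longrightarrow> A \<inter> I = {} \<Longrightarrow> rho I (sone + lift l \<star> eI I) = 1 + mun z z (emb l)"
    using rho_eI[OF fin I(2), where 'k = 'k] by blast
  obtain \<epsilon> where e: "\<epsilon> \<in> elm (emb ` Lv ({1..n} - I))" "rho I u = (1 + mun z z (emb (sg \<kappa> c) - 1)) * \<epsilon>"
    using k(4) by blast
  obtain g where g: "g \<in> Einf n I" "rho I g = \<epsilon>" using Einf_lift[OF I e(1)] by blast
  have "sg \<kappa> c - 1 \<in> Lv ({1..n} - I)" by (intro LvD(3) LvD(1) Lv_single k(2))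
  then have "rho I (sone + lift (sg \<kappa> c - 1) \<star> eI I) = 1 + mun z z (emb (sg \<kappa> c) - 1)" using z by force
  then have "rho I u = rho I ((sone + lift (sg \<kappa> c - 1) \<star> eI I) \<star> g)" using e(2) g(2) by (simp add: rho_mult[OF fin I(2)])
  then show thesis using that k(1-3) g(1) by blast
qed


section \<open>The elements \<open>\<theta>\<close> and their determinants\<close>

lemma Yg_Xg: "Yg i \<star> Xg i = sone"
  by (simp add: Yg_def Xg_def smul_single bmul_def sone_def sc_def)

lemma ee_XY: "ee i = sone - Xg i \<star> Yg i"
  by (simp add: ee_def Est_eq Yg_def Xg_def smul_single bmul_def sone_def sc_def)

lemma Yg_ee: "Yg i \<star> ee i = 0"
  by (simp add: ee_XY smul_diff_right Yg_Xg flip: smul_assoc)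

lemma ee_Xg: "ee i \<star> Xg i = 0"
  by (simp add: ee_XY smul_diff_left Yg_Xg smul_assoc)

lemma lift_Xg: "lift (sg (sg i 1) 1) = Xg i"
proof -
  have "pp (sg i 1) = sg i 1" "pp (- sg i 1) = 0"
    by (rule poly_mapping_eqI, simp add: lookup_pp lookup_single when_def)+
  then show ?thesis by (simp add: lift_single Xg_def)
qed

lemma lift_Yg: "lift (sg (sg i (- 1)) 1) = Yg i"
proof -
  have "pp (sg i (- 1)) = 0" "pp (- sg i (- 1)) = sg i 1"
    by (rule poly_mapping_eqI, simp add: lookup_pp lookup_single when_def)+
  then show ?thesis by (simp add: lift_single Yg_def)
qed

lemma eI_remove:
  assumes "finite J" "i \<in> J" shows "eI J = ee i \<star> eI (J - {i})"
  using EI_insert[of "J - {i}" i "\<lambda>_. 0" "\<lambda>_. 0"] assms by (simp add: insert_absorb eI_EI ee_def)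

lemma eI_commute:
  assumes "finite J" "a \<in> alg_gen {i}" shows "eI (J - {i}) \<star> a = a \<star> eI (J - {i})"
  unfolding eI_EI by (rule alg_gen_commute[OF EI_alg_gen[of "J - {i}" "J - {i}"] assms(2)]) (use assms(1) in auto)

text \<open>\<open>Pf\<close> and \<open>Qf\<close> are the shifts down and up along the axis
  \<open>i\<close> of \<open>J\<close>, trivial off the axis. They are one-sided inverses with
  defect \<open>eI J\<close>, hence of opposite index, which is why \<theta> combines one of
  each.\<close>

definition Pf :: "nat \<Rightarrow> nat set \<Rightarrow> 'k::field sn" where
  "Pf i J = sone + (Yg i - sone) \<star> eI (J - {i})"

definition Qf :: "nat \<Rightarrow> nat set \<Rightarrow> 'k::field sn" where
  "Qf i J = sone + (Xg i - sone) \<star> eI (J - {i})"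

lemma theta_eq: "theta i j J = Pf i J \<star> Qf j J"
  by (simp add: theta_def Pf_def Qf_def)

lemma one_plus_mult:
  assumes "finite J" "b \<in> alg_gen {i}"
  shows "(sone + a \<star> eI (J - {i})) \<star> (sone + b \<star> eI (J - {i})) = sone + (a + b + a \<star> b) \<star> eI (J - {i})"
proof -
  have "(a \<star> eI (J - {i})) \<star> (b \<star> eI (J - {i})) = (a \<star> b) \<star> eI (J - {i})"
    using smul_interchange[OF eI_commute[OF assms], of a "eI (J - {i})"] assms(1) by (simp add: eI_idem)
  then show ?thesis by (simp add: smul_add_left smul_add_right)
qed

lemma XY_alg_gen: "Xg i - sone \<in> alg_gen {i}" "Yg i - sone \<in> alg_gen {i}"
  by (intro alg_gen_diff alg_gen.genx alg_gen.geny alg_gen_one singletonI)+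

lemma Pf_Qf: assumes "finite J" shows "Pf i J \<star> Qf i J = sone"
proof -
  have 0: "(Yg i - sone) + (Xg i - sone) + (Yg i - sone) \<star> (Xg i - sone) = 0"
    by (simp add: smul_diff_left smul_diff_right Yg_Xg)
  show ?thesis unfolding Pf_def Qf_def one_plus_mult[OF assms XY_alg_gen(1)] 0 by simp
qed

lemma Qf_Pf: assumes "finite J" "i \<in> J" shows "Qf i J \<star> Pf i J = sone - eI J"
proof -
  have 0: "(Xg i - sone) + (Yg i - sone) + (Xg i - sone) \<star> (Yg i - sone) = - ee i"
    by (simp add: smul_diff_left smul_diff_right ee_XY)
  show ?thesis unfolding Pf_def Qf_def one_plus_mult[OF assms(1) XY_alg_gen(2)] 0 eI_remove[OF assms] by simp
qed

lemma Pf_eI: assumes "finite J" "i \<in> J" shows "(Pf i J :: 'k::field sn) \<star> eI J = 0"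
proof -
  have c: "(ee i :: 'k sn) \<in> alg_gen {i}" by (simp add: ee_def Est_alg_gen)
  have "eI (J - {i}) \<star> (ee i \<star> eI (J - {i})) = (ee i \<star> eI (J - {i}) :: 'k sn)"
    by (simp add: smul_left_commute[OF eI_commute[OF assms(1) c]] eI_idem assms(1))
  then have 1: "eI (J - {i}) \<star> eI J = (eI J :: 'k sn)" by (simp add: eI_remove[OF assms])
  have 2: "(Yg i :: 'k sn) \<star> eI J = 0" by (simp add: eI_remove[OF assms] Yg_ee flip: smul_assoc)
  show ?thesis unfolding Pf_def by (simp add: smul_add_left smul_diff_left smul_assoc 1 2)
qed

text \<open>The defect \<open>eI J\<close> of \<open>Qf j J \<star> Pf j J\<close> is the same for
  all \<open>j \<in> J\<close>, and \<open>Pf i J\<close> annihilates it.\<close>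

lemma theta_inverse:
  assumes "finite J" "i \<in> J" "j \<in> J" shows "theta i j J \<star> theta j i J = sone"
proof -
  have "theta i j J \<star> theta j i J = (Pf i J \<star> (Qf j J \<star> Pf j J)) \<star> Qf i J" by (simp add: theta_eq smul_assoc)
  also have "\<dots> = Pf i J \<star> Qf i J - (Pf i J \<star> eI J) \<star> Qf i J"
    by (simp add: Qf_Pf[OF assms(1,3)] smul_diff_left smul_diff_right)
  finally show ?thesis by (simp add: Pf_Qf[OF assms(1)] Pf_eI[OF assms(1,2)])
qed

lemma Pf_Qf_idl:
  assumes "J \<subseteq> {1..n}" "i \<in> J"
  shows "Pf i J - sone \<in> idl n {I. J - {i} \<subseteq> I}" "Qf i J - sone \<in> idl n {I. J - {i} \<subseteq> I}"
proof -
  have s: "J - {i} \<subseteq> {1..n}" "{i} \<subseteq> {1..n}" using assms by auto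
  have x: "Xg i - sone \<in> Sn n" "Yg i - sone \<in> Sn n"
    unfolding Sn_def by (rule subsetD[OF alg_gen_mono[OF s(2)] XY_alg_gen(1)], rule subsetD[OF alg_gen_mono[OF s(2)] XY_alg_gen(2)])
  show "Pf i J - sone \<in> idl n {I. J - {i} \<subseteq> I}" "Qf i J - sone \<in> idl n {I. J - {i} \<subseteq> I}"
    using idl_EI[OF s(1) x(1)] idl_EI[OF s(1) x(2)] by (simp_all add: Pf_def Qf_def eI_EI)
qed

lemma theta_gp:
  assumes "J \<subseteq> {1..n}" "i \<in> J" "j \<in> J"
  shows "theta i j J \<in> gp n {I. J - {i} \<subseteq> I \<or> J - {j} \<subseteq> I}"
proof -
  have fin: "finite J" using assms finite_subset by blast
  have i: "theta i j J - sone \<in> idl n {I. J - {i} \<subseteq> I \<or> J - {j} \<subseteq> I}" if "i \<in> J" "j \<in> J" for i j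
  proof -
    have m: "idl n {I. J - {i} \<subseteq> I} \<subseteq> idl n {I. J - {i} \<subseteq> I \<or> J - {j} \<subseteq> I}"
      "idl n {I. J - {j} \<subseteq> I} \<subseteq> idl n {I. J - {i} \<subseteq> I \<or> J - {j} \<subseteq> I}" by (rule idl_mono, simp)+
    have Q: "Qf j J \<in> Sn n" using Sn_add[OF idl_Sn[OF Pf_Qf_idl(2)[OF assms(1) that(2)]] Sn_one] by simp
    have "theta i j J - sone = (Pf i J - sone) \<star> Qf j J + (Qf j J - sone)" by (simp add: theta_eq smul_diff_left)
    also have "\<dots> \<in> idl n {I. J - {i} \<subseteq> I \<or> J - {j} \<subseteq> I}"
      by (rule idl_add[OF idl_mult_right[OF subsetD[OF m(1) Pf_Qf_idl(1)[OF assms(1) that(1)]] Q] subsetD[OF m(2) Pf_Qf_idl(2)[OF assms(1) that(2)]]])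
    finally show ?thesis .
  qed
  have S: "theta i j J \<in> Sn n" if "i \<in> J" "j \<in> J" for i j using Sn_add[OF idl_Sn[OF i[OF that]] Sn_one] by simp
  show ?thesis
    by (rule gpI[OF S[OF assms(2,3)] S[OF assms(3,2)] theta_inverse[OF fin assms(2,3)] theta_inverse[OF fin assms(3,2)] i[OF assms(2,3)]])
qed

text \<open>The Laurent exponent of the determinant at \<open>I\<close> of the \<theta> with these
  data, for \<open>I\<close> with one element fewer than \<open>J\<close>; see
  \<open>Dt_theta\<close>.\<close>

definition th_exp :: "nat set \<Rightarrow> nat \<times> nat \<times> nat set \<Rightarrow> (nat \<Rightarrow>\<^sub>0 int)" where
  "th_exp I = (\<lambda>(m, j, J). if I = J - {m} then sg m (- 1) else if I = J - {j} then sg j 1 else 0)"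

text \<open>By size, \<open>I\<close> contains \<open>J - {k}\<close> only if it equals it. So at
  most one of the two factors is visible at \<open>I\<close>, and its determinant is a single
  variable or its inverse.\<close>

lemma Dt_theta:
  assumes J: "J \<subseteq> {1..n}" "m \<in> J" "j \<in> J" "m \<noteq> j" and I: "I \<subseteq> {1..n}" "I \<noteq> {}" "card J = Suc (card I)"
  shows "Dt (rho I (theta m j J)) = emb (sg (th_exp I (m, j, J)) (1 :: 'k::field))"
proof -
  have fin: "finite I" "finite J" using finite_subset I J by blast+
  have sub: "I = J - {k}" if "J - {k} \<subseteq> I" "k \<in> J" for k
    using card_subset_eq[OF fin(1) that(1)] that(2) I(3) fin by simp
  have mult: "rho I (theta m j J) = rho I (Pf m J) * (rho I (Qf j J) :: 'k lau fract cf)"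
    by (simp add: theta_eq rho_mult[OF fin(1) I(2)])
  have P: "rho I (Pf m J :: 'k sn) = 1" if "I \<noteq> J - {m}"
    by (rule rho_one_idl[OF Pf_Qf_idl(1)[OF J(1,2)] I(1) _ I(2)]) (use that sub[OF _ J(2)] in blast)
  have Q: "rho I (Qf j J :: 'k sn) = 1" if "I \<noteq> J - {j}"
    by (rule rho_one_idl[OF Pf_Qf_idl(2)[OF J(1,3)] I(1) _ I(2)]) (use that sub[OF _ J(3)] in blast)
  have l: "sg (sg k e) 1 - 1 \<in> (Lv {k} :: 'k lau set)" for k and e :: int
    by (intro LvD(3) LvD(1) Lv_single) simp
  have DP: "Dt (rho I (Pf m J :: 'k sn)) = emb (sg (sg m (- 1)) 1)" if "I = J - {m}"
  proof -
    have "Pf m J = (sone + lift (sg (sg m (- 1)) 1 - 1) \<star> eI I :: 'k sn)" by (simp add: Pf_def that lift_diff lift_Yg)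
    then show ?thesis using Dt_rho_eI[OF fin(1) I(2) l[of m "-1"]] that by simp
  qed
  have DQ: "Dt (rho I (Qf j J :: 'k sn)) = emb (sg (sg j 1) 1)" if "I = J - {j}"
  proof -
    have "Qf j J = (sone + lift (sg (sg j 1) 1 - 1) \<star> eI I :: 'k sn)" using lift_Xg[of j, where 'a = 'k] by (simp add: Qf_def that lift_diff)
    then show ?thesis using Dt_rho_eI[OF fin(1) I(2) l[of j 1]] that by simp
  qed
  have ne: "J - {m} \<noteq> J - {j}" using J by blast
  consider "I = J - {m}" | "I = J - {j}" "I \<noteq> J - {m}" | "I \<noteq> J - {m}" "I \<noteq> J - {j}" by blast
  then show ?thesis
  proof cases
    case 1
    then have "rho I (Qf j J :: 'k sn) = 1" "th_exp I (m, j, J) = sg m (- 1)" using Q ne by (simp_all add: th_exp_def)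
    then show ?thesis using DP[OF 1] by (simp add: mult)
  next
    case 2
    then have "th_exp I (m, j, J) = sg j 1" using ne by (auto simp: th_exp_def)
    then show ?thesis using DQ[OF 2(1)] P[OF 2(2)] by (simp add: mult)
  next
    case 3
    then show ?thesis using Q P by (simp add: mult th_exp_def Dt_one)
  qed
qed

definition zm :: "int \<Rightarrow> (nat \<Rightarrow>\<^sub>0 int) \<Rightarrow> (nat \<Rightarrow>\<^sub>0 int)" where
  "zm z \<kappa> = Poly_Mapping.map (\<lambda>e. z * e) \<kappa>"

lemma lookup_zm: "lk (zm z \<kappa>) k = z * lk \<kappa> k"
  by (simp add: zm_def map.rep_eq when_def)

text \<open>No proper subset of \<open>I\<close> is visible, so the matrices at \<open>I\<close> of
  the group for \<open>JJ\<close> are finite blocks and the stable determinant is multiplicative on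
  it.\<close>

locale minimal_index =
  fixes n :: nat and JJ :: "nat set set" and I :: "nat set"
  assumes up: "\<And>I I'. I \<in> JJ \<Longrightarrow> I \<subseteq> I' \<Longrightarrow> I' \<subseteq> {1..n} \<Longrightarrow> I' \<in> JJ"
    and I: "I \<subseteq> {1..n}" "I \<noteq> {}" and min: "\<And>I'. I' \<subset> I \<Longrightarrow> I' \<notin> JJ"
begin

lemma fin: "finite I" using I finite_subset by blast

lemma Dt_rho_mult:
  assumes "u \<in> gp n JJ" "v \<in> gp n JJ" shows "Dt (rho I (u \<star> v)) = Dt (rho I u) * Dt (rho I v)"
proof -
  have "\<exists>r. rho I x \<in> bdd r" if "x \<in> gp n JJ" for x
    by (rule gp_rho_bdd[OF that _ I(1) _ I(2)], rule up, assumption+, rule min)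
  then obtain r r' where "rho I u \<in> bdd r" "rho I v \<in> bdd r'" using assms by blast
  from Dt_mult[OF this] show ?thesis by (simp add: rho_mult[OF fin I(2)])
qed

lemma Dt_rho_spow:
  assumes "u \<in> gp n JJ" "Dt (rho I u) = emb (sg \<kappa> 1)"
  shows "Dt (rho I (spow u k)) = emb (sg (zm (int k) \<kappa>) 1)"
proof (induction k)
  case 0
  have "zm 0 \<kappa> = 0" by (rule poly_mapping_eqI) (simp add: lookup_zm)
  then show ?case by (simp add: spow_def rho_one[OF fin I(2)] Dt_one)
next
  case (Suc k)
  have z: "zm (1 + int k) \<kappa> = \<kappa> + zm (int k) \<kappa>"
    by (rule poly_mapping_eqI) (simp add: lookup_zm lookup_add algebra_simps)
  have "spow u (Suc k) = u \<star> spow u k" by (simp add: spow_def)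
  then show ?case
    using Dt_rho_mult[OF assms(1) gp_spow[OF assms(1), of k]] Suc assms(2)
    by (simp add: z mult_single flip: emb_simps(4))
qed

lemma Dt_rho_inverse:
  assumes "u \<in> gp n JJ" "v \<in> gp n JJ" "v \<star> u = sone" "Dt (rho I u) = emb (sg \<kappa> 1)"
  shows "Dt (rho I v) = emb (sg (- \<kappa>) 1)"
proof -
  have 1: "Dt (rho I v) * emb (sg \<kappa> 1) = 1"
    using Dt_rho_mult[OF assms(2,1)] assms(3,4) by (simp add: rho_one[OF fin I(2)] Dt_one)
  have 2: "emb (sg \<kappa> 1) * emb (sg (- \<kappa>) 1) = 1" by (simp add: mult_single flip: emb_simps(4))
  have "Dt (rho I v) * (emb (sg \<kappa> 1) * emb (sg (- \<kappa>) 1)) = emb (sg (- \<kappa>) 1)"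
    using 1 by (simp flip: mult.assoc)
  from this[unfolded 2 mult_1_right] show ?thesis .
qed

lemma Dt_rho_zpow:
  assumes "u \<in> gp n JJ" "Dt (rho I u) = emb (sg \<kappa> 1)"
  shows "Dt (rho I (zpow (Sn n) u z)) = emb (sg (zm z \<kappa>) 1)"
proof (cases "0 \<le> z")
  case True
  then show ?thesis using Dt_rho_spow[OF assms, of "nat z"] by (simp add: zpow_def)
next
  case False
  have "zm (- z) (- \<kappa>) = zm z \<kappa>" by (rule poly_mapping_eqI) (simp add: lookup_zm)
  then show ?thesis
    using False Dt_rho_spow[OF gp_sinv(1)[OF assms(1)] Dt_rho_inverse[OF assms(1) gp_sinv(1)[OF assms(1)] gp_sinv(3)[OF assms(1)] assms(2)], of "nat (- z)"]
    by (simp add: zpow_def)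
qed

lemma Dt_rho_sprod_list:
  assumes "\<And>x. x \<in> set xs \<Longrightarrow> f x \<in> gp n JJ" "\<And>x. x \<in> set xs \<Longrightarrow> Dt (rho I (f x)) = emb (sg (E x) 1)"
  shows "Dt (rho I (sprod_list (map f xs))) = emb (sg (\<Sum>x\<leftarrow>xs. E x) 1)"
  using assms
proof (induction xs)
  case Nil
  show ?case by (simp add: rho_one[OF fin I(2)] Dt_one)
next
  case (Cons x xs)
  have "sprod_list (map f xs) \<in> gp n JJ" by (rule gp_sprod_list) (use Cons.prems(1) in auto)
  then show ?case using Cons Dt_rho_mult[of "f x" "sprod_list (map f xs)"]
    by (simp add: mult_single flip: emb_simps(4))
qed

end

section \<open>The index relation\<close>

text \<open>Pad both matrices with zeros to squares of size \<open>card G\<close>. If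
  \<open>card G'\<close> were smaller, the one-sided identity would become two-sided, yet the
  product in the other order has a zero row.\<close>

lemma rectangular_left_inverse:
  fixes A :: "'a \<Rightarrow> 'b \<Rightarrow> 'f::field" and B :: "'b \<Rightarrow> 'a \<Rightarrow> 'f"
  assumes "finite G" "finite G'"
    and inv: "\<And>\<beta> \<beta>'. \<beta> \<in> G \<Longrightarrow> \<beta>' \<in> G \<Longrightarrow> (\<Sum>\<alpha>\<in>G'. B \<beta> \<alpha> * A \<alpha> \<beta>') = (if \<beta> = \<beta>' then 1 else 0)"
  shows "card G \<le> card G'"
proof (rule ccontr)
  let ?b = "card G" and ?a = "card G'"
  assume "\<not> ?b \<le> ?a"
  then have ab: "?a < ?b" by simp
  obtain h where h: "bij_betw h {0..<?b} G" using ex_bij_betw_nat_finite[OF assms(1)] by blast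
  obtain h' where h': "bij_betw h' {0..<?a} G'" using ex_bij_betw_nat_finite[OF assms(2)] by blast
  define M where "M = mat ?b ?b (\<lambda>(i, j). if j < ?a then B (h i) (h' j) else 0)"
  define N where "N = mat ?b ?b (\<lambda>(i, j). if i < ?a then A (h' i) (h j) else 0)"
  have c: "M \<in> carrier_mat ?b ?b" "N \<in> carrier_mat ?b ?b" by (simp_all add: M_def N_def)
  have "M * N = 1\<^sub>m ?b"
  proof (rule eq_matI)
    fix i j assume "i < dim_row (1\<^sub>m ?b :: 'f Matrix.mat)" "j < dim_col (1\<^sub>m ?b :: 'f Matrix.mat)"
    then have ij: "i < ?b" "j < ?b" by simp_all
    have "(M * N) $$ (i, j) = (\<Sum>k\<in>{0..<?b}. (if k < ?a then B (h i) (h' k) * A (h' k) (h j) else 0))"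
      using ij by (simp add: M_def N_def scalar_prod_def) (rule sum.cong, auto)
    also have "\<dots> = (\<Sum>k\<in>{0..<?a}. B (h i) (h' k) * A (h' k) (h j))"
      by (rule sum.mono_neutral_cong_right) (use ab in auto)
    also have "\<dots> = (\<Sum>\<alpha>\<in>G'. B (h i) \<alpha> * A \<alpha> (h j))" by (rule sum.reindex_bij_betw[OF h'])
    also have "\<dots> = (if h i = h j then 1 else 0)" using inv bij_betwE[OF h] ij by simp
    also have "\<dots> = 1\<^sub>m ?b $$ (i, j)" using bij_betw_imp_inj_on[OF h] ij by (auto simp: inj_on_def)
    finally show "(M * N) $$ (i, j) = 1\<^sub>m ?b $$ (i, j)" .
  qed (simp_all add: M_def N_def)
  then have "N * M = 1\<^sub>m ?b" by (rule mat_mult_left_right_inverse[OF c])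
  then have "(N * M) $$ (?a, ?a) = 1" using ab by simp
  moreover have "(N * M) $$ (?a, ?a) = 0" using ab by (simp add: M_def N_def scalar_prod_def)
  ultimately show False by simp
qed

lemma R_lift_eI:
  assumes "finite J" "\<beta> \<in> NI J"
  shows "R J (lift l \<star> eI (J - {j})) \<alpha> \<beta> = (if \<forall>k\<in>J - {j}. \<beta> k = 0 then R J (lift l) \<alpha> \<beta> else 0)"
proof -
  have e: "R J (eI (J - {j}) :: 'a sn) \<gamma> \<beta> = (if (\<forall>k\<in>J - {j}. \<beta> k = 0) \<and> \<gamma> = \<beta> then 1 else 0)" for \<gamma>
  proof -
    have "(\<lambda>k. if k \<in> J - {j} then 0 else \<beta> k) = \<beta>" if "\<forall>k\<in>J - {j}. \<beta> k = 0" using that by auto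
    then show ?thesis unfolding eI_EI using R_EI[of "J - {j}" J \<beta> "\<lambda>_. 0" "\<lambda>_. 0" \<gamma>, where 'k = 'a] assms by auto
  qed
  show ?thesis
  proof (cases "\<forall>k\<in>J - {j}. \<beta> k = 0")
    case True
    have "R J (lift l \<star> eI (J - {j})) \<alpha> \<beta> = R J (lift l) \<alpha> \<beta> * R J (eI (J - {j})) \<beta> \<beta>"
      by (rule R_mult_single_col) (simp add: e)
    then show ?thesis using True by (simp add: e)
  next
    case False
    have "R J (lift l \<star> eI (J - {j})) \<alpha> \<beta> = 0" by (rule R_mult_right_zero) (use False in \<open>auto simp: e\<close>)
    then show ?thesis unfolding if_not_P[OF False] .
  qed
qed

definition ax :: "nat set \<Rightarrow> nat \<Rightarrow> nat \<Rightarrow> (nat \<Rightarrow> nat)" where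
  "ax J j x = (\<lambda>i\<in>J. if i = j then x else 0)"

lemma ax_NI: "ax J j x \<in> NI J"
  by (simp add: ax_def NI_def)

lemma ax_apply: "i \<in> J \<Longrightarrow> ax J j x i = (if i = j then x else 0)"
  by (simp add: ax_def)

lemma ax_eqI: "\<beta> \<in> NI J \<Longrightarrow> \<forall>k\<in>J - {j}. \<beta> k = 0 \<Longrightarrow> \<beta> = ax J j (\<beta> j)"
  by (rule NI_eqI[OF _ ax_NI]) (auto simp: ax_def)

lemma act_ax:
  assumes "j \<in> J" "ky \<kappa> \<inter> (J - {j}) = {}" "0 \<le> int x + lk \<kappa> j"
  shows "act J (pp \<kappa>, pp (- \<kappa>)) (ax J j x) = Some (ax J j (nat (int x + lk \<kappa> j)))"
proof -
  have z: "lk \<kappa> i = 0" if "i \<in> J" "i \<noteq> j" for i using assms(2) that by (auto simp: in_keys_iff)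
  have "\<forall>i\<in>J. lk (snd (pp \<kappa>, pp (- \<kappa>))) i \<le> ax J j x i"
    using assms(3) z by (auto simp: lookup_pp ax_def)
  moreover have "(\<lambda>i\<in>J. ax J j x i - lk (snd (pp \<kappa>, pp (- \<kappa>))) i + lk (fst (pp \<kappa>, pp (- \<kappa>))) i) = ax J j (nat (int x + lk \<kappa> j))"
    using assms(3) z by (auto simp: lookup_pp ax_def restrict_def fun_eq_iff)
  ultimately show ?thesis unfolding act_def by simp
qed

lemma act_ax_Some:
  assumes "j \<in> J" "ky \<kappa> \<inter> (J - {j}) = {}" "act J (pp \<kappa>, pp (- \<kappa>)) (ax J j x) = Some \<alpha>"
  shows "\<alpha> = ax J j (nat (int x + lk \<kappa> j))"
proof -
  have "nat (- lk \<kappa> j) \<le> x" using assms(1,3) by (auto simp: act_def lookup_pp ax_def split: if_splits)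
  then have "0 \<le> int x + lk \<kappa> j" by simp
  then show ?thesis using act_ax[OF assms(1,2)] assms(3) by simp
qed

lemma R_lift_unit:
  assumes "\<beta> \<in> NI J"
  shows "R J (lift (sg \<kappa> c - 1)) \<alpha> \<beta> = (if act J (pp \<kappa>, pp (- \<kappa>)) \<beta> = Some \<alpha> then sg (dg J (pp \<kappa>, pp (- \<kappa>))) c else 0)
    - (if \<alpha> = \<beta> then 1 else 0)"
  by (simp add: lift_diff lift_single R_single R_one[OF assms])

text \<open>The counting argument: an invertible column-finite matrix which, far out on the axes \<open>j \<in> T\<close>,
  is the shift by \<open>\<delta> j\<close>, and is the identity elsewhere up to finitely many entries, has index zero.\<close>

lemma shift_index:
  fixes W W' :: "(nat \<Rightarrow> nat) \<Rightarrow> (nat \<Rightarrow> nat) \<Rightarrow> 'f::field" and \<delta> :: "nat \<Rightarrow> int"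
  assumes J: "finite J" "T \<subseteq> J" and M: "1 \<le> M" "\<And>j. j \<in> T \<Longrightarrow> \<bar>\<delta> j\<bar> \<le> int M"
    and far: "\<And>j x \<alpha>. j \<in> T \<Longrightarrow> M < x \<Longrightarrow> W \<alpha> (ax J j x) \<noteq> 0 \<Longrightarrow> \<alpha> = ax J j (nat (int x + \<delta> j))"
    and near: "\<And>\<alpha> \<beta>. \<beta> \<in> NI J \<Longrightarrow> \<not> (\<exists>j\<in>T. \<exists>x>M. \<beta> = ax J j x) \<Longrightarrow> W \<alpha> \<beta> \<noteq> 0 \<Longrightarrow>
      \<alpha> = \<beta> \<or> (\<forall>i\<in>J. \<alpha> i \<le> 2 * M \<and> \<beta> i \<le> 2 * M)"
    and NI: "\<And>\<alpha> \<beta>. W \<alpha> \<beta> \<noteq> 0 \<Longrightarrow> \<alpha> \<in> NI J" "\<And>\<alpha> \<beta>. W' \<alpha> \<beta> \<noteq> 0 \<Longrightarrow> \<alpha> \<in> NI J"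
    and fin: "\<And>\<beta>. finite {\<alpha>. W' \<alpha> \<beta> \<noteq> 0}"
    and inv1: "\<And>\<alpha> \<beta> G. \<beta> \<in> NI J \<Longrightarrow> finite G \<Longrightarrow> {\<gamma>. W \<gamma> \<beta> \<noteq> 0} \<subseteq> G \<Longrightarrow> (\<Sum>\<gamma>\<in>G. W' \<alpha> \<gamma> * W \<gamma> \<beta>) = (if \<alpha> = \<beta> then 1 else 0)"
    and inv2: "\<And>\<alpha> \<beta> G. \<beta> \<in> NI J \<Longrightarrow> finite G \<Longrightarrow> {\<gamma>. W' \<gamma> \<beta> \<noteq> 0} \<subseteq> G \<Longrightarrow> (\<Sum>\<gamma>\<in>G. W \<alpha> \<gamma> * W' \<gamma> \<beta>) = (if \<alpha> = \<beta> then 1 else 0)"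
  shows "(\<Sum>j\<in>T. \<delta> j) = 0"
proof -
  \<comment> \<open>Shifts are at most \<open>M\<close>, so the moved cutoff
    \<open>N + \<delta> j\<close> is still at least \<open>2 * M\<close> and the natural-number
    subtractions in the count are exact.\<close>
  define N where "N = 3 * M"
  define isfar where "isfar \<beta> \<longleftrightarrow> (\<exists>j\<in>T. \<exists>x>2 * M. \<beta> = ax J j x)" for \<beta>
  define H where "H = {\<beta> \<in> NI J. (\<forall>i\<in>J. \<beta> i \<le> N) \<and> \<not> isfar \<beta>}"
  \<comment> \<open>A finite region in which only the cutoffs \<open>f j\<close> on the axes vary;
    \<open>cardG\<close> computes its size from them.\<close>
  define Gs where "Gs f = H \<union> (\<Union>j\<in>T. ax J j ` {2 * M<..f j})" for f :: "nat \<Rightarrow> nat"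
  have finT: "finite T" using J finite_subset by blast
  have "H \<subseteq> PiE J (\<lambda>_. {..N})" by (auto simp: H_def NI_def PiE_def)
  then have finH: "finite H" using finite_PiE[OF J(1), of "\<lambda>_. {..N}"] finite_subset by blast
  have finG: "finite (Gs f)" for f using finH finT by (simp add: Gs_def)
  have GNI: "\<beta> \<in> NI J" if "\<beta> \<in> Gs f" for \<beta> f using that by (auto simp: Gs_def H_def ax_NI)
  have ax_eq: "i = j \<and> x = y" if "ax J i x = ax J j y" "i \<in> T" "j \<in> T" "2 * M < x" for i j x y
    using fun_cong[OF that(1), of i] ax_apply[of i J i x] ax_apply[of i J j y] J(2) that by (auto split: if_splits)
  have far_mem: "ax J j x \<in> Gs f \<longleftrightarrow> x \<le> f j" if "j \<in> T" "2 * M < x" for j x f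
  proof
    assume "ax J j x \<in> Gs f"
    moreover have "isfar (ax J j x)" using that by (auto simp: isfar_def)
    ultimately obtain i y where "i \<in> T" "ax J j x = ax J i y" "y \<le> f i" by (auto simp: Gs_def H_def)
    then show "x \<le> f j" using ax_eq[of j x i y] that by auto
  next
    assume "x \<le> f j"
    then have "ax J j x \<in> ax J j ` {2 * M<..f j}" using that by simp
    then show "ax J j x \<in> Gs f" using that unfolding Gs_def by blast
  qed
  have near_mem: "\<beta> \<in> Gs f \<longleftrightarrow> (\<forall>i\<in>J. \<beta> i \<le> N)" if "\<beta> \<in> NI J" "\<not> isfar \<beta>" for \<beta> f
  proof -
    have "\<beta> \<noteq> ax J j x" if "j \<in> T" "2 * M < x" for j x using \<open>\<not> isfar \<beta>\<close> that unfolding isfar_def by blast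
    then have "\<beta> \<notin> (\<Union>j\<in>T. ax J j ` {2 * M<..f j})"
      unfolding UN_iff image_iff Bex_def greaterThanAtMost_iff by blast
    then show ?thesis using that by (simp add: Gs_def H_def)
  qed
  have cardG: "card (Gs f) = card H + (\<Sum>j\<in>T. f j - 2 * M)" for f
  proof -
    have "card (ax J j ` {2 * M<..f j}) = f j - 2 * M" if "j \<in> T" for j
      using that by (subst card_image) (auto intro!: inj_onI dest: ax_eq)
    moreover have "card (\<Union>j\<in>T. ax J j ` {2 * M<..f j}) = (\<Sum>j\<in>T. card (ax J j ` {2 * M<..f j}))"
      by (rule card_UN_disjoint[OF finT]) (auto dest: ax_eq)
    moreover have "H \<inter> (\<Union>j\<in>T. ax J j ` {2 * M<..f j}) = {}"
      unfolding H_def isfar_def disjoint_iff UN_iff image_iff Bex_def greaterThanAtMost_iff mem_Collect_eq by blast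
    ultimately show ?thesis unfolding Gs_def using finH finT by (simp add: card_Un_disjoint)
  qed
  define f f' where "f = (\<lambda>j::nat. N)" and "f' = (\<lambda>j. nat (int N + \<delta> j))"
  \<comment> \<open>With cutoffs moved along with the shift, \<open>W\<close> links inside to inside
    and outside to outside. Cutting \<open>W\<close> and \<open>W'\<close> to the two regions
    therefore keeps both products equal to the identity, and the regions have equal size.\<close>
  have key: "\<alpha> \<in> Gs f' \<longleftrightarrow> \<beta> \<in> Gs f" if b: "\<beta> \<in> NI J" and w: "W \<alpha> \<beta> \<noteq> 0" for \<alpha> \<beta>
  proof (cases "\<exists>j\<in>T. \<exists>x>M. \<beta> = ax J j x")
    case True
    then obtain j x where jx: "j \<in> T" "M < x" "\<beta> = ax J j x" by blast
    then have a: "\<alpha> = ax J j (nat (int x + \<delta> j))" using far w by blast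
    have d: "\<bar>\<delta> j\<bar> \<le> int M" by (rule M(2)[OF jx(1)])
    have small: "ax J j y \<in> Gs g" if "y \<le> 2 * M" for y g
    proof -
      have "\<not> isfar (ax J j y)"
      proof
        assume "isfar (ax J j y)"
        then obtain i x where ix: "i \<in> T" "2 * M < x" "ax J j y = ax J i x" by (auto simp: isfar_def)
        from ax_eq[OF ix(3)[symmetric] ix(1) jx(1) ix(2)] show False using that ix(2) by simp
      qed
      moreover have "\<forall>i\<in>J. ax J j y i \<le> N" using that by (auto simp: ax_def N_def)
      ultimately show ?thesis using near_mem[OF ax_NI] by blast
    qed
    have 1: "\<beta> \<in> Gs f \<longleftrightarrow> x \<le> N"
      using far_mem[OF jx(1), of x f] small[of x f] jx(3) by (cases "2 * M < x") (auto simp: f_def N_def)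
    have 2: "\<alpha> \<in> Gs f' \<longleftrightarrow> int x + \<delta> j \<le> int N + \<delta> j"
    proof (cases "2 * M < nat (int x + \<delta> j)")
      case True
      then show ?thesis using far_mem[OF jx(1) True, of f'] a d jx(2) by (auto simp: f'_def N_def)
    next
      case False
      then show ?thesis using small[of "nat (int x + \<delta> j)" f'] a d jx(2) by (auto simp: N_def)
    qed
    show ?thesis using 1 2 by simp
  next
    case False
    have nb: "\<not> isfar \<beta>" using False by (auto simp: isfar_def)
    from near[OF b False w] show ?thesis
    proof
      assume "\<alpha> = \<beta>"
      then show ?thesis using near_mem[OF b nb] by blast
    next
      assume *: "\<forall>i\<in>J. \<alpha> i \<le> 2 * M \<and> \<beta> i \<le> 2 * M"
      have "\<not> isfar \<alpha>"
      proof
        assume "isfar \<alpha>"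
        then obtain j x where j: "j \<in> T" "2 * M < x" "\<alpha> = ax J j x" by (auto simp: isfar_def)
        then have "\<alpha> j = x" using J(2) ax_apply[of j J j x] by auto
        then show False using * j J(2) by (meson subsetD not_le)
      qed
      moreover have "\<forall>i\<in>J. \<alpha> i \<le> N" "\<forall>i\<in>J. \<beta> i \<le> N" using * by (force simp: N_def)+
      ultimately show ?thesis using near_mem[OF b nb] near_mem[OF NI(1)[OF w]] by blast
    qed
  qed
  have "card (Gs f) \<le> card (Gs f')"
  proof (rule rectangular_left_inverse[OF finG finG])
    fix \<beta> \<beta>' assume b: "\<beta> \<in> Gs f" "\<beta>' \<in> Gs f"
    show "(\<Sum>\<alpha>\<in>Gs f'. W' \<beta> \<alpha> * W \<alpha> \<beta>') = (if \<beta> = \<beta>' then 1 else 0)"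
      by (rule inv1[OF GNI[OF b(2)] finG]) (use key[OF GNI[OF b(2)]] b(2) in blast)
  qed
  moreover have "card (Gs f') \<le> card (Gs f)"
  proof (rule rectangular_left_inverse[OF finG finG])
    fix \<alpha> \<alpha>' assume a: "\<alpha> \<in> Gs f'" "\<alpha>' \<in> Gs f'"
    let ?K = "Gs f \<union> {\<gamma>. W' \<gamma> \<alpha>' \<noteq> 0}"
    have "(\<Sum>\<gamma>\<in>Gs f. W \<alpha> \<gamma> * W' \<gamma> \<alpha>') = (\<Sum>\<gamma>\<in>?K. W \<alpha> \<gamma> * W' \<gamma> \<alpha>')"
    proof (rule sum.mono_neutral_left)
      show "finite ?K" using finG fin by simp
      show "\<forall>\<gamma>\<in>?K - Gs f. W \<alpha> \<gamma> * W' \<gamma> \<alpha>' = 0"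
      proof
        fix \<gamma> assume g: "\<gamma> \<in> ?K - Gs f"
        then have "\<gamma> \<in> NI J" using NI(2) by blast
        then have "W \<alpha> \<gamma> = 0" using key[of \<gamma> \<alpha>] a(1) g by blast
        then show "W \<alpha> \<gamma> * W' \<gamma> \<alpha>' = 0" by simp
      qed
    qed blast
    also have "\<dots> = (if \<alpha> = \<alpha>' then 1 else 0)" by (rule inv2[OF GNI[OF a(2)]]) (use finG fin in auto)
    finally show "(\<Sum>\<gamma>\<in>Gs f. W \<alpha> \<gamma> * W' \<gamma> \<alpha>') = (if \<alpha> = \<alpha>' then 1 else 0)" .
  qed
  ultimately have "(\<Sum>j\<in>T. f j - 2 * M) = (\<Sum>j\<in>T. f' j - 2 * M)" by (simp add: cardG)
  then have "(\<Sum>j\<in>T. int (f j - 2 * M)) = (\<Sum>j\<in>T. int (f' j - 2 * M))" by (simp flip: of_nat_sum)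
  moreover have "int (f' j - 2 * M) = int (f j - 2 * M) + \<delta> j" if "j \<in> T" for j
    using M(2)[OF that] by (auto simp: f_def f'_def N_def)
  ultimately show ?thesis by (simp add: sum.distrib)
qed


text \<open>The elements \<open>g j\<close> account for everything visible at the facets
  \<open>J - {j}\<close>; what remains acts on the basis of \<open>J\<close> with finite support. So
  \<open>w\<close> is the identity corrected by shifts along the axes in \<open>T\<close> and by
  finitely many entries, and \<open>shift_index\<close> applies over the fraction field.\<close>

lemma index_sum:
  fixes w :: "'k::field sn"
  assumes w: "w \<in> gp n JJ" and up: "\<And>I I'. I \<in> JJ \<Longrightarrow> I \<subseteq> I' \<Longrightarrow> I' \<subseteq> {1..n} \<Longrightarrow> I' \<in> JJ"
    and J: "J \<subseteq> {1..n}" and max: "\<And>I. I \<subset> J \<Longrightarrow> I \<in> JJ \<Longrightarrow> \<exists>j\<in>J. I = J - {j}"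
    and T: "T = {j \<in> J. J - {j} \<in> JJ}" and k: "\<And>j. j \<in> T \<Longrightarrow> ky (\<kappa> j) \<subseteq> {1..n} - (J - {j})"
    and Rw: "\<And>j \<alpha> \<beta>. j \<in> T \<Longrightarrow> \<beta> \<in> NI (J - {j}) \<Longrightarrow>
      R (J - {j}) (w - sone) \<alpha> \<beta> = R (J - {j}) (lift (sg (\<kappa> j) (c j) - 1) \<star> eI (J - {j})) \<alpha> \<beta>"
  shows "(\<Sum>j\<in>T. lk (\<kappa> j) j) = 0"
proof -
  obtain w' where w': "w' \<in> gp n JJ" "w \<star> w' = sone" "w' \<star> w = sone" using gp_inverse[OF w] by metis
  have finJ: "finite J" using J finite_subset by blast
  have TJ: "T \<subseteq> J" using T by blast
  have finT: "finite T" using TJ finJ finite_subset by blast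
  define g where "g j = lift (sg (\<kappa> j) (c j) - 1) \<star> eI (J - {j})" for j
  have gi: "g j \<in> idl n {I. J - {j} \<subseteq> I}" if "j \<in> T" for j
  proof -
    have "sg (\<kappa> j) (c j) - 1 \<in> Lv ({1..n} - (J - {j}))" by (intro LvD(3) LvD(1) Lv_single k[OF that])
    from idl_EI[OF _ Sn_lift[OF this], of "J - {j}"] show ?thesis unfolding g_def eI_EI using J by blast
  qed
  have gz: "R I (g j) \<alpha> \<beta> = 0" if "j \<in> T" "I \<subseteq> {1..n}" "\<not> J - {j} \<subseteq> I" "\<beta> \<in> NI I" for I j \<alpha> \<beta>
    using gi[OF that(1)] that unfolding idl_def by blast
  define d where "d = w - sone - (\<Sum>j\<in>T. g j)"
  have Rd: "R I d \<alpha> \<beta> = R I (w - sone) \<alpha> \<beta> - (\<Sum>j\<in>T. R I (g j) \<alpha> \<beta>)" for I \<alpha> \<beta>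
    unfolding d_def by (simp only: R_diff R_sum)
  have d: "d \<in> idl n {I \<in> JJ. \<not> I \<subset> J}"
    unfolding idl_def
  proof (intro CollectI conjI allI impI ballI)
    show "d \<in> Sn n" unfolding d_def by (rule Sn_diff[OF idl_Sn[OF gp_idl[OF w]] Sn_sum[OF idl_Sn[OF gi]]])
    fix I \<alpha> \<beta> assume I: "I \<subseteq> {1..n}" "I \<notin> {I \<in> JJ. \<not> I \<subset> J}" "\<beta> \<in> NI I"
    show "R I d \<alpha> \<beta> = 0"
    proof (cases "I \<in> JJ")
      case False
      have 1: "R I (w - sone) \<alpha> \<beta> = 0" using gp_idl[OF w] I False unfolding idl_def by blast
      have "R I (g j) \<alpha> \<beta> = 0" if "j \<in> T" for j
        by (rule gz[OF that I(1) _ I(3)]) (use up[of "J - {j}" I] that T False I(1) in blast)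
      then show ?thesis unfolding Rd 1 by simp
    next
      case True
      then have "I \<subset> J" using I by blast
      then obtain i where i: "i \<in> J" "I = J - {i}" using max True by blast
      then have iT: "i \<in> T" using T True by blast
      have "(\<Sum>j\<in>T. R I (g j) \<alpha> \<beta>) = (\<Sum>j\<in>T. if j = i then R I (g i) \<alpha> \<beta> else 0)"
      proof (rule sum.cong[OF refl])
        fix j assume j: "j \<in> T"
        have "R I (g j) \<alpha> \<beta> = 0" if "j \<noteq> i" by (rule gz[OF j I(1) _ I(3)]) (use that i in blast)
        then show "R I (g j) \<alpha> \<beta> = (if j = i then R I (g i) \<alpha> \<beta> else 0)" by simp
      qed
      also have "\<dots> = R I (g i) \<alpha> \<beta>" using finT iT by (simp add: sum.delta)
      also have "\<dots> = R I (w - sone) \<alpha> \<beta>" using Rw[OF iT, of \<beta> \<alpha>] I(3) by (simp only: g_def i(2))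
      finally show ?thesis unfolding Rd by simp
    qed
  qed
  let ?D = "{(\<alpha>, \<beta>). \<beta> \<in> NI J \<and> R J d \<alpha> \<beta> \<noteq> 0}"
  have finD: "finite ?D"
  proof (rule idl_support[OF d _ J])
    fix I I' assume I: "I \<in> {I \<in> JJ. \<not> I \<subset> J}" "I \<subseteq> I'" "I' \<subseteq> {1..n}"
    then have "I' \<in> JJ" using up[of I I'] by blast
    then show "I' \<in> {I \<in> JJ. \<not> I \<subset> J}" using I by blast
  qed blast
  \<comment> \<open>Positive, and at least every coordinate in the support of the finite remainder
    and every shift length.\<close>
  define M where "M = Suc ((\<Sum>p\<in>?D. \<Sum>i\<in>J. fst p i + snd p i) + (\<Sum>j\<in>T. nat \<bar>lk (\<kappa> j) j\<bar>))"
  have MD: "\<alpha> i \<le> M \<and> \<beta> i \<le> M" if "R J d \<alpha> \<beta> \<noteq> 0" "\<beta> \<in> NI J" "i \<in> J" for \<alpha> \<beta> i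
  proof -
    have "fst (\<alpha>, \<beta>) i + snd (\<alpha>, \<beta>) i \<le> (\<Sum>i\<in>J. fst (\<alpha>, \<beta>) i + snd (\<alpha>, \<beta>) i)"
      by (rule member_le_sum[OF that(3) _ finJ]) simp
    also have "\<dots> \<le> (\<Sum>p\<in>?D. \<Sum>i\<in>J. fst p i + snd p i)"
      by (rule member_le_sum[of "(\<alpha>, \<beta>)" ?D "\<lambda>p. \<Sum>i\<in>J. fst p i + snd p i", OF _ _ finD]) (use that in simp_all)
    finally show ?thesis unfolding M_def fst_conv snd_conv by linarith
  qed
  have MT: "\<bar>lk (\<kappa> j) j\<bar> \<le> int M" if "j \<in> T" for j
  proof -
    have "nat \<bar>lk (\<kappa> j) j\<bar> \<le> (\<Sum>j\<in>T. nat \<bar>lk (\<kappa> j) j\<bar>)" by (rule member_le_sum[OF that _ finT]) simp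
    then show ?thesis unfolding M_def by linarith
  qed
  have kd: "ky (\<kappa> j) \<inter> (J - {j}) = {}" if "j \<in> T" for j using k[OF that] by blast
  have Wf: "R J w \<alpha> \<beta> = (if \<alpha> = \<beta> then 1 else 0) + (\<Sum>j\<in>T. R J (g j) \<alpha> \<beta>) + R J d \<alpha> \<beta>" if "\<beta> \<in> NI J" for \<alpha> \<beta>
    unfolding Rd R_diff R_one[OF that] by simp
  have gf: "R J (g j) \<alpha> \<beta> = (if \<forall>k\<in>J - {j}. \<beta> k = 0 then R J (lift (sg (\<kappa> j) (c j) - 1)) \<alpha> \<beta> else 0)" if "\<beta> \<in> NI J" for j \<alpha> \<beta>
    unfolding g_def by (rule R_lift_eI[OF finJ that])
  show ?thesis
  proof (rule shift_index[of J T M "\<lambda>j. lk (\<kappa> j) j" "\<lambda>\<alpha> \<beta>. emb (R J w \<alpha> \<beta>)" "\<lambda>\<alpha> \<beta>. emb (R J w' \<alpha> \<beta>)", OF finJ TJ _ MT])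
    show "1 \<le> M" by (simp add: M_def)
  next
    fix j x \<alpha> assume j: "j \<in> T" "M < x" and nz: "emb (R J w \<alpha> (ax J j x)) \<noteq> 0"
    have jJ: "j \<in> J" using j TJ by blast
    let ?b = "ax J j x"
    have "R J d \<alpha> ?b = 0"
    proof (rule ccontr)
      assume "R J d \<alpha> ?b \<noteq> 0"
      from MD[OF this ax_NI jJ] show False using j(2) ax_apply[OF jJ, of j x] by simp
    qed
    moreover have "(\<Sum>i\<in>T. R J (g i) \<alpha> ?b) = (\<Sum>i\<in>T. if i = j then R J (lift (sg (\<kappa> j) (c j) - 1)) \<alpha> ?b else 0)"
    proof (rule sum.cong[OF refl])
      fix i assume "i \<in> T"
      show "R J (g i) \<alpha> ?b = (if i = j then R J (lift (sg (\<kappa> j) (c j) - 1)) \<alpha> ?b else 0)"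
      proof (cases "i = j")
        case True
        have "\<forall>k\<in>J - {j}. ?b k = 0" by (simp add: ax_def)
        then have "R J (g j) \<alpha> ?b = R J (lift (sg (\<kappa> j) (c j) - 1)) \<alpha> ?b" unfolding gf[OF ax_NI] by (rule if_P)
        then show ?thesis using True by simp
      next
        case False
        have "\<not> (\<forall>k\<in>J - {i}. ?b k = 0)"
        proof
          assume "\<forall>k\<in>J - {i}. ?b k = 0"
          then have "?b j = 0" using jJ False by blast
          then show False using j(2) ax_apply[OF jJ, of j x] by simp
        qed
        then have "R J (g i) \<alpha> ?b = 0" unfolding gf[OF ax_NI] by (rule if_not_P)
        then show ?thesis using False by simp
      qed
    qed
    moreover have "\<dots> = R J (lift (sg (\<kappa> j) (c j) - 1)) \<alpha> ?b" using finT j(1) by (simp add: sum.delta)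
    ultimately have "R J w \<alpha> ?b = (if act J (pp (\<kappa> j), pp (- \<kappa> j)) ?b = Some \<alpha> then sg (dg J (pp (\<kappa> j), pp (- \<kappa> j))) (c j) else 0)"
      unfolding Wf[OF ax_NI] R_lift_unit[OF ax_NI] by simp
    then have "act J (pp (\<kappa> j), pp (- \<kappa> j)) ?b = Some \<alpha>" using nz by (auto split: if_splits)
    then show "\<alpha> = ax J j (nat (int x + lk (\<kappa> j) j))" by (rule act_ax_Some[OF jJ kd[OF j(1)]])
  next
    fix \<alpha> \<beta> assume b: "\<beta> \<in> NI J" and nf: "\<not> (\<exists>j\<in>T. \<exists>x>M. \<beta> = ax J j x)" and nz: "emb (R J w \<alpha> \<beta>) \<noteq> 0"
    show "\<alpha> = \<beta> \<or> (\<forall>i\<in>J. \<alpha> i \<le> 2 * M \<and> \<beta> i \<le> 2 * M)"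
    proof (cases "\<alpha> = \<beta>", simp, rule disjI2)
      assume ne: "\<alpha> \<noteq> \<beta>"
      show "\<forall>i\<in>J. \<alpha> i \<le> 2 * M \<and> \<beta> i \<le> 2 * M"
      proof (cases "R J d \<alpha> \<beta> = 0")
        case False
        show ?thesis
        proof
          fix i assume "i \<in> J"
          from MD[OF False b this] show "\<alpha> i \<le> 2 * M \<and> \<beta> i \<le> 2 * M" by auto
        qed
      next
        case True
        have s0: "(\<Sum>j\<in>T. R J (g j) \<alpha> \<beta>) \<noteq> 0"
        proof
          assume "(\<Sum>j\<in>T. R J (g j) \<alpha> \<beta>) = 0"
          then have "R J w \<alpha> \<beta> = 0" unfolding Wf[OF b] using True ne by simp
          then show False using nz by simp
        qed
        obtain j where j: "j \<in> T" "R J (g j) \<alpha> \<beta> \<noteq> 0"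
          by (rule sum.not_neutral_contains_not_neutral[OF s0], rule that)
        have jJ: "j \<in> J" using j TJ by blast
        have z: "\<forall>k\<in>J - {j}. \<beta> k = 0" "R J (lift (sg (\<kappa> j) (c j) - 1)) \<alpha> \<beta> \<noteq> 0"
          using j(2) unfolding gf[OF b] by (auto split: if_splits)
        have bx: "\<beta> = ax J j (\<beta> j)" by (rule ax_eqI[OF b z(1)])
        have "\<not> M < \<beta> j" using nf j(1) bx by blast
        then have bM: "\<beta> j \<le> M" by simp
        have "act J (pp (\<kappa> j), pp (- \<kappa> j)) \<beta> = Some \<alpha>" using z(2) ne unfolding R_lift_unit[OF b] by (auto split: if_splits)
        then have "act J (pp (\<kappa> j), pp (- \<kappa> j)) (ax J j (\<beta> j)) = Some \<alpha>" using bx by metis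
        then have ax: "\<alpha> = ax J j (nat (int (\<beta> j) + lk (\<kappa> j) j))" by (rule act_ax_Some[OF jJ kd[OF j(1)]])
        have nb: "nat (int (\<beta> j) + lk (\<kappa> j) j) \<le> 2 * M" using bM MT[OF j(1)] by linarith
        show ?thesis
        proof
          fix i assume i: "i \<in> J"
          have "\<alpha> i \<le> 2 * M" unfolding ax ax_apply[OF i] using nb by simp
          moreover have "\<beta> i \<le> 2 * M" using z(1) i bM by (cases "i = j") auto
          ultimately show "\<alpha> i \<le> 2 * M \<and> \<beta> i \<le> 2 * M" ..
        qed
      qed
    qed
  next
    fix \<alpha> \<beta> assume "emb (R J w \<alpha> \<beta>) \<noteq> 0"
    then show "\<alpha> \<in> NI J" using R_NI[of J w \<alpha> \<beta>] by auto
  next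
    fix \<alpha> \<beta> assume "emb (R J w' \<alpha> \<beta>) \<noteq> 0"
    then show "\<alpha> \<in> NI J" using R_NI[of J w' \<alpha> \<beta>] by auto
  next
    fix \<beta> show "finite {\<alpha>. emb (R J w' \<alpha> \<beta>) \<noteq> 0}" using finite_R_col[of J w' \<beta>] by simp
  next
    fix \<alpha> \<beta> G assume b: "\<beta> \<in> NI J" and G: "finite G" "{\<gamma>. emb (R J w \<gamma> \<beta>) \<noteq> 0} \<subseteq> G"
    have "R J (w' \<star> w) \<alpha> \<beta> = (\<Sum>\<gamma>\<in>G. R J w' \<alpha> \<gamma> * R J w \<gamma> \<beta>)" by (rule R_mult[OF G(1)]) (use G(2) in simp)
    from arg_cong[OF this, of emb] show "(\<Sum>\<gamma>\<in>G. emb (R J w' \<alpha> \<gamma>) * emb (R J w \<gamma> \<beta>)) = (if \<alpha> = \<beta> then 1 else 0)"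
      by (simp add: w'(3) R_one[OF b] split: if_splits)
  next
    fix \<alpha> \<beta> G assume b: "\<beta> \<in> NI J" and G: "finite G" "{\<gamma>. emb (R J w' \<gamma> \<beta>) \<noteq> 0} \<subseteq> G"
    have "R J (w \<star> w') \<alpha> \<beta> = (\<Sum>\<gamma>\<in>G. R J w \<alpha> \<gamma> * R J w' \<gamma> \<beta>)" by (rule R_mult[OF G(1)]) (use G(2) in simp)
    from arg_cong[OF this, of emb] show "(\<Sum>\<gamma>\<in>G. emb (R J w \<alpha> \<gamma>) * emb (R J w' \<gamma> \<beta>)) = (if \<alpha> = \<beta> then 1 else 0)"
      by (simp add: w'(2) R_one[OF b] split: if_splits)
  qed
qed

section \<open>Absorbing \<open>(1 + F\<^sub>n)\<^sup>*\<close>\<close>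

lemma EI_block_mult:
  assumes "finite I" "y \<in> alg_gen A" "A \<inter> I = {}"
  shows "(x \<star> EI \<alpha> \<beta> I) \<star> (y \<star> EI \<gamma> \<delta> I) = (if \<forall>i\<in>I. \<beta> i = \<gamma> i then (x \<star> y) \<star> EI \<alpha> \<delta> I else 0)"
proof -
  have "EI \<alpha> \<beta> I \<star> y = y \<star> EI \<alpha> \<beta> I"
    using alg_gen_commute[OF assms(2) EI_alg_gen[OF assms(1) subset_refl] assms(3)] by simp
  from smul_interchange[OF this, of x] show ?thesis by (simp add: EI_mult[OF assms(1)])
qed

text \<open>The 2 by 2 matrix with rows \<open>a, b\<close> and \<open>c, d\<close> at the positions
  \<open>p\<close> and \<open>q\<close>, with the identity elsewhere; hence the subtraction of
  \<open>sone\<close> on the diagonal. Entries need not commute with each other.\<close>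

definition blk :: "nat set \<Rightarrow> (nat \<Rightarrow> nat) \<Rightarrow> (nat \<Rightarrow> nat) \<Rightarrow> 'k::field sn \<Rightarrow> 'k sn \<Rightarrow> 'k sn \<Rightarrow> 'k sn \<Rightarrow> 'k sn" where
  "blk I p q a b c d = sone + ((a - sone) \<star> EI p p I + b \<star> EI p q I + c \<star> EI q p I + (d - sone) \<star> EI q q I)"

lemma blk_mult:
  fixes a b c d a' b' c' d' :: "'k::field sn"
  assumes I: "finite I" "A \<inter> I = {}" and pq: "\<exists>i\<in>I. p i \<noteq> q i"
    and m: "a' \<in> alg_gen A" "b' \<in> alg_gen A" "c' \<in> alg_gen A" "d' \<in> alg_gen A"
  shows "blk I p q a b c d \<star> blk I p q a' b' c' d' =
    blk I p q (a \<star> a' + b \<star> c') (a \<star> b' + b \<star> d') (c \<star> a' + d \<star> c') (c \<star> b' + d \<star> d')"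
proof -
  let ?P = "(a - sone) \<star> EI p p I + b \<star> EI p q I + c \<star> EI q p I + (d - sone) \<star> EI q q I"
  let ?Q = "(a' - sone) \<star> EI p p I + b' \<star> EI p q I + c' \<star> EI q p I + (d' - sone) \<star> EI q q I"
  have f: "(\<forall>i\<in>I. p i = q i) = False" "(\<forall>i\<in>I. q i = p i) = False" using pq by (auto dest: sym)
  note m' = alg_gen_diff[OF m(1) alg_gen_one] m(2,3) alg_gen_diff[OF m(4) alg_gen_one]
  note t = EI_block_mult[OF I(1) m'(1) I(2)] EI_block_mult[OF I(1) m'(2) I(2)]
    EI_block_mult[OF I(1) m'(3) I(2)] EI_block_mult[OF I(1) m'(4) I(2)]
  have PQ: "?P \<star> ?Q = ((a - sone) \<star> (a' - sone) + b \<star> c') \<star> EI p p I + ((a - sone) \<star> b' + b \<star> (d' - sone)) \<star> EI p q I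
    + (c \<star> (a' - sone) + (d - sone) \<star> c') \<star> EI q p I + (c \<star> b' + (d - sone) \<star> (d' - sone)) \<star> EI q q I"
    by (simp add: smul_add_left[of _ _ "EI _ _ _ \<star> _"] smul_add_left smul_add_right t f)
  have "blk I p q a b c d \<star> blk I p q a' b' c' d' = sone + ?P + ?Q + ?P \<star> ?Q"
    unfolding blk_def smul_add_left[of sone] smul_add_right[of _ sone] smul_one by (simp only: add.assoc add.commute add.left_commute)
  then show ?thesis unfolding PQ blk_def
    by (simp add: smul_add_left smul_diff_left smul_diff_right algebra_simps)
qed

locale two_block =
  fixes n :: nat and I :: "nat set" and p q :: "nat \<Rightarrow> nat"
  assumes I: "finite I" and pq: "\<exists>i\<in>I. p i \<noteq> q i"
begin

abbreviation "A \<equiv> {1..n} - I"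

lemma disj: "A \<inter> I = {}" by blast

lemma upper: "x \<in> alg_gen A \<Longrightarrow> blk I p q sone x 0 sone \<in> Einf n I"
  unfolding blk_def using Einf.gen[of x n I p q] pq by simp

lemma lower: "x \<in> alg_gen A \<Longrightarrow> blk I p q sone 0 x sone \<in> Einf n I"
proof -
  assume x: "x \<in> alg_gen A"
  have "\<exists>i\<in>I. q i \<noteq> p i" using pq by metis
  from Einf.gen[OF x this] show ?thesis by (simp add: blk_def)
qed

lemmas mult = blk_mult[OF I disj pq]

text \<open>Upper \<open>a\<close>, lower \<open>- b\<close>, upper \<open>a\<close>: the usual
  product giving a monomial matrix. Since \<open>b\<close> is an inverse of \<open>a\<close> on one
  side only, the defect \<open>sone - a \<star> b\<close> appears in the corner.\<close>

lemma weyl: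
  assumes "a \<in> alg_gen A" "b \<in> alg_gen A" "b \<star> a = sone"
  shows "blk I p q (sone - a \<star> b) a (- b) 0 \<in> Einf n I"
proof -
  note z = alg_gen_zero[of A] alg_gen_one[of A]
  have "blk I p q sone a 0 sone \<star> blk I p q sone 0 (- b) sone = blk I p q (sone - a \<star> b) a (- b) sone"
    by (subst mult[OF z(2) z(1) alg_gen_uminus[OF assms(2)] z(2)]) simp
  moreover have "blk I p q (sone - a \<star> b) a (- b) sone \<star> blk I p q sone a 0 sone = blk I p q (sone - a \<star> b) a (- b) 0"
    by (subst mult[OF z(2) assms(1) z(1) z(2)]) (simp add: smul_diff_left smul_assoc assms(3))
  ultimately show ?thesis
    using Einf.mul[OF Einf.mul[OF upper[OF assms(1)] lower[OF alg_gen_uminus[OF assms(2)]]] upper[OF assms(1)]] by simp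
qed

text \<open>The element is the commutator of \<open>1 + x E\<^sub>p\<^sub>q\<close> and \<open>1 + y E\<^sub>q\<^sub>p\<close>.\<close>

lemma commutator:
  assumes "x \<in> alg_gen A" "y \<in> alg_gen A" "y \<star> x = 0"
  shows "sone + (x \<star> y) \<star> EI p p I \<in> Einf n I"
proof -
  note z = alg_gen_zero[of A] alg_gen_one[of A]
  have xy: "x \<star> y \<in> alg_gen A" using assms(1,2) by (rule alg_gen.mul)
  note s = alg_gen.add[OF z(2) xy] alg_gen_uminus[OF assms(1)] alg_gen_uminus[OF assms(2)]
  have 0: "y \<star> (x \<star> t) = 0" for t using assms(3) by (simp flip: smul_assoc)
  have 1: "blk I p q sone x 0 sone \<star> blk I p q sone 0 y sone = blk I p q (sone + x \<star> y) x y sone"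
    by (subst mult[OF z(2) z(1) assms(2) z(2)]) simp
  have 2: "blk I p q sone (- x) 0 sone \<star> blk I p q sone 0 (- y) sone = blk I p q (sone + x \<star> y) (- x) (- y) sone"
    by (subst mult[OF z(2) z(1) s(3) z(2)]) simp
  have 3: "blk I p q (sone + x \<star> y) x y sone \<star> blk I p q (sone + x \<star> y) (- x) (- y) sone = blk I p q (sone + x \<star> y) 0 0 sone"
    by (subst mult[OF s(1-3) z(2)]) (simp add: smul_add_left smul_add_right smul_assoc 0 assms(3))
  have "blk I p q (sone + x \<star> y) 0 0 sone \<in> Einf n I"
    unfolding 3[symmetric] unfolding 1[symmetric] 2[symmetric]
    by (intro Einf.mul upper lower assms(1,2) s)
  then show ?thesis by (simp add: blk_def)
qed

text \<open>With \<open>y x = 1\<close>, \<open>e = 1 - x y\<close>: the product of the diagonal-type matrices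
  \<open>[[x, -e], [0, y]]\<close> and \<open>[[y, 0], [-c e, x]]\<close> is \<open>diag (1 - e + c e, 1)\<close>; each of them is a product of
  two matrices as in \<open>weyl\<close>.\<close>

lemma diagonal:
  fixes c :: "'k::field"
  assumes j: "j \<in> A" and c: "c \<noteq> 0"
  shows "sone + (sc c \<star> ee j - ee j) \<star> EI p p I \<in> Einf n I"
proof -
  let ?x = "Xg j :: 'k sn" and ?y = "Yg j :: 'k sn" and ?e = "ee j :: 'k sn" and ?c = "sc c :: 'k sn" and ?d = "sc (inverse c) :: 'k sn"
  note z = alg_gen_zero[of A, where 'a = 'k] alg_gen_one[of A, where 'a = 'k]
  have x: "?x \<in> alg_gen A" and y: "?y \<in> alg_gen A" by (rule alg_gen.genx[OF j], rule alg_gen.geny[OF j])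
  have e: "?e \<in> alg_gen A" unfolding ee_def by (rule Est_alg_gen[OF j])
  have sc: "?c \<in> alg_gen A" "?d \<in> alg_gen A" by (rule alg_gen.scal)+
  have cd: "?c \<star> ?d = sone" "?d \<star> ?c = sone" using c by (simp_all add: sc_mult sone_def)
  have cd': "?c \<star> (?d \<star> t) = t" "?d \<star> (?c \<star> t) = t" for t using cd by (simp_all flip: smul_assoc)
  have cm: "?x \<star> (?d \<star> t) = ?d \<star> (?x \<star> t)" "?y \<star> (?c \<star> t) = ?c \<star> (?y \<star> t)" "?e \<star> (?c \<star> t) = ?c \<star> (?e \<star> t)" for t
    by (rule smul_left_commute[OF sc_commute])+
  have ee: "?e \<star> ?e = ?e" by (simp add: ee_def Est_mult)
  have yc: "?y \<star> (?c \<star> ?e) = 0" using cm(2)[of ?e] by (simp add: Yg_ee)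
  have dx: "?d \<star> ?x \<in> alg_gen A" "?c \<star> ?y \<in> alg_gen A" "?c \<star> ?e \<in> alg_gen A"
    by (rule alg_gen.mul[OF sc(2) x], rule alg_gen.mul[OF sc(1) y], rule alg_gen.mul[OF sc(1) e])
  have 1: "blk I p q ?e ?x (- ?y) 0 \<in> Einf n I" using weyl[OF x y Yg_Xg] by (simp add: ee_XY)
  have 2: "blk I p q 0 (- sone) (sone :: 'k sn) 0 \<in> Einf n I"
    using weyl[OF alg_gen_uminus[OF z(2)] alg_gen_uminus[OF z(2)]] by simp
  have 3: "blk I p q 0 ?d (- ?c) 0 \<in> Einf n I" using weyl[OF sc(2,1) cd(1)] by (simp add: cd)
  have 4: "blk I p q ?e (- (?d \<star> ?x)) (?c \<star> ?y) 0 \<in> Einf n I"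
  proof -
    have "(- (?c \<star> ?y)) \<star> (- (?d \<star> ?x)) = sone" using smul_interchange[OF sc_commute, of ?c ?y "inverse c" ?x] by (simp add: cd Yg_Xg)
    moreover have "(- (?d \<star> ?x)) \<star> (- (?c \<star> ?y)) = ?x \<star> ?y" using smul_interchange[OF sc_commute, of ?d ?x c ?y] by (simp add: cd)
    ultimately show ?thesis using weyl[OF alg_gen_uminus[OF dx(1)] alg_gen_uminus[OF dx(2)]] by (simp add: ee_XY)
  qed
  have 12: "blk I p q ?e ?x (- ?y) 0 \<star> blk I p q 0 (- sone) sone 0 = blk I p q ?x (- ?e) 0 ?y"
    by (subst mult[OF z(1) alg_gen_uminus[OF z(2)] z(2) z(1)]) simp
  have 34: "blk I p q 0 ?d (- ?c) 0 \<star> blk I p q ?e (- (?d \<star> ?x)) (?c \<star> ?y) 0 = blk I p q ?y 0 (- (?c \<star> ?e)) ?x"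
    by (subst mult[OF e alg_gen_uminus[OF dx(1)] dx(2) z(1)]) (simp add: cd')
  have 5: "blk I p q ?x (- ?e) 0 ?y \<star> blk I p q ?y 0 (- (?c \<star> ?e)) ?x = blk I p q (?x \<star> ?y + ?c \<star> ?e) 0 0 sone"
    by (subst mult[OF y z(1) alg_gen_uminus[OF dx(3)] x]) (simp add: cm(3) ee yc ee_Xg Yg_Xg)
  have "blk I p q (?x \<star> ?y + ?c \<star> ?e) 0 0 sone \<in> Einf n I"
    unfolding 5[symmetric] unfolding 12[symmetric] 34[symmetric] by (intro Einf.mul 1 2 3 4)
  moreover have "?x \<star> ?y + ?c \<star> ?e - sone = ?c \<star> ?e - ?e" by (simp add: ee_XY)
  ultimately show ?thesis by (simp add: blk_def)
qed

end

text \<open>The factor of a generator at \<open>j\<close> is moved into the coefficient. If the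
  remaining multi-indices differ, this is a generator again; if they agree, the indices at
  \<open>j\<close> differ, the coefficient is a product \<open>x \<star> y\<close> with
  \<open>y \<star> x = 0\<close>, and \<open>commutator\<close> applies.\<close>

lemma Einf_full_subset:
  fixes g :: "'k::field sn"
  assumes j: "j \<in> {1..n}" and ne2: "{1..n} - {j} \<noteq> {}" and g: "g \<in> Einf n {1..n}"
  shows "g \<in> Einf n ({1..n} - {j})"
  using g
proof induction
  case (gen a \<alpha> \<beta>)
  let ?I = "{1..n} - {j}"
  have jA: "j \<in> {1..n} - ?I" using j by blast
  have a: "a \<in> alg_gen {}" using gen(1) by simp
  then have aA: "a \<in> alg_gen ({1..n} - ?I)" using alg_gen_mono[of "{}"] by blast
  have "EI \<alpha> \<beta> {1..n} = (Est (\<alpha> j) (\<beta> j) j \<star> EI \<alpha> \<beta> ?I :: 'k sn)"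
    using EI_insert[of ?I j \<alpha> \<beta>, where 'k = 'k] j by (simp add: insert_absorb)
  then have e: "a \<star> EI \<alpha> \<beta> {1..n} = (a \<star> Est (\<alpha> j) (\<beta> j) j) \<star> EI \<alpha> \<beta> ?I" by (simp add: smul_assoc)
  have x: "a \<star> Est (\<alpha> j) (\<beta> j) j \<in> alg_gen ({1..n} - ?I)" by (rule alg_gen.mul[OF aA Est_alg_gen[OF jA]])
  show ?case
  proof (cases "\<exists>i\<in>?I. \<alpha> i \<noteq> \<beta> i")
    case True
    then show ?thesis unfolding e by (rule Einf.gen[OF x])
  next
    case False
    then have ne: "\<alpha> j \<noteq> \<beta> j" using gen(2) by blast
      \<comment> \<open>The successor merely supplies a second position different from \<alpha> on
        the nonempty index set.\<close>
      interpret two_block n ?I \<alpha> "\<lambda>i. Suc (\<alpha> i)" by unfold_locales (use ne2 in auto)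
      have "Est (\<beta> j) (\<beta> j) j \<star> a = a \<star> (Est (\<beta> j) (\<beta> j) j :: 'k sn)"
        by (rule alg_gen_commute[OF Est_alg_gen[of j "{j}"] a]) auto
      then have yx: "Est (\<beta> j) (\<beta> j) j \<star> (a \<star> Est (\<alpha> j) (\<beta> j) j) = 0"
        using smul_left_commute[of "Est (\<beta> j) (\<beta> j) j" a "Est (\<alpha> j) (\<beta> j) j"] ne by (simp add: Est_mult)
      have "(a \<star> Est (\<alpha> j) (\<beta> j) j) \<star> Est (\<beta> j) (\<beta> j) j = a \<star> Est (\<alpha> j) (\<beta> j) j" by (simp add: smul_assoc Est_mult)
      moreover have "EI \<alpha> \<beta> ?I = (EI \<alpha> \<alpha> ?I :: 'k sn)" by (rule EI_cong) (use False in auto)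
      ultimately show ?thesis unfolding e using commutator[OF x Est_alg_gen[OF jA] yx] by simp
  qed
qed (auto intro: Einf.intros)

text \<open>At the full index set no Laurent variable is left, so \<open>u\<close> is a constant
  diagonal factor times elementary ones. Omitting \<open>j\<close> frees \<open>x_j\<close> and
  \<open>y_j\<close> as coefficients, by which \<open>diagonal\<close> makes the constant factor
  elementary too.\<close>

lemma Fn_units_Einf:
  fixes u :: "'k::field sn"
  assumes j: "j \<in> {1..n}" "2 \<le> n" and u: "u \<in> gp n {{1..n}}"
  shows "u \<in> Einf n ({1..n} - {j})"
proof -
  let ?N = "{1..n}" and ?I = "{1..n} - {j}"
  have N: "?N \<noteq> {}" using j by auto
  have I0: "?I \<noteq> {}"
  proof
    assume "?I = {}"
    then have "?N \<subseteq> {j}" by blast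
    then have "card ?N \<le> 1" using card_mono[of "{j}" ?N] by simp
    then show False using j(2) by simp
  qed
  obtain \<kappa> c g where k: "c \<noteq> 0" "ky \<kappa> \<subseteq> ?N - ?N" "Dt (rho ?N u) = emb (sg \<kappa> c)" and g: "g \<in> Einf n ?N"
    and r: "rho ?N u = rho ?N ((sone + lift (sg \<kappa> c - 1) \<star> eI ?N) \<star> g)"
    by (rule gp_K1[OF u _ subset_refl N]) auto
  have "\<kappa> = 0" using k(2) by simp
  then have r': "rho ?N u = rho ?N (mu ?N c \<star> g)" using r by (simp add: mu_lift)
  have sub: "gp n {J. ?N \<subseteq> J} \<subseteq> (gp n {?N} :: 'k sn set)" by (rule gp_mono) auto
  have "mu ?N c \<star> g \<in> gp n {?N}"
    by (rule subsetD[OF sub gp_mul[OF mu_gp[OF subset_refl k(1)] Einf_gp[OF subset_refl g]]])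
  then have ug: "u = mu ?N c \<star> g" using gp_faithful[OF u] r' N by blast
  have "mu ?N c \<in> Einf n ?I"
  proof -
    interpret two_block n ?I "\<lambda>_. 0" "\<lambda>_. 1" by unfold_locales (use I0 in auto)
    have "eI ?N = (ee j \<star> eI ?I :: 'k sn)" by (rule eI_remove) (use j in auto)
    moreover have "j \<in> ?N - ?I" using j by blast
    ultimately show ?thesis using diagonal[OF _ k(1), of j] by (simp add: mu_def eI_EI smul_diff_left smul_assoc algebra_simps)
  qed
  then show ?thesis unfolding ug using Einf_full_subset[OF j(1) I0 g] by (rule Einf.mul)
qed


section \<open>The factorisation\<close>

definition JS :: "nat \<Rightarrow> nat set \<Rightarrow> nat \<Rightarrow> nat set set" where
  "JS n S s = {I \<in> Jp n S. s \<le> card I}"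

lemma Jp_finite: "I \<in> Jp n S \<Longrightarrow> finite I"
  unfolding Jp_def using finite_subset[of I "{1..n}"] by auto

lemma Jp_sub: "I \<in> Jp n S \<Longrightarrow> I \<subseteq> {1..n}"
  by (simp add: Jp_def)

lemma Jp_ne: "I \<in> Jp n S \<Longrightarrow> I \<noteq> {}"
  by (auto simp: Jp_def)

lemma Jp_up: "I \<in> Jp n S \<Longrightarrow> I \<subseteq> I' \<Longrightarrow> I' \<subseteq> {1..n} \<Longrightarrow> I' \<in> Jp n S"
  unfolding Jp_def by blast

lemma JS_up:
  assumes "I \<in> JS n S s" "I \<subseteq> I'" "I' \<subseteq> {1..n}" shows "I' \<in> JS n S s"
proof -
  have "card I \<le> card I'" by (rule card_mono[OF finite_subset[OF assms(3)] assms(2)]) simp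
  then show ?thesis using assms Jp_up[of I n S I'] by (simp add: JS_def)
qed

lemma minimal_index_JS:
  assumes "I \<in> Jp n S" "card I = s" shows "minimal_index n (JS n S s) I"
proof
  fix I' assume "I' \<subset> I"
  then have "card I' < card I" by (rule psubset_card_mono[OF Jp_finite[OF assms(1)]])
  then show "I' \<notin> JS n S s" using assms(2) by (simp add: JS_def)
qed (use JS_up Jp_sub[OF assms(1)] Jp_ne[OF assms(1)] in blast)+

lemma onep_s_gp:
  assumes "S \<subseteq> {1..n-1}" "1 \<le> n" shows "onep_s n S s = (gp n (JS n S s) :: 'k::field sn set)"
proof -
  have "idl n (Jp n S) \<inter> idl n {I. s \<le> card I} = (idl n (JS n S s) :: 'k sn set)"
  proof
    have "Jp n S \<inter> {I. s \<le> card I} = JS n S s" by (auto simp: JS_def)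
    then show "idl n (Jp n S) \<inter> idl n {I. s \<le> card I} \<subseteq> (idl n (JS n S s) :: 'k sn set)" using idl_Int by fastforce
    show "(idl n (JS n S s) :: 'k sn set) \<subseteq> idl n (Jp n S) \<inter> idl n {I. s \<le> card I}"
      by (intro Int_greatest idl_mono) (auto simp: JS_def)
  qed
  then show ?thesis unfolding onep_s_def onep_def ppn_eq_idl[OF assms] ans_eq_idl by blast
qed

lemma Jp_card_ge_2:
  assumes "I \<in> Jp n S" "S \<subseteq> {1..n-1}" "1 \<le> n" shows "2 \<le> card I"
proof -
  obtain i where i: "i \<in> I" "i \<in> S" "n \<in> I" using assms(1) by (auto simp: Jp_def)
  then have "i \<noteq> n" using assms by auto
  then have "card {i, n} = 2" by simp
  moreover have "card {i, n} \<le> card I" by (rule card_mono[OF Jp_finite[OF assms(1)]]) (use i in auto)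
  ultimately show ?thesis by simp
qed

lemma JS_2: "S \<subseteq> {1..n-1} \<Longrightarrow> 1 \<le> n \<Longrightarrow> JS n S 2 = Jp n S"
  using Jp_card_ge_2 by (auto simp: JS_def)

lemma JS_n:
  assumes "S \<noteq> {}" "S \<subseteq> {1..n-1}" "1 \<le> n" shows "JS n S n = {{1..n}}"
proof
  show "JS n S n \<subseteq> {{1..n}}"
  proof
    fix I assume "I \<in> JS n S n"
    then have I: "I \<subseteq> {1..n}" "n \<le> card I" by (auto simp: JS_def Jp_def)
    have "card I = card {1..n}" using card_mono[OF _ I(1)] I(2) by simp
    then show "I \<in> {{1..n}}" using card_subset_eq[OF _ I(1)] by simp
  qed
  obtain i where i: "i \<in> S" using assms by blast
  have "i \<in> {1..n}" using subsetD[OF assms(2) i] by auto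
  with i show "{{1..n}} \<subseteq> JS n S n" using assms(3) by (auto simp: JS_def Jp_def)
qed

text \<open>The axes \<open>j\<close> whose facet \<open>J - {j}\<close> is still visible. The two
  kinds of \<theta> in the statement differ by whether removing an element of \<open>S\<close> can
  make the facet invisible.\<close>

definition TT :: "nat \<Rightarrow> nat set \<Rightarrow> nat set \<Rightarrow> nat set" where
  "TT n S J = {j \<in> J. J - {j} \<in> Jp n S}"

lemma TT_single: "J \<in> Jp n S \<Longrightarrow> J \<inter> S = {i} \<Longrightarrow> TT n S J = J - {n, i}"
  unfolding TT_def Jp_def by blast

lemma TT_many:
  assumes "J \<in> Jp n S" "2 \<le> card (J \<inter> S)" shows "TT n S J = J - {n}"
proof -
  have "(J - {j}) \<inter> S \<noteq> {}" for j
  proof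
    assume "(J - {j}) \<inter> S = {}"
    then have "J \<inter> S \<subseteq> {j}" by blast
    then have "card (J \<inter> S) \<le> 1" using card_mono[of "{j}" "J \<inter> S"] by simp
    then show False using assms(2) by simp
  qed
  then show ?thesis using assms(1) unfolding TT_def Jp_def by blast
qed

text \<open>Both kinds follow one rule: \<open>m\<close> is the largest axis in
  \<open>TT n S J\<close> and \<open>j\<close> any other one, so each remaining axis is paired with
  \<open>m\<close>.\<close>

lemma theta_idx_iff:
  "(m, j, J) \<in> theta_idx n S s \<longleftrightarrow>
    J \<in> Jp n S \<and> card J = s + 1 \<and> m = Max (TT n S J) \<and> j \<in> TT n S J - {m}"
proof
  assume "(m, j, J) \<in> theta_idx n S s"
  then consider i where "i \<in> S" "J \<subseteq> {1..n}" "card J = s + 1" "n \<in> J" "J \<inter> S = {i}" "m = Max (J - {n, i})" "j \<in> J - {n, i, m}"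
    | "J \<subseteq> {1..n}" "card J = s + 1" "n \<in> J" "2 \<le> card (J \<inter> S)" "m = Max (J - {n})" "j \<in> J - {n, m}"
    unfolding theta_idx_def by blast
  then show "J \<in> Jp n S \<and> card J = s + 1 \<and> m = Max (TT n S J) \<and> j \<in> TT n S J - {m}"
  proof cases
    case 1
    then have "J \<in> Jp n S" by (simp add: Jp_def)
    moreover from TT_single[OF this 1(5)] have "TT n S J = J - {n, i}" .
    ultimately show ?thesis using 1 by auto
  next
    case 2
    then have "J \<inter> S \<noteq> {}" by auto
    then have "J \<in> Jp n S" using 2 by (simp add: Jp_def)
    moreover from TT_many[OF this 2(4)] have "TT n S J = J - {n}" .
    ultimately show ?thesis using 2 by auto
  qed
next
  assume *: "J \<in> Jp n S \<and> card J = s + 1 \<and> m = Max (TT n S J) \<and> j \<in> TT n S J - {m}"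
  then have J: "J \<in> Jp n S" by blast
  then have f: "finite (J \<inter> S)" "J \<inter> S \<noteq> {}" "J \<subseteq> {1..n}" "n \<in> J" using Jp_finite by (auto simp: Jp_def)
  show "(m, j, J) \<in> theta_idx n S s"
  proof (cases "card (J \<inter> S) = 1")
    case True
    then obtain i where i: "J \<inter> S = {i}" by (rule card_1_singletonE)
    have t: "TT n S J = J - {n, i}" by (rule TT_single[OF J i])
    have "i \<in> S" using i by blast
    moreover have "m = Max (J - {n, i})" "j \<in> J - {n, i, m}" using * t by auto
    ultimately show ?thesis using i f * unfolding theta_idx_def by blast
  next
    case False
    moreover have "card (J \<inter> S) \<noteq> 0" using f by simp
    ultimately have c: "2 \<le> card (J \<inter> S)" by linarith
    have t: "TT n S J = J - {n}" by (rule TT_many[OF J c])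
    then have "m = Max (J - {n})" "j \<in> J - {n, m}" using * by auto
    then show ?thesis using c f * unfolding theta_idx_def by blast
  qed
qed

lemma theta_idxD:
  assumes "(m, j, J) \<in> theta_idx n S s"
  shows "J \<in> Jp n S" "card J = Suc s" "m \<in> TT n S J" "j \<in> TT n S J" "m \<noteq> j" "m \<in> J" "j \<in> J" "J \<subseteq> {1..n}"
proof -
  have t: "J \<in> Jp n S" "card J = s + 1" "m = Max (TT n S J)" "j \<in> TT n S J - {m}" using assms unfolding theta_idx_iff by auto
  have f: "finite (TT n S J)" using Jp_finite[OF t(1)] by (simp add: TT_def)
  have "TT n S J \<noteq> {}" using t(4) by blast
  from Max_in[OF f this] show m: "m \<in> TT n S J" unfolding t(3) .
  show "j \<in> TT n S J" "m \<noteq> j" using t by auto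
  then show "m \<in> J" "j \<in> J" using m by (auto simp: TT_def)
  show "J \<in> Jp n S" "card J = Suc s" "J \<subseteq> {1..n}" using t Jp_sub by auto
qed

lemma theta_gp_JS:
  assumes "(m, j, J) \<in> theta_idx n S s" shows "theta m j J \<in> gp n (JS n S s)"
proof -
  note t = theta_idxD[OF assms]
  have "J - {k} \<in> JS n S s" if "k \<in> TT n S J" for k
    using that t(2) Jp_finite[OF t(1)] by (simp add: JS_def TT_def)
  then have "gp n {I. J - {m} \<subseteq> I \<or> J - {j} \<subseteq> I} \<subseteq> (gp n (JS n S s) :: 'a sn set)"
    using t(3,4) JS_up by (intro gp_mono) blast
  then show ?thesis using theta_gp[OF t(8,6,7)] by blast
qed

lemma setprod_list_Nil [simp]: "setprod_list [] = {sone}"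
  and setprod_list_Cons [simp]: "setprod_list (A # As) = setmul A (setprod_list As)"
  by (simp_all add: setprod_list_def)

lemma setmulI: "a \<in> A \<Longrightarrow> b \<in> B \<Longrightarrow> a \<star> b \<in> setmul A B"
  unfolding setmul_def by blast

lemma setmul_gp: "A \<subseteq> gp n JJ \<Longrightarrow> B \<subseteq> gp n JJ \<Longrightarrow> setmul A B \<subseteq> gp n JJ"
  unfolding setmul_def using gp_mul by blast

lemma setprod_list_gp: "(\<And>A. A \<in> set As \<Longrightarrow> A \<subseteq> gp n JJ) \<Longrightarrow> setprod_list As \<subseteq> gp n JJ"
  by (induction As) (simp_all add: gp_one setmul_gp)

lemma setprod_list_mem:
  "(\<And>I. I \<in> set Is \<Longrightarrow> x I \<in> F I) \<Longrightarrow> sprod_list (map x Is) \<in> setprod_list (map F Is)"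
  by (induction Is) (simp_all add: setmulI)

lemma Thtil_gp:
  assumes "set ts = theta_idx n S s" shows "Thtil n ts \<subseteq> (gp n (JS n S s) :: 'k::field sn set)"
proof
  fix v :: "'k sn" assume "v \<in> Thtil n ts"
  then obtain zs where v: "v = sprod_list (map (\<lambda>((m, j, J), z). zpow (Sn n) (theta m j J) z) (zip ts zs))"
    by (auto simp: Thtil_def)
  show "v \<in> gp n (JS n S s)"
    unfolding v
  proof (rule gp_sprod_list)
    fix x :: "'k sn" assume "x \<in> set (map (\<lambda>((m, j, J), z). zpow (Sn n) (theta m j J) z) (zip ts zs))"
    then obtain m j J z where "((m, j, J), z) \<in> set (zip ts zs)" and x: "x = zpow (Sn n) (theta m j J) z" by auto
    then have "(m, j, J) \<in> theta_idx n S s" using set_zip_leftD assms by fast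
    then show "x \<in> gp n (JS n S s)" unfolding x by (intro gp_zpow theta_gp_JS)
  qed
qed

lemma UE_gp_JS:
  assumes "I \<in> Jp n S" "card I = s" shows "UE n I \<subseteq> (gp n (JS n S s) :: 'k::field sn set)"
proof -
  have "I \<in> JS n S s" using assms by (simp add: JS_def)
  then have "gp n {J. I \<subseteq> J} \<subseteq> (gp n (JS n S s) :: 'k sn set)" using JS_up by (intro gp_mono) blast
  then show ?thesis using UE_gp[OF Jp_sub[OF assms(1)]] by blast
qed

lemma Etil_gp:
  assumes "set Is = {I \<in> Jp n S. card I = s}" shows "Etil n Is \<subseteq> (gp n (JS n S s) :: 'k::field sn set)"
  unfolding Etil_def
proof (rule setprod_list_gp)
  fix A :: "'k sn set" assume "A \<in> set (map (UE n) Is)"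
  then obtain I where "A = UE n I" "I \<in> Jp n S" "card I = s" using assms by auto
  then show "A \<subseteq> gp n (JS n S s)" using UE_gp_JS by blast
qed

text \<open>For sets of equal size, the factor at \<open>I'\<close> is invisible to \<open>rho I\<close> unless \<open>I' = I\<close>.\<close>

lemma rho_sprod_list_select:
  fixes x :: "nat set \<Rightarrow> 'k::field sn"
  assumes "distinct Is" "\<And>I. I \<in> set Is \<Longrightarrow> I \<subseteq> {1..n} \<and> I \<noteq> {} \<and> card I = s"
    "\<And>I. I \<in> set Is \<Longrightarrow> x I \<in> gp n {K. I \<subseteq> K}" "I \<subseteq> {1..n}" "I \<noteq> {}" "card I = s"
  shows "rho I (sprod_list (map x Is)) = (if I \<in> set Is then rho I (x I) else 1)"
  using assms(1-3)
proof (induction Is)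
  case Nil
  have "finite I" using assms(4) finite_subset by blast
  then show ?case by (simp add: rho_one assms(5))
next
  case (Cons L Is)
  have fin: "finite I" using assms(4) finite_subset by blast
  have "rho I (sprod_list (map x (L # Is))) = rho I (x L) * rho I (sprod_list (map x Is))"
    by (simp add: rho_mult[OF fin assms(5)])
  also have "rho I (sprod_list (map x Is)) = (if I \<in> set Is then rho I (x I) else 1)"
    by (rule Cons.IH) (use Cons.prems in auto)
  finally have e: "rho I (sprod_list (map x (L # Is))) = rho I (x L) * (if I \<in> set Is then rho I (x I) else 1)" .
  show ?case
  proof (cases "L = I")
    case True
    then show ?thesis using e Cons.prems(1) by simp
  next
    case False
    have "\<not> L \<subseteq> I" using card_subset_eq[OF fin, of L] False Cons.prems(2)[of L] assms(6) by auto
    then have "rho I (x L) = 1" using gp_rho_one[OF Cons.prems(3)[of L] assms(4) _ assms(5)] by simp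
    then show ?thesis using e False by auto
  qed
qed

lemma gp_JS_Suc:
  fixes u :: "'k::field sn"
  assumes u: "u \<in> gp n (JS n S s)" and r: "\<And>I. I \<in> Jp n S \<Longrightarrow> card I = s \<Longrightarrow> rho I u = 1"
  shows "u \<in> gp n (JS n S (Suc s))"
proof -
  obtain v where v: "v \<in> gp n (JS n S s)" "u \<star> v = sone" "v \<star> u = sone" using gp_inverse[OF u] by metis
  have "u - sone \<in> idl n (JS n S (Suc s))"
    unfolding idl_def
  proof (intro CollectI conjI allI impI ballI)
    show "u - sone \<in> Sn n" by (rule idl_Sn[OF gp_idl[OF u]])
    fix I \<alpha> \<beta> assume I: "I \<subseteq> {1..n}" "I \<notin> JS n S (Suc s)" "\<beta> \<in> NI I"
    show "R I (u - sone) \<alpha> \<beta> = 0"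
    proof (cases "I \<in> JS n S s")
      case True
      then have J: "I \<in> Jp n S" "card I = s" using I(2) by (auto simp: JS_def)
      note f = Jp_finite[OF J(1)] Jp_ne[OF J(1)]
      have "rho I u = rho I sone" using r[OF J] rho_one[OF f] by simp
      from rho_eqD[OF f this I(3)] show ?thesis by simp
    next
      case False
      then show ?thesis using gp_idl[OF u] I unfolding idl_def by blast
    qed
  qed
  then show ?thesis by (rule gpI[OF gp_Sn[OF u] gp_Sn[OF v(1)] v(2,3)])
qed


text \<open>The exponent of the variable \<open>k\<close> receives contributions only from
  \<open>J = insert k I\<close>. If \<open>k\<close> is not the distinguished axis \<open>m\<close>,
  exactly the \<theta> with \<open>j = k\<close> contributes, with the prescribed power; if
  \<open>k = m\<close>, all of them contribute with sign -1, and the index relation turns their sum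
  into the required exponent.\<close>

lemma theta_exponents:
  fixes \<kappa> :: "nat set \<Rightarrow> nat \<Rightarrow>\<^sub>0 int"
  assumes k: "\<And>I. I \<in> Jp n S \<Longrightarrow> card I = s \<Longrightarrow> ky (\<kappa> I) \<subseteq> {1..n} - I"
    and idx: "\<And>J. J \<in> Jp n S \<Longrightarrow> card J = Suc s \<Longrightarrow> (\<Sum>j\<in>TT n S J. lk (\<kappa> (J - {j})) j) = 0"
    and fin: "finite (theta_idx n S s)"
    and I: "I \<in> Jp n S" "card I = s"
  shows "(\<Sum>t\<in>theta_idx n S s. zm (case t of (m, j, J) \<Rightarrow> lk (\<kappa> (J - {j})) j) (th_exp I t)) = \<kappa> I"
proof (rule poly_mapping_eqI)
  fix k
  let ?f = "\<lambda>(m, j, J). lk (\<kappa> (J - {j})) j * lk (th_exp I (m, j, J)) k"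
  have l: "lk (\<Sum>t\<in>theta_idx n S s. zm (case t of (m, j, J) \<Rightarrow> lk (\<kappa> (J - {j})) j) (th_exp I t)) k = (\<Sum>t\<in>theta_idx n S s. ?f t)"
    unfolding lookup_sum by (rule sum.cong[OF refl]) (auto simp: lookup_zm)
  have zero: "?f (m, j, J) = 0" if "(m, j, J) \<in> theta_idx n S s" "\<not> (J = insert k I \<and> k \<notin> I)" for m j J
  proof -
    have mj: "m \<in> J" "j \<in> J" using theta_idxD[OF that(1)] by auto
    have "k \<noteq> m" if "I = J - {m}" using that mj \<open>\<not> (J = insert k I \<and> k \<notin> I)\<close> by auto
    moreover have "k \<noteq> j" if "I = J - {j}" using that mj \<open>\<not> (J = insert k I \<and> k \<notin> I)\<close> by auto
    ultimately have "lk (th_exp I (m, j, J)) k = 0" by (auto simp: th_exp_def lookup_single when_def)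
    then show ?thesis by simp
  qed
  show "lk (\<Sum>t\<in>theta_idx n S s. zm (case t of (m, j, J) \<Rightarrow> lk (\<kappa> (J - {j})) j) (th_exp I t)) k = lk (\<kappa> I) k"
  proof (cases "k \<in> {1..n} - I")
    case False
    then have "k \<notin> ky (\<kappa> I)" using k[OF I] by blast
    moreover have "(\<Sum>t\<in>theta_idx n S s. ?f t) = 0"
    proof (rule sum.neutral, rule ballI)
      fix t assume t: "t \<in> theta_idx n S s"
      obtain m j J where e: "t = (m, j, J)" by (cases t)
      have "J \<subseteq> {1..n}" using theta_idxD(8)[of m j J n S s] t e by simp
      then show "?f t = 0" unfolding e using zero[of m j J] t e False by blast
    qed
    ultimately show ?thesis unfolding l by (simp add: in_keys_iff)
  next
    case True
    define J where "J = insert k I"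
    have kI: "k \<notin> I" "k \<in> {1..n}" using True by auto
    have JI: "J - {k} = I" using kI by (auto simp: J_def)
    have J: "J \<in> Jp n S" by (rule Jp_up[OF I(1)]) (use kI Jp_sub[OF I(1)] in \<open>auto simp: J_def\<close>)
    have cJ: "card J = Suc s" using kI I(2) Jp_finite[OF I(1)] by (simp add: J_def)
    have kT: "k \<in> TT n S J" using I(1) JI by (simp add: TT_def J_def)
    have finT: "finite (TT n S J)" using Jp_finite[OF J] by (simp add: TT_def)
    define m where "m = Max (TT n S J)"
    have mT: "m \<in> TT n S J" unfolding m_def using Max_in[OF finT] kT by blast
    let ?T = "TT n S J - {m}"
    have "(\<Sum>t\<in>theta_idx n S s. ?f t) = (\<Sum>t\<in>(\<lambda>j. (m, j, J)) ` ?T. ?f t)"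
    proof (rule sum.mono_neutral_right[OF fin])
      show "(\<lambda>j. (m, j, J)) ` ?T \<subseteq> theta_idx n S s" using J cJ m_def by (auto simp: theta_idx_iff)
      show "\<forall>t\<in>theta_idx n S s - (\<lambda>j. (m, j, J)) ` ?T. ?f t = 0"
      proof
        fix t assume t: "t \<in> theta_idx n S s - (\<lambda>j. (m, j, J)) ` ?T"
        obtain m' j' J' where e: "t = (m', j', J')" by (cases t)
        have "J' \<noteq> J"
        proof
          assume "J' = J"
          then have "m' = m" "j' \<in> ?T" using t e unfolding m_def by (auto simp: theta_idx_iff)
          then show False using t e \<open>J' = J\<close> by blast
        qed
        then show "?f t = 0" unfolding e using zero[of m' j' J'] t e by (auto simp: J_def)
      qed
    qed
    also have "\<dots> = (\<Sum>j\<in>?T. lk (\<kappa> (J - {j})) j * lk (th_exp I (m, j, J)) k)"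
      by (subst sum.reindex) (auto simp: inj_on_def)
    also have "\<dots> = lk (\<kappa> I) k"
    proof (cases "k = m")
      case km: True
      have "th_exp I (m, j, J) = sg m (- 1)" for j using JI km by (simp add: th_exp_def)
      then have "(\<Sum>j\<in>?T. lk (\<kappa> (J - {j})) j * lk (th_exp I (m, j, J)) k) = - (\<Sum>j\<in>?T. lk (\<kappa> (J - {j})) j)"
        using km by (simp add: sum_negf)
      also have "\<dots> = lk (\<kappa> (J - {m})) m" using idx[OF J cJ] sum.remove[OF finT mT, of "\<lambda>j. lk (\<kappa> (J - {j})) j"] by linarith
      finally show ?thesis using JI km by simp
    next
      case km: False
      have "lk (th_exp I (m, j, J)) k = (if j = k then 1 else 0)" if "j \<in> ?T" for j
      proof -
        have "I \<noteq> J - {m}" using JI km kT mT by (auto simp: TT_def)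
        moreover have "I = J - {j} \<longleftrightarrow> j = k" using JI that kT by (auto simp: TT_def)
        ultimately show ?thesis by (simp add: th_exp_def lookup_single when_def)
      qed
      then have "(\<Sum>j\<in>?T. lk (\<kappa> (J - {j})) j * lk (th_exp I (m, j, J)) k) = (\<Sum>j\<in>?T. if j = k then lk (\<kappa> I) k else 0)"
        using JI by (intro sum.cong refl) auto
      also have "\<dots> = lk (\<kappa> I) k" using finT kT km by (simp add: sum.delta)
      finally show ?thesis .
    qed
    finally show ?thesis unfolding l .
  qed
qed

text \<open>Dividing out elementary parts on the right serves to obtain the index relation. Powers
  of \<theta> then match the Laurent exponents of \<open>u\<close> itself, leaving constant
  determinants, and a product over the index sets of size \<open>s\<close> matches the matrices. The
  quotient is trivial at that size.\<close>

lemma gp_step: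
  fixes u :: "'k::field sn"
  assumes ts: "distinct ts" "set ts = theta_idx n S s" and Is: "distinct Is" "set Is = {I \<in> Jp n S. card I = s}"
    and u: "u \<in> gp n (JS n S s)"
  shows "\<exists>v\<in>Thtil n ts. \<exists>w\<in>Etil n Is. \<exists>u'\<in>gp n (JS n S (Suc s)). u = v \<star> (w \<star> u')"
proof -
  have min: "minimal_index n (JS n S s) I" if "I \<in> set Is" for I using minimal_index_JS that Is(2) by blast
  have Isub: "I \<subseteq> {1..n} \<and> I \<noteq> {} \<and> card I = s" if "I \<in> set Is" for I using that Is(2) Jp_sub Jp_ne by blast
  have Ifin: "finite I" "I \<noteq> {}" if "I \<in> set Is" for I using Jp_finite[of I n S] Jp_ne[of I n S] that Is(2) by auto
  have K1: "\<exists>x. fst (snd x) \<noteq> 0 \<and> ky (fst x) \<subseteq> {1..n} - I \<and> Dt (rho I a) = emb (sg (fst x) (fst (snd x))) \<and> snd (snd x) \<in> Einf n I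
      \<and> rho I a = rho I ((sone + lift (sg (fst x) (fst (snd x)) - 1) \<star> eI I) \<star> snd (snd x))"
    if "I \<in> set Is" "a \<in> gp n (JS n S s)" for I and a :: "'k sn"
  proof -
    show ?thesis
    proof (rule gp_K1[OF that(2), of I])
      fix I1 I2 assume "I1 \<in> JS n S s" "I1 \<subseteq> I2" "I2 \<subseteq> {1..n}"
      then show "I2 \<in> JS n S s" by (rule JS_up)
    next
      show "I \<subseteq> {1..n}" "I \<noteq> {}" using Isub[OF that(1)] by simp_all
    next
      fix I' assume "I' \<subset> I"
      then show "I' \<notin> JS n S s" by (rule minimal_index.min[OF min[OF that(1)]])
    next
      fix \<kappa> c g assume "c \<noteq> 0" "ky \<kappa> \<subseteq> {1..n} - I" "Dt (rho I a) = emb (sg \<kappa> c)" "g \<in> Einf n I"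
        "rho I a = rho I ((sone + lift (sg \<kappa> c - 1) \<star> eI I) \<star> g)"
      then show ?thesis by (intro exI[of _ "(\<kappa>, c, g)"]) simp
    qed
  qed
  have "\<forall>I\<in>set Is. \<exists>x. fst (snd x) \<noteq> 0 \<and> ky (fst x) \<subseteq> {1..n} - I \<and> Dt (rho I u) = emb (sg (fst x) (fst (snd x))) \<and> snd (snd x) \<in> Einf n I
      \<and> rho I u = rho I ((sone + lift (sg (fst x) (fst (snd x)) - 1) \<star> eI I) \<star> snd (snd x))"
    using K1[OF _ u] by blast
  from bchoice[OF this] obtain F where F: "\<forall>I\<in>set Is. fst (snd (F I)) \<noteq> 0 \<and> ky (fst (F I)) \<subseteq> {1..n} - I \<and> Dt (rho I u) = emb (sg (fst (F I)) (fst (snd (F I))))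
      \<and> snd (snd (F I)) \<in> Einf n I \<and> rho I u = rho I ((sone + lift (sg (fst (F I)) (fst (snd (F I))) - 1) \<star> eI I) \<star> snd (snd (F I)))" by blast
  define \<kappa> c g where "\<kappa> I = fst (F I)" and "c I = fst (snd (F I))" and "g I = snd (snd (F I))" for I
  have K: "c I \<noteq> 0" "ky (\<kappa> I) \<subseteq> {1..n} - I" "Dt (rho I u) = emb (sg (\<kappa> I) (c I))" "g I \<in> Einf n I"
    "rho I u = rho I ((sone + lift (sg (\<kappa> I) (c I) - 1) \<star> eI I) \<star> g I)" if "I \<in> set Is" for I
  proof -
    note b = bspec[OF F that, folded \<kappa>_def c_def g_def]
    show "c I \<noteq> 0" by (rule conjunct1[OF b])
    show "ky (\<kappa> I) \<subseteq> {1..n} - I" by (rule conjunct1[OF conjunct2[OF b]])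
    show "Dt (rho I u) = emb (sg (\<kappa> I) (c I))" by (rule conjunct1[OF conjunct2[OF conjunct2[OF b]]])
    show "g I \<in> Einf n I" by (rule conjunct1[OF conjunct2[OF conjunct2[OF conjunct2[OF b]]]])
    show "rho I u = rho I ((sone + lift (sg (\<kappa> I) (c I) - 1) \<star> eI I) \<star> g I)"
      by (rule conjunct2[OF conjunct2[OF conjunct2[OF conjunct2[OF b]]]])
  qed
  have up1: "gp n {K. I \<subseteq> K} \<subseteq> (gp n (JS n S s) :: 'k sn set)" if "I \<in> set Is" for I
  proof -
    have I: "I \<in> JS n S s" using that unfolding Is(2) JS_def by simp
    show ?thesis
    proof (rule gp_mono)
      fix L assume "L \<subseteq> {1..n}" "L \<in> {K. I \<subseteq> K}"
      then show "L \<in> JS n S s" using JS_up[OF I] by simp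
    qed
  qed
  \<comment> \<open>Factors for other index sets of the same size are invisible at \<open>I\<close>,
    so one product realises all elementary parts at once.\<close>
  define h where "h = sprod_list (map g Is)"
  have gg: "g I \<in> gp n {K. I \<subseteq> K}" if "I \<in> set Is" for I using Einf_gp[OF _ K(4)[OF that]] Isub[OF that] by blast
  have h: "h \<in> gp n (JS n S s)" unfolding h_def
    by (rule gp_sprod_list) (use gg up1 in auto)
  have rh: "rho I h = rho I (g I)" if "I \<in> set Is" for I
    unfolding h_def using rho_sprod_list_select[of Is n s g I, OF Is(1) Isub gg] Isub[OF that] that by simp
  obtain h' where h': "h' \<in> gp n (JS n S s)" "h \<star> h' = sone" "h' \<star> h = sone" using gp_inverse[OF h] by metis
  \<comment> \<open>The relation is derived for this modification of \<open>u\<close>, whose matrix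
    at each \<open>I\<close> is 1 except for one diagonal entry, as \<open>index_sum\<close>
    requires.\<close>
  have w0: "u \<star> h' \<in> gp n (JS n S s)" by (rule gp_mul[OF u h'(1)])
  have r0: "rho I (u \<star> h') = rho I (sone + lift (sg (\<kappa> I) (c I) - 1) \<star> eI I)" if "I \<in> set Is" for I
  proof -
    have "rho I (u \<star> h') = rho I (sone + lift (sg (\<kappa> I) (c I) - 1) \<star> eI I) * (rho I h * rho I h')"
      by (simp add: rho_mult[OF Ifin[OF that]] K(5)[OF that] rh[OF that] mult.assoc)
    also have "rho I h * rho I h' = 1" by (simp add: rho_mult[OF Ifin[OF that], symmetric] h' rho_one[OF Ifin[OF that]])
    finally show ?thesis by simp
  qed
  have idx: "(\<Sum>j\<in>TT n S J. lk (\<kappa> (J - {j})) j) = 0" if J: "J \<in> Jp n S" "card J = Suc s" for J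
  proof -
    have finJ: "finite J" by (rule Jp_finite[OF J(1)])
    have cj: "card (J - {j}) = s" if "j \<in> J" for j using that J(2) finJ by simp
    have inIs: "J - {j} \<in> set Is" if "j \<in> TT n S J" for j using that cj[of j] unfolding Is(2) TT_def by blast
    show ?thesis
    proof (rule index_sum[of "u \<star> h'" n "JS n S s" J _ "\<lambda>j. \<kappa> (J - {j})" "\<lambda>j. c (J - {j})", OF w0 _ Jp_sub[OF J(1)]])
      fix I I' assume "I \<in> JS n S s" "I \<subseteq> I'" "I' \<subseteq> {1..n}"
      then show "I' \<in> JS n S s" by (rule JS_up)
    next
      fix I assume I: "I \<subset> J" "I \<in> JS n S s"
      have "card I < card J" by (rule psubset_card_mono[OF finJ I(1)])
      then have "card I = s" using I(2) J(2) by (simp add: JS_def)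
      then have "card (J - I) = 1" using card_Diff_subset[of I J] I(1) finJ finite_subset[of I J] J(2) by auto
      then obtain j where "J - I = {j}" by (rule card_1_singletonE)
      then show "\<exists>j\<in>J. I = J - {j}" using I(1) by blast
    next
      show "TT n S J = {j \<in> J. J - {j} \<in> JS n S s}" using cj by (auto simp: TT_def JS_def)
    next
      fix j assume "j \<in> TT n S J"
      then show "ky (\<kappa> (J - {j})) \<subseteq> {1..n} - (J - {j})" using K(2) inIs by blast
    next
      fix j \<alpha> \<beta> assume j: "j \<in> TT n S J" and b: "\<beta> \<in> NI (J - {j})"
      from rho_eqD[OF Ifin[OF inIs[OF j]] r0[OF inIs[OF j]] b]
      show "R (J - {j}) (u \<star> h' - sone) \<alpha> \<beta> = R (J - {j}) (lift (sg (\<kappa> (J - {j})) (c (J - {j})) - 1) \<star> eI (J - {j})) \<alpha> \<beta>"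
        by simp
    qed
  qed
  \<comment> \<open>The power of each \<theta> is the exponent of \<open>t_j\<close> at the facet
    \<open>J - {j}\<close>; the exponent of \<open>t_m\<close> at \<open>J - {m}\<close> then comes
    out right by the index relation.\<close>
  define z where "z = (\<lambda>(m :: nat, j, J). lk (\<kappa> (J - {j})) j)"
  define th where "th = (\<lambda>t. zpow (Sn n) (case t of (m, j, J) \<Rightarrow> theta m j J) (z t) :: 'k sn)"
  define v where "v = sprod_list (map th ts)"
  have "map th ts = map (\<lambda>((m, j, J), z). zpow (Sn n) (theta m j J) z) (zip ts (map z ts))"
    by (rule nth_equalityI) (auto simp: th_def split: prod.splits)
  then have vT: "v \<in> Thtil n ts" unfolding Thtil_def v_def by (intro CollectI exI[of _ "map z ts"]) simp
  then have vg: "v \<in> gp n (JS n S s)" using Thtil_gp[OF ts(2)] by blast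
  have Dv: "Dt (rho I v) = emb (sg (\<kappa> I) 1)" if "I \<in> set Is" for I
  proof -
    interpret minimal_index n "JS n S s" I by (rule min[OF that])
    have I: "I \<in> Jp n S" "card I = s" using that Is(2) by auto
    have "Dt (rho I (sprod_list (map th ts))) = emb (sg (\<Sum>t\<leftarrow>ts. zm (z t) (th_exp I t)) 1)"
    proof (rule Dt_rho_sprod_list)
      fix t assume "t \<in> set ts"
      moreover obtain m j J where e: "t = (m, j, J)" by (cases t)
      ultimately have t: "(m, j, J) \<in> theta_idx n S s" using ts(2) by simp
      note d = theta_idxD[OF t]
      have g: "theta m j J \<in> (gp n (JS n S s) :: 'k sn set)" by (rule theta_gp_JS[OF t])
      show "th t \<in> gp n (JS n S s)" unfolding th_def e prod.case by (rule gp_zpow[OF g])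
      have "Dt (rho I (theta m j J)) = emb (sg (th_exp I (m, j, J)) (1 :: 'k))"
        by (rule Dt_theta[OF d(8,6,7,5)]) (use d(2) I Jp_sub Jp_ne in auto)
      from Dt_rho_zpow[OF g this] show "Dt (rho I (th t)) = emb (sg (zm (z t) (th_exp I t)) 1)" unfolding th_def e prod.case .
    qed
    also have "(\<Sum>t\<leftarrow>ts. zm (z t) (th_exp I t)) = (\<Sum>t\<in>theta_idx n S s. zm (z t) (th_exp I t))"
      by (simp only: sum_list_distinct_conv_sum_set[OF ts(1)] ts(2))
    also have "\<dots> = \<kappa> I" unfolding z_def
      by (rule theta_exponents[OF _ idx _ I]) (use K(2) Is(2) ts(2)[symmetric] in auto)
    finally show ?thesis unfolding v_def .
  qed
  obtain v' where v': "v' \<in> gp n (JS n S s)" "v \<star> v' = sone" "v' \<star> v = sone" using gp_inverse[OF vg] by metis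
  define u1 where "u1 = v' \<star> u"
  have u1: "u1 \<in> gp n (JS n S s)" unfolding u1_def by (rule gp_mul[OF v'(1) u])
  have "\<exists>x. x \<in> UE n I \<and> rho I u1 = rho I x" if II: "I \<in> set Is" for I
  proof -
    interpret minimal_index n "JS n S s" I by (rule min[OF that])
    have "Dt (rho I u1) = emb (sg (- \<kappa> I) 1) * emb (sg (\<kappa> I) (c I))"
      unfolding u1_def Dt_rho_mult[OF v'(1) u] K(3)[OF that] Dt_rho_inverse[OF vg v'(1) v'(3) Dv[OF that]] ..
    then have D: "Dt (rho I u1) = emb (sg 0 (c I))" by (simp add: mult_single flip: emb_simps(4))
    obtain x where x: "snd (snd x) \<in> Einf n I" "Dt (rho I u1) = emb (sg (fst x) (fst (snd x)))"
      "rho I u1 = rho I ((sone + lift (sg (fst x) (fst (snd x)) - 1) \<star> eI I) \<star> snd (snd x))"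
      using K1[OF II u1] by blast
    have "sg (fst x) (fst (snd x)) = sg 0 (c I)" using x(2) D by simp
    then have "rho I u1 = rho I (mu I (c I) \<star> snd (snd x))" using x(3) by (simp add: mu_lift)
    moreover have "mu I (c I) \<star> snd (snd x) \<in> UE n I" unfolding UE_def using x(1) K(1)[OF that] by blast
    ultimately show ?thesis by blast
  qed
  then have "\<forall>I\<in>set Is. \<exists>x. x \<in> UE n I \<and> rho I u1 = rho I x" by blast
  from bchoice[OF this] obtain x where x: "\<forall>I\<in>set Is. x I \<in> UE n I \<and> rho I u1 = rho I (x I)" by blast
  define w where "w = sprod_list (map x Is)"
  have wE: "w \<in> Etil n Is" unfolding w_def Etil_def by (rule setprod_list_mem) (use x in blast)
  then have wg: "w \<in> gp n (JS n S s)" using Etil_gp[OF Is(2)] by blast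
  have xg: "x I \<in> gp n {K. I \<subseteq> K}" if "I \<in> set Is" for I using UE_gp[of I n "x I"] x Isub that by blast
  have rw: "rho I w = rho I u1" if "I \<in> set Is" for I
    unfolding w_def using rho_sprod_list_select[of Is n s x I, OF Is(1) Isub xg] Isub[OF that] that x by simp
  obtain w' where w': "w' \<in> gp n (JS n S s)" "w \<star> w' = sone" "w' \<star> w = sone" using gp_inverse[OF wg] by metis
  have "w' \<star> u1 \<in> gp n (JS n S (Suc s))"
  proof (rule gp_JS_Suc[OF gp_mul[OF w'(1) u1]])
    fix I assume "I \<in> Jp n S" "card I = s"
    then have I: "I \<in> set Is" using Is(2) by blast
    have "rho I (w' \<star> u1) = rho I (w' \<star> w)" by (simp add: rho_mult[OF Ifin[OF I]] rw[OF I])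
    then show "rho I (w' \<star> u1) = 1" by (simp add: w' rho_one[OF Ifin[OF I]])
  qed
  moreover have "u = v \<star> (w \<star> (w' \<star> u1))"
  proof -
    have "v \<star> (w \<star> (w' \<star> u1)) = v \<star> ((w \<star> w') \<star> u1)" by (simp only: smul_assoc)
    also have "\<dots> = (v \<star> v') \<star> u" by (simp add: w' u1_def smul_assoc)
    finally show ?thesis by (simp add: v')
  qed
  ultimately show ?thesis using vT wE by blast
qed

lemma chain_Suc:
  "s < n \<Longrightarrow> chain n ordT ordE s = setmul (Thtil n (ordT s)) (setmul (Etil n (ordE s)) (chain n ordT ordE (Suc s)))"
  by (simp add: chain_def upt_conv_Cons)

lemma chain_n: "chain n ordT ordE n = {sone}"
  by (simp add: chain_def)

text \<open>The last factor of the product is closed under right multiplication by its own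
  elementary group; this is how units of \<open>1 + F_n\<close> disappear into the chain.\<close>

lemma Etil_absorb:
  "Is \<noteq> [] \<Longrightarrow> w \<in> Etil n Is \<Longrightarrow> g \<in> Einf n (last Is) \<Longrightarrow> w \<star> g \<in> Etil n Is"
proof (induction Is arbitrary: w)
  case (Cons I Is)
  obtain a b where w: "w = a \<star> b" "a \<in> UE n I" "b \<in> Etil n Is" using Cons.prems(2) by (auto simp: Etil_def setmul_def)
  show ?case
  proof (cases "Is = []")
    case True
    then have "b = sone" using w(3) by (simp add: Etil_def)
    then have "w \<star> g \<in> UE n I" using UE_Einf[OF w(2), of g] w(1) Cons.prems(3) True by simp
    then have "(w \<star> g) \<star> sone \<in> setmul (UE n I) {sone}" by (intro setmulI) simp_all
    then show ?thesis using True by (simp add: Etil_def)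
  next
    case False
    then have "b \<star> g \<in> Etil n Is" using Cons.IH[OF False w(3)] Cons.prems(3) by simp
    then have "a \<star> (b \<star> g) \<in> Etil n (I # Is)" using setmulI[OF w(2)] by (simp add: Etil_def)
    then show ?thesis by (simp add: w(1) smul_assoc)
  qed
qed simp

text \<open>For the inclusion into the chain, descend from size \<open>n - 1\<close>, where the
  remainder lies in \<open>1 + F_n\<close> and is absorbed by the factor of the last listed index
  set, of the form \<open>{1..n} - {j}\<close>; smaller sizes follow with
  \<open>gp_step\<close>.\<close>

lemma chain_eq:
  assumes n: "3 \<le> n" and S: "S \<noteq> {}" "S \<subseteq> {1..n-1}"
    and T: "\<And>s. s \<in> {2..n-1} \<Longrightarrow> distinct (ordT s) \<and> set (ordT s) = theta_idx n S s"
    and E: "\<And>s. s \<in> {2..n-1} \<Longrightarrow> distinct (ordE s) \<and> set (ordE s) = {I \<in> Jp n S. card I = s}"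
    and s: "2 \<le> s" "s \<le> n - 1"
  shows "gp n (JS n S s) = (chain n ordT ordE s :: 'k::field sn set)"
proof
  have n1: "1 \<le> n" using n by simp
  have "2 \<le> s \<longrightarrow> chain n ordT ordE s \<subseteq> (gp n (JS n S s) :: 'k sn set)"
  proof (rule inc_induct[of s n])
    show "s \<le> n" using s by simp
    show "2 \<le> n \<longrightarrow> chain n ordT ordE n \<subseteq> (gp n (JS n S n) :: 'k sn set)" by (simp add: chain_n gp_one)
  next
    fix r assume r: "s \<le> r" "r < n" and IH: "2 \<le> Suc r \<longrightarrow> chain n ordT ordE (Suc r) \<subseteq> (gp n (JS n S (Suc r)) :: 'k sn set)"
    show "2 \<le> r \<longrightarrow> chain n ordT ordE r \<subseteq> (gp n (JS n S r) :: 'k sn set)"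
    proof
      assume "2 \<le> r"
      then have ri: "r \<in> {2..n-1}" using r(2) by auto
      have "gp n (JS n S (Suc r)) \<subseteq> (gp n (JS n S r) :: 'k sn set)" by (rule gp_mono) (simp add: JS_def)
      then have "chain n ordT ordE (Suc r) \<subseteq> (gp n (JS n S r) :: 'k sn set)" using IH \<open>2 \<le> r\<close> by auto
      then show "chain n ordT ordE r \<subseteq> (gp n (JS n S r) :: 'k sn set)"
        unfolding chain_Suc[OF r(2)] 
        by (rule setmul_gp[OF Thtil_gp[OF conjunct2[OF T[OF ri]]] setmul_gp[OF Etil_gp[OF conjunct2[OF E[OF ri]]]]])
    qed
  qed
  then show "chain n ordT ordE s \<subseteq> (gp n (JS n S s) :: 'k sn set)" using s by blast
  have "2 \<le> s \<longrightarrow> gp n (JS n S s) \<subseteq> (chain n ordT ordE s :: 'k sn set)"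
  proof (rule inc_induct[OF s(2)])
    show "2 \<le> n - 1 \<longrightarrow> gp n (JS n S (n - 1)) \<subseteq> (chain n ordT ordE (n - 1) :: 'k sn set)"
    proof (intro impI subsetI)
      fix u :: "'k sn" assume u: "u \<in> gp n (JS n S (n - 1))"
      have ri: "n - 1 \<in> {2..n-1}" using n by simp
      have sn: "Suc (n - 1) = n" using n by simp
      obtain v w u' where vwu: "v \<in> Thtil n (ordT (n - 1))" "w \<in> Etil n (ordE (n - 1))" "u' \<in> gp n (JS n S n)" "u = v \<star> (w \<star> u')"
        using gp_step[OF conjunct1[OF T[OF ri]] conjunct2[OF T[OF ri]] conjunct1[OF E[OF ri]] conjunct2[OF E[OF ri]] u] unfolding sn by blast
      obtain i where i: "i \<in> S" using S by blast
      \<comment> \<open>Some index other than \<open>i\<close> and \<open>n\<close>, available as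
        \<open>3 \<le> n\<close>; its complement shows that the list of index sets of size
        \<open>n - 1\<close> is nonempty.\<close>
      define k where "k = (if i = 1 then 2 else 1 :: nat)"
      have k: "k \<noteq> i" "k \<in> {1..n}" "k \<noteq> n" using n by (auto simp: k_def)
      have "i \<in> {1..n}" using subsetD[OF S(2) i] by auto
      then have "{1..n} - {k} \<in> Jp n S" using k i n1 unfolding Jp_def by auto
      moreover have "card ({1..n} - {k}) = n - 1" using k by simp
      ultimately have ne: "ordE (n - 1) \<noteq> []" using E[OF ri] by (metis (mono_tags, lifting) mem_Collect_eq empty_iff list.set(1))
      define I where "I = last (ordE (n - 1))"
      have "I \<in> set (ordE (n - 1))" using ne by (simp add: I_def)
      then have I: "I \<subseteq> {1..n}" "card I = n - 1" using E[OF ri] Jp_sub by auto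
      have "card ({1..n} - I) = 1" using card_Diff_subset[of I "{1..n}"] I finite_subset[OF I(1)] n by simp
      then obtain j where jI: "{1..n} - I = {j}" by (rule card_1_singletonE)
      have j: "j \<in> {1..n}" "I = {1..n} - {j}" using jI double_diff[OF I(1) subset_refl] by auto
      have n2: "2 \<le> n" using n by simp
      have "u' \<in> Einf n I" unfolding j(2) by (rule Fn_units_Einf[OF j(1) n2]) (use vwu(3) JS_n[OF S n1] in simp)
      then have "w \<star> u' \<in> Etil n (ordE (n - 1))" unfolding I_def by (rule Etil_absorb[OF ne vwu(2)])
      then have "v \<star> ((w \<star> u') \<star> sone) \<in> setmul (Thtil n (ordT (n - 1))) (setmul (Etil n (ordE (n - 1))) {sone})"
        by (intro setmulI vwu(1)) simp_all
      then have "v \<star> (w \<star> u') \<in> setmul (Thtil n (ordT (n - 1))) (setmul (Etil n (ordE (n - 1))) {sone})"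
        by (simp only: smul_one)
      moreover
      have "n - 1 < n" using n by simp
      from chain_Suc[OF this] have "chain n ordT ordE (n - 1) = (setmul (Thtil n (ordT (n - 1))) (setmul (Etil n (ordE (n - 1))) {sone}) :: 'k sn set)"
        unfolding sn chain_n .
      ultimately show "u \<in> chain n ordT ordE (n - 1)" unfolding vwu(4) by simp
    qed
  next
    fix r assume r: "s \<le> r" "r < n - 1" and IH: "2 \<le> Suc r \<longrightarrow> gp n (JS n S (Suc r)) \<subseteq> (chain n ordT ordE (Suc r) :: 'k sn set)"
    show "2 \<le> r \<longrightarrow> gp n (JS n S r) \<subseteq> (chain n ordT ordE r :: 'k sn set)"
    proof (intro impI subsetI)
      fix u :: "'k sn" assume r2: "2 \<le> r" and u: "u \<in> gp n (JS n S r)"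
      have ri: "r \<in> {2..n-1}" using r r2 by simp
      obtain v w u' where vwu: "v \<in> Thtil n (ordT r)" "w \<in> Etil n (ordE r)" "u' \<in> gp n (JS n S (Suc r))" "u = v \<star> (w \<star> u')"
        using gp_step[OF conjunct1[OF T[OF ri]] conjunct2[OF T[OF ri]] conjunct1[OF E[OF ri]] conjunct2[OF E[OF ri]] u] by blast
      have "u' \<in> chain n ordT ordE (Suc r)" using IH r2 vwu(3) by auto
      then have "v \<star> (w \<star> u') \<in> setmul (Thtil n (ordT r)) (setmul (Etil n (ordE r)) (chain n ordT ordE (Suc r)))"
        by (rule setmulI[OF vwu(1) setmulI[OF vwu(2)]])
      moreover have "r < n" using r by simp
      ultimately show "u \<in> chain n ordT ordE r" unfolding vwu(4) by (simp add: chain_Suc)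
    qed
  qed
  then show "gp n (JS n S s) \<subseteq> (chain n ordT ordE s :: 'k sn set)" using s by blast
qed

theorem theorem5p2:
  fixes n :: nat and S :: "nat set"
    and ordT :: "nat \<Rightarrow> (nat \<times> nat \<times> nat set) list"
    and ordE :: "nat \<Rightarrow> nat set list"
  assumes "3 \<le> n" and "S \<noteq> {}" and "S \<subseteq> {1..n-1}"
    and "\<forall>s\<in>{2..n-1}. distinct (ordT s) \<and> set (ordT s) = theta_idx n S s"
    and "\<forall>s\<in>{2..n-1}. distinct (ordE s) \<and> set (ordE s) = {I \<in> Jp n S. card I = s}"
  shows "phiGL n ` GLcong (Sn (n-1)) (frakp n S) = (onep (Sn n) (ppn n S) :: 'k::field sn set)
    \<and> onep (Sn n) (ppn n S) = (chain n ordT ordE 2 :: 'k sn set)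
    \<and> (\<forall>s\<in>{2..n-1}. onep_s n S s = (chain n ordT ordE s :: 'k sn set))
    \<and> onep_s n S n = (onep (Sn n) (Fn n) :: 'k sn set)"
proof -
  have n1: "1 \<le> n" using assms(1) by simp
  have ch: "gp n (JS n S s) = (chain n ordT ordE s :: 'k sn set)" if "s \<in> {2..n-1}" for s
    by (rule chain_eq[OF assms(1-3)]) (use that assms(4,5) in auto)
  have "onep (Sn n) (ppn n S) = (chain n ordT ordE 2 :: 'k sn set)"
    using ch[of 2] assms(1) unfolding ppn_eq_idl[OF assms(3) n1] JS_2[OF assms(3) n1] by simp
  moreover have "\<forall>s\<in>{2..n-1}. onep_s n S s = (chain n ordT ordE s :: 'k sn set)"
    unfolding onep_s_gp[OF assms(3) n1] using ch by blast
  moreover have "onep_s n S n = (onep (Sn n) (Fn n) :: 'k sn set)"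
    unfolding onep_s_gp[OF assms(3) n1] Fn_eq_idl JS_n[OF assms(2,3) n1] ..
  ultimately show ?thesis using phiGL_GLcong[OF n1 assms(3)] by blast
qed

end
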